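(* Let $V$ be the universe (a model of $\mathsf{ZFC}$). Let $\mathcal L$ be a first-order language, $M$ an $\mathcal L$-structure, $\mathscr G\subseteq\mathrm{Aut}(M)$ a group of automorphisms of $M$, and $\mathcal I$ an ideal of subsets of $M$. Then there is a symmetric extension $W$ of $V$, with $V\subseteq W\subseteq V[G]$, in which there is a symmetric copy $N$ of $M$ such that for every $k$, every subset of $N^k$ which lies in $W$ is a symmetric copy of a subset of $M^k$ that is stable under a large group of automorphisms. Moreover, if $\mathcal I$ is $\kappa$-complete, then $W$ can be taken to satisfy $\mathsf{DC}_{<\kappa}$. One can also require that $M$ does not have any new subsets.
   Context: Symmetric extensions. A symmetric system is a triple $\langle\mathbb P,\mathscr H,\mathscr F\rangle$ where $\mathbb P$ is a notion of forcing (a preordered set with a maximum), $\mathscr H$ is a group of automorphisms of $\mathbb P$, and $\mathscr F$ is a normal filter of subgroups of $\mathscr H$: a non-empty collection of subgroups closed under supergroups, finite intersections, and conjugation by elements of $\mathscr H$, and not containing the trivial group. Automorphisms act on $\mathbb P$-names by $\pi\dot x=\{\langle\pi p,\pi\dot y\rangle\mid\langle p,\dot y\rangle\in\dot x\}$. A name $\dot x$ is $\mathscr F$-symmetric if $\{\pi\in\mathscr H\mid\pi\dot x=\dot x\}\in\mathscr F$, and hereditarily $\mathscr F$-symmetric if this holds for $\dot x$ and, hereditarily, for all names appearing in its transitive closure. For a $V$-generic filter $G\subseteq\mathbb P$, the symmetric extension is the class $W$ of all $\dot x^G$ with $\dot x$ hereditarily $\mathscr F$-symmetric; it is a transitive model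 of $\mathsf{ZF}$ with $V\subseteq W\subseteq V[G]$. Symmetric copies. A symmetric copy of $M$ is a structure $N\in W$ such that $V[G]\models M\cong_{\mathcal L}N$. Subsets of $M^k$ are transported to subsets of $N^k$ via a fixed such isomorphism in $V[G]$: a subset $X\subseteq N^k$ in $W$ is a symmetric copy of a subset $X_*\subseteq M^k$ (with $X_*\in V[G]$) if this isomorphism carries $X_*$ onto $X$. Large groups and stability. A subgroup of $\mathscr G$ is large if it contains $\mathrm{fix}(A)=\{\pi\in\mathscr G\mid\pi\restriction A=\mathrm{id}\}$ for some $A\in\mathcal I$. A set $X$ is stable under an automorphism $\pi$ if $\pi``X=X$ (with $\pi$ acting coordinatewise on $M^k$), and stable under a group $H$ if it is stable under every $\pi\in H$. An ideal is $\kappa$-complete if it is closed under unions of fewer than $\kappa$ of its members. For an aleph $\lambda$, $\mathsf{DC}_\lambda$ is the statement "every $\lambda$-closed tree has a maximal element or a chain of type $\lambda$", where $\lambda$-closed means that every chain of length less than $\lambda$ has an upper bound; $\mathsf{DC}_{<\kappa}$ means $\mathsf{DC}_\lambda$ for all $\lambda<\kappa$.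
   Formalization: The ideal of subsets of M is assumed to contain all singletons; without this the claim fails, e.g. for the ideal {∅} and a group acting transitively on M with at least two points, since singletons of N would have to copy invariant singletons. *)

theory Defs
  imports "HOL-Library.Countable_Set"
begin

section \<open>A universe of well-founded sets\<close>

text \<open>
  HOL has no built-in cumulative hierarchy. The type \<open>'i hset\<close> consists of all sets that are
  hereditarily of cardinality at most that of \<open>nat + 'i\<close>: well-founded trees with branching
  indexed by \<open>nat + 'i\<close>, modulo bisimilarity. The index type is arbitrary, so every transitive set
  has a copy in some \<open>'i hset\<close> (and every countable one in \<open>unit hset\<close>); it plays the role of the
  background universe in which a transitive model of ZFC and its generic extensions live.
\<close>

datatype 'i wftree = Branch (kid: "nat + 'i \<Rightarrow> 'i wftree option")

definition kids :: "'i wftree \<Rightarrow> 'i wftree set" where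
  "kids t = {s. \<exists>i. kid t i = Some s}"

inductive ext_eq :: "'i wftree \<Rightarrow> 'i wftree \<Rightarrow> bool" where
  "\<lbrakk>\<forall>s\<in>kids a. \<exists>t\<in>kids b. ext_eq s t; \<forall>t\<in>kids b. \<exists>s\<in>kids a. ext_eq s t\<rbrakk> \<Longrightarrow> ext_eq a b"

lemma kids_induct:
  assumes "\<And>t. (\<And>s. s \<in> kids t \<Longrightarrow> P s) \<Longrightarrow> P t"
  shows "P t"
proof (induction t)
  case (Branch f)
  show ?case by (rule assms) (auto simp: kids_def intro: Branch rangeI)
qed

lemma ext_eq_refl: "ext_eq t t"
  by (induction t rule: kids_induct) (blast intro: ext_eq.intros)

lemma ext_eq_sym: "ext_eq a b \<Longrightarrow> ext_eq b a"
  by (induction rule: ext_eq.induct) (blast intro: ext_eq.intros)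

lemma ext_eq_trans: "ext_eq a b \<Longrightarrow> ext_eq b c \<Longrightarrow> ext_eq a c"
proof (induction arbitrary: c rule: ext_eq.induct)
  case (1 a b)
  from 1(3) have "\<forall>s\<in>kids b. \<exists>t\<in>kids c. ext_eq s t" "\<forall>t\<in>kids c. \<exists>s\<in>kids b. ext_eq s t"
    by (auto elim: ext_eq.cases)
  with 1(1,2) show ?case by (intro ext_eq.intros) metis+
qed

quotient_type 'i hset = "'i wftree" / ext_eq
  by (intro equivpI reflpI sympI transpI) (blast intro: ext_eq_refl ext_eq_sym ext_eq_trans)+

definition elts :: "'i hset \<Rightarrow> 'i hset set" where
  "elts x = abs_hset ` kids (rep_hset x)"

definition small :: "'i hset set \<Rightarrow> bool" where
  "small A \<longleftrightarrow> (\<exists>(J :: (nat + 'i) set) f. A = f ` J)"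

text \<open>\<open>hset A\<close> is the set with exactly the elements \<open>A\<close>; it is meaningful only for small \<open>A\<close>.\<close>

definition hset :: "'i hset set \<Rightarrow> 'i hset" where
  "hset A = (THE x. elts x = A)"

lemma abs_rep: "abs_hset (rep_hset x) = x"
  by (rule Quotient3_abs_rep[OF Quotient3_hset])

lemma abs_eq: "abs_hset a = abs_hset b \<longleftrightarrow> ext_eq a b"
  using Quotient3_rel[OF Quotient3_hset] ext_eq_refl by blast

lemma ext_eq_rep: "ext_eq (rep_hset (abs_hset a)) a"
  using abs_eq abs_rep by blast

lemma elts_abs: "elts (abs_hset a) = abs_hset ` kids a"
proof -
  have "\<forall>s\<in>kids (rep_hset (abs_hset a)). \<exists>t\<in>kids a. ext_eq s t"
       "\<forall>t\<in>kids a. \<exists>s\<in>kids (rep_hset (abs_hset a)). ext_eq s t"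
    using ext_eq_rep[of a] by (auto elim: ext_eq.cases)
  then show ?thesis
    unfolding elts_def by (auto simp: image_iff abs_eq) (metis ext_eq_sym)+
qed

lemma elts_inject: "elts x = elts y \<longleftrightarrow> x = y"
proof
  assume eq: "elts x = elts y"
  let ?a = "rep_hset x" and ?b = "rep_hset y"
  have img: "abs_hset ` kids ?a = abs_hset ` kids ?b"
    using eq unfolding elts_def .
  have "ext_eq ?a ?b"
  proof (rule ext_eq.intros)
    show "\<forall>s\<in>kids ?a. \<exists>t\<in>kids ?b. ext_eq s t"
    proof
      fix s assume "s \<in> kids ?a"
      then have "abs_hset s \<in> abs_hset ` kids ?b" using img by blast
      then show "\<exists>t\<in>kids ?b. ext_eq s t" using abs_eq by blast
    qed
    show "\<forall>t\<in>kids ?b. \<exists>s\<in>kids ?a. ext_eq s t"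
    proof
      fix t assume "t \<in> kids ?b"
      then have "abs_hset t \<in> abs_hset ` kids ?a" using img by blast
      then obtain s where "s \<in> kids ?a" "abs_hset t = abs_hset s" by blast
      then show "\<exists>s\<in>kids ?a. ext_eq s t" using abs_eq[of s t] by auto
    qed
  qed
  then show "x = y" using abs_eq[of ?a ?b] by (simp add: abs_rep)
qed simp

lemma smallI: "A = f ` (J :: (nat + 'i) set) \<Longrightarrow> small (A :: 'i hset set)"
  unfolding small_def by (intro exI)

lemma small_elts: "small (elts x)"
proof -
  have "elts x = (\<lambda>i. abs_hset (the (kid (rep_hset x) i))) ` {i. kid (rep_hset x) i \<noteq> None}"
    unfolding elts_def kids_def by (force simp: image_iff)
  then show ?thesis by (rule smallI)
qed

lemma small_ex:
  assumes "small A"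
  shows "\<exists>x. elts x = A"
proof -
  obtain J :: "(nat + 'a) set" and f where A: "A = f ` J"
    using assms unfolding small_def by (elim exE)
  define t where "t = Branch (\<lambda>i. if i \<in> J then Some (rep_hset (f i)) else None)"
  have "kids t = (\<lambda>i. rep_hset (f i)) ` J" by (auto simp: kids_def t_def)
  then have "elts (abs_hset t) = A"
    using A by (simp add: elts_abs image_image abs_rep)
  then show ?thesis ..
qed

lemma elts_hset: "small A \<Longrightarrow> elts (hset A) = A"
proof -
  assume "small A"
  then obtain x where "elts x = A" using small_ex by blast
  then show ?thesis
    unfolding hset_def by (intro theI[where P = "\<lambda>x. elts x = A"]) (auto simp: elts_inject)
qed

lemma hset_elts [simp]: "hset (elts x) = x"
  using elts_hset[OF small_elts] elts_inject by blast

lemma hset_induct: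
  assumes "\<And>x. (\<And>y. y \<in> elts x \<Longrightarrow> P y) \<Longrightarrow> P x"
  shows "P x"
proof -
  have "P (abs_hset a)" for a
  proof (induction a rule: kids_induct)
    case (1 t)
    show ?case by (rule assms) (use 1 in \<open>auto simp: elts_abs\<close>)
  qed
  from this[of "rep_hset x"] show ?thesis by (simp add: abs_rep)
qed

lemma wf_mem: "wf {(x, y). x \<in> elts y}"
proof (rule wfUNIVI)
  fix P :: "'a hset \<Rightarrow> bool" and x
  assume "\<forall>x. (\<forall>y. (y, x) \<in> {(x, y). x \<in> elts y} \<longrightarrow> P y) \<longrightarrow> P x"
  then show "P x" by (induction x rule: hset_induct) blast
qed

lemma small_image:
  fixes A :: "'i hset set" and f :: "'i hset \<Rightarrow> 'i hset"
  shows "small A \<Longrightarrow> small (f ` A)"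
proof -
  assume "small A"
  then obtain J :: "(nat + 'i) set" and g where "A = g ` J" unfolding small_def by (elim exE)
  then have "f ` A = (\<lambda>j. f (g j)) ` J" by (simp add: image_image)
  then show ?thesis by (rule smallI)
qed

lemma small_subset:
  fixes A :: "'i hset set"
  shows "small A \<Longrightarrow> B \<subseteq> A \<Longrightarrow> small B"
proof -
  assume "small A" "B \<subseteq> A"
  then obtain J :: "(nat + 'i) set" and f where "A = f ` J" unfolding small_def by (elim exE)
  then have "B = f ` {j \<in> J. f j \<in> B}" using \<open>B \<subseteq> A\<close> by auto
  then show ?thesis by (rule smallI)
qed

lemma small_countable:
  fixes A :: "'i hset set"
  assumes "countable A"
  shows "small A"
proof -
  have "A = (from_nat_into A \<circ> projl) ` (Inl ` to_nat_on A ` A :: (nat + 'i) set)"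
    using assms by (force simp: image_image image_comp)
  then show ?thesis by (rule smallI)
qed

lemma small_insert:
  fixes A :: "'i hset set"
  assumes "small A"
  shows "small (insert x A)"
proof -
  obtain J :: "(nat + 'i) set" and f where A: "A = f ` J"
    using assms unfolding small_def by (elim exE)
  define h :: "nat + 'i \<Rightarrow> nat + 'i" where "h = case_sum (\<lambda>n. Inl (Suc n)) Inr"
  have inj: "inj h" by (auto simp: h_def inj_on_def split: sum.splits)
  have ne: "h j \<noteq> Inl 0" for j by (auto simp: h_def split: sum.splits)
  have "insert x A = (\<lambda>z. if z = Inl 0 then x else f (inv h z)) ` insert (Inl 0) (h ` J)"
  proof -
    have "(\<lambda>z. if z = Inl 0 then x else f (inv h z)) ` h ` J = f ` J"
      unfolding image_image by (intro image_cong refl) (simp add: ne inv_f_f[OF inj])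
    then show ?thesis by (simp only: A image_insert) simp
  qed
  then show ?thesis by (rule smallI)
qed

lemma elts_hset_countable [simp]: "countable A \<Longrightarrow> elts (hset A) = A"
  by (simp add: elts_hset small_countable)


section \<open>Basic set theory\<close>

definition opair :: "'i hset \<Rightarrow> 'i hset \<Rightarrow> 'i hset"  ("(\<langle>_,/ _\<rangle>)") where
  "\<langle>a, b\<rangle> = hset {hset {a}, hset {a, b}}"

lemma hset_countable_inject:
  "countable A \<Longrightarrow> countable B \<Longrightarrow> hset A = hset B \<longleftrightarrow> A = B"
proof
  assume "countable A" "countable B" "hset A = hset B"
  have "A = elts (hset A)" by (rule elts_hset_countable[OF \<open>countable A\<close>, symmetric])
  also have "\<dots> = elts (hset B)" using \<open>hset A = hset B\<close> by (rule arg_cong)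
  also have "\<dots> = B" by (rule elts_hset_countable[OF \<open>countable B\<close>])
  finally show "A = B" .
qed (rule arg_cong)

lemma opair_inject [simp]: "\<langle>a, b\<rangle> = \<langle>c, d\<rangle> \<longleftrightarrow> a = c \<and> b = d"
  by (simp add: opair_def hset_countable_inject doubleton_eq_iff) metis

lemma opair_mem_wf: "(y, \<langle>p, y\<rangle>) \<in> {(x, y). x \<in> elts y}\<^sup>+"
proof -
  have "(y, hset {p, y}) \<in> {(x, y). x \<in> elts y}" "(hset {p, y}, \<langle>p, y\<rangle>) \<in> {(x, y). x \<in> elts y}"
    by (simp_all add: opair_def)
  then show ?thesis by (blast intro: trancl_into_trancl)
qed

primrec nat_set :: "nat \<Rightarrow> 'i hset" where
  "nat_set 0 = hset {}"
| "nat_set (Suc n) = hset (insert (nat_set n) (elts (nat_set n)))"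

definition is_func :: "'i hset \<Rightarrow> 'i hset set \<Rightarrow> 'i hset set \<Rightarrow> bool" where
  "is_func f A B \<longleftrightarrow> (\<forall>z\<in>elts f. \<exists>a\<in>A. \<exists>b\<in>B. z = \<langle>a, b\<rangle>) \<and> (\<forall>a\<in>A. \<exists>!b. \<langle>a, b\<rangle> \<in> elts f)"

definition is_bij :: "'i hset \<Rightarrow> 'i hset set \<Rightarrow> 'i hset set \<Rightarrow> bool" where
  "is_bij f A B \<longleftrightarrow> is_func f A B \<and> (\<forall>b\<in>B. \<exists>!a. \<langle>a, b\<rangle> \<in> elts f)"

definition fdom :: "'i hset \<Rightarrow> 'i hset set" where
  "fdom f = {a. \<exists>b. \<langle>a, b\<rangle> \<in> elts f}"

definition app :: "'i hset \<Rightarrow> 'i hset \<Rightarrow> 'i hset" where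
  "app f a = (THE b. \<langle>a, b\<rangle> \<in> elts f)"

definition ident :: "'i hset \<Rightarrow> 'i hset" where
  "ident A = hset ((\<lambda>a. \<langle>a, a\<rangle>) ` elts A)"

definition compose :: "'i hset \<Rightarrow> 'i hset \<Rightarrow> 'i hset" where
  "compose g f = hset ((\<lambda>a. \<langle>a, app g (app f a)\<rangle>) ` fdom f)"

definition conv :: "'i hset \<Rightarrow> 'i hset" where
  "conv f = hset {\<langle>b, a\<rangle> |a b. \<langle>a, b\<rangle> \<in> elts f}"

text \<open>\<open>k\<close>-tuples over \<open>A\<close> are functions from the von Neumann numeral \<open>k\<close> to \<open>A\<close>. A map \<open>f\<close> defined
  on \<open>A\<close> acts coordinatewise on tuples as \<open>compose f\<close>.\<close>

definition tuples :: "'i hset set \<Rightarrow> nat \<Rightarrow> 'i hset set" where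
  "tuples A k = {t. is_func t (elts (nat_set k)) A}"

definition is_ord :: "'i hset \<Rightarrow> bool" where
  "is_ord x \<longleftrightarrow> (\<forall>y\<in>elts x. elts y \<subseteq> elts x \<and> (\<forall>z\<in>elts y. elts z \<subseteq> elts y))"


section \<open>Transitive models of ZFC\<close>

datatype fm = Mem nat nat | Eq nat nat | Neg fm | And fm fm | All nat fm

primrec sats :: "'i hset set \<Rightarrow> (nat \<Rightarrow> 'i hset) \<Rightarrow> fm \<Rightarrow> bool" where
  "sats V e (Mem i j) \<longleftrightarrow> e i \<in> elts (e j)"
| "sats V e (Eq i j) \<longleftrightarrow> e i = e j"
| "sats V e (Neg \<phi>) \<longleftrightarrow> \<not> sats V e \<phi>"
| "sats V e (And \<phi> \<psi>) \<longleftrightarrow> sats V e \<phi> \<and> sats V e \<psi>"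
| "sats V e (All i \<phi>) \<longleftrightarrow> (\<forall>x\<in>V. sats V (e(i := x)) \<phi>)"

text \<open>Each axiom is its relativization to \<open>V\<close>, simplified using transitivity of \<open>V\<close>;
  Extensionality and Foundation hold in every transitive class.\<close>

definition transitive_ZFC_model :: "'i hset set \<Rightarrow> bool" where
  "transitive_ZFC_model V \<longleftrightarrow>
     (\<forall>x\<in>V. elts x \<subseteq> V) \<and>
     (\<forall>a\<in>V. \<forall>b\<in>V. hset {a, b} \<in> V) \<and>
     (\<forall>A\<in>V. \<exists>U\<in>V. elts U = (\<Union>x\<in>elts A. elts x)) \<and>
     (\<forall>A\<in>V. \<exists>Q\<in>V. elts Q = {x \<in> V. elts x \<subseteq> elts A}) \<and>
     (\<exists>A\<in>V. hset {} \<in> elts A \<and> (\<forall>x\<in>elts A. hset (insert x (elts x)) \<in> elts A)) \<and>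
     (\<forall>\<phi> e. \<forall>A\<in>V. range e \<subseteq> V \<longrightarrow> (\<exists>B\<in>V. elts B = {x \<in> elts A. sats V (e(0 := x)) \<phi>})) \<and>
     (\<forall>\<phi> e. \<forall>A\<in>V. range e \<subseteq> V \<longrightarrow> (\<forall>x\<in>elts A. \<exists>!y. y \<in> V \<and> sats V (e(0 := x, 1 := y)) \<phi>) \<longrightarrow>
        (\<exists>B\<in>V. elts B = {y \<in> V. \<exists>x\<in>elts A. sats V (e(0 := x, 1 := y)) \<phi>})) \<and>
     (\<forall>A\<in>V. (\<forall>x\<in>elts A. elts x \<noteq> {}) \<longrightarrow>
        (\<forall>x\<in>elts A. \<forall>y\<in>elts A. x \<noteq> y \<longrightarrow> elts x \<inter> elts y = {}) \<longrightarrow>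
        (\<exists>C\<in>V. \<forall>x\<in>elts A. \<exists>!z. z \<in> elts C \<and> z \<in> elts x))"

text \<open>\<open>\<kappa>\<close> is an infinite initial ordinal (an aleph) in the sense of the transitive model \<open>U\<close>.\<close>

definition aleph_in :: "'i hset set \<Rightarrow> 'i hset \<Rightarrow> bool" where
  "aleph_in U \<kappa> \<longleftrightarrow> \<kappa> \<in> U \<and> is_ord \<kappa> \<and> range nat_set \<subseteq> elts \<kappa> \<and>
     \<not> (\<exists>\<alpha>\<in>elts \<kappa>. \<exists>f\<in>U. is_bij f (elts \<alpha>) (elts \<kappa>))"


section \<open>Groups of permutations\<close>

definition perm_group :: "'i hset \<Rightarrow> 'i hset \<Rightarrow> bool" where
  "perm_group A K \<longleftrightarrow> (\<forall>\<pi>\<in>elts K. is_bij \<pi> (elts A) (elts A)) \<and> ident A \<in> elts K \<and>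
     (\<forall>\<pi>\<in>elts K. \<forall>\<sigma>\<in>elts K. compose \<pi> \<sigma> \<in> elts K) \<and> (\<forall>\<pi>\<in>elts K. conv \<pi> \<in> elts K)"

definition perm_subgroup :: "'i hset \<Rightarrow> 'i hset \<Rightarrow> 'i hset \<Rightarrow> bool" where
  "perm_subgroup A K H \<longleftrightarrow> perm_group A K \<and> elts K \<subseteq> elts H"

definition conjugate :: "'i hset \<Rightarrow> 'i hset \<Rightarrow> 'i hset" where
  "conjugate \<pi> K = hset ((\<lambda>\<sigma>. compose \<pi> (compose \<sigma> (conv \<pi>))) ` elts K)"


section \<open>Symmetric extensions\<close>

record 'i symsys =
  conds :: "'i hset"
  leq :: "'i hset"
  top_cond :: "'i hset"
  grp :: "'i hset"
  filt :: "'i hset"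

definition forcing_notion :: "'i symsys \<Rightarrow> bool" where
  "forcing_notion S \<longleftrightarrow>
     (\<forall>z\<in>elts (leq S). \<exists>p\<in>elts (conds S). \<exists>q\<in>elts (conds S). z = \<langle>p, q\<rangle>) \<and>
     (\<forall>p\<in>elts (conds S). \<langle>p, p\<rangle> \<in> elts (leq S)) \<and>
     (\<forall>p q r. \<langle>p, q\<rangle> \<in> elts (leq S) \<longrightarrow> \<langle>q, r\<rangle> \<in> elts (leq S) \<longrightarrow> \<langle>p, r\<rangle> \<in> elts (leq S)) \<and>
     top_cond S \<in> elts (conds S) \<and> (\<forall>p\<in>elts (conds S). \<langle>p, top_cond S\<rangle> \<in> elts (leq S))"

text \<open>A preorder may have several maxima; automorphisms are required to fix the distinguished one,
  so that canonical names of ground model sets are symmetric.\<close>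

definition forcing_aut :: "'i symsys \<Rightarrow> 'i hset \<Rightarrow> bool" where
  "forcing_aut S \<pi> \<longleftrightarrow> is_bij \<pi> (elts (conds S)) (elts (conds S)) \<and> app \<pi> (top_cond S) = top_cond S \<and>
     (\<forall>p\<in>elts (conds S). \<forall>q\<in>elts (conds S).
        \<langle>p, q\<rangle> \<in> elts (leq S) \<longleftrightarrow> \<langle>app \<pi> p, app \<pi> q\<rangle> \<in> elts (leq S))"

definition normal_filter :: "'i hset set \<Rightarrow> 'i symsys \<Rightarrow> bool" where
  "normal_filter V S \<longleftrightarrow>
     elts (filt S) \<noteq> {} \<and>
     (\<forall>K\<in>elts (filt S). perm_subgroup (conds S) K (grp S)) \<and>
     (\<forall>K\<in>elts (filt S). \<forall>K'\<in>V. perm_subgroup (conds S) K' (grp S) \<longrightarrow> elts K \<subseteq> elts K' \<longrightarrow>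
        K' \<in> elts (filt S)) \<and>
     (\<forall>K\<in>elts (filt S). \<forall>K'\<in>elts (filt S). hset (elts K \<inter> elts K') \<in> elts (filt S)) \<and>
     (\<forall>K\<in>elts (filt S). \<forall>\<pi>\<in>elts (grp S). conjugate \<pi> K \<in> elts (filt S)) \<and>
     hset {ident (conds S)} \<notin> elts (filt S)"

definition symmetric_system :: "'i hset set \<Rightarrow> 'i symsys \<Rightarrow> bool" where
  "symmetric_system V S \<longleftrightarrow>
     {conds S, leq S, top_cond S, grp S, filt S} \<subseteq> V \<and>
     forcing_notion S \<and>
     perm_group (conds S) (grp S) \<and> (\<forall>\<pi>\<in>elts (grp S). forcing_aut S \<pi>) \<and>
     normal_filter V S"

definition dense_in :: "'i symsys \<Rightarrow> 'i hset \<Rightarrow> bool" where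
  "dense_in S D \<longleftrightarrow> elts D \<subseteq> elts (conds S) \<and>
     (\<forall>p\<in>elts (conds S). \<exists>d\<in>elts D. \<langle>d, p\<rangle> \<in> elts (leq S))"

text \<open>The generic filter is an external set of conditions, in general not in \<open>V\<close>.\<close>

definition generic :: "'i hset set \<Rightarrow> 'i symsys \<Rightarrow> 'i hset set \<Rightarrow> bool" where
  "generic V S G \<longleftrightarrow> G \<subseteq> elts (conds S) \<and> G \<noteq> {} \<and>
     (\<forall>p\<in>G. \<forall>q\<in>elts (conds S). \<langle>p, q\<rangle> \<in> elts (leq S) \<longrightarrow> q \<in> G) \<and>
     (\<forall>p\<in>G. \<forall>q\<in>G. \<exists>r\<in>G. \<langle>r, p\<rangle> \<in> elts (leq S) \<and> \<langle>r, q\<rangle> \<in> elts (leq S)) \<and>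
     (\<forall>D\<in>V. dense_in S D \<longrightarrow> G \<inter> elts D \<noteq> {})"

inductive is_name :: "'i symsys \<Rightarrow> 'i hset \<Rightarrow> bool" for S where
  "\<forall>z\<in>elts x. \<exists>p\<in>elts (conds S). \<exists>y. z = \<langle>p, y\<rangle> \<and> is_name S y \<Longrightarrow> is_name S x"

function val :: "'i hset set \<Rightarrow> 'i hset \<Rightarrow> 'i hset" where
  "val G x = hset (val G ` {y. \<exists>p\<in>G. \<langle>p, y\<rangle> \<in> elts x})"
  by auto
termination
proof (relation "inv_image ({(x, y). x \<in> elts y}\<^sup>+) snd")
  show "wf (inv_image ({(x, y). x \<in> elts y}\<^sup>+) (snd :: 'i hset set \<times> 'i hset \<Rightarrow> 'i hset))"
    by (intro wf_inv_image wf_trancl wf_mem)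
next
  fix G :: "'i hset set" and x y :: "'i hset"
  assume "y \<in> {y. \<exists>p\<in>G. \<langle>p, y\<rangle> \<in> elts x}"
  then obtain p where "\<langle>p, y\<rangle> \<in> elts x" by blast
  then show "((G, y), (G, x)) \<in> inv_image ({(x, y). x \<in> elts y}\<^sup>+) snd"
    using opair_mem_wf[of y p] by (auto intro: trancl_into_trancl)
qed

text \<open>The action \<open>\<pi> x = {\<langle>\<pi> p, \<pi> y\<rangle> | \<langle>p, y\<rangle> \<in> x}\<close> of automorphisms on names.\<close>

function act :: "'i hset \<Rightarrow> 'i hset \<Rightarrow> 'i hset" where
  "act \<pi> x = hset (\<Union>y\<in>{y. \<exists>p. \<langle>p, y\<rangle> \<in> elts x}. (\<lambda>p. \<langle>app \<pi> p, act \<pi> y\<rangle>) ` {p. \<langle>p, y\<rangle> \<in> elts x})"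
  by auto
termination
proof (relation "inv_image ({(x, y). x \<in> elts y}\<^sup>+) snd")
  show "wf (inv_image ({(x, y). x \<in> elts y}\<^sup>+) (snd :: 'i hset \<times> 'i hset \<Rightarrow> 'i hset))"
    by (intro wf_inv_image wf_trancl wf_mem)
next
  fix \<pi> x y p :: "'i hset"
  assume "y \<in> {y. \<exists>p. \<langle>p, y\<rangle> \<in> elts x}"
  then obtain p where "\<langle>p, y\<rangle> \<in> elts x" by blast
  then show "((\<pi>, y), (\<pi>, x)) \<in> inv_image ({(x, y). x \<in> elts y}\<^sup>+) snd"
    using opair_mem_wf[of y p] by (auto intro: trancl_into_trancl)
qed

declare val.simps [simp del] act.simps [simp del]

definition symmetric_name :: "'i symsys \<Rightarrow> 'i hset \<Rightarrow> bool" where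
  "symmetric_name S x \<longleftrightarrow> is_name S x \<and> hset {\<pi> \<in> elts (grp S). act \<pi> x = x} \<in> elts (filt S)"

inductive hered_symmetric :: "'i symsys \<Rightarrow> 'i hset \<Rightarrow> bool" for S where
  "\<lbrakk>symmetric_name S x; \<forall>p y. \<langle>p, y\<rangle> \<in> elts x \<longrightarrow> hered_symmetric S y\<rbrakk> \<Longrightarrow> hered_symmetric S x"

definition generic_extension :: "'i hset set \<Rightarrow> 'i symsys \<Rightarrow> 'i hset set \<Rightarrow> 'i hset set" where
  "generic_extension V S G = val G ` {x \<in> V. is_name S x}"

definition symmetric_extension :: "'i hset set \<Rightarrow> 'i symsys \<Rightarrow> 'i hset set \<Rightarrow> 'i hset set" where
  "symmetric_extension V S G = val G ` {x \<in> V. hered_symmetric S x}"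

text \<open>Generic filters over countable models exist, so that quantification over all of them is not
  vacuous.\<close>

lemma generic_exists:
  assumes V: "countable V" and S: "forcing_notion S" and p: "p \<in> elts (conds S)"
  shows "\<exists>G. generic V S G \<and> p \<in> G"
proof -
  let ?P = "elts (conds S)"
  let ?le = "\<lambda>a b. \<langle>a, b\<rangle> \<in> elts (leq S)"
  have lefl: "?le a a" if "a \<in> ?P" for a
    using S that unfolding forcing_notion_def by (elim conjE) (rule bspec)
  have "\<forall>p q r. ?le p q \<longrightarrow> ?le q r \<longrightarrow> ?le p r"
    using S unfolding forcing_notion_def by (elim conjE)
  then have letr: "?le a c" if "?le a b" "?le b c" for a b c
    using that(1,2) by (elim allE[of _ a] allE[of _ b] allE[of _ c] impE)
  define E where "E n = from_nat_into V n" for n :: nat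
  define Q where "Q n a b \<longleftrightarrow> ?le b a \<and> (dense_in S (E n) \<longrightarrow> b \<in> elts (E n))" for n :: nat and a b
  have extend: "\<exists>b. b \<in> ?P \<and> Q n a b" if "a \<in> ?P" for a n
  proof (cases "dense_in S (E n)")
    case True
    then show ?thesis using that unfolding dense_in_def Q_def by blast
  next
    case False
    then show ?thesis using that lefl unfolding Q_def by blast
  qed
  have "\<exists>f. \<forall>n. (f n \<in> ?P \<and> (n = 0 \<longrightarrow> f n = p)) \<and> Q n (f n) (f (Suc n))"
  proof (rule dependent_nat_choice)
    show "\<exists>x. x \<in> ?P \<and> (0 = (0::nat) \<longrightarrow> x = p)" using p by simp
  next
    fix x and n :: nat assume "x \<in> ?P \<and> (n = 0 \<longrightarrow> x = p)"
    then show "\<exists>y. (y \<in> ?P \<and> (Suc n = 0 \<longrightarrow> y = p)) \<and> Q n x y"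
      using extend[of x n] by simp
  qed
  then obtain f where f: "\<And>n. f n \<in> ?P" "f 0 = p" "\<And>n. Q n (f n) (f (Suc n))" by metis
  have mono: "?le (f n) (f m)" if "m \<le> n" for m n :: nat
    using that
  proof (induction rule: dec_induct)
    case base
    show ?case using f(1) lefl by blast
  next
    case (step n)
    have "?le (f (Suc n)) (f n)" using f(3)[of n] unfolding Q_def by blast
    then show ?case using step.IH by (rule letr)
  qed
  define G where "G = {q \<in> ?P. \<exists>n. ?le (f n) q}"
  have fG: "f n \<in> G" for n using f(1) lefl unfolding G_def by blast
  have "generic V S G"
    unfolding generic_def
  proof (intro conjI ballI impI)
    show "G \<subseteq> ?P" unfolding G_def by blast
    show "G \<noteq> {}" using fG by blast
  next
    fix a b assume "a \<in> G" "b \<in> ?P" "?le a b"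
    moreover from \<open>a \<in> G\<close> obtain n where "?le (f n) a" unfolding G_def by blast
    ultimately have "?le (f n) b" using letr[of "f n" a b] by simp
    with \<open>b \<in> ?P\<close> show "b \<in> G" unfolding G_def by blast
  next
    fix a b assume "a \<in> G" "b \<in> G"
    then obtain m n where mn: "?le (f m) a" "?le (f n) b" unfolding G_def by blast
    have "?le (f (max m n)) a" "?le (f (max m n)) b"
      using letr[OF mono[of m "max m n"] mn(1)] letr[OF mono[of n "max m n"] mn(2)] by simp_all
    then show "\<exists>r\<in>G. ?le r a \<and> ?le r b" using fG by blast
  next
    fix D assume D: "D \<in> V" "dense_in S D"
    then obtain n where "E n = D" using from_nat_into_surj[OF V D(1)] unfolding E_def by blast
    then have "f (Suc n) \<in> elts D" using f(3)[of n] D unfolding Q_def by blast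
    then show "G \<inter> elts D \<noteq> {}" using fG by blast
  qed
  then show ?thesis using fG[of 0] f(2) by blast
qed


section \<open>First-order structures\<close>

text \<open>A language assigns arities to its relation and function symbols (constants are function
  symbols of arity 0). Languages and structures are given by sets, so that it makes sense for them
  to belong to a model.\<close>

record 'i lang =
  rel_ar :: "'i hset"
  fun_ar :: "'i hset"

record 'i struct =
  univ :: "'i hset"
  rels :: "'i hset"
  funs :: "'i hset"

definition lang_in :: "'i hset set \<Rightarrow> 'i lang \<Rightarrow> bool" where
  "lang_in U L \<longleftrightarrow> {rel_ar L, fun_ar L} \<subseteq> U \<and>
     is_func (rel_ar L) (fdom (rel_ar L)) (range nat_set) \<and> is_func (fun_ar L) (fdom (fun_ar L)) (range nat_set)"

abbreviation rel_symb :: "'i lang \<Rightarrow> 'i hset \<Rightarrow> nat \<Rightarrow> bool" where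
  "rel_symb L r k \<equiv> \<langle>r, nat_set k\<rangle> \<in> elts (rel_ar L)"

abbreviation fun_symb :: "'i lang \<Rightarrow> 'i hset \<Rightarrow> nat \<Rightarrow> bool" where
  "fun_symb L g k \<equiv> \<langle>g, nat_set k\<rangle> \<in> elts (fun_ar L)"

definition struct_in :: "'i hset set \<Rightarrow> 'i lang \<Rightarrow> 'i struct \<Rightarrow> bool" where
  "struct_in U L M \<longleftrightarrow> {univ M, rels M, funs M} \<subseteq> U \<and>
     is_func (rels M) (fdom (rel_ar L)) UNIV \<and> is_func (funs M) (fdom (fun_ar L)) UNIV \<and>
     (\<forall>r k. rel_symb L r k \<longrightarrow> elts (app (rels M) r) \<subseteq> tuples (elts (univ M)) k) \<and>
     (\<forall>g k. fun_symb L g k \<longrightarrow> is_func (app (funs M) g) (tuples (elts (univ M)) k) (elts (univ M)))"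

definition isomorphism :: "'i lang \<Rightarrow> 'i struct \<Rightarrow> 'i struct \<Rightarrow> 'i hset \<Rightarrow> bool" where
  "isomorphism L M N f \<longleftrightarrow> is_bij f (elts (univ M)) (elts (univ N)) \<and>
     (\<forall>r k. rel_symb L r k \<longrightarrow> (\<forall>t\<in>tuples (elts (univ M)) k.
        t \<in> elts (app (rels M) r) \<longleftrightarrow> compose f t \<in> elts (app (rels N) r))) \<and>
     (\<forall>g k. fun_symb L g k \<longrightarrow> (\<forall>t\<in>tuples (elts (univ M)) k.
        app f (app (app (funs M) g) t) = app (app (funs N) g) (compose f t)))"

definition aut_group_in :: "'i hset set \<Rightarrow> 'i lang \<Rightarrow> 'i struct \<Rightarrow> 'i hset \<Rightarrow> bool" where
  "aut_group_in U L M \<G> \<longleftrightarrow> \<G> \<in> U \<and> perm_group (univ M) \<G> \<and> (\<forall>\<pi>\<in>elts \<G>. isomorphism L M M \<pi>)"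


section \<open>Ideals, large groups and stability\<close>

text \<open>As usual for ideals of subsets of a given set, all singletons are required to be members.\<close>

definition ideal_in :: "'i hset set \<Rightarrow> 'i hset \<Rightarrow> 'i hset \<Rightarrow> bool" where
  "ideal_in U D \<I> \<longleftrightarrow> \<I> \<in> U \<and> (\<forall>A\<in>elts \<I>. elts A \<subseteq> elts D) \<and>
     hset {} \<in> elts \<I> \<and> (\<forall>d\<in>elts D. hset {d} \<in> elts \<I>) \<and>
     (\<forall>A\<in>elts \<I>. \<forall>B\<in>U. elts B \<subseteq> elts A \<longrightarrow> B \<in> elts \<I>) \<and>
     (\<forall>A\<in>elts \<I>. \<forall>B\<in>elts \<I>. hset (elts A \<union> elts B) \<in> elts \<I>)"

definition complete_ideal_in :: "'i hset set \<Rightarrow> 'i hset \<Rightarrow> 'i hset \<Rightarrow> bool" where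
  "complete_ideal_in U \<kappa> \<I> \<longleftrightarrow>
     (\<forall>\<A>\<in>U. elts \<A> \<subseteq> elts \<I> \<longrightarrow> (\<exists>\<alpha>\<in>elts \<kappa>. \<exists>f\<in>U. is_bij f (elts \<alpha>) (elts \<A>)) \<longrightarrow>
        hset (\<Union>A\<in>elts \<A>. elts A) \<in> elts \<I>)"

definition fix_group :: "'i hset \<Rightarrow> 'i hset \<Rightarrow> 'i hset set" where
  "fix_group \<G> A = {\<pi> \<in> elts \<G>. \<forall>a\<in>elts A. app \<pi> a = a}"

definition large_subgroup :: "'i struct \<Rightarrow> 'i hset \<Rightarrow> 'i hset \<Rightarrow> 'i hset \<Rightarrow> bool" where
  "large_subgroup M \<G> \<I> K \<longleftrightarrow> perm_subgroup (univ M) K \<G> \<and> (\<exists>A\<in>elts \<I>. fix_group \<G> A \<subseteq> elts K)"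

definition stable :: "'i hset \<Rightarrow> 'i hset \<Rightarrow> bool" where
  "stable \<pi> X \<longleftrightarrow> compose \<pi> ` elts X = elts X"


section \<open>Symmetric copies\<close>

text \<open>The extension \<open>W = symmetric_extension V S G\<close> contains a structure \<open>N\<close> and \<open>V[G]\<close> an isomorphism
  \<open>f\<close> from \<open>M\<close> to \<open>N\<close> which carries a suitably stable subset \<open>Y\<close> of \<open>M^k\<close> onto any given
  \<open>X \<subseteq> N^k\<close> from \<open>W\<close>.\<close>

definition has_symmetric_copy ::
  "'i hset set \<Rightarrow> 'i symsys \<Rightarrow> 'i hset set \<Rightarrow> 'i lang \<Rightarrow> 'i struct \<Rightarrow> 'i hset \<Rightarrow> 'i hset \<Rightarrow> bool" where
  "has_symmetric_copy V S G L M \<G> \<I> \<longleftrightarrow>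
     (\<exists>N. \<exists>f\<in>generic_extension V S G.
        struct_in (symmetric_extension V S G) L N \<and> isomorphism L M N f \<and>
        (\<forall>k. \<forall>X\<in>symmetric_extension V S G. elts X \<subseteq> tuples (elts (univ N)) k \<longrightarrow>
           (\<exists>Y\<in>generic_extension V S G. elts Y \<subseteq> tuples (elts (univ M)) k \<and>
              compose f ` elts Y = elts X \<and>
              (\<exists>K\<in>V. large_subgroup M \<G> \<I> K \<and> (\<forall>\<pi>\<in>elts K. stable \<pi> Y)))))"

definition no_new_subsets :: "'i hset set \<Rightarrow> 'i hset set \<Rightarrow> 'i hset \<Rightarrow> bool" where
  "no_new_subsets V U D \<longleftrightarrow> (\<forall>X\<in>U. elts X \<subseteq> elts D \<longrightarrow> X \<in> V)"


section \<open>Dependent choice\<close>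

text \<open>All notions are relativized to the transitive class \<open>W\<close>; \<open>T\<close> is ordered by the set of pairs
  \<open>le\<close>.\<close>

definition tree_in :: "'i hset set \<Rightarrow> 'i hset \<Rightarrow> 'i hset \<Rightarrow> bool" where
  "tree_in W T le \<longleftrightarrow> T \<in> W \<and> le \<in> W \<and>
     (\<forall>z\<in>elts le. \<exists>s\<in>elts T. \<exists>t\<in>elts T. z = \<langle>s, t\<rangle>) \<and>
     (\<forall>s\<in>elts T. \<langle>s, s\<rangle> \<in> elts le) \<and>
     (\<forall>s t. \<langle>s, t\<rangle> \<in> elts le \<longrightarrow> \<langle>t, s\<rangle> \<in> elts le \<longrightarrow> s = t) \<and>
     (\<forall>s t u. \<langle>s, t\<rangle> \<in> elts le \<longrightarrow> \<langle>t, u\<rangle> \<in> elts le \<longrightarrow> \<langle>s, u\<rangle> \<in> elts le) \<and>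
     (\<forall>t\<in>elts T. \<forall>B\<in>W. elts B \<noteq> {} \<longrightarrow> (\<forall>s\<in>elts B. s \<noteq> t \<and> \<langle>s, t\<rangle> \<in> elts le) \<longrightarrow>
        (\<exists>m\<in>elts B. \<forall>s\<in>elts B. \<langle>m, s\<rangle> \<in> elts le))"

text \<open>A chain of type \<open>\<alpha>\<close>, given by its increasing enumeration.\<close>

definition chain_in :: "'i hset set \<Rightarrow> 'i hset \<Rightarrow> 'i hset \<Rightarrow> 'i hset \<Rightarrow> 'i hset \<Rightarrow> bool" where
  "chain_in W T le \<alpha> f \<longleftrightarrow> f \<in> W \<and> is_func f (elts \<alpha>) (elts T) \<and>
     (\<forall>\<gamma>\<in>elts \<alpha>. \<forall>\<beta>\<in>elts \<gamma>. app f \<beta> \<noteq> app f \<gamma> \<and> \<langle>app f \<beta>, app f \<gamma>\<rangle> \<in> elts le)"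

definition closed_tree_in :: "'i hset set \<Rightarrow> 'i hset \<Rightarrow> 'i hset \<Rightarrow> 'i hset \<Rightarrow> bool" where
  "closed_tree_in W l T le \<longleftrightarrow> (\<forall>\<alpha>\<in>elts l. \<forall>f. chain_in W T le \<alpha> f \<longrightarrow>
     (\<exists>u\<in>elts T. \<forall>\<beta>\<in>elts \<alpha>. \<langle>app f \<beta>, u\<rangle> \<in> elts le))"

definition DC_in :: "'i hset set \<Rightarrow> 'i hset \<Rightarrow> bool" where
  "DC_in W l \<longleftrightarrow> (\<forall>T le. tree_in W T le \<longrightarrow> closed_tree_in W l T le \<longrightarrow>
     (\<exists>t\<in>elts T. \<forall>s\<in>elts T. \<langle>t, s\<rangle> \<in> elts le \<longrightarrow> s = t) \<or> (\<exists>f. chain_in W T le l f))"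

definition DC_below_in :: "'i hset set \<Rightarrow> 'i hset \<Rightarrow> bool" where
  "DC_below_in W \<kappa> \<longleftrightarrow> (\<forall>l\<in>elts \<kappa>. aleph_in W l \<longrightarrow> DC_in W l)"

end

theory Submission
  imports Defs
begin

text \<open>
  Conditions are partial functions from \<open>M\<^sup>+ \<times> J\<close> to \<open>2\<close> of size at most \<open>|X|\<close>, where \<open>M\<^sup>+\<close> is
  \<open>M\<close> with one extra point, \<open>X\<close> is a set containing \<open>M\<close> and \<open>\<kappa>\<close> and closed under pairing, and \<open>J\<close> is
  the power set of \<open>X\<close>; so every \<open>m\<close> receives a generic subset \<open>a\<^sub>m\<close> of \<open>J\<close>. Its copy \<open>n\<^sub>m\<close> is the set of
  all \<open>a\<^sub>m \<triangle> b\<close> with \<open>b \<in> V\<close>. The group consists of the automorphisms induced by some \<open>\<pi> \<in> \<G>\<close> on the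
  columns together with arbitrary bit flips from \<open>V\<close>, and a subgroup is in the filter if it contains
  all automorphisms that are trivial on the columns in some member of the ideal. Automorphisms over
  \<open>\<pi>\<close> map the name of \<open>n\<^sub>m\<close> to that of \<open>n\<^bsub>\<pi> m\<^esub>\<close>. If \<open>X'\<close> has support \<open>A\<close> and \<open>\<pi>\<close> fixes \<open>A\<close> pointwise,
  then bit flips outside the columns in \<open>A\<close> turn any condition \<open>q\<close> into one whose image under an
  automorphism over \<open>\<pi>\<close> is compatible with \<open>q\<close>; by density the set pulled back from \<open>X'\<close> is stable
  under \<open>\<pi>\<close>. The forcing is closed under chains of size \<open>|X|\<close>, so it adds no subset of \<open>M\<close> and decides
  sequences of names of length below \<open>\<kappa>\<close>, which gives dependent choice when the ideal, and hence the
  filter, is \<open>\<kappa>\<close>-complete. Only the forcing relation for \<open>=\<close> is needed; since \<open>V\<close> satisfies the axioms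
  for first-order formulas only, all constructions are carried out with definable operations.
\<close>

section \<open>Definability over a transitive model\<close>

text \<open>Stability asks that every condition be compatible with a suitable translate of itself.
  Bit flips achieve this, but they change the generic subsets a_m; hence an element of the copy is
  not a_m but the class of all its modifications from the ground model, which flips leave unchanged
  as a set. Different columns must still give different classes: by Cantor's theorem every condition
  leaves a row in the power set of X untouched, and there two columns can be made to violate any
  correlation prescribed in the ground model. V is an arbitrary subset of a HOL type, so a HOL
  function on V has no reason to belong to V, and operations defined by descriptions, such as
  \<open>app\<close> and \<open>act\<close>, may leave it. Total definable counterparts
  (\<open>ap\<close>, \<open>comp'\<close>, \<open>conv'\<close>, \<open>act'\<close>) replace them
  wherever membership in V is at stake; they agree on genuine functions and names. Forced equality
  suffices because everything read off an extension here, be it an element of a subset or a pair of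
  a tree order, is membership in a given name and hence equality with the value of one of its
  entries.\<close>

primrec ren :: "(nat \<Rightarrow> nat) \<Rightarrow> fm \<Rightarrow> fm" where
  "ren r (Mem i j) = Mem (r i) (r j)"
| "ren r (Eq i j) = Eq (r i) (r j)"
| "ren r (Neg \<phi>) = Neg (ren r \<phi>)"
| "ren r (And \<phi> \<psi>) = And (ren r \<phi>) (ren r \<psi>)"
| "ren r (All i \<phi>) = All (r i) (ren r \<phi>)"

text \<open>Injectivity keeps distinct variables distinct, so that updating the environment at the
  renamed bound variable disturbs no other variable.\<close>

lemma sats_ren: "inj r \<Longrightarrow> sats U e (ren r \<phi>) \<longleftrightarrow> sats U (\<lambda>n. e (r n)) \<phi>"
proof (induction \<phi> arbitrary: e)
  case (All i \<phi>)
  have "(\<lambda>n. (e(r i := x)) (r n)) = (\<lambda>n. e (r n))(i := x)" for x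
    using \<open>inj r\<close> by (auto simp: inj_eq)
  then show ?case by (simp add: All.IH[OF \<open>inj r\<close>])
qed simp_all

text \<open>Even indices carry variables and odd ones parameters, so that formulas with different
  parameters can be combined after renaming.\<close>

definition merge :: "(nat \<Rightarrow> 'a) \<Rightarrow> (nat \<Rightarrow> 'a) \<Rightarrow> nat \<Rightarrow> 'a" where
  "merge e p k = (if even k then e (k div 2) else p (k div 2))"

lemma merge_even [simp]: "merge e p (2 * k) = e k"
  and merge_odd [simp]: "merge e p (Suc (2 * k)) = p k"
  by (simp_all add: merge_def)

lemma parity_cases:
  fixes n :: nat
  obtains k where "n = 2 * k" | k where "n = Suc (2 * k)"
  by (cases "even n") (auto elim!: evenE oddE)

lemma merge_eqI:
  assumes "\<And>k. g (2 * k) = e k" "\<And>k. g (Suc (2 * k)) = p k"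
  shows "g = merge e p"
proof
  fix n show "g n = merge e p n"
    by (cases n rule: parity_cases) (simp_all only: assms merge_even merge_odd)
qed

text \<open>Tailored to renamings that preserve parity, under which variables and parameters cannot
  collide.\<close>

lemma inj_parityI:
  fixes r f g :: "nat \<Rightarrow> nat"
  assumes "\<And>k. r (2 * k) = 2 * f k" "\<And>k. r (Suc (2 * k)) = Suc (2 * g k)" "inj f" "inj g"
  shows "inj r"
proof (rule injI)
  fix m n assume "r m = r n"
  moreover have "2 * a \<noteq> Suc (2 * b)" for a b :: nat by presburger
  ultimately show "m = n"
    by (cases m rule: parity_cases; cases n rule: parity_cases)
      (simp_all add: assms(1,2) inj_eq[OF assms(3)] inj_eq[OF assms(4)], metis+)
qed

section \<open>The axioms of the model; definable predicates and operations\<close>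

locale zfc_model =
  fixes V :: "'i hset set"
  assumes zfc: "transitive_ZFC_model V"
begin

lemmas zfc' = zfc[unfolded transitive_ZFC_model_def]

lemma V_trans: "x \<in> V \<Longrightarrow> y \<in> elts x \<Longrightarrow> y \<in> V"
  using conjunct1[OF zfc'] by blast

lemma V_pair: "a \<in> V \<Longrightarrow> b \<in> V \<Longrightarrow> hset {a, b} \<in> V"
  using conjunct1[OF conjunct2[OF zfc']] by blast

lemma V_Union_ex: "A \<in> V \<Longrightarrow> \<exists>U\<in>V. elts U = (\<Union>x\<in>elts A. elts x)"
  using conjunct1[OF conjunct2[OF conjunct2[OF zfc']]] by (rule bspec)

lemma V_Pow_ex: "A \<in> V \<Longrightarrow> \<exists>Q\<in>V. elts Q = {x \<in> V. elts x \<subseteq> elts A}"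
  using conjunct1[OF conjunct2[OF conjunct2[OF conjunct2[OF zfc']]]] by (rule bspec)

lemma V_infinity: "\<exists>A\<in>V. hset {} \<in> elts A \<and> (\<forall>x\<in>elts A. hset (insert x (elts x)) \<in> elts A)"
  by (rule conjunct1[OF conjunct2[OF conjunct2[OF conjunct2[OF conjunct2[OF zfc']]]]])

lemma V_separation: "A \<in> V \<Longrightarrow> range e \<subseteq> V \<Longrightarrow> \<exists>B\<in>V. elts B = {x \<in> elts A. sats V (e(0 := x)) \<phi>}"
  by (rule conjunct1[OF conjunct2[OF conjunct2[OF conjunct2[OF conjunct2[OF conjunct2[OF zfc']]]]],
      rule_format])

lemma V_replacement:
  "A \<in> V \<Longrightarrow> range e \<subseteq> V \<Longrightarrow> \<forall>x\<in>elts A. \<exists>!y. y \<in> V \<and> sats V (e(0 := x, 1 := y)) \<phi> \<Longrightarrow>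
   \<exists>B\<in>V. elts B = {y \<in> V. \<exists>x\<in>elts A. sats V (e(0 := x, 1 := y)) \<phi>}"
  using conjunct1[OF conjunct2[OF conjunct2[OF conjunct2[OF conjunct2[OF conjunct2[OF conjunct2[OF zfc']]]]]],
      THEN spec, THEN spec, THEN bspec, THEN mp, THEN mp, of A e \<phi>] .

lemma V_choice:
  "A \<in> V \<Longrightarrow> \<forall>x\<in>elts A. elts x \<noteq> {} \<Longrightarrow>
   \<forall>x\<in>elts A. \<forall>y\<in>elts A. x \<noteq> y \<longrightarrow> elts x \<inter> elts y = {} \<Longrightarrow>
   \<exists>C\<in>V. \<forall>x\<in>elts A. \<exists>!z. z \<in> elts C \<and> z \<in> elts x"
  using conjunct2[OF conjunct2[OF conjunct2[OF conjunct2[OF conjunct2[OF conjunct2[OF conjunct2[OF zfc']]]]]],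
      THEN bspec, THEN mp, THEN mp, of A] .

definition env :: "(nat \<Rightarrow> 'i hset) \<Rightarrow> bool" where
  "env e \<longleftrightarrow> range e \<subseteq> V"

lemma env_V [simp]: "env e \<Longrightarrow> e n \<in> V"
  unfolding env_def by auto

lemma env_comp [simp]: "env e \<Longrightarrow> env (\<lambda>n. e (f n))"
  unfolding env_def by auto

lemma env_case_nat [simp]: "env (case_nat x e) \<longleftrightarrow> x \<in> V \<and> env e"
proof
  assume env: "env (case_nat x e)"
  then have "x \<in> V" using env_V[of "case_nat x e" 0] by simp
  moreover have "e n \<in> V" for n using env env_V[of "case_nat x e" "Suc n"] by simp
  ultimately show "x \<in> V \<and> env e" unfolding env_def by blast
next
  assume "x \<in> V \<and> env e"
  then have "case_nat x e n \<in> V" for n by (cases n) simp_all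
  then show "env (case_nat x e)" unfolding env_def by blast
qed

lemma env_merge [simp]: "env e \<Longrightarrow> env p \<Longrightarrow> env (merge e p)"
  unfolding env_def merge_def by auto

lemma env_const [simp]: "env (\<lambda>_. c) \<longleftrightarrow> c \<in> V"
  unfolding env_def by auto

text \<open>Environments list de Bruijn variables: under a binder, \<open>e 0\<close> is the bound variable and
  \<open>\<lambda>n. e (Suc n)\<close> the outer environment. Both notions only matter on environments from \<open>V\<close>.\<close>

definition dpred :: "((nat \<Rightarrow> 'i hset) \<Rightarrow> bool) \<Rightarrow> bool" where
  "dpred P \<longleftrightarrow> (\<exists>\<phi> p. env p \<and> (\<forall>e. env e \<longrightarrow> (P e \<longleftrightarrow> sats V (merge e p) \<phi>)))"

definition dfun :: "((nat \<Rightarrow> 'i hset) \<Rightarrow> 'i hset) \<Rightarrow> bool" where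
  "dfun t \<longleftrightarrow> (\<forall>e. env e \<longrightarrow> t e \<in> V) \<and> dpred (\<lambda>e. e 0 = t (\<lambda>n. e (Suc n)))"

lemma dfun_V: "dfun t \<Longrightarrow> env e \<Longrightarrow> t e \<in> V"
  unfolding dfun_def by simp

text \<open>Syntax-directed closure rules: \<open>intro dintros\<close> takes a predicate or term
  apart along its HOL structure and leaves only the membership of its parameters in V.\<close>

named_theorems dintros

lemma dpredI: "env p \<Longrightarrow> (\<And>e. env e \<Longrightarrow> P e \<longleftrightarrow> sats V (merge e p) \<phi>) \<Longrightarrow> dpred P"
  unfolding dpred_def by blast

lemma dpred_cong: "(\<And>e. env e \<Longrightarrow> P e \<longleftrightarrow> Q e) \<Longrightarrow> dpred Q \<Longrightarrow> dpred P"
  unfolding dpred_def by simp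

lemma V_nonempty: "\<exists>x. x \<in> V"
  using V_infinity by blast

lemma dpred_eq_var: "dpred (\<lambda>e. e i = e j)"
proof -
  obtain c where "c \<in> V" using V_nonempty ..
  then show ?thesis by (intro dpredI[of "\<lambda>_. c" _ "Eq (2*i) (2*j)"]) simp_all
qed

lemma dpred_mem_var: "dpred (\<lambda>e. e i \<in> elts (e j))"
proof -
  obtain c where "c \<in> V" using V_nonempty ..
  then show ?thesis by (intro dpredI[of "\<lambda>_. c" _ "Mem (2*i) (2*j)"]) simp_all
qed

lemma dpred_eq_const: "c \<in> V \<Longrightarrow> dpred (\<lambda>e. e i = c)"
  by (intro dpredI[of "\<lambda>_. c" _ "Eq (2*i) (Suc (2*0))"]) (simp_all only: env_const sats.simps merge_even merge_odd)

lemma dpred_reindex: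
  assumes "dpred P" "inj f"
  shows "dpred (\<lambda>e. P (\<lambda>n. e (f n)))"
proof -
  obtain \<phi> p where p: "env p" and *: "\<And>e. env e \<Longrightarrow> P e \<longleftrightarrow> sats V (merge e p) \<phi>"
    using assms(1) unfolding dpred_def by blast
  define r where "r k = (if even k then 2 * f (k div 2) else k)" for k
  have r: "r (2 * k) = 2 * f k" "r (Suc (2 * k)) = Suc (2 * k)" for k
    unfolding r_def by simp_all
  have "inj r" using assms(2) by (intro inj_parityI[OF r]) simp_all
  have "(\<lambda>n. merge e p (r n)) = merge (\<lambda>n. e (f n)) p" for e
    by (rule merge_eqI) (simp_all only: r merge_even merge_odd)
  then show ?thesis
    using p by (intro dpredI[of p _ "ren r \<phi>"]) (simp_all add: sats_ren[OF \<open>inj r\<close>] *)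
qed

lemma dpred_not [dintros]: "dpred P \<Longrightarrow> dpred (\<lambda>e. \<not> P e)"
  unfolding dpred_def by (metis sats.simps(3))

lemma dpred_conj [dintros]:
  assumes "dpred P" "dpred Q"
  shows "dpred (\<lambda>e. P e \<and> Q e)"
proof -
  obtain \<phi> p where p: "env p" and 1: "\<And>e. env e \<Longrightarrow> P e \<longleftrightarrow> sats V (merge e p) \<phi>"
    using assms(1) unfolding dpred_def by blast
  obtain \<psi> q where q: "env q" and 2: "\<And>e. env e \<Longrightarrow> Q e \<longleftrightarrow> sats V (merge e q) \<psi>"
    using assms(2) unfolding dpred_def by blast
  \<comment> \<open>Both renamings keep the variables. The parameters of \<open>\<phi>\<close> move
    to the even parameter slots and those of \<open>\<psi>\<close> to the odd ones, which is where
    \<open>merge p q\<close> stores them.\<close>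
  define r where "r k = (if even k then k else Suc (2 * (2 * (k div 2))))" for k :: nat
  define s where "s k = (if even k then k else Suc (2 * Suc (2 * (k div 2))))" for k :: nat
  have r: "r (2 * k) = 2 * k" "r (Suc (2 * k)) = Suc (2 * (2 * k))" for k
    unfolding r_def by simp_all
  have s: "s (2 * k) = 2 * k" "s (Suc (2 * k)) = Suc (2 * Suc (2 * k))" for k
    unfolding s_def by simp_all
  have "inj r" "inj s"
    by (rule inj_parityI[OF r] inj_parityI[OF s]; simp add: inj_def)+
  have "(\<lambda>n. merge e (merge p q) (r n)) = merge e p" for e
    by (rule merge_eqI) (simp_all only: r merge_even merge_odd)
  moreover have "(\<lambda>n. merge e (merge p q) (s n)) = merge e q" for e
    by (rule merge_eqI) (simp_all only: s merge_even merge_odd)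
  ultimately show ?thesis
    using p q by (intro dpredI[of "merge p q" _ "And (ren r \<phi>) (ren s \<psi>)"])
      (simp_all add: sats_ren[OF \<open>inj r\<close>] sats_ren[OF \<open>inj s\<close>] 1 2)
qed

lemma dpred_all [dintros]:
  assumes "dpred (\<lambda>e. Q (e 0) (\<lambda>n. e (Suc n)))"
  shows "dpred (\<lambda>e. \<forall>x\<in>V. Q x e)"
proof -
  obtain \<phi> p where p: "env p"
    and *: "\<And>e. env e \<Longrightarrow> Q (e 0) (\<lambda>n. e (Suc n)) \<longleftrightarrow> sats V (merge e p) \<phi>"
    using assms unfolding dpred_def by blast
  have 1: "Q x e \<longleftrightarrow> sats V (merge (case_nat x e) p) \<phi>" if "env e" "x \<in> V" for x e
    using *[of "case_nat x e"] that by simp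
  \<comment> \<open>The bound variable moves from index 0 to index 1, the first parameter slot, and
    the outer variables move down by one place. The parameters move up by one place to vacate that
    slot, whose entry \<open>p 0\<close> in the new list is a dummy overwritten by the
    quantifier.\<close>
  define r where "r k = (if even k then if k = 0 then 1 else k - 2 else k + 2)" for k :: nat
  have "inj r"
    unfolding r_def by (auto simp: inj_def split: if_splits; presburger)
  have 2: "(\<lambda>n. ((merge e (case_nat (p 0) p))(1 := x)) (r n)) = merge (case_nat x e) p" for e x
  proof
    fix n :: nat
    show "((merge e (case_nat (p 0) p))(1 := x)) (r n) = merge (case_nat x e) p n"
    proof (cases "even n")
      case True
      then obtain k where "n = 2 * k" by blast
      then have "((merge e (case_nat (p 0) p))(1 := x)) (r n) = case_nat x e k"
        by (cases k) (auto simp: r_def)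
      then show ?thesis unfolding \<open>n = 2 * k\<close> merge_even .
    next
      case False
      then obtain k where "n = Suc (2 * k)" using oddE by fastforce
      moreover have "r (Suc (2 * k)) = Suc (2 * Suc k)" by (simp add: r_def)
      ultimately show ?thesis by (simp del: mult_Suc_right)
    qed
  qed
  show ?thesis
    using p by (intro dpredI[of "case_nat (p 0) p" _ "All 1 (ren r \<phi>)"])
      (simp_all add: sats_ren[OF \<open>inj r\<close>] 1 2 del: fun_upd_apply One_nat_def)
qed

lemma dpred_ex [dintros]:
  assumes "dpred (\<lambda>e. Q (e 0) (\<lambda>n. e (Suc n)))"
  shows "dpred (\<lambda>e. \<exists>x\<in>V. Q x e)"
  by (rule dpred_cong[OF _ dpred_not[OF dpred_all[OF dpred_not[OF assms]]]]) simp

lemma dpred_disj [dintros]: "dpred P \<Longrightarrow> dpred Q \<Longrightarrow> dpred (\<lambda>e. P e \<or> Q e)"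
  by (rule dpred_cong[of _ "\<lambda>e. \<not> (\<not> P e \<and> \<not> Q e)"]) (blast, intro dintros)

lemma dpred_imp [dintros]: "dpred P \<Longrightarrow> dpred Q \<Longrightarrow> dpred (\<lambda>e. P e \<longrightarrow> Q e)"
  by (rule dpred_cong[of _ "\<lambda>e. \<not> P e \<or> Q e"]) (blast, intro dintros)

lemma dpred_iff [dintros]: "dpred P \<Longrightarrow> dpred Q \<Longrightarrow> dpred (\<lambda>e. P e \<longleftrightarrow> Q e)"
  by (rule dpred_cong[of _ "\<lambda>e. (P e \<longrightarrow> Q e) \<and> (Q e \<longrightarrow> P e)"]) (blast, intro dintros)

text \<open>Formulas contain no terms, so a definable term is eliminated by quantifying over its
  value: some x in V equals \<open>s e\<close> and satisfies the predicate.\<close>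

lemma dpred_subst:
  assumes "dpred (\<lambda>e. Q (e 0) (\<lambda>n. e (Suc n)))" "dfun s"
  shows "dpred (\<lambda>e. Q (s e) e)"
proof -
  have "dpred (\<lambda>e. \<exists>x\<in>V. x = s e \<and> Q x e)"
    using assms by (intro dintros) (simp_all add: dfun_def)
  then show ?thesis
    by (rule dpred_cong[rotated]) (use assms(2) in \<open>auto simp: dfun_V\<close>)
qed

lemma dfun_reindex:
  assumes "dfun t" "inj f"
  shows "dfun (\<lambda>e. t (\<lambda>n. e (f n)))"
proof -
  let ?f = "case_nat 0 (\<lambda>n. Suc (f n))"
  have "inj ?f"
  proof (rule injI)
    fix m n assume "?f m = ?f n"
    then show "m = n" by (cases m; cases n) (simp_all add: inj_eq[OF assms(2)])
  qed
  moreover have "dpred (\<lambda>e. e 0 = t (\<lambda>n. e (Suc n)))" using assms(1) unfolding dfun_def ..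
  ultimately have "dpred (\<lambda>e. e (?f 0) = t (\<lambda>n. e (?f (Suc n))))"
    using dpred_reindex[of "\<lambda>e. e 0 = t (\<lambda>n. e (Suc n))" ?f] by blast
  then show ?thesis
    unfolding dfun_def nat.case using dfun_V[OF assms(1)] env_comp by blast
qed

lemma dfun_weaken: "dfun t \<Longrightarrow> dfun (\<lambda>e. t (\<lambda>n. e (Suc n)))"
  by (rule dfun_reindex) simp_all

lemma dfun_subst:
  assumes "dfun (\<lambda>e. t (e 0) (\<lambda>n. e (Suc n)))" "dfun s"
  shows "dfun (\<lambda>e. t (s e) e)"
proof -
  \<comment> \<open>In the graph of \<open>t\<close> the value stands at index 0 and the variable to
    be replaced at index 1. Swapping the two brings the latter to the front, where substitution into
    a predicate applies.\<close>
  let ?f = "\<lambda>n. case n of 0 \<Rightarrow> Suc 0 | Suc 0 \<Rightarrow> 0 | Suc (Suc n) \<Rightarrow> Suc (Suc n)"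
  have "inj ?f" by (auto simp: inj_def split: nat.splits)
  have "dpred (\<lambda>e. e 0 = t (e (Suc 0)) (\<lambda>n. e (Suc (Suc n))))"
    using assms(1) unfolding dfun_def by simp
  from dpred_reindex[OF this \<open>inj ?f\<close>]
  have "dpred (\<lambda>e. (\<lambda>x e'. e' 0 = t x (\<lambda>n. e' (Suc n))) (e 0) (\<lambda>n. e (Suc n)))" by simp
  from dpred_subst[OF this dfun_weaken[OF assms(2)]]
  have "dpred (\<lambda>e. e 0 = t (s (\<lambda>n. e (Suc n))) (\<lambda>n. e (Suc n)))" .
  moreover have "t (s e) e \<in> V" if "env e" for e
    using dfun_V[OF assms(1), of "case_nat (s e) e"] dfun_V[OF assms(2)] that by simp
  ultimately show ?thesis unfolding dfun_def by simp
qed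

lemma dfun_var [dintros]: "dfun (\<lambda>e. e i)"
  unfolding dfun_def using dpred_eq_var by simp

lemma dfun_const [dintros]: "c \<in> V \<Longrightarrow> dfun (\<lambda>e. c)"
  unfolding dfun_def using dpred_eq_const by simp

text \<open>With these composition rules definability of a relation or operation without further
  environment has to be checked at variables only; arbitrary definable terms are plugged in
  afterwards.\<close>

lemma dpred_comp1: "dpred (\<lambda>e. R (e 0)) \<Longrightarrow> dfun s \<Longrightarrow> dpred (\<lambda>e. R (s e))"
  by (rule dpred_subst)

lemma dfun_comp1: "dfun (\<lambda>e. F (e 0)) \<Longrightarrow> dfun s \<Longrightarrow> dfun (\<lambda>e. F (s e))"
  by (rule dfun_subst)

lemma dpred_comp2:
  assumes "dpred (\<lambda>e. R (e 0) (e (Suc 0)))" "dfun s" "dfun t"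
  shows "dpred (\<lambda>e. R (s e) (t e))"
proof -
  have "dpred (\<lambda>e. R (s (\<lambda>n. e (Suc n))) (e 0))"
    using dpred_subst[of "\<lambda>x e. R x (e 0)" "\<lambda>e. s (\<lambda>n. e (Suc n))"] assms(1) dfun_weaken[OF assms(2)]
    by simp
  then show ?thesis using dpred_subst[of "\<lambda>x e. R (s e) x"] assms(3) by simp
qed

lemma dfun_comp2:
  assumes "dfun (\<lambda>e. F (e 0) (e (Suc 0)))" "dfun s" "dfun t"
  shows "dfun (\<lambda>e. F (s e) (t e))"
proof -
  have "dfun (\<lambda>e. F (s (\<lambda>n. e (Suc n))) (e 0))"
    using dfun_subst[of "\<lambda>x e. F x (e 0)" "\<lambda>e. s (\<lambda>n. e (Suc n))"] assms(1) dfun_weaken[OF assms(2)]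
    by simp
  then show ?thesis using dfun_subst[of "\<lambda>x e. F (s e) x"] assms(3) by simp
qed

lemma dpred_comp3:
  assumes "dpred (\<lambda>e. R (e 0) (e (Suc 0)) (e (Suc (Suc 0))))" "dfun s" "dfun t" "dfun u"
  shows "dpred (\<lambda>e. R (s e) (t e) (u e))"
proof -
  have "dpred (\<lambda>e. R (s (\<lambda>n. e (Suc (Suc n)))) (e 0) (e (Suc 0)))"
    using dpred_subst[of "\<lambda>x e. R x (e 0) (e (Suc 0))" "\<lambda>e. s (\<lambda>n. e (Suc (Suc n)))"]
      assms(1) dfun_weaken[OF dfun_weaken[OF assms(2)]] by simp
  from dpred_subst[of "\<lambda>x e. R (s (\<lambda>n. e (Suc n))) x (e 0)", OF this dfun_weaken[OF assms(3)]]
  show ?thesis using dpred_subst[of "\<lambda>x e. R (s e) (t e) x"] assms(4) by simp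
qed

lemma dpred_mem [dintros]: "dfun s \<Longrightarrow> dfun t \<Longrightarrow> dpred (\<lambda>e. s e \<in> elts (t e))"
  by (rule dpred_comp2[OF dpred_mem_var[of 0 "Suc 0"]])

lemma dpred_eq [dintros]: "dfun s \<Longrightarrow> dfun t \<Longrightarrow> dpred (\<lambda>e. s e = t e)"
  by (rule dpred_comp2[OF dpred_eq_var[of 0 "Suc 0"]])

lemma dpred_ball [dintros]:
  assumes "dfun t" "dpred (\<lambda>e. Q (e 0) (\<lambda>n. e (Suc n)))"
  shows "dpred (\<lambda>e. \<forall>x\<in>elts (t e). Q x e)"
proof -
  have "dpred (\<lambda>e. \<forall>x\<in>V. x \<in> elts (t e) \<longrightarrow> Q x e)"
    using assms by (intro dintros dfun_weaken)
  then show ?thesis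
    by (rule dpred_cong[rotated]) (use assms(1) V_trans dfun_V in blast)
qed

lemma dpred_bex [dintros]:
  assumes "dfun t" "dpred (\<lambda>e. Q (e 0) (\<lambda>n. e (Suc n)))"
  shows "dpred (\<lambda>e. \<exists>x\<in>elts (t e). Q x e)"
  by (rule dpred_cong[OF _ dpred_not[OF dpred_ball[OF assms(1) dpred_not[OF assms(2)]]]]) simp

lemma dpred_subset [dintros]: "dfun s \<Longrightarrow> dfun t \<Longrightarrow> dpred (\<lambda>e. elts (s e) \<subseteq> elts (t e))"
  unfolding subset_eq by (intro dintros dfun_weaken)

lemma dpred_const [dintros]: "dpred (\<lambda>e. b)"
proof -
  obtain c where "c \<in> V" using V_nonempty ..
  then have "dpred (\<lambda>e. c = c)" by (intro dintros)
  then show ?thesis using dpred_not by (cases b) fastforce+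
qed

lemma dfunI:
  assumes "\<And>e. env e \<Longrightarrow> t e \<in> V" "dpred (\<lambda>e. R (e 0) (\<lambda>n. e (Suc n)))"
    and "\<And>x e. env e \<Longrightarrow> x \<in> V \<Longrightarrow> x = t e \<longleftrightarrow> R x e"
  shows "dfun t"
proof -
  have "dpred (\<lambda>e. e 0 = t (\<lambda>n. e (Suc n)))"
    by (rule dpred_cong[OF _ assms(2)]) (simp add: assms(3))
  then show ?thesis unfolding dfun_def using assms(1) by simp
qed

text \<open>By extensionality in the transitive set V, the graph of a set-valued term is definable
  as soon as membership in its value is. That the value belongs to V has to be supplied by an axiom
  in each case.\<close>

lemma dfun_setI:
  assumes "\<And>e. env e \<Longrightarrow> t e \<in> V" "dpred (\<lambda>e. R (e 0) (\<lambda>n. e (Suc n)))"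
    and "\<And>x e. env e \<Longrightarrow> x \<in> elts (t e) \<longleftrightarrow> x \<in> V \<and> R x e"
  shows "dfun t"
proof (rule dfunI[OF assms(1)])
  have inj: "inj (\<lambda>n::nat. case n of 0 \<Rightarrow> 0 | Suc n \<Rightarrow> Suc (Suc n))"
    by (auto simp: inj_def split: nat.splits)
  have "dpred (\<lambda>e. R (e 0) (\<lambda>n. e (Suc (Suc n))))"
    using dpred_reindex[OF assms(2) inj] by simp
  then show "dpred (\<lambda>e. \<forall>y\<in>V. y \<in> elts (e 0) \<longleftrightarrow> R y (\<lambda>n. e (Suc n)))"
    by (intro dintros)
next
  fix x e assume "env e" "x \<in> V"
  then show "x = t e \<longleftrightarrow> (\<forall>y\<in>V. y \<in> elts x \<longleftrightarrow> R y e)"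
    using assms(3)[of e] V_trans[of x] elts_inject[of x "t e"] by blast
qed

lemma V_sep_ex:
  assumes "dpred (\<lambda>e. Q (e 0) (\<lambda>n. e (Suc n)))" "A \<in> V" "env e"
  shows "\<exists>B\<in>V. elts B = {x \<in> elts A. Q x e}"
proof -
  obtain \<phi> p where p: "env p"
    and *: "\<And>e. env e \<Longrightarrow> Q (e 0) (\<lambda>n. e (Suc n)) \<longleftrightarrow> sats V (merge e p) \<phi>"
    using assms(1) unfolding dpred_def by blast
  \<comment> \<open>Separation tests elements at index 0, the first variable slot of
    \<open>merge\<close>. The entry \<open>A\<close> placed there is a dummy which every test
    overwrites.\<close>
  let ?e = "merge (case_nat A e) p"
  have "?e(0 := x) = merge (case_nat x e) p" for x
    by (auto simp: merge_def fun_eq_iff split: nat.splits elim!: evenE)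
  moreover have "Q x e \<longleftrightarrow> sats V (merge (case_nat x e) p) \<phi>" if "x \<in> V" for x
    using *[of "case_nat x e"] assms(3) that by simp
  moreover have "env ?e" using assms p by simp
  ultimately show ?thesis
    using V_separation[OF assms(2), of ?e \<phi>] V_trans[OF assms(2)] unfolding env_def
    by (auto simp del: fun_upd_apply cong: conj_cong)
qed

lemma V_repl_ex:
  assumes "dpred (\<lambda>e. Q (e 0) (e (Suc 0)) (\<lambda>n. e (Suc (Suc n))))" "A \<in> V" "env e"
    and "\<And>x. x \<in> elts A \<Longrightarrow> \<exists>!y. y \<in> V \<and> Q x y e"
  shows "\<exists>B\<in>V. elts B = {y \<in> V. \<exists>x\<in>elts A. Q x y e}"
proof -
  obtain \<phi> p where p: "env p"
    and *: "\<And>e. env e \<Longrightarrow> Q (e 0) (e (Suc 0)) (\<lambda>n. e (Suc (Suc n))) \<longleftrightarrow> sats V (merge e p) \<phi>"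
    using assms(1) unfolding dpred_def by blast
  \<comment> \<open>The axiom places argument and value at indices 0 and 1, whereas the second
    variable of a merged environment sits at index 2; hence the swap of 1 and 2.\<close>
  define r where "r = (\<lambda>n. n)(1 := 2, 2 := 1 :: nat)"
  have "inj r" unfolding r_def by (auto simp: inj_def)
  let ?e = "\<lambda>n. merge (case_nat A (case_nat A e)) p (r n)"
  have 1: "(\<lambda>n. (?e(0 := x, 1 := y)) (r n)) = merge (case_nat x (case_nat y e)) p" for x y
  proof
    fix n :: nat
    have "n = 0 \<or> n = 1 \<or> n = 2 \<or> n > 2" by auto
    moreover have "merge (case_nat A (case_nat A e)) p n = merge (case_nat x (case_nat y e)) p n"
      if "n > 2"
    proof -
      have "n div 2 = Suc (Suc (n div 2 - 2))" if "even n"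
        using that \<open>n > 2\<close> by (auto elim!: evenE)
      then show ?thesis unfolding merge_def by (metis nat.case(2))
    qed
    ultimately show "(?e(0 := x, 1 := y)) (r n) = merge (case_nat x (case_nat y e)) p n"
      by (auto simp: r_def merge_def)
  qed
  have 2: "Q x y e \<longleftrightarrow> sats V (?e(0 := x, 1 := y)) (ren r \<phi>)" if "x \<in> V" "y \<in> V" for x y
    unfolding sats_ren[OF \<open>inj r\<close>] 1
    using *[of "case_nat x (case_nat y e)"] assms(3) that by simp
  have "range ?e \<subseteq> V" using assms p unfolding env_def[symmetric] by simp
  moreover have "\<forall>x\<in>elts A. \<exists>!y. y \<in> V \<and> sats V (?e(0 := x, 1 := y)) (ren r \<phi>)"
    using assms(4) 2 V_trans[OF assms(2)] by metis
  ultimately obtain B where "B \<in> V"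
    and "elts B = {y \<in> V. \<exists>x\<in>elts A. sats V (?e(0 := x, 1 := y)) (ren r \<phi>)}"
    using V_replacement[OF assms(2), of ?e "ren r \<phi>"] by blast
  moreover have "{y \<in> V. \<exists>x\<in>elts A. sats V (?e(0 := x, 1 := y)) (ren r \<phi>)} = {y \<in> V. \<exists>x\<in>elts A. Q x y e}"
    using 2 V_trans[OF assms(2)] by blast
  ultimately show ?thesis by metis
qed

end

section \<open>Set operations in the model\<close>

text \<open>The summand \<open>nat\<close> makes the index type infinite, hence equinumerous with
  its square. The bijection \<open>g\<close> splits an index into one for the member of A and one
  for an element below it.\<close>

lemma small_Union:
  fixes A :: "'i hset set" and F :: "'i hset \<Rightarrow> 'i hset"
  assumes "small A"
  shows "small (\<Union>x\<in>A. elts (F x))"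
proof -
  obtain J :: "(nat + 'i) set" and f where A: "A = f ` J"
    using assms unfolding small_def by (elim exE)
  have "\<forall>j. \<exists>(K :: (nat + 'i) set) h. elts (F (f j)) = h ` K"
    by (intro allI small_elts[unfolded small_def])
  then obtain K :: "nat + 'i \<Rightarrow> (nat + 'i) set" and h where K: "\<And>j. elts (F (f j)) = h j ` K j"
    by metis
  have "infinite (UNIV :: (nat + 'i) set)"
    by (simp add: finite_Plus_UNIV_iff)
  from card_of_Times_same_infinite[OF this]
  obtain g where g: "bij_betw g (UNIV :: (nat + 'i) set) (UNIV \<times> UNIV :: ((nat + 'i) \<times> (nat + 'i)) set)"
    using card_of_ordIso ordIso_symmetric by blast
  let ?v = "\<lambda>z. h (fst (g z)) (snd (g z))"
  have "(\<Union>x\<in>A. elts (F x)) = ?v ` {z. fst (g z) \<in> J \<and> snd (g z) \<in> K (fst (g z))}"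
  proof (intro equalityI subsetI)
    fix y assume "y \<in> (\<Union>x\<in>A. elts (F x))"
    then obtain j k where jk: "j \<in> J" "k \<in> K j" "y = h j k" using A K by auto
    moreover obtain z where "g z = (j, k)"
      using bij_betw_imp_surj_on[OF g] by (metis UNIV_I UNIV_Times_UNIV image_iff)
    ultimately show "y \<in> ?v ` {z. fst (g z) \<in> J \<and> snd (g z) \<in> K (fst (g z))}"
      by (intro image_eqI[of _ _ z]) simp_all
  qed (use A K in auto)
  then show ?thesis by (rule smallI)
qed

lemma small_Collect [simp]: "small {x \<in> elts A. P x}"
  by (rule small_subset[OF small_elts]) blast

declare small_elts [simp] small_image [simp] small_insert [simp] elts_hset [simp]

lemma small_UN [simp]:
  fixes B :: "'i hset \<Rightarrow> 'i hset set"
  assumes "small A" "\<And>x. x \<in> A \<Longrightarrow> small (B x)"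
  shows "small (\<Union>x\<in>A. B x)"
  using small_Union[OF assms(1), of "\<lambda>x. hset (B x)"] assms(2) by simp

lemma small_Un [simp]:
  assumes "small A" "small B"
  shows "small (A \<union> B)"
proof -
  have "small (\<Union>x\<in>{hset A, hset B}. elts x)"
    by (rule small_Union) (simp add: small_countable)
  then show ?thesis using assms by simp
qed

lemma small_Int [simp]: "small A \<Longrightarrow> small (A \<inter> B)"
  by (rule small_subset) blast+

lemma mem_sep: "x \<in> elts (hset {x \<in> elts A. P x}) \<longleftrightarrow> x \<in> elts A \<and> P x"
  by simp

lemma small_empty [simp]: "small {}"
  by (simp add: small_countable)

abbreviation mem_rel :: "('i hset \<times> 'i hset) set" where
  "mem_rel \<equiv> {(x, y). x \<in> elts y}"

lemma trancl_mem_induct: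
  assumes "\<And>x. (\<And>y. (y, x) \<in> mem_rel\<^sup>+ \<Longrightarrow> P y) \<Longrightarrow> P x"
  shows "P x"
  using wf_trancl[OF wf_mem] by (rule wf_induct_rule) (rule assms)

lemma mem_irrefl: "x \<notin> elts x"
  using wf_mem by (auto elim: wf_irrefl)

text \<open>On non-pairs both projections return their argument. This keeps them total and inside V,
  and it makes \<open>hsnd\<close> descend along membership whether or not an entry is a
  pair.\<close>

definition hfst :: "'i hset \<Rightarrow> 'i hset" where
  "hfst z = (if \<exists>a b. z = \<langle>a, b\<rangle> then THE a. \<exists>b. z = \<langle>a, b\<rangle> else z)"

definition hsnd :: "'i hset \<Rightarrow> 'i hset" where
  "hsnd z = (if \<exists>a b. z = \<langle>a, b\<rangle> then THE b. \<exists>a. z = \<langle>a, b\<rangle> else z)"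

lemma hfst_opair [simp]: "hfst \<langle>a, b\<rangle> = a"
  and hsnd_opair [simp]: "hsnd \<langle>a, b\<rangle> = b"
  by (auto simp: hfst_def hsnd_def)

lemma hfst_nopair: "\<nexists>a b. z = \<langle>a, b\<rangle> \<Longrightarrow> hfst z = z"
  and hsnd_nopair: "\<nexists>a b. z = \<langle>a, b\<rangle> \<Longrightarrow> hsnd z = z"
  by (auto simp: hfst_def hsnd_def)

text \<open>Makes recursion on the entries of a name terminate on arbitrary sets, so that such
  recursions can be defined without first checking that the argument is a name.\<close>

lemma hsnd_trancl: "w \<in> elts x \<Longrightarrow> (hsnd w, x) \<in> mem_rel\<^sup>+"
proof (cases "\<exists>a b. w = \<langle>a, b\<rangle>")
  case True
  then obtain a b where w: "w = \<langle>a, b\<rangle>" by blast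
  assume "w \<in> elts x"
  then have "(\<langle>a, b\<rangle>, x) \<in> mem_rel" using w by simp
  with opair_mem_wf[of b a] show ?thesis unfolding w hsnd_opair by (rule trancl_into_trancl)
qed (auto simp: hsnd_nopair)

definition prodset :: "'i hset \<Rightarrow> 'i hset \<Rightarrow> 'i hset" where
  "prodset A B = hset (\<Union>a\<in>elts A. elts (hset ((\<lambda>b. \<langle>a, b\<rangle>) ` elts B)))"

lemma elts_prodset: "elts (prodset A B) = {\<langle>a, b\<rangle> |a b. a \<in> elts A \<and> b \<in> elts B}"
  unfolding prodset_def by auto

lemma opair_in_prodset [simp]: "\<langle>a, b\<rangle> \<in> elts (prodset A B) \<longleftrightarrow> a \<in> elts A \<and> b \<in> elts B"
  by (auto simp: elts_prodset)

text \<open>A total variant of application: unlike \<open>app\<close> it never leaves the model.\<close>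

definition ap :: "'i hset \<Rightarrow> 'i hset \<Rightarrow> 'i hset" where
  "ap f a = hset (\<Union>z\<in>elts (hset {z \<in> elts f. \<langle>a, hsnd z\<rangle> = z}). elts (hsnd z))"

lemma ap_eq:
  assumes "\<langle>a, b\<rangle> \<in> elts f" "\<And>b'. \<langle>a, b'\<rangle> \<in> elts f \<Longrightarrow> b' = b"
  shows "ap f a = b"
proof -
  have "z = \<langle>a, b\<rangle>" if "z \<in> elts f" "\<langle>a, hsnd z\<rangle> = z" for z
    using assms(2)[of "hsnd z"] that by metis
  moreover have "\<langle>a, hsnd \<langle>a, b\<rangle>\<rangle> = \<langle>a, b\<rangle>" by simp
  ultimately have "{z \<in> elts f. \<langle>a, hsnd z\<rangle> = z} = {\<langle>a, b\<rangle>}"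
    using assms(1) by blast
  then show ?thesis unfolding ap_def by simp
qed

lemma ap_eq_app:
  assumes "is_func f A B" "a \<in> A"
  shows "ap f a = app f a"
proof -
  obtain b where b: "\<langle>a, b\<rangle> \<in> elts f" "\<And>b'. \<langle>a, b'\<rangle> \<in> elts f \<Longrightarrow> b' = b"
    using assms unfolding is_func_def by blast
  then have "app f a = b" unfolding app_def by (intro the_equality)
  with ap_eq[OF b] show ?thesis by simp
qed

definition trans_set :: "'i hset \<Rightarrow> bool" where
  "trans_set x \<longleftrightarrow> (\<forall>y\<in>elts x. elts y \<subseteq> elts x)"

lemma trans_set_trancl:
  assumes "trans_set T" "(y, x) \<in> mem_rel\<^sup>+" "x \<in> elts T"
  shows "y \<in> elts T"
  using assms(2,3)
proof (induction rule: trancl_induct)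
  case (base x) then show ?case using assms(1) unfolding trans_set_def by blast
next
  case (step x z) then show ?case using assms(1) unfolding trans_set_def by blast
qed

definition functional :: "'i hset \<Rightarrow> bool" where
  "functional f \<longleftrightarrow> (\<forall>z\<in>elts f. \<forall>w\<in>elts f. \<langle>hfst z, hsnd z\<rangle> = z \<and> (hfst z = hfst w \<longrightarrow> hsnd z = hsnd w))"

lemma functional_pair: "functional f \<Longrightarrow> z \<in> elts f \<Longrightarrow> \<langle>hfst z, hsnd z\<rangle> = z"
  unfolding functional_def by blast

lemma functionalD: "functional f \<Longrightarrow> \<langle>a, b\<rangle> \<in> elts f \<Longrightarrow> \<langle>a, c\<rangle> \<in> elts f \<Longrightarrow> b = c"
  unfolding functional_def by (metis hfst_opair hsnd_opair)

lemma functionalI: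
  assumes "\<And>z. z \<in> elts f \<Longrightarrow> \<exists>a b. z = \<langle>a, b\<rangle>"
    and "\<And>a b c. \<langle>a, b\<rangle> \<in> elts f \<Longrightarrow> \<langle>a, c\<rangle> \<in> elts f \<Longrightarrow> b = c"
  shows "functional f"
  unfolding functional_def
proof (intro ballI)
  fix z w assume "z \<in> elts f" "w \<in> elts f"
  moreover then obtain a b c d where "z = \<langle>a, b\<rangle>" "w = \<langle>c, d\<rangle>" using assms(1) by meson
  ultimately show "\<langle>hfst z, hsnd z\<rangle> = z \<and> (hfst z = hfst w \<longrightarrow> hsnd z = hsnd w)"
    using assms(2) by auto
qed

lemma functional_ap: "functional f \<Longrightarrow> \<langle>a, b\<rangle> \<in> elts f \<Longrightarrow> ap f a = b"
  by (rule ap_eq) (auto dest: functionalD)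

lemma functional_subset: "functional f \<Longrightarrow> elts g \<subseteq> elts f \<Longrightarrow> functional g"
  unfolding functional_def by blast

section \<open>Definability of the set operations and closure of the model under them\<close>

context zfc_model
begin

lemma V_hset: "B \<in> V \<Longrightarrow> elts B = S \<Longrightarrow> hset S \<in> V"
  using hset_elts by metis

lemma dpred_tl: "dpred (\<lambda>e. P (\<lambda>n. e (Suc n)))" if "dpred P"
  using dpred_reindex[OF that] by simp

lemma dfun_sep [dintros]:
  assumes "dfun t" "dpred (\<lambda>e. Q (e 0) (\<lambda>n. e (Suc n)))"
  shows "dfun (\<lambda>e. hset {x \<in> elts (t e). Q x e})"
proof (rule dfun_setI)
  fix e assume "env e"
  then show "hset {x \<in> elts (t e). Q x e} \<in> V"
    using V_sep_ex[OF assms(2) dfun_V[OF assms(1)]] V_hset by blast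
next
  show "dpred (\<lambda>e. e 0 \<in> elts (t (\<lambda>n. e (Suc n))) \<and> Q (e 0) (\<lambda>n. e (Suc n)))"
    by (intro dintros assms dfun_weaken)
qed (use V_trans dfun_V[OF assms(1)] in auto)

text \<open>Replacement for operations instead of formulas: the graph of F is permuted so that
  argument and value come in the order in which \<open>V_repl_ex\<close> expects them.\<close>

lemma dfun_image [dintros]:
  assumes "dfun t" "dfun (\<lambda>e. F (e 0) (\<lambda>n. e (Suc n)))"
  shows "dfun (\<lambda>e. hset ((\<lambda>x. F x e) ` elts (t e)))"
proof (rule dfun_setI)
  let ?f = "\<lambda>n. case n of 0 \<Rightarrow> Suc 0 | Suc 0 \<Rightarrow> 0 | Suc (Suc n) \<Rightarrow> Suc (Suc n)"
  have inj: "inj ?f" by (auto simp: inj_def split: nat.splits)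
  have "dpred (\<lambda>e. e 0 = F (e (Suc 0)) (\<lambda>n. e (Suc (Suc n))))"
    using assms(2) unfolding dfun_def by simp
  from dpred_reindex[OF this inj]
  have d: "dpred (\<lambda>e. e (Suc 0) = F (e 0) (\<lambda>n. e (Suc (Suc n))))" by simp
  have F: "F x e \<in> V" if "x \<in> V" "env e" for x e
    using dfun_V[OF assms(2), of "case_nat x e"] that by simp
  show "dpred (\<lambda>e. \<exists>x\<in>elts (t (\<lambda>n. e (Suc n))). e 0 = F x (\<lambda>n. e (Suc n)))"
    by (intro dintros dfun_weaken assms(1) d)
  fix e assume e: "env e"
  have "\<exists>B\<in>V. elts B = {y \<in> V. \<exists>x\<in>elts (t e). y = F x e}"
    using e assms(1) F V_trans[OF dfun_V[OF assms(1) e]]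
    by (intro V_repl_ex[where Q = "\<lambda>x y e. y = F x e", OF d]) (auto simp: dfun_V)
  moreover have "{y \<in> V. \<exists>x\<in>elts (t e). y = F x e} = (\<lambda>x. F x e) ` elts (t e)"
    using F e V_trans[OF dfun_V[OF assms(1) e]] by auto
  ultimately show "hset ((\<lambda>x. F x e) ` elts (t e)) \<in> V" using V_hset by metis
  fix y
  show "y \<in> elts (hset ((\<lambda>x. F x e) ` elts (t e))) \<longleftrightarrow> y \<in> V \<and> (\<exists>x\<in>elts (t e). y = F x e)"
    using F e V_trans[OF dfun_V[OF assms(1) e]] by auto
qed

lemma dfun_Union:
  assumes "dfun t"
  shows "dfun (\<lambda>e. hset (\<Union>x\<in>elts (t e). elts x))"
proof (rule dfun_setI)
  fix e assume "env e"
  then show "hset (\<Union>x\<in>elts (t e). elts x) \<in> V"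
    using V_Union_ex[OF dfun_V[OF assms]] V_hset by blast
next
  show "dpred (\<lambda>e. \<exists>x\<in>elts (t (\<lambda>n. e (Suc n))). e 0 \<in> elts x)"
    by (intro dintros assms dfun_weaken)
next
  fix x e assume "env e"
  then have "x \<in> V" if "y \<in> elts (t e)" "x \<in> elts y" for y
    using that V_trans dfun_V[OF assms] by meson
  then show "x \<in> elts (hset (\<Union>x\<in>elts (t e). elts x)) \<longleftrightarrow> x \<in> V \<and> (\<exists>y\<in>elts (t e). x \<in> elts y)"
    by auto
qed

lemma dfun_UN [dintros]:
  assumes "dfun t" "dfun (\<lambda>e. F (e 0) (\<lambda>n. e (Suc n)))"
  shows "dfun (\<lambda>e. hset (\<Union>x\<in>elts (t e). elts (F x e)))"
  using dfun_Union[OF dfun_image[OF assms]] by simp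

lemma dfun_pair [dintros]:
  assumes "dfun s" "dfun t"
  shows "dfun (\<lambda>e. hset {s e, t e})"
proof (rule dfun_setI)
  show "dpred (\<lambda>e. e 0 = s (\<lambda>n. e (Suc n)) \<or> e 0 = t (\<lambda>n. e (Suc n)))"
    by (intro dintros assms dfun_weaken)
qed (use assms dfun_V in \<open>auto intro: V_pair\<close>)

lemma dfun_single [dintros]: "dfun s \<Longrightarrow> dfun (\<lambda>e. hset {s e})"
  using dfun_pair[of s s] by simp

lemma dfun_opair [dintros]: "dfun s \<Longrightarrow> dfun t \<Longrightarrow> dfun (\<lambda>e. \<langle>s e, t e\<rangle>)"
  unfolding opair_def by (intro dintros)

lemma dfun_Un [dintros]:
  assumes "dfun s" "dfun t"
  shows "dfun (\<lambda>e. hset (elts (s e) \<union> elts (t e)))"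
  using dfun_Union[OF dfun_pair[OF assms]] by simp

lemma dfun_insert [dintros]: "dfun s \<Longrightarrow> dfun t \<Longrightarrow> dfun (\<lambda>e. hset (insert (s e) (elts (t e))))"
  using dfun_Un[OF dfun_single, of s t] by simp

lemma dfun_Int [dintros]: "dfun s \<Longrightarrow> dfun t \<Longrightarrow> dfun (\<lambda>e. hset (elts (s e) \<inter> elts (t e)))"
  unfolding Int_def by (intro dintros dfun_weaken)

text \<open>Closure of the model under an operation is read off from its definability.\<close>

lemma dfun_V0: "dfun (\<lambda>e. c) \<Longrightarrow> c \<in> V"
  using V_nonempty dfun_V[of "\<lambda>e. c"] env_const by blast

lemma V_opair [simp]: "\<langle>a, b\<rangle> \<in> V \<longleftrightarrow> a \<in> V \<and> b \<in> V"
proof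
  assume "\<langle>a, b\<rangle> \<in> V"
  then have "hset {a, b} \<in> V" by (rule V_trans) (simp add: opair_def)
  then show "a \<in> V \<and> b \<in> V" using V_trans[of "hset {a, b}"] by simp
next
  assume "a \<in> V \<and> b \<in> V"
  then show "\<langle>a, b\<rangle> \<in> V" by (intro dfun_V0[OF dfun_opair] dintros) simp_all
qed

lemma V_Un [simp]: "a \<in> V \<Longrightarrow> b \<in> V \<Longrightarrow> hset (elts a \<union> elts b) \<in> V"
  and V_Int [simp]: "a \<in> V \<Longrightarrow> b \<in> V \<Longrightarrow> hset (elts a \<inter> elts b) \<in> V"
  and V_insert [simp]: "a \<in> V \<Longrightarrow> b \<in> V \<Longrightarrow> hset (insert a (elts b)) \<in> V"
  and V_single [simp]: "a \<in> V \<Longrightarrow> hset {a} \<in> V"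
  by (rule dfun_V0, rule dintros; rule dfun_const; assumption)+

lemma V_opair_memD: "\<langle>a, b\<rangle> \<in> elts f \<Longrightarrow> f \<in> V \<Longrightarrow> a \<in> V \<and> b \<in> V"
  using V_trans V_opair by blast

lemma V_empty [simp]: "hset {} \<in> V"
  using V_infinity V_trans by blast

lemma V_hfst [simp]: "z \<in> V \<Longrightarrow> hfst z \<in> V" and V_hsnd [simp]: "z \<in> V \<Longrightarrow> hsnd z \<in> V"
  by (metis V_opair hfst_nopair hfst_opair, metis V_opair hsnd_nopair hsnd_opair)

lemma dfun_hfst [dintros]: "dfun s \<Longrightarrow> dfun (\<lambda>e. hfst (s e))"
proof (rule dfun_comp1[where F = hfst])
  show "dfun (\<lambda>e. hfst (e 0))"
  proof (rule dfunI[where R = "\<lambda>x e. (\<exists>b\<in>V. e 0 = \<langle>x, b\<rangle>) \<or> (\<not> (\<exists>a\<in>V. \<exists>b\<in>V. e 0 = \<langle>a, b\<rangle>) \<and> x = e 0)"])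
    show "dpred (\<lambda>e. (\<exists>b\<in>V. e (Suc 0) = \<langle>e 0, b\<rangle>) \<or> (\<not> (\<exists>a\<in>V. \<exists>b\<in>V. e (Suc 0) = \<langle>a, b\<rangle>) \<and> e 0 = e (Suc 0)))"
      by (intro dintros)
  next
    fix x e assume "env e" "x \<in> V"
    then have "e 0 \<in> V" by simp
    then show "x = hfst (e 0) \<longleftrightarrow> (\<exists>b\<in>V. e 0 = \<langle>x, b\<rangle>) \<or> (\<not> (\<exists>a\<in>V. \<exists>b\<in>V. e 0 = \<langle>a, b\<rangle>) \<and> x = e 0)"
      by (cases "\<exists>a b. e 0 = \<langle>a, b\<rangle>") (auto simp: hfst_nopair)
  qed simp
qed

lemma dfun_hsnd [dintros]: "dfun s \<Longrightarrow> dfun (\<lambda>e. hsnd (s e))"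
proof (rule dfun_comp1[where F = hsnd])
  show "dfun (\<lambda>e. hsnd (e 0))"
  proof (rule dfunI[where R = "\<lambda>x e. (\<exists>b\<in>V. e 0 = \<langle>b, x\<rangle>) \<or> (\<not> (\<exists>a\<in>V. \<exists>b\<in>V. e 0 = \<langle>a, b\<rangle>) \<and> x = e 0)"])
    show "dpred (\<lambda>e. (\<exists>b\<in>V. e (Suc 0) = \<langle>b, e 0\<rangle>) \<or> (\<not> (\<exists>a\<in>V. \<exists>b\<in>V. e (Suc 0) = \<langle>a, b\<rangle>) \<and> e 0 = e (Suc 0)))"
      by (intro dintros)
  next
    fix x e assume "env e" "x \<in> V"
    then have "e 0 \<in> V" by simp
    then show "x = hsnd (e 0) \<longleftrightarrow> (\<exists>b\<in>V. e 0 = \<langle>b, x\<rangle>) \<or> (\<not> (\<exists>a\<in>V. \<exists>b\<in>V. e 0 = \<langle>a, b\<rangle>) \<and> x = e 0)"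
      by (cases "\<exists>a b. e 0 = \<langle>a, b\<rangle>") (auto simp: hsnd_nopair)
  qed simp
qed

lemma dfun_prodset [dintros]: "dfun s \<Longrightarrow> dfun t \<Longrightarrow> dfun (\<lambda>e. prodset (s e) (t e))"
  unfolding prodset_def by (intro dintros dfun_weaken)

lemma dfun_ap [dintros]: "dfun s \<Longrightarrow> dfun t \<Longrightarrow> dfun (\<lambda>e. ap (s e) (t e))"
  unfolding ap_def by (intro dintros dfun_weaken)

text \<open>The power set in the sense of V; the external power set may be larger, and it need not
  be small.\<close>

definition powV :: "'i hset \<Rightarrow> 'i hset" where
  "powV A = hset {x \<in> V. elts x \<subseteq> elts A}"

lemma V_powV [simp]: "A \<in> V \<Longrightarrow> powV A \<in> V"
  unfolding powV_def using V_Pow_ex V_hset by blast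

lemma elts_powV [simp]: "A \<in> V \<Longrightarrow> elts (powV A) = {x \<in> V. elts x \<subseteq> elts A}"
proof -
  assume "A \<in> V"
  then obtain Q where "elts Q = {x \<in> V. elts x \<subseteq> elts A}" using V_Pow_ex by blast
  then show ?thesis unfolding powV_def by (simp flip: \<open>elts Q = _\<close>)
qed

lemma dfun_powV [dintros]: "dfun s \<Longrightarrow> dfun (\<lambda>e. powV (s e))"
proof (rule dfun_comp1[where F = powV])
  show "dfun (\<lambda>e. powV (e 0))"
  proof (rule dfun_setI[where R = "\<lambda>x e. elts x \<subseteq> elts (e 0)"])
    show "dpred (\<lambda>e. elts (e 0) \<subseteq> elts (e (Suc 0)))" by (intro dintros)
  qed simp_all
qed

lemma dpred_trans_set [dintros]: "dfun s \<Longrightarrow> dpred (\<lambda>e. trans_set (s e))"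
  unfolding trans_set_def by (intro dintros dfun_weaken)

lemma dpred_functional [dintros]: "dfun s \<Longrightarrow> dpred (\<lambda>e. functional (s e))"
  unfolding functional_def by (intro dintros dfun_weaken)

lemma V_finite: "finite A \<Longrightarrow> A \<subseteq> V \<Longrightarrow> hset A \<in> V"
proof (induction rule: finite_induct)
  case (insert a A)
  then have "hset (insert a (elts (hset A))) \<in> V"
    by (intro dfun_V0[OF dfun_insert] dintros) auto
  then show ?case using insert(1) by (simp add: countable_finite)
qed simp

lemma V_nat_set [simp]: "nat_set n \<in> V"
proof (induction n)
  case (Suc n)
  then have "hset (insert (nat_set n) (elts (nat_set n))) \<in> V"
    by (intro dfun_V0[OF dfun_insert] dintros)
  then show ?case by simp
qed simp

subsection \<open>Recursion\<close>

text \<open>The hypothesis on \<open>H\<close> says that \<open>F x\<close> is computed by \<open>H\<close> from any approximation that agrees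
  with \<open>F\<close> on the transitive closure of \<open>x\<close>.\<close>

lemma dfun_rec:
  assumes H: "dfun (\<lambda>e. H (e 0) (e (Suc 0)) (\<lambda>n. e (Suc (Suc n))))"
    and rec: "\<And>x f e. env e \<Longrightarrow> x \<in> V \<Longrightarrow> f \<in> V \<Longrightarrow> (\<And>y. (y, x) \<in> mem_rel\<^sup>+ \<Longrightarrow> ap f y = F y e) \<Longrightarrow>
      F x e = H x f e"
    and s: "dfun s"
  shows "dfun (\<lambda>e. F (s e) e)"
proof -
  have H': "dfun (\<lambda>e. H (a e) (b e) (\<lambda>n. e (k n)))" if "dfun a" "dfun b" "inj k" for a b k
  proof -
    let ?k = "\<lambda>n. case n of 0 \<Rightarrow> 0 | Suc 0 \<Rightarrow> Suc 0 | Suc (Suc n) \<Rightarrow> Suc (Suc (k n))"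
    have "inj ?k" by (rule injI) (auto dest: injD[OF that(3)] split: nat.splits)
    from dfun_reindex[OF H this]
    have "dfun (\<lambda>e. H (e 0) (e (Suc 0)) (\<lambda>n. e (Suc (Suc (k n)))))" by simp
    then have "dfun (\<lambda>e. H (a (\<lambda>n. e (Suc n))) (e 0) (\<lambda>n. e (Suc (k n))))"
      using dfun_subst[of "\<lambda>x e. H x (e 0) (\<lambda>n. e (Suc (k n)))"] dfun_weaken[OF that(1)] by simp
    then show ?thesis
      using dfun_subst[of "\<lambda>x e. H (a e) x (\<lambda>n. e (k n))"] that(2) by simp
  qed
  \<comment> \<open>Approximations: every recorded value obeys H and the domain is closed under
    elements. Agreement with F then follows by induction along the transitive closure, because an
    approximation defined at x is defined everywhere below x.\<close>
  define App where "App f e \<longleftrightarrow> (\<forall>z\<in>elts f. \<exists>a\<in>V. \<exists>b\<in>V. z = \<langle>a, b\<rangle> \<and> b = H a f e \<and>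
    (\<forall>c\<in>elts a. \<exists>d\<in>V. \<langle>c, d\<rangle> \<in> elts f))" for f e
  have App: "dpred (\<lambda>e. App (t e) (\<lambda>n. e (k n)))" if "dfun t" "inj k" for t and k :: "nat \<Rightarrow> nat"
  proof -
    have "inj (\<lambda>n. Suc (k n))" using that(2) by (auto simp: inj_def)
    then show ?thesis unfolding App_def
      by (intro dintros H' dfun_weaken that(1)) (use that(2) in \<open>auto simp: inj_def\<close>)
  qed
  have dom: "\<exists>d. \<langle>y, d\<rangle> \<in> elts f" if "f \<in> V" "App f e" "(y, x) \<in> mem_rel\<^sup>+" "\<langle>x, c\<rangle> \<in> elts f" for f e y x c
    using that(3)
  proof (induction rule: converse_trancl_induct)
    case (base y) then show ?case using that(2,4) unfolding App_def by fastforce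
  next
    case (step y z) then show ?case using that(2) unfolding App_def by fastforce
  qed
  have AppF: "b = F x e" if "f \<in> V" "App f e" "env e" "\<langle>x, b\<rangle> \<in> elts f" for f e x b
    using that(4)
  proof (induction x arbitrary: b rule: trancl_mem_induct)
    case (1 x)
    have "ap f y = F y e" if yx: "(y, x) \<in> mem_rel\<^sup>+" for y
    proof -
      obtain d where "\<langle>y, d\<rangle> \<in> elts f" using dom[OF \<open>f \<in> V\<close> \<open>App f e\<close> yx 1(2)] ..
      then show ?thesis using 1(1)[OF yx] by (intro ap_eq) metis+
    qed
    then have "F x e = H x f e"
      using rec[OF \<open>env e\<close> _ \<open>f \<in> V\<close>] V_opair_memD[OF 1(2) \<open>f \<in> V\<close>] by blast
    moreover have "b = H x f e" using 1(2) \<open>App f e\<close> unfolding App_def by fastforce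
    ultimately show ?case by simp
  qed
  define g where "g x e = (\<lambda>z. \<langle>z, F z e\<rangle>) ` {z. (z, x) \<in> mem_rel\<^sup>*}" for x e
  have g: "\<exists>f\<in>V. App f e \<and> elts f = g x e" if "env e" "x \<in> V" for x e
    using that(2)
  proof (induction x rule: hset_induct)
    case (1 x)
    \<comment> \<open>The least approximation defined at y. Minimality makes it unique, as
      Replacement requires; the induction hypothesis supplies it as the graph of F on y and
      everything hereditarily below y.\<close>
    define Q where "Q y f e \<longleftrightarrow> App f e \<and> (\<exists>b\<in>V. \<langle>y, b\<rangle> \<in> elts f) \<and>
      (\<forall>h\<in>V. App h e \<longrightarrow> (\<exists>b\<in>V. \<langle>y, b\<rangle> \<in> elts h) \<longrightarrow> elts f \<subseteq> elts h)" for y f e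
    have Q: "dpred (\<lambda>e. Q (e 0) (e (Suc 0)) (\<lambda>n. e (Suc (Suc n))))"
      unfolding Q_def by (intro dintros App) (simp_all add: inj_def)
    have gmin: "g y e \<subseteq> elts h" if h: "h \<in> V" "App h e" "\<langle>y, b\<rangle> \<in> elts h" for h b y
    proof
      fix w assume "w \<in> g y e"
      then obtain z where z: "w = \<langle>z, F z e\<rangle>" "(z, y) \<in> mem_rel\<^sup>*" unfolding g_def by blast
      then obtain d where "\<langle>z, d\<rangle> \<in> elts h"
        using dom[OF h(1,2) _ h(3)] h(3) by (auto simp: rtrancl_eq_or_trancl)
      then show "w \<in> elts h" using AppF[OF that(1,2) \<open>env e\<close>] z(1) by blast
    qed
    have Qg: "\<exists>f\<in>V. elts f = g y e \<and> Q y f e" if y: "y \<in> elts x" for y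
    proof -
      have "y \<in> V" using y 1(2) V_trans by blast
      then obtain f where f: "f \<in> V" "App f e" "elts f = g y e" using 1(1)[OF y] by blast
      then have "\<langle>y, F y e\<rangle> \<in> elts f" unfolding g_def by blast
      moreover from this have "F y e \<in> V" using V_opair_memD f(1) by blast
      ultimately show ?thesis unfolding Q_def using f gmin by blast
    qed
    have Q1: "\<exists>!f. f \<in> V \<and> Q y f e" if "y \<in> elts x" for y
    proof -
      have "f = h" if "f \<in> V" "Q y f e" "h \<in> V" "Q y h e" for f h
        using that elts_inject[of f h] unfolding Q_def by blast
      then show ?thesis using Qg[OF that] by blast
    qed
    obtain B where B: "B \<in> V" "elts B = {f \<in> V. \<exists>y\<in>elts x. Q y f e}"
      using V_repl_ex[OF Q 1(2) \<open>env e\<close> Q1] by blast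
    obtain U where U: "U \<in> V" "elts U = (\<Union>f\<in>elts B. elts f)"
      using V_Union_ex[OF B(1)] by blast
    have "elts U = (\<Union>y\<in>elts x. g y e)"
    proof (intro equalityI subsetI)
      fix w assume "w \<in> elts U"
      then obtain f y where f: "f \<in> V" "y \<in> elts x" "Q y f e" "w \<in> elts f" unfolding U(2) B(2) by blast
      moreover obtain h where "h \<in> V" "elts h = g y e" "Q y h e" using Qg[OF f(2)] by blast
      ultimately show "w \<in> (\<Union>y\<in>elts x. g y e)" using Q1[OF f(2)] by blast
    next
      fix w assume "w \<in> (\<Union>y\<in>elts x. g y e)"
      then obtain y where y: "y \<in> elts x" "w \<in> g y e" by blast
      moreover obtain h where "h \<in> V" "elts h = g y e" "Q y h e" using Qg[OF y(1)] by blast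
      ultimately show "w \<in> elts U" unfolding U(2) B(2) by blast
    qed
    also have "\<dots> = (\<lambda>z. \<langle>z, F z e\<rangle>) ` {z. (z, x) \<in> mem_rel\<^sup>+}"
    proof -
      have "{z. (z, x) \<in> mem_rel\<^sup>+} = (\<Union>y\<in>elts x. {z. (z, y) \<in> mem_rel\<^sup>*})"
        unfolding trancl_unfold_right by blast
      then show ?thesis unfolding g_def by blast
    qed
    finally have Ug: "elts U = (\<lambda>z. \<langle>z, F z e\<rangle>) ` {z. (z, x) \<in> mem_rel\<^sup>+}" .
    have apU: "ap U y = F y e" if "(y, x) \<in> mem_rel\<^sup>+" for y
      by (rule ap_eq) (use that in \<open>auto simp: Ug\<close>)
    have FH: "F x e = H x U e" by (rule rec[OF \<open>env e\<close> 1(2) U(1) apU])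
    have HV: "H y f e \<in> V" if "y \<in> V" "f \<in> V" for y f
      using dfun_V[OF H, of "case_nat y (case_nat f e)"] that \<open>env e\<close> by simp
    define f where "f = hset (insert \<langle>x, F x e\<rangle> (elts U))"
    have "f \<in> V" unfolding f_def using 1(2) U(1) HV by (intro dfun_V0[OF dfun_insert] dintros) (simp_all add: FH)
    have ef: "elts f = g x e"
    proof -
      have "elts f = insert \<langle>x, F x e\<rangle> (elts U)" unfolding f_def by simp
      then show ?thesis unfolding Ug g_def by (auto simp: rtrancl_eq_or_trancl)
    qed
    have apf: "ap f y = F y e" if "(y, x) \<in> mem_rel\<^sup>*" for y
      by (rule ap_eq) (use that in \<open>auto simp: ef g_def\<close>)
    have "App f e"
      unfolding App_def
    proof
      fix w assume "w \<in> elts f"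
      then obtain z where z: "w = \<langle>z, F z e\<rangle>" "(z, x) \<in> mem_rel\<^sup>*" unfolding ef g_def by blast
      have zV: "z \<in> V" "F z e \<in> V" using \<open>w \<in> elts f\<close> z(1) V_opair_memD[OF _ \<open>f \<in> V\<close>] by blast+
      have "F z e = H z f e"
        using z(2) by (intro rec[OF \<open>env e\<close> zV(1) \<open>f \<in> V\<close>] apf) (meson rtrancl_trans trancl_into_rtrancl)
      moreover have "\<exists>d\<in>V. \<langle>c, d\<rangle> \<in> elts f" if "c \<in> elts z" for c
      proof -
        have "(c, x) \<in> mem_rel\<^sup>*" using that z(2) by (auto intro: converse_rtrancl_into_rtrancl)
        then have "\<langle>c, F c e\<rangle> \<in> elts f" unfolding ef g_def by blast
        then show ?thesis using V_opair_memD[OF _ \<open>f \<in> V\<close>] by blast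
      qed
      ultimately show "\<exists>a\<in>V. \<exists>b\<in>V. w = \<langle>a, b\<rangle> \<and> b = H a f e \<and> (\<forall>c\<in>elts a. \<exists>d\<in>V. \<langle>c, d\<rangle> \<in> elts f)"
        using z(1) zV by blast
    qed
    then show ?case using \<open>f \<in> V\<close> ef by blast
  qed
  have ex: "\<exists>f\<in>V. App f e \<and> \<langle>x, F x e\<rangle> \<in> elts f" if "env e" "x \<in> V" for x e
    using g[OF that] unfolding g_def by blast
  show ?thesis
  proof (rule dfunI)
    show "dpred (\<lambda>e. \<exists>f\<in>V. App f (\<lambda>n. e (Suc n)) \<and> \<langle>s (\<lambda>n. e (Suc n)), e 0\<rangle> \<in> elts f)"
      by (intro dintros App dfun_weaken s) (simp add: inj_def)
  next
    fix e assume "env e"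
    then show "F (s e) e \<in> V" using ex[OF \<open>env e\<close> dfun_V[OF s]] V_opair_memD by blast
  next
    fix x e assume "env e" "x \<in> V"
    then show "x = F (s e) e \<longleftrightarrow> (\<exists>f\<in>V. App f e \<and> \<langle>s e, x\<rangle> \<in> elts f)"
      using ex[OF \<open>env e\<close> dfun_V[OF s]] AppF by blast
  qed
qed

subsection \<open>Choice and Zorn's lemma\<close>

lemma V_choice_fun:
  assumes "R \<in> V" "I \<in> V" "\<And>i. i \<in> elts I \<Longrightarrow> \<exists>b. \<langle>i, b\<rangle> \<in> elts R"
  shows "\<exists>f\<in>V. elts f \<subseteq> elts R \<and> functional f \<and> (\<forall>i\<in>elts I. \<langle>i, ap f i\<rangle> \<in> elts f)"
proof -
  define X where "X i = hset {z \<in> elts R. \<langle>i, hsnd z\<rangle> = z}" for i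
  define A where "A = hset (X ` elts I)"
  have "A \<in> V" unfolding A_def X_def using assms(1,2) by (intro dfun_V0[OF dfun_image] dintros)
  have X: "z \<in> elts (X i) \<longleftrightarrow> z \<in> elts R \<and> (\<exists>b. z = \<langle>i, b\<rangle>)" for z i
    unfolding X_def mem_sep by (metis hsnd_opair)
  have "\<forall>x\<in>elts A. elts x \<noteq> {}" unfolding A_def using assms(3) X by fastforce
  moreover have "\<forall>x\<in>elts A. \<forall>y\<in>elts A. x \<noteq> y \<longrightarrow> elts x \<inter> elts y = {}"
    unfolding A_def by (auto simp: X)
  ultimately obtain C where C: "C \<in> V" "\<forall>x\<in>elts A. \<exists>!z. z \<in> elts C \<and> z \<in> elts x"
    using V_choice[OF \<open>A \<in> V\<close>] by blast
  define f where "f = hset {z \<in> elts R. z \<in> elts C \<and> hfst z \<in> elts I \<and> \<langle>hfst z, hsnd z\<rangle> = z}"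
  have "f \<in> V" unfolding f_def using assms(1,2) C(1) by (intro dfun_V0[OF dfun_sep] dintros)
  have ex1: "\<exists>!b. \<langle>i, b\<rangle> \<in> elts f" if "i \<in> elts I" for i
  proof -
    have "\<exists>!z. z \<in> elts C \<and> z \<in> elts (X i)" using C(2) that unfolding A_def by simp
    then obtain z where z: "z \<in> elts C" "z \<in> elts (X i)" "\<And>w. w \<in> elts C \<Longrightarrow> w \<in> elts (X i) \<Longrightarrow> w = z"
      by blast
    obtain b where b: "z = \<langle>i, b\<rangle>" using z(2) X by blast
    show ?thesis
    proof (rule ex1I)
      show "\<langle>i, b\<rangle> \<in> elts f" using z(1,2) that unfolding f_def mem_sep X b by simp
      fix c assume "\<langle>i, c\<rangle> \<in> elts f"
      then have "\<langle>i, c\<rangle> = z" unfolding f_def mem_sep by (intro z(3)) (auto simp: X)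
      then show "c = b" using b by simp
    qed
  qed
  have "functional f"
  proof (rule functionalI)
    fix z assume "z \<in> elts f" then show "\<exists>a b. z = \<langle>a, b\<rangle>" unfolding f_def by (auto, metis)
  next
    fix a b c assume "\<langle>a, b\<rangle> \<in> elts f" "\<langle>a, c\<rangle> \<in> elts f"
    then show "b = c" using ex1[of a] unfolding f_def by auto
  qed
  moreover have "elts f \<subseteq> elts R" unfolding f_def by auto
  moreover have "\<forall>i\<in>elts I. \<langle>i, ap f i\<rangle> \<in> elts f"
    using ex1 functional_ap[OF \<open>functional f\<close>] by metis
  ultimately show ?thesis using \<open>f \<in> V\<close> by blast
qed

text \<open>Classical well-ordering argument: \<open>W\<close> consists of the chains generated by a choice \<open>h\<close> of
  strict upper bounds; any two of them are comparable as initial segments, so that their union \<open>U\<close>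
  is again one, and the strict upper bound of \<open>U\<close> would have to belong to \<open>U\<close>.\<close>

lemma V_zorn:
  assumes Z: "Z \<in> V" and le: "dpred (\<lambda>e. le (e 0) (e (Suc 0)))"
    and refl: "\<And>x. x \<in> elts Z \<Longrightarrow> le x x"
    and trans: "\<And>x y z. x \<in> elts Z \<Longrightarrow> y \<in> elts Z \<Longrightarrow> z \<in> elts Z \<Longrightarrow> le x y \<Longrightarrow> le y z \<Longrightarrow> le x z"
    and antisym: "\<And>x y. x \<in> elts Z \<Longrightarrow> y \<in> elts Z \<Longrightarrow> le x y \<Longrightarrow> le y x \<Longrightarrow> x = y"
    and chain: "\<And>C. C \<in> V \<Longrightarrow> elts C \<subseteq> elts Z \<Longrightarrow> (\<And>x y. x \<in> elts C \<Longrightarrow> y \<in> elts C \<Longrightarrow> le x y \<or> le y x) \<Longrightarrow>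
      \<exists>u\<in>elts Z. \<forall>x\<in>elts C. le x u"
  shows "\<exists>m\<in>elts Z. \<forall>x\<in>elts Z. le m x \<longrightarrow> x = m"
proof (rule ccontr)
  assume "\<not> ?thesis"
  then have strict: "\<exists>x\<in>elts Z. le m x \<and> x \<noteq> m" if "m \<in> elts Z" for m using that by blast
  have dle: "dpred (\<lambda>e. le (s e) (t e))" if "dfun s" "dfun t" for s t
    using dpred_comp2[of le, OF le that] .
  define Ch where "Ch = hset {C \<in> elts (powV Z). \<forall>x\<in>elts C. \<forall>y\<in>elts C. le x y \<or> le y x}"
  have "Ch \<in> V" unfolding Ch_def by (intro dfun_V0[OF dfun_sep] dintros dle Z)
  have Ch: "C \<in> elts Ch \<longleftrightarrow> C \<in> V \<and> elts C \<subseteq> elts Z \<and> (\<forall>x\<in>elts C. \<forall>y\<in>elts C. le x y \<or> le y x)" for C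
    unfolding Ch_def mem_sep using Z by auto
  define R where "R = hset {z \<in> elts (prodset Ch Z). \<forall>c\<in>elts (hfst z). le c (hsnd z) \<and> c \<noteq> hsnd z}"
  have "R \<in> V" unfolding R_def by (intro dfun_V0[OF dfun_sep] dintros dle \<open>Ch \<in> V\<close> Z)
  have "\<exists>u. \<langle>C, u\<rangle> \<in> elts R" if C: "C \<in> elts Ch" for C
  proof -
    obtain u where u: "u \<in> elts Z" "\<forall>x\<in>elts C. le x u" using chain[of C] C unfolding Ch by blast
    obtain v where v: "v \<in> elts Z" "le u v" "v \<noteq> u" using strict[OF u(1)] by blast
    have "le c v \<and> c \<noteq> v" if "c \<in> elts C" for c
      using u v trans[of c u v] antisym[of u v] C that unfolding Ch by blast
    then show ?thesis unfolding R_def using C v(1) by auto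
  qed
  from V_choice_fun[OF \<open>R \<in> V\<close> \<open>Ch \<in> V\<close> this] obtain h where
    h: "h \<in> V" "elts h \<subseteq> elts R" "\<And>C. C \<in> elts Ch \<Longrightarrow> \<langle>C, ap h C\<rangle> \<in> elts h" by blast
  have g: "ap h C \<in> elts Z \<and> (\<forall>c\<in>elts C. le c (ap h C) \<and> c \<noteq> ap h C)" if "C \<in> elts Ch" for C
    using h(2,3) that unfolding R_def by fastforce
  define Init where "Init D C \<longleftrightarrow> elts D \<subseteq> elts C \<and> (\<forall>d\<in>elts D. \<forall>c\<in>elts C. le c d \<longrightarrow> c \<in> elts D)" for D C
  define W where "W C \<longleftrightarrow> C \<in> elts Ch \<and> (\<forall>D\<in>V. Init D C \<longrightarrow> D \<noteq> C \<longrightarrow> ap h D \<in> elts C \<and>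
      (\<forall>c\<in>elts C. c \<in> elts D \<longleftrightarrow> le c (ap h D) \<and> c \<noteq> ap h D))" for C
  have dInit: "dpred (\<lambda>e. Init (s e) (t e))" if "dfun s" "dfun t" for s t
    unfolding Init_def by (intro dintros dfun_weaken dle that)
  have dW: "dpred (\<lambda>e. W (s e))" if "dfun s" for s
    unfolding W_def by (intro dintros dfun_weaken dle dInit that \<open>Ch \<in> V\<close> h(1))
  have Ch_sub: "D \<in> elts Ch" if "C \<in> elts Ch" "D \<in> V" "elts D \<subseteq> elts C" for C D
    using that unfolding Ch by blast
  have compare: "Init C C' \<or> Init C' C" if "W C" "W C'" for C C'
  proof -
    have CZ: "C \<in> elts Ch" "C' \<in> elts Ch" "C \<in> V" "C' \<in> V" using that unfolding W_def Ch by blast+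
    \<comment> \<open>The largest common initial segment of the two chains. If it were proper in
      both, \<open>ap h D\<close> would be the next element of both, and adding it would give a
      larger common initial segment.\<close>
    define D where "D = hset {x \<in> elts C. \<exists>B\<in>elts (powV C). Init B C \<and> Init B C' \<and> x \<in> elts B}"
    have "D \<in> V" unfolding D_def by (intro dfun_V0[OF dfun_sep] dintros dInit CZ(3,4))
    have D: "x \<in> elts D \<longleftrightarrow> (\<exists>B\<in>V. Init B C \<and> Init B C' \<and> x \<in> elts B)" for x
      unfolding D_def using CZ(3) by (auto simp: Init_def)
    have "Init D E" if "E \<in> {C, C'}" for E
    proof -
      have "elts D \<subseteq> elts E" using D that unfolding Init_def by blast
      moreover have "c \<in> elts D" if d: "d \<in> elts D" and c: "c \<in> elts E" "le c d" for c d
      proof -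
        obtain B where B: "B \<in> V" "Init B C" "Init B C'" "d \<in> elts B" using D d by blast
        then have "c \<in> elts B" using c \<open>E \<in> {C, C'}\<close> unfolding Init_def by blast
        then show ?thesis using D B by blast
      qed
      ultimately show ?thesis unfolding Init_def by blast
    qed
    then have DI: "Init D C" "Init D C'" by blast+
    show ?thesis
    proof (rule ccontr)
      assume "\<not> ?thesis"
      then have "D \<noteq> C" "D \<noteq> C'" using DI by blast+
      then have w: "ap h D \<in> elts C" "ap h D \<in> elts C'"
        "\<forall>c\<in>elts C. c \<in> elts D \<longleftrightarrow> le c (ap h D) \<and> c \<noteq> ap h D"
        "\<forall>c\<in>elts C'. c \<in> elts D \<longleftrightarrow> le c (ap h D) \<and> c \<noteq> ap h D"
        using that DI \<open>D \<in> V\<close> unfolding W_def by blast+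
      define E where "E = hset (insert (ap h D) (elts D))"
      have "E \<in> V" unfolding E_def using w(1) CZ(3) V_trans \<open>D \<in> V\<close> by simp
      have "Init E C" "Init E C'" using DI w unfolding Init_def E_def by auto
      then have "ap h D \<in> elts D" using D \<open>E \<in> V\<close> unfolding E_def by auto
      moreover have "D \<in> elts Ch" using Ch_sub[OF CZ(1) \<open>D \<in> V\<close>] DI(1) unfolding Init_def by blast
      ultimately show False using g by blast
    qed
  qed
  define U where "U = hset {x \<in> elts Z. \<exists>C\<in>elts Ch. W C \<and> x \<in> elts C}"
  have "U \<in> V" unfolding U_def by (intro dfun_V0[OF dfun_sep] dintros dW \<open>Ch \<in> V\<close> Z)
  have U: "x \<in> elts U \<longleftrightarrow> (\<exists>C. W C \<and> x \<in> elts C)" for x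
    unfolding U_def by (auto simp: W_def Ch)
  have WU: "Init C U" if "W C" for C
    unfolding Init_def
  proof (intro conjI ballI impI)
    fix d c assume dc: "d \<in> elts C" "c \<in> elts U" "le c d"
    then obtain C' where C': "W C'" "c \<in> elts C'" unfolding U by blast
    then show "c \<in> elts C" using compare[OF \<open>W C\<close> C'(1)] dc unfolding Init_def by blast
  qed (use that U in blast)
  have "U \<in> elts Ch"
    unfolding Ch
  proof (intro conjI ballI)
    fix x y assume "x \<in> elts U" "y \<in> elts U"
    then obtain C C' where C: "W C" "x \<in> elts C" "W C'" "y \<in> elts C'" unfolding U by blast
    from compare[OF C(1,3)] obtain C'' where "W C''" "x \<in> elts C''" "y \<in> elts C''"
      using C unfolding Init_def by blast
    then show "le x y \<or> le y x" unfolding W_def Ch by blast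
  qed (use \<open>U \<in> V\<close> in \<open>auto simp: U_def\<close>)
  have Uprop: "ap h D \<in> elts U \<and> (\<forall>c\<in>elts U. c \<in> elts D \<longleftrightarrow> le c (ap h D) \<and> c \<noteq> ap h D)"
    if D: "D \<in> V" "Init D U" "D \<noteq> U" for D
  proof -
    have "elts D \<subseteq> elts U" using D(2) unfolding Init_def by blast
    then obtain u where u: "u \<in> elts U" "u \<notin> elts D" using D(3) elts_inject by blast
    then obtain C where C: "W C" "u \<in> elts C" unfolding U by blast
    have "elts D \<subseteq> elts C"
    proof
      fix d assume d: "d \<in> elts D"
      then have "le d u" using u D(2) \<open>U \<in> elts Ch\<close> \<open>elts D \<subseteq> elts U\<close> unfolding Init_def Ch by blast
      then show "d \<in> elts C" using WU[OF C(1)] C(2) d \<open>elts D \<subseteq> elts U\<close> unfolding Init_def by blast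
    qed
    then have "Init D C" using D(2) WU[OF C(1)] unfolding Init_def by blast
    moreover have "D \<noteq> C" using u(2) C(2) by blast
    ultimately have w: "ap h D \<in> elts C" "\<forall>c\<in>elts C. c \<in> elts D \<longleftrightarrow> le c (ap h D) \<and> c \<noteq> ap h D"
      using C(1) D(1) unfolding W_def by blast+
    have "c \<in> elts D \<longleftrightarrow> le c (ap h D) \<and> c \<noteq> ap h D" if "c \<in> elts U" for c
      using w WU[OF C(1)] that \<open>elts D \<subseteq> elts C\<close> unfolding Init_def by blast
    then show ?thesis using w(1) WU[OF C(1)] unfolding Init_def by blast
  qed
  note gU = g[OF \<open>U \<in> elts Ch\<close>]
  define T where "T = hset (insert (ap h U) (elts U))"
  have T: "elts T = insert (ap h U) (elts U)" unfolding T_def by simp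
  have UZ: "elts U \<subseteq> elts Z" unfolding U_def by auto
  have "T \<in> V" unfolding T_def using \<open>U \<in> V\<close> gU Z V_trans by simp
  then have "T \<in> elts Ch" using \<open>U \<in> elts Ch\<close> gU refl unfolding Ch T by blast
  have "W T"
    unfolding W_def
  proof (intro conjI ballI impI \<open>T \<in> elts Ch\<close>)
    fix D assume D: "D \<in> V" "Init D T" "D \<noteq> T"
    have "ap h U \<notin> elts D"
    proof
      assume "ap h U \<in> elts D"
      then have "elts T \<subseteq> elts D" using D(2) gU refl unfolding Init_def T by blast
      then show False using D(2,3) elts_inject unfolding Init_def by blast
    qed
    then have DU: "Init D U" using D(2) unfolding Init_def T by blast
    have *: "ap h D \<in> elts T \<and> (\<forall>c\<in>elts T. c \<in> elts D \<longleftrightarrow> le c (ap h D) \<and> c \<noteq> ap h D)"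
    proof (cases "D = U")
      case True
      then show ?thesis using gU \<open>ap h U \<notin> elts D\<close> unfolding T by blast
    next
      case False
      note p = Uprop[OF D(1) DU False]
      have "ap h D \<in> elts U" using conjunct1[OF p] .
      then have "le (ap h D) (ap h U)" "ap h D \<noteq> ap h U" "ap h D \<in> elts Z" using gU UZ by blast+
      then have "\<not> le (ap h U) (ap h D)"
        using conjunct1[OF gU] antisym[of "ap h U" "ap h D"] by metis
      then show ?thesis using conjunct1[OF p] conjunct2[OF p] \<open>ap h U \<notin> elts D\<close> unfolding T by blast
    qed
    then show "ap h D \<in> elts T" by blast
    fix c assume "c \<in> elts T"
    then show "c \<in> elts D \<longleftrightarrow> le c (ap h D) \<and> c \<noteq> ap h D" using * by blast
  qed
  then have "ap h U \<in> elts U" unfolding U T_def by auto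
  then show False using gU by blast
qed

subsection \<open>Smallness relative to a set closed under pairing\<close>

text \<open>Numerals have a first-order description: transitive sets which, like all their elements,
  are empty or a successor. Induction along membership shows that nothing else satisfies it, so
  Separation from any inductive set yields exactly the standard numerals.\<close>

lemma omega_ex: "\<exists>\<omega>\<in>V. elts \<omega> = range nat_set"
proof -
  define Q where "Q x \<longleftrightarrow> elts x = {} \<or> (\<exists>y\<in>elts x. elts x = elts (hset (insert y (elts y))))" for x :: "'i hset"
  define N where "N x \<longleftrightarrow> trans_set x \<and> Q x \<and> (\<forall>y\<in>elts x. Q y)" for x :: "'i hset"
  have dQ: "dpred (\<lambda>e. Q (s e))" if "dfun s" for s
    unfolding Q_def set_eq_subset[of "elts (s _)" "elts (hset _)"]
  proof (intro dintros dfun_weaken that)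
    show "dpred (\<lambda>e. elts (s e) = {})"
      by (rule dpred_cong[where Q = "\<lambda>e. \<forall>y\<in>elts (s e). False"]) (blast, intro dintros that)
  qed
  have dN: "dpred (\<lambda>e. N (e 0))" unfolding N_def by (intro dintros dQ)
  obtain A where A: "A \<in> V" "hset {} \<in> elts A" "\<forall>x\<in>elts A. hset (insert x (elts x)) \<in> elts A"
    using V_infinity by blast
  have natA: "nat_set n \<in> elts A" for n by (induction n) (use A in auto)
  have N1: "N (nat_set n)" for n
    by (induction n) (auto simp: N_def Q_def trans_set_def)
  have N2: "N x \<Longrightarrow> x \<in> range nat_set" for x
  proof (induction x rule: hset_induct)
    case (1 x)
    show ?case
    proof (cases "elts x = {}")
      case True
      then have "x = nat_set 0" using elts_inject[of x "nat_set 0"] by simp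
      then show ?thesis by blast
    next
      case False
      then obtain y where y: "y \<in> elts x" "elts x = insert y (elts y)"
        using 1(2) unfolding N_def Q_def by auto
      have "trans_set y"
        unfolding trans_set_def
      proof (intro ballI subsetI)
        fix z w assume zw: "z \<in> elts y" "w \<in> elts z"
        then have "w \<in> elts x" using 1(2) y unfolding N_def trans_set_def by blast
        \<comment> \<open>Transitivity of x only places w in the successor of y; a membership cycle
          excludes the case that w is y itself.\<close>
        moreover have "w \<noteq> y"
        proof
          assume "w = y"
          then have "(y, y) \<in> mem_rel\<^sup>+" using zw by (auto intro: trancl_into_trancl)
          then show False using wf_trancl[OF wf_mem] by (auto elim: wf_irrefl)
        qed
        ultimately show "w \<in> elts y" using y(2) by blast
      qed
      then have "N y" using 1(2) y unfolding N_def by blast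
      then obtain n where "y = nat_set n" using 1(1)[OF y(1)] by blast
      then have "elts x = elts (nat_set (Suc n))" using y(2) by simp
      then show ?thesis using elts_inject by blast
    qed
  qed
  have "hset {x \<in> elts A. N x} \<in> V" by (intro dfun_V0[OF dfun_sep] dintros A(1) dN)
  moreover have "elts (hset {x \<in> elts A. N x}) = range nat_set" using N1 N2 natA by auto
  ultimately show ?thesis by blast
qed

lemma nat_set_mono: "m \<le> n \<Longrightarrow> nat_set m = (nat_set n :: 'i hset) \<or> nat_set m \<in> elts (nat_set n :: 'i hset)"
proof (induction n)
  case (Suc n)
  have "elts (nat_set (Suc n)) = insert (nat_set n) (elts (nat_set n :: 'i hset))" by simp
  note * = this
  show ?case
  proof (cases "m = Suc n")
    case False
    then have "nat_set m = (nat_set n :: 'i hset) \<or> nat_set m \<in> elts (nat_set n :: 'i hset)"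
      using Suc by simp
    then show ?thesis unfolding * by (elim disjE) (simp only: insertI1 simp_thms, blast)
  qed blast
qed simp

end

text \<open>Recursion along membership on arbitrary sets rather than on natural numbers, so that
  definability by recursion applies in V; at the numerals these are the usual cumulative stages of
  closing B under pairing.\<close>

function pclose :: "'i hset \<Rightarrow> 'i hset \<Rightarrow> 'i hset" where
  "pclose B n = hset (elts B \<union> (\<Union>m\<in>elts n. elts (hset (elts (pclose B m) \<union> elts (prodset (pclose B m) (pclose B m))))))"
  by auto
termination
proof (relation "inv_image mem_rel snd")
  show "wf (inv_image mem_rel (snd :: 'i hset \<times> 'i hset \<Rightarrow> 'i hset))"
    by (intro wf_inv_image wf_mem)
qed auto

declare pclose.simps [simp del]

context zfc_model
begin

text \<open>The union of the stages over all numerals works: two elements already lie in a common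
  stage, and their pair enters at the following one.\<close>

lemma pairing_closed_ex:
  assumes "B \<in> V"
  shows "\<exists>X\<in>V. elts B \<subseteq> elts X \<and> (\<forall>a\<in>elts X. \<forall>b\<in>elts X. \<langle>a, b\<rangle> \<in> elts X)"
proof -
  have dp: "dfun (\<lambda>e. pclose B (s e))" if "dfun s" for s
  proof (rule dfun_rec[where H = "\<lambda>n f e. hset (elts B \<union> elts (hset (\<Union>m\<in>elts n. elts (hset (elts (ap f m) \<union> elts (prodset (ap f m) (ap f m)))))))"
          and F = "\<lambda>x e. pclose B x", OF _ _ that])
    show "dfun (\<lambda>e. hset (elts B \<union> elts (hset (\<Union>m\<in>elts (e 0). elts (hset (elts (ap (e (Suc 0)) m) \<union>
          elts (prodset (ap (e (Suc 0)) m) (ap (e (Suc 0)) m))))))))"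
      by (intro dintros assms)
  qed (subst pclose.simps, simp add: r_into_trancl)
  obtain \<omega> where \<omega>: "\<omega> \<in> V" "elts \<omega> = range nat_set" using omega_ex by blast
  define X where "X = hset (\<Union>n\<in>elts \<omega>. elts (pclose B n))"
  have "X \<in> V" unfolding X_def by (intro dfun_V0[OF dfun_UN] dp dintros \<omega>(1))
  have X: "x \<in> elts X \<longleftrightarrow> (\<exists>n. x \<in> elts (pclose B (nat_set n)))" for x
  proof -
    have "elts X = (\<Union>n\<in>elts \<omega>. elts (pclose B n))" unfolding X_def by simp
    then show ?thesis unfolding \<omega>(2) by blast
  qed
  have step: "elts (pclose B m) \<subseteq> elts (pclose B n) \<and>
      (\<forall>a\<in>elts (pclose B m). \<forall>b\<in>elts (pclose B m). \<langle>a, b\<rangle> \<in> elts (pclose B n))" if "m \<in> elts n" for m n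
    unfolding pclose.simps[of B n] using that by auto
  have mono: "elts (pclose B (nat_set m)) \<subseteq> elts (pclose B (nat_set n))" if "m \<le> n" for m n
  proof (cases "nat_set m = (nat_set n :: 'i hset)")
    case False
    then show ?thesis using nat_set_mono[OF that] step[of "nat_set m" "nat_set n"] by blast
  qed simp
  have "elts B \<subseteq> elts X"
  proof
    fix x assume "x \<in> elts B"
    then have "x \<in> elts (pclose B (nat_set 0))" unfolding pclose.simps[of B "nat_set 0"] by simp
    then show "x \<in> elts X" unfolding X by blast
  qed
  moreover have "\<langle>a, b\<rangle> \<in> elts X" if ab: "a \<in> elts X" "b \<in> elts X" for a b
  proof -
    obtain m n where "a \<in> elts (pclose B (nat_set m))" "b \<in> elts (pclose B (nat_set n))"
      using ab unfolding X by blast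
    then have "a \<in> elts (pclose B (nat_set (max m n)))" "b \<in> elts (pclose B (nat_set (max m n)))"
      using mono[of m "max m n"] mono[of n "max m n"] by auto
    then have "\<langle>a, b\<rangle> \<in> elts (pclose B (nat_set (Suc (max m n))))"
      using step[of "nat_set (max m n)" "nat_set (Suc (max m n))"] by simp
    then show ?thesis unfolding X by blast
  qed
  ultimately show ?thesis using \<open>X \<in> V\<close> by blast
qed

text \<open>\<open>dominated X A\<close> is the form of \<open>|A| \<le> |X|\<close> for which closure under \<open>X\<close>-indexed unions needs
  no cardinal arithmetic.\<close>

definition dominated :: "'i hset \<Rightarrow> 'i hset \<Rightarrow> bool" where
  "dominated X A \<longleftrightarrow> (\<exists>g\<in>V. functional g \<and> (\<forall>a\<in>elts A. \<exists>x\<in>elts X. \<langle>x, a\<rangle> \<in> elts g))"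

lemma dpred_dominated [dintros]: "dfun s \<Longrightarrow> dfun t \<Longrightarrow> dpred (\<lambda>e. dominated (s e) (t e))"
  unfolding dominated_def by (intro dintros dfun_weaken)

lemma dominated_subset: "dominated X A \<Longrightarrow> elts B \<subseteq> elts A \<Longrightarrow> dominated X B"
  unfolding dominated_def by blast

lemma dominated_refl:
  assumes "X \<in> V" "elts A \<subseteq> elts X"
  shows "dominated X A"
  unfolding dominated_def
proof (intro bexI conjI ballI)
  show "functional (hset ((\<lambda>x. \<langle>x, x\<rangle>) ` elts X))" by (rule functionalI) auto
  show "hset ((\<lambda>x. \<langle>x, x\<rangle>) ` elts X) \<in> V" by (intro dfun_V0[OF dfun_image] dintros assms)
qed (use assms(2) in auto)

lemma dominated_image:
  assumes "dominated X A" "dfun (\<lambda>e. F (e 0))" "elts B \<subseteq> F ` elts A" "A \<in> V" "X \<in> V"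
  shows "dominated X B"
proof -
  obtain g where g: "g \<in> V" "functional g" "\<forall>a\<in>elts A. \<exists>x\<in>elts X. \<langle>x, a\<rangle> \<in> elts g"
    using assms(1) unfolding dominated_def by blast
  let ?h = "hset ((\<lambda>x. \<langle>x, F (ap g x)\<rangle>) ` elts X)"
  have "?h \<in> V"
    by (intro dfun_V0[OF dfun_image] dintros assms dfun_comp1[of F] g(1))
  moreover have "functional ?h" by (rule functionalI) auto
  moreover have "\<exists>x\<in>elts X. \<langle>x, b\<rangle> \<in> elts ?h" if b: "b \<in> elts B" for b
  proof -
    obtain a where a: "a \<in> elts A" "b = F a" using b assms(3) by blast
    obtain x where x: "x \<in> elts X" "\<langle>x, a\<rangle> \<in> elts g" using g(3) a(1) by blast
    then have "ap g x = a" using functional_ap[OF g(2)] by blast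
    then show ?thesis using x(1) a(2) by auto
  qed
  ultimately show ?thesis unfolding dominated_def by blast
qed

text \<open>An element of the union is coded by a pair: the first component codes an index i through
  \<open>g\<close>, the second codes the element through an enumeration chosen for i. Closure of X
  under pairing keeps the codes in X.\<close>

lemma dominated_Union:
  assumes X: "X \<in> V" "\<And>a b. a \<in> elts X \<Longrightarrow> b \<in> elts X \<Longrightarrow> \<langle>a, b\<rangle> \<in> elts X"
    and I: "I \<in> V" "dominated X I" and F: "dfun (\<lambda>e. F (e 0))"
    and dom: "\<And>i. i \<in> elts I \<Longrightarrow> dominated X (F i)"
  shows "dominated X (hset (\<Union>i\<in>elts I. elts (F i)))"
proof -
  have FV: "F i \<in> V" if "i \<in> V" for i using dfun_V[OF F, of "\<lambda>_. i"] that by simp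
  have dF: "dfun (\<lambda>e. F (s e))" if "dfun s" for s by (rule dfun_comp1[of F, OF F that])
  obtain g where g: "g \<in> V" "functional g" "\<forall>a\<in>elts I. \<exists>x\<in>elts X. \<langle>x, a\<rangle> \<in> elts g"
    using I(2) unfolding dominated_def by blast
  define A where "A = hset (\<Union>i\<in>elts I. elts (F i))"
  have "A \<in> V" unfolding A_def by (intro dfun_V0[OF dfun_UN] dintros I F)
  have A: "a \<in> elts A \<longleftrightarrow> (\<exists>i\<in>elts I. a \<in> elts (F i))" for a unfolding A_def by auto
  define Q where "Q h i \<longleftrightarrow> functional h \<and> (\<forall>a\<in>elts (F i). \<exists>x\<in>elts X. \<langle>x, a\<rangle> \<in> elts h)" for h i
  define R where "R = hset {z \<in> elts (prodset I (powV (prodset X A))). Q (hsnd z) (hfst z)}"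
  have V1: "powV (prodset X A) \<in> V" by (intro dfun_V0[OF dfun_powV] dintros X \<open>A \<in> V\<close>)
  then have V2: "prodset X A \<in> V" by (intro dfun_V0[OF dfun_prodset] dintros X \<open>A \<in> V\<close>)
  have "R \<in> V" unfolding R_def Q_def
    by (intro dfun_V0[OF dfun_sep] dintros dF V1 X(1) I(1))
  have "\<exists>h. \<langle>i, h\<rangle> \<in> elts R" if i: "i \<in> elts I" for i
  proof -
    obtain h where h: "h \<in> V" "Q h i" using dom[OF i] unfolding dominated_def Q_def by blast
    \<comment> \<open>Restricting an enumeration to pairs from X and A bounds all candidates by one
      power set, as needed for choosing them simultaneously.\<close>
    let ?h = "hset (elts h \<inter> elts (prodset X A))"
    have "?h \<in> V" using h V2 by simp
    moreover have "Q ?h i"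
      using h(2) i unfolding Q_def by (auto simp: A intro: functional_subset)
    ultimately show ?thesis unfolding R_def using V2 i by auto
  qed
  from V_choice_fun[OF \<open>R \<in> V\<close> I(1) this] obtain f where
    f: "f \<in> V" "elts f \<subseteq> elts R" "functional f" "\<And>i. i \<in> elts I \<Longrightarrow> \<langle>i, ap f i\<rangle> \<in> elts f" by blast
  then have Qf: "Q (ap f i) i" if "i \<in> elts I" for i using that unfolding R_def by fastforce
  let ?k = "hset ((\<lambda>z. \<langle>z, ap (ap f (ap g (hfst z))) (hsnd z)\<rangle>) ` elts X)"
  have "?k \<in> V" by (intro dfun_V0[OF dfun_image] dintros X f g)
  moreover have "functional ?k" by (rule functionalI) auto
  moreover have "\<exists>x\<in>elts X. \<langle>x, a\<rangle> \<in> elts ?k" if a: "a \<in> elts A" for a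
  proof -
    obtain i where i: "i \<in> elts I" "a \<in> elts (F i)" using a A by blast
    obtain x where x: "x \<in> elts X" "\<langle>x, i\<rangle> \<in> elts g" using g(3) i(1) by blast
    obtain y where y: "y \<in> elts X" "\<langle>y, a\<rangle> \<in> elts (ap f i)" using Qf[OF i(1)] i(2) unfolding Q_def by blast
    have "ap g x = i" "ap (ap f i) y = a"
      using functional_ap[OF g(2) x(2)] functional_ap[OF _ y(2)] Qf[OF i(1)] unfolding Q_def by blast+
    then have "\<langle>\<langle>x, y\<rangle>, a\<rangle> \<in> elts ?k" using X(2)[OF x(1) y(1)] by (auto intro!: image_eqI[of _ _ "\<langle>x, y\<rangle>"])
    then show ?thesis using X(2)[OF x(1) y(1)] by blast
  qed
  ultimately show ?thesis unfolding dominated_def A_def by blast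
qed

text \<open>Cantor's diagonal set. Taking the rows from the power set of X therefore prevents any
  condition from meeting all rows.\<close>

lemma not_dominated_powV:
  assumes "X \<in> V"
  shows "\<not> dominated X (powV X)"
proof
  assume "dominated X (powV X)"
  then obtain g where g: "g \<in> V" "functional g" "\<forall>a\<in>elts (powV X). \<exists>x\<in>elts X. \<langle>x, a\<rangle> \<in> elts g"
    unfolding dominated_def by blast
  define D where "D = hset {x \<in> elts X. x \<notin> elts (ap g x)}"
  have "D \<in> V" unfolding D_def by (intro dfun_V0[OF dfun_sep] dintros assms g(1))
  moreover have "elts D \<subseteq> elts X" unfolding D_def by auto
  ultimately have "D \<in> elts (powV X)" using assms by simp
  then obtain x where x: "x \<in> elts X" "\<langle>x, D\<rangle> \<in> elts g" using g(3) by blast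
  then have "ap g x = D" using functional_ap[OF g(2)] by blast
  moreover have "x \<in> elts D \<longleftrightarrow> x \<notin> elts (ap g x)" using x(1) unfolding D_def mem_sep by blast
  ultimately have "x \<in> elts D \<longleftrightarrow> x \<notin> elts D" by simp
  then show False by blast
qed

end

section \<open>Names, evaluation and atomic forcing\<close>

lemma is_nameD: "is_name S x \<Longrightarrow> w \<in> elts x \<Longrightarrow> \<exists>p\<in>elts (conds S). \<exists>y. w = \<langle>p, y\<rangle> \<and> is_name S y"
  by (erule is_name.cases) blast

lemma is_name_pair: "is_name S x \<Longrightarrow> w \<in> elts x \<Longrightarrow> \<langle>hfst w, hsnd w\<rangle> = w"
  by (drule (1) is_nameD) auto

lemma is_name_hfst: "is_name S x \<Longrightarrow> w \<in> elts x \<Longrightarrow> hfst w \<in> elts (conds S)"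
  by (drule (1) is_nameD) auto

lemma is_name_hsnd: "is_name S x \<Longrightarrow> w \<in> elts x \<Longrightarrow> is_name S (hsnd w)"
  by (drule (1) is_nameD) auto

lemma small_val: "small (val G ` {y. \<exists>p\<in>G. \<langle>p, y\<rangle> \<in> elts x})"
proof (rule small_image, rule small_subset)
  show "small (hsnd ` elts x)" by simp
  show "{y. \<exists>p\<in>G. \<langle>p, y\<rangle> \<in> elts x} \<subseteq> hsnd ` elts x" by force
qed

lemma mem_val: "u \<in> elts (val G x) \<longleftrightarrow> (\<exists>p\<in>G. \<exists>y. \<langle>p, y\<rangle> \<in> elts x \<and> u = val G y)"
  unfolding val.simps[of G x] elts_hset[OF small_val] by blast

lemma mem_act: "w \<in> elts (act \<pi> x) \<longleftrightarrow> (\<exists>p y. \<langle>p, y\<rangle> \<in> elts x \<and> w = \<langle>app \<pi> p, act \<pi> y\<rangle>)"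
proof -
  let ?A = "\<Union>y\<in>{y. \<exists>p. \<langle>p, y\<rangle> \<in> elts x}. (\<lambda>p. \<langle>app \<pi> p, act \<pi> y\<rangle>) ` {p. \<langle>p, y\<rangle> \<in> elts x}"
  have "?A \<subseteq> (\<lambda>w. \<langle>app \<pi> (hfst w), act \<pi> (hsnd w)\<rangle>) ` elts x" by force
  then have "small ?A" by (rule small_subset[rotated]) simp
  then show ?thesis unfolding act.simps[of \<pi> x] by (subst elts_hset) (assumption, blast)
qed

text \<open>The set x itself is included, so that the result is a transitive set having x as an
  element, which is what the tables \<open>ftab\<close> need.\<close>

function tc :: "'i hset \<Rightarrow> 'i hset" where
  "tc x = hset (insert x (\<Union>y\<in>elts x. elts (tc y)))"
  by auto
termination
proof (relation mem_rel)
  show "wf (mem_rel :: ('i hset \<times> 'i hset) set)" by (rule wf_mem)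
qed auto

declare tc.simps [simp del]

lemma elts_tc: "elts (tc x) = insert x (\<Union>y\<in>elts x. elts (tc y))"
  unfolding tc.simps[of x] by simp

lemma trans_set_tc: "trans_set (tc x)"
proof (induction x rule: hset_induct)
  case (1 x)
  show ?case
    unfolding trans_set_def
  proof (intro ballI subsetI)
    fix z u assume z: "z \<in> elts (tc x)" and u: "u \<in> elts z"
    consider "z = x" | y where "y \<in> elts x" "z \<in> elts (tc y)" using z unfolding elts_tc[of x] by blast
    then show "u \<in> elts (tc x)"
    proof cases
      case 1
      then show ?thesis using u elts_tc[of u] unfolding elts_tc[of x] by blast
    next
      case 2
      then have "u \<in> elts (tc y)" using 1[OF 2(1)] u unfolding trans_set_def by blast
      then show ?thesis using 2(1) unfolding elts_tc[of x] by blast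
    qed
  qed
qed

text \<open>Forcing of equality: below p, every entry of either name is matched densely by an entry
  of the other. Both clauses keep the entry of \<open>a\<close> in first position of the recursive
  call, so the recursion descends on \<open>a\<close> alone although equality is symmetric.\<close>

function feq :: "'i symsys \<Rightarrow> 'i hset \<Rightarrow> 'i hset \<Rightarrow> 'i hset \<Rightarrow> bool" where
  "feq S p a b \<longleftrightarrow> p \<in> elts (conds S) \<and>
     (\<forall>w\<in>elts a. \<forall>q\<in>elts (conds S). \<langle>q, p\<rangle> \<in> elts (leq S) \<longrightarrow> \<langle>q, hfst w\<rangle> \<in> elts (leq S) \<longrightarrow>
        (\<exists>v\<in>elts b. \<exists>r\<in>elts (conds S). \<langle>r, q\<rangle> \<in> elts (leq S) \<and> \<langle>r, hfst v\<rangle> \<in> elts (leq S) \<and>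
           feq S r (hsnd w) (hsnd v))) \<and>
     (\<forall>v\<in>elts b. \<forall>q\<in>elts (conds S). \<langle>q, p\<rangle> \<in> elts (leq S) \<longrightarrow> \<langle>q, hfst v\<rangle> \<in> elts (leq S) \<longrightarrow>
        (\<exists>w\<in>elts a. \<exists>r\<in>elts (conds S). \<langle>r, q\<rangle> \<in> elts (leq S) \<and> \<langle>r, hfst w\<rangle> \<in> elts (leq S) \<and>
           feq S r (hsnd w) (hsnd v)))"
  by auto
termination
proof (relation "inv_image (mem_rel\<^sup>+) (\<lambda>(S, p, a, b). a)")
  show "wf (inv_image (mem_rel\<^sup>+) (\<lambda>(S :: 'i symsys, p :: 'i hset, a :: 'i hset, b :: 'i hset). a))"
    by (intro wf_inv_image wf_trancl wf_mem)
qed (simp_all add: hsnd_trancl)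

declare feq.simps [simp del]

text \<open>Strong membership: a single entry witnesses it, and p lies below the condition of that
  entry. It persists to stronger conditions, but it need not hold at p when it holds densely below
  p; \<open>wforce\<close> takes care of that.\<close>

definition fmem :: "'i symsys \<Rightarrow> 'i hset \<Rightarrow> 'i hset \<Rightarrow> 'i hset \<Rightarrow> bool" where
  "fmem S p c x \<longleftrightarrow> (\<exists>w\<in>elts x. \<langle>p, hfst w\<rangle> \<in> elts (leq S) \<and> feq S p c (hsnd w))"

function check :: "'i symsys \<Rightarrow> 'i hset \<Rightarrow> 'i hset" where
  "check S x = hset ((\<lambda>y. \<langle>top_cond S, check S y\<rangle>) ` elts x)"
  by auto
termination
proof (relation "inv_image mem_rel snd")
  show "wf (inv_image mem_rel (snd :: 'i symsys \<times> 'i hset \<Rightarrow> 'i hset))"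
    by (intro wf_inv_image wf_mem)
qed auto

declare check.simps [simp del]

text \<open>Unlike \<open>act\<close>, this variant is definable on all of \<open>V\<close>.\<close>

function act' :: "'i hset \<Rightarrow> 'i hset \<Rightarrow> 'i hset" where
  "act' \<pi> x = hset ((\<lambda>w. \<langle>ap \<pi> (hfst w), act' \<pi> (hsnd w)\<rangle>) ` elts x)"
  by auto
termination
proof (relation "inv_image (mem_rel\<^sup>+) snd")
  show "wf (inv_image (mem_rel\<^sup>+) (snd :: 'i hset \<times> 'i hset \<Rightarrow> 'i hset))"
    by (intro wf_inv_image wf_trancl wf_mem)
qed (simp_all add: hsnd_trancl)

declare act'.simps [simp del]

lemma act'_eq:
  assumes "is_func \<pi> (elts (conds S)) B"
  shows "is_name S x \<Longrightarrow> act' \<pi> x = act \<pi> x"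
proof (induction x rule: is_name.induct)
  case (1 x)
  have *: "\<exists>p\<in>elts (conds S). \<exists>y. w = \<langle>p, y\<rangle> \<and> act' \<pi> y = act \<pi> y" if "w \<in> elts x" for w
    using 1 that by blast
  have "elts (act' \<pi> x) = elts (act \<pi> x)"
  proof (intro equalityI subsetI)
    fix u assume "u \<in> elts (act' \<pi> x)"
    then obtain w where w: "w \<in> elts x" "u = \<langle>ap \<pi> (hfst w), act' \<pi> (hsnd w)\<rangle>"
      unfolding act'.simps[of \<pi> x] by auto
    with *[OF w(1)] show "u \<in> elts (act \<pi> x)"
      unfolding mem_act using ap_eq_app[OF assms] by force
  next
    fix u assume "u \<in> elts (act \<pi> x)"
    then obtain p y where "\<langle>p, y\<rangle> \<in> elts x" "u = \<langle>app \<pi> p, act \<pi> y\<rangle>" unfolding mem_act by blast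
    with *[OF this(1)] show "u \<in> elts (act' \<pi> x)"
      unfolding act'.simps[of \<pi> x] using ap_eq_app[OF assms] by force
  qed
  then show ?case using elts_inject by blast
qed

context zfc_model
begin

lemma dfun_tc [dintros]: "dfun s \<Longrightarrow> dfun (\<lambda>e. tc (s e))"
proof (rule dfun_rec[where H = "\<lambda>x f e. hset (insert x (elts (hset (\<Union>y\<in>elts x. elts (ap f y)))))"
      and F = "\<lambda>x e. tc x"])
  show "dfun (\<lambda>e. hset (insert (e 0) (elts (hset (\<Union>y\<in>elts (e 0). elts (ap (e (Suc 0)) y))))))"
    by (intro dintros)
qed (subst tc.simps, simp_all add: r_into_trancl)

lemma dfun_act' [dintros]: "dfun s \<Longrightarrow> dfun t \<Longrightarrow> dfun (\<lambda>e. act' (s e) (t e))"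
proof (rule dfun_comp2[of act'])
  show "dfun (\<lambda>e. act' (e 0) (e (Suc 0)))"
  proof (rule dfun_rec[where F = "\<lambda>x e. act' (e 0) x"
        and H = "\<lambda>x f e. hset ((\<lambda>w. \<langle>ap (e 0) (hfst w), ap f (hsnd w)\<rangle>) ` elts x)"])
    show "dfun (\<lambda>e. hset ((\<lambda>w. \<langle>ap (e (Suc (Suc 0))) (hfst w), ap (e (Suc 0)) (hsnd w)\<rangle>) ` elts (e 0)))"
      by (intro dintros)
  next
    fix x f e
    assume *: "\<And>y. (y, x) \<in> mem_rel\<^sup>+ \<Longrightarrow> ap f y = act' (e 0) y"
    show "act' (e 0) x = hset ((\<lambda>w. \<langle>ap (e 0) (hfst w), ap f (hsnd w)\<rangle>) ` elts x)"
      unfolding act'.simps[of "e 0" x] by (intro arg_cong[of _ _ hset] image_cong refl) (simp add: * hsnd_trancl)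
  qed (intro dintros)
qed

end

section \<open>Definability of forced equality, and maximal functions decided by a condition\<close>

locale forcing = zfc_model V for V :: "'i hset set" +
  fixes S :: "'i symsys"
  assumes conds_V [simp]: "conds S \<in> V" and leq_V [simp]: "leq S \<in> V" and notion: "forcing_notion S"
begin

abbreviation P :: "'i hset set" where "P \<equiv> elts (conds S)"
abbreviation le :: "'i hset \<Rightarrow> 'i hset \<Rightarrow> bool" (infix "\<preceq>" 50) where "p \<preceq> q \<equiv> \<langle>p, q\<rangle> \<in> elts (leq S)"

lemma leD: "p \<preceq> q \<Longrightarrow> p \<in> P" "p \<preceq> q \<Longrightarrow> q \<in> P"
  using conjunct1[OF notion[unfolded forcing_notion_def]] by force+

lemma le_refl [simp]: "p \<in> P \<Longrightarrow> p \<preceq> p"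
  using conjunct1[OF conjunct2[OF notion[unfolded forcing_notion_def]]] by blast

lemma le_trans: "p \<preceq> q \<Longrightarrow> q \<preceq> r \<Longrightarrow> p \<preceq> r"
  using conjunct1[OF conjunct2[OF conjunct2[OF notion[unfolded forcing_notion_def]]]] by blast

lemma top [simp]: "top_cond S \<in> P" "p \<in> P \<Longrightarrow> p \<preceq> top_cond S"
  using conjunct2[OF conjunct2[OF conjunct2[OF notion[unfolded forcing_notion_def]]]] by blast+

lemma P_V: "p \<in> P \<Longrightarrow> p \<in> V"
  by (rule V_trans[OF conds_V])

lemma top_V [simp]: "top_cond S \<in> V"
  by (rule P_V) simp

lemma feq_P: "feq S p a b \<Longrightarrow> p \<in> P"
  by (simp add: feq.simps[of S p])

lemma feq_mono: "feq S p a b \<Longrightarrow> q \<preceq> p \<Longrightarrow> feq S q a b"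
proof -
  assume "feq S p a b" and q: "q \<preceq> p"
  moreover have "r \<preceq> p" if "r \<preceq> q" for r using that q by (rule le_trans)
  moreover have "q \<in> P" using q by (rule leD)
  ultimately show ?thesis unfolding feq.simps[of S p] feq.simps[of S q] by simp
qed

lemma fmem_mono: "fmem S p a b \<Longrightarrow> q \<preceq> p \<Longrightarrow> fmem S q a b"
  unfolding fmem_def using feq_mono le_trans by blast

text \<open>The recursion for \<open>feq\<close> is on its first name only, the second one ranging over a transitive
  set \<open>T\<close>; this yields definability by recursion on a single argument.\<close>

definition ftab :: "'i hset \<Rightarrow> 'i hset \<Rightarrow> 'i hset" where
  "ftab T a = hset {z \<in> elts (prodset T (conds S)). trans_set T \<and> feq S (hsnd z) a (hfst z)}"

lemma dfun_ftab: "dfun s \<Longrightarrow> dfun t \<Longrightarrow> dfun (\<lambda>e. ftab (s e) (t e))"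
proof (rule dfun_comp2[of ftab])
  define H where "H a f e = hset {z \<in> elts (prodset (e 0) (conds S)). trans_set (e 0) \<and>
     (\<forall>w\<in>elts a. \<forall>q\<in>P. q \<preceq> hsnd z \<longrightarrow> q \<preceq> hfst w \<longrightarrow>
        (\<exists>v\<in>elts (hfst z). \<exists>r\<in>P. r \<preceq> q \<and> r \<preceq> hfst v \<and> \<langle>hsnd v, r\<rangle> \<in> elts (ap f (hsnd w)))) \<and>
     (\<forall>v\<in>elts (hfst z). \<forall>q\<in>P. q \<preceq> hsnd z \<longrightarrow> q \<preceq> hfst v \<longrightarrow>
        (\<exists>w\<in>elts a. \<exists>r\<in>P. r \<preceq> q \<and> r \<preceq> hfst w \<and> \<langle>hsnd v, r\<rangle> \<in> elts (ap f (hsnd w))))}"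
    for a f and e :: "nat \<Rightarrow> 'i hset"
  show "dfun (\<lambda>e. ftab (e 0) (e (Suc 0)))"
  proof (rule dfun_rec[where F = "\<lambda>a e. ftab (e 0) a" and H = H])
    show "dfun (\<lambda>e. H (e 0) (e (Suc 0)) (\<lambda>n. e (Suc (Suc n))))"
      unfolding H_def by (intro dintros) simp_all
  next
    fix a f and e :: "nat \<Rightarrow> 'i hset"
    assume "\<And>y. (y, a) \<in> mem_rel\<^sup>+ \<Longrightarrow> ap f y = ftab (e 0) y"
    then have f: "ap f (hsnd w) = ftab (e 0) (hsnd w)" if "w \<in> elts a" for w
      using that hsnd_trancl by blast
    \<comment> \<open>The range of a table is transitive, so the name in an entry of b lies in the
      range again and the recursive value can be looked up.\<close>
    have ft: "\<langle>hsnd v, r\<rangle> \<in> elts (ap f (hsnd w)) \<longleftrightarrow> feq S r (hsnd w) (hsnd v)"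
      if "trans_set (e 0)" "b \<in> elts (e 0)" "w \<in> elts a" "v \<in> elts b" "r \<in> P" for w v r b
    proof -
      have "hsnd v \<in> elts (e 0)" using trans_set_trancl[OF that(1) hsnd_trancl[OF that(4)] that(2)] .
      then show ?thesis unfolding f[OF that(3)] ftab_def mem_sep using that by simp
    qed
    show "ftab (e 0) a = H a f e"
      unfolding ftab_def H_def
    proof (intro arg_cong[of _ _ hset] Collect_cong conj_cong refl)
      fix z assume z: "z \<in> elts (prodset (e 0) (conds S))" and T: "trans_set (e 0)"
      then have b: "hfst z \<in> elts (e 0)" "hsnd z \<in> P" by (auto simp: elts_prodset)
      note ft' = ft[OF T b(1)]
      show "feq S (hsnd z) a (hfst z) \<longleftrightarrow>
         (\<forall>w\<in>elts a. \<forall>q\<in>P. q \<preceq> hsnd z \<longrightarrow> q \<preceq> hfst w \<longrightarrow>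
            (\<exists>v\<in>elts (hfst z). \<exists>r\<in>P. r \<preceq> q \<and> r \<preceq> hfst v \<and> \<langle>hsnd v, r\<rangle> \<in> elts (ap f (hsnd w)))) \<and>
         (\<forall>v\<in>elts (hfst z). \<forall>q\<in>P. q \<preceq> hsnd z \<longrightarrow> q \<preceq> hfst v \<longrightarrow>
            (\<exists>w\<in>elts a. \<exists>r\<in>P. r \<preceq> q \<and> r \<preceq> hfst w \<and> \<langle>hsnd v, r\<rangle> \<in> elts (ap f (hsnd w))))"
        unfolding feq.simps[of S "hsnd z" a "hfst z"] using b(2) by (simp add: ft' cong: ball_cong bex_cong conj_cong)
    qed
  qed (intro dintros)
qed

lemma dpred_feq [dintros]:
  assumes "dfun s" "dfun t" "dfun u"
  shows "dpred (\<lambda>e. feq S (s e) (t e) (u e))"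
proof (rule dpred_comp3[of "feq S", OF _ assms])
  show "dpred (\<lambda>e. feq S (e 0) (e (Suc 0)) (e (Suc (Suc 0))))"
  proof (rule dpred_cong)
    show "dpred (\<lambda>e. \<langle>e (Suc (Suc 0)), e 0\<rangle> \<in> elts (ftab (tc (e (Suc (Suc 0)))) (e (Suc 0))))"
      by (intro dintros dfun_ftab)
    fix e
    show "feq S (e 0) (e (Suc 0)) (e (Suc (Suc 0))) \<longleftrightarrow>
        \<langle>e (Suc (Suc 0)), e 0\<rangle> \<in> elts (ftab (tc (e (Suc (Suc 0)))) (e (Suc 0)))"
      unfolding ftab_def mem_sep using feq_P elts_tc[of "e (Suc (Suc 0))"] trans_set_tc by auto
  qed
qed

lemma dpred_fmem [dintros]: "dfun s \<Longrightarrow> dfun t \<Longrightarrow> dfun u \<Longrightarrow> dpred (\<lambda>e. fmem S (s e) (t e) (u e))"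
  unfolding fmem_def by (intro dintros dfun_weaken) simp_all

lemma dfun_check [dintros]: "dfun s \<Longrightarrow> dfun (\<lambda>e. check S (s e))"
proof (rule dfun_rec[where H = "\<lambda>x f e. hset ((\<lambda>y. \<langle>top_cond S, ap f y\<rangle>) ` elts x)"
      and F = "\<lambda>x e. check S x"])
  show "dfun (\<lambda>e. hset ((\<lambda>y. \<langle>top_cond S, ap (e (Suc 0)) y\<rangle>) ` elts (e 0)))"
    by (intro dintros) simp
qed (subst check.simps, simp_all add: r_into_trancl)

lemma is_name_check: "is_name S (check S x)"
proof (induction x rule: hset_induct)
  case (1 x)
  then show ?case by (intro is_name.intros) (auto simp: check.simps[of S x])
qed

text \<open>Density of D below p. Its failure at a condition p yields an extension none of whose
  extensions satisfies D, which is how undecided alternatives are settled later.\<close>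

definition wforce :: "'i hset \<Rightarrow> ('i hset \<Rightarrow> bool) \<Rightarrow> bool" where
  "wforce p D \<longleftrightarrow> p \<in> P \<and> (\<forall>q\<in>P. q \<preceq> p \<longrightarrow> (\<exists>r\<in>P. r \<preceq> q \<and> D r))"

lemma wforce_mono: "wforce p D \<Longrightarrow> q \<preceq> p \<Longrightarrow> wforce q D"
  unfolding wforce_def using le_trans leD by blast

lemma dpred_wforce:
  assumes "dfun s" "dpred (\<lambda>e. D (e 0) (\<lambda>n. e (Suc n)))"
  shows "dpred (\<lambda>e. wforce (s e) (\<lambda>r. D r e))"
proof -
  have "inj (\<lambda>n. case n of 0 \<Rightarrow> 0 | Suc n \<Rightarrow> Suc (Suc n))" by (auto simp: inj_def split: nat.splits)
  from dpred_reindex[OF assms(2) this]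
  have "dpred (\<lambda>e. D (e 0) (\<lambda>n. e (Suc (Suc n))))" by simp
  then show ?thesis unfolding wforce_def by (intro dintros dfun_weaken assms(1)) simp_all
qed

text \<open>In a chain without top element, the second components can be thinned out to a cofinal family
  indexed by the domain of the union of the first components, and hence have a lower bound.\<close>

lemma dense_extension:
  assumes X: "X \<in> V" and I: "I \<in> V" "dominated X I" and B: "B \<in> V"
    and closed: "\<And>A. A \<in> V \<Longrightarrow> elts A \<subseteq> P \<Longrightarrow> dominated X A \<Longrightarrow>
      (\<And>a b. a \<in> elts A \<Longrightarrow> b \<in> elts A \<Longrightarrow> a \<preceq> b \<or> b \<preceq> a) \<Longrightarrow> \<exists>q\<in>P. \<forall>a\<in>elts A. q \<preceq> a"
    and \<Phi>: "dpred (\<lambda>e. \<Phi> (e 0) (e (Suc 0)))"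
    and \<Phi>_fun: "\<And>s q. \<Phi> s q \<Longrightarrow> functional s \<and> elts s \<subseteq> elts (prodset I B)"
    and \<Phi>_mono: "\<And>s q r. \<Phi> s q \<Longrightarrow> r \<preceq> q \<Longrightarrow> \<Phi> s r"
    and \<Phi>_chain: "\<And>C q. C \<in> V \<Longrightarrow> q \<in> P \<Longrightarrow> (\<And>s. s \<in> elts C \<Longrightarrow> \<Phi> s q) \<Longrightarrow>
      (\<And>s t. s \<in> elts C \<Longrightarrow> t \<in> elts C \<Longrightarrow> elts s \<subseteq> elts t \<or> elts t \<subseteq> elts s) \<Longrightarrow>
      \<Phi> (hset (\<Union>s\<in>elts C. elts s)) q"
    and p: "p \<in> P"
  shows "\<exists>s\<in>V. \<exists>q. q \<preceq> p \<and> \<Phi> s q \<and> (\<forall>t\<in>V. \<forall>r. r \<preceq> q \<longrightarrow> \<Phi> t r \<longrightarrow> elts s \<subseteq> elts t \<longrightarrow> t = s)"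
proof -
  have d\<Phi>: "dpred (\<lambda>e. \<Phi> (s e) (t e))" if "dfun s" "dfun t" for s t
    using dpred_comp2[of \<Phi>, OF \<Phi> that] .
  define Q where "Q = powV (prodset I B)"
  have IB: "prodset I B \<in> V" by (intro dfun_V0[OF dfun_prodset] dintros I(1) B)
  then have "Q \<in> V" unfolding Q_def by simp
  have inQ: "s \<in> elts Q" if "s \<in> V" "\<Phi> s q" for s q
    unfolding Q_def elts_powV[OF IB] using that \<Phi>_fun by blast
  define Z where "Z = hset {z \<in> elts (prodset Q (conds S)). \<Phi> (hfst z) (hsnd z) \<and> hsnd z \<preceq> p}"
  have pV: "p \<in> V" using p P_V by blast
  have "Z \<in> V" unfolding Z_def by (intro dfun_V0[OF dfun_sep] dintros d\<Phi> \<open>Q \<in> V\<close> pV conds_V leq_V)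
  have Z: "\<langle>s, q\<rangle> \<in> elts Z \<longleftrightarrow> s \<in> V \<and> \<Phi> s q \<and> q \<preceq> p" for s q
    unfolding Z_def mem_sep using inQ leD V_trans[OF \<open>Q \<in> V\<close>] by auto
  have Zp: "\<exists>s q. z = \<langle>s, q\<rangle> \<and> s \<in> V \<and> \<Phi> s q \<and> q \<preceq> p" if "z \<in> elts Z" for z
  proof -
    from that obtain s q where "z = \<langle>s, q\<rangle>" unfolding Z_def mem_sep by (auto simp: elts_prodset)
    then show ?thesis using that Z by blast
  qed
  \<comment> \<open>Strict growth of the first component is built into the order. This makes it
    antisymmetric although the forcing is only a preorder, and maximality then speaks about
    extensions of the first component under arbitrary stronger conditions.\<close>
  define L where "L z z' \<longleftrightarrow> z = z' \<or> (elts (hfst z) \<subseteq> elts (hfst z') \<and> hfst z \<noteq> hfst z' \<and> hsnd z' \<preceq> hsnd z)"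
    for z z'
  have "\<exists>m\<in>elts Z. \<forall>x\<in>elts Z. L m x \<longrightarrow> x = m"
  proof (rule V_zorn[OF \<open>Z \<in> V\<close>])
    show "dpred (\<lambda>e. L (e 0) (e (Suc 0)))" unfolding L_def by (intro dintros) simp
    show "L x x" for x unfolding L_def by simp
    show "L x z" if xyz: "L x y" "L y z" for x y z
    proof (cases "x = y \<or> y = z")
      case False
      then have "elts (hfst x) \<subseteq> elts (hfst y)" "elts (hfst y) \<subseteq> elts (hfst z)" "hfst x \<noteq> hfst y"
        "hsnd z \<preceq> hsnd x" using xyz le_trans unfolding L_def by blast+
      moreover from this have "hfst x \<noteq> hfst z" using elts_inject by blast
      ultimately show ?thesis unfolding L_def by blast
    qed (use xyz in blast)
    show "x = y" if "L x y" "L y x" for x y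
      using that elts_inject[of "hfst x" "hfst y"] unfolding L_def by blast
  next
    fix C assume C: "C \<in> V" "elts C \<subseteq> elts Z" "\<And>x y. x \<in> elts C \<Longrightarrow> y \<in> elts C \<Longrightarrow> L x y \<or> L y x"
    have sub: "elts (hfst x) \<subseteq> elts (hfst y) \<or> elts (hfst y) \<subseteq> elts (hfst x)"
      and cmp: "hsnd x \<preceq> hsnd y \<or> hsnd y \<preceq> hsnd x" if xy: "x \<in> elts C" "y \<in> elts C" for x y
    proof -
      have "hsnd x \<in> P" using xy(1) C(2) Zp leD(1) by fastforce
      then show "elts (hfst x) \<subseteq> elts (hfst y) \<or> elts (hfst y) \<subseteq> elts (hfst x)"
        "hsnd x \<preceq> hsnd y \<or> hsnd y \<preceq> hsnd x" using C(3)[OF xy] le_refl unfolding L_def by blast+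
    qed
    consider "elts C = {}" | z where "z \<in> elts C" "\<forall>x\<in>elts C. L x z"
      | "elts C \<noteq> {}" "\<And>z. z \<in> elts C \<Longrightarrow> \<exists>x\<in>elts C. \<not> L x z" by blast
    then show "\<exists>u\<in>elts Z. \<forall>x\<in>elts C. L x u"
    proof cases
      case 1
      \<comment> \<open>The union hypothesis at the empty family shows that the empty function is
        admissible, which bounds the empty chain.\<close>
      have "\<Phi> (hset (\<Union>s\<in>elts (hset {}). elts s)) p" by (rule \<Phi>_chain[OF V_empty p]) simp_all
      then have "\<langle>hset {}, p\<rangle> \<in> elts Z" unfolding Z using p by simp
      then show ?thesis using 1 by blast
    next
      case 2
      then show ?thesis using C(2) by blast
    next
      case 3
      define I0 where "I0 = hset {i \<in> elts I. \<exists>z\<in>elts C. \<exists>b\<in>elts B. \<langle>i, b\<rangle> \<in> elts (hfst z)}"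
      have "I0 \<in> V" unfolding I0_def by (intro dfun_V0[OF dfun_sep] dintros I(1) B C(1))
      define R where "R = hset {w \<in> elts (prodset I0 C). \<exists>b\<in>elts B. \<langle>hfst w, b\<rangle> \<in> elts (hfst (hsnd w))}"
      have "R \<in> V" unfolding R_def by (intro dfun_V0[OF dfun_sep] dintros \<open>I0 \<in> V\<close> B C(1))
      have "\<exists>z. \<langle>i, z\<rangle> \<in> elts R" if "i \<in> elts I0" for i
        using that unfolding R_def I0_def mem_sep by auto
      from V_choice_fun[OF \<open>R \<in> V\<close> \<open>I0 \<in> V\<close> this] obtain c where c: "c \<in> V" "elts c \<subseteq> elts R"
        "\<And>i. i \<in> elts I0 \<Longrightarrow> \<langle>i, ap c i\<rangle> \<in> elts c" by blast
      have ci: "ap c i \<in> elts C \<and> (\<exists>b. \<langle>i, b\<rangle> \<in> elts (hfst (ap c i)))" if "i \<in> elts I0" for i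
      proof -
        have "\<langle>i, ap c i\<rangle> \<in> elts R" using c(2) c(3)[OF that] by blast
        then show ?thesis unfolding R_def mem_sep by auto
      qed
      define A where "A = hset ((\<lambda>i. hsnd (ap c i)) ` elts I0)"
      have A: "elts A = (\<lambda>i. hsnd (ap c i)) ` elts I0" unfolding A_def by simp
      have "A \<in> V" unfolding A_def by (intro dfun_V0[OF dfun_image] dintros \<open>I0 \<in> V\<close> c(1))
      have CP: "hsnd z \<in> P" if "z \<in> elts C" for z using that C(2) Zp leD(1) by fastforce
      have "dominated X I0" by (rule dominated_subset[OF I(2)]) (auto simp: I0_def)
      then have "dominated X A"
        by (rule dominated_image[where F = "\<lambda>i. hsnd (ap c i)"]) (intro dintros c(1), simp_all add: A \<open>I0 \<in> V\<close> X)
      moreover have "elts A \<subseteq> P" unfolding A using ci CP by blast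
      moreover have "a \<preceq> b \<or> b \<preceq> a" if "a \<in> elts A" "b \<in> elts A" for a b
        using that ci cmp unfolding A by blast
      ultimately obtain q where q: "q \<in> P" "\<And>a. a \<in> elts A \<Longrightarrow> q \<preceq> a" using closed[OF \<open>A \<in> V\<close>] by blast
      have qz: "q \<preceq> hsnd z" and strict: "\<exists>x\<in>elts C. elts (hfst z) \<subseteq> elts (hfst x) \<and> hfst x \<noteq> hfst z"
        if z: "z \<in> elts C" for z
      proof -
        obtain x where x: "x \<in> elts C" "\<not> L x z" using 3(2)[OF z] by blast
        then have zx: "elts (hfst z) \<subseteq> elts (hfst x)" "hfst x \<noteq> hfst z"
          using C(3)[OF x(1) z] unfolding L_def by auto
        then show "\<exists>x\<in>elts C. elts (hfst z) \<subseteq> elts (hfst x) \<and> hfst x \<noteq> hfst z" using x(1) by blast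
        obtain sx qx where sx: "x = \<langle>sx, qx\<rangle>" "\<Phi> sx qx" using Zp C(2) x(1) by blast
        then have f: "functional (hfst x)" "elts (hfst x) \<subseteq> elts (prodset I B)" using \<Phi>_fun by simp_all
        obtain w where w: "w \<in> elts (hfst x)" "w \<notin> elts (hfst z)" using zx elts_inject by blast
        then obtain i b where ib: "w = \<langle>i, b\<rangle>" "i \<in> elts I" "b \<in> elts B" using f(2) by (auto simp: elts_prodset)
        then have "i \<in> elts I0" unfolding I0_def mem_sep using w(1) x(1) by blast
        then obtain b' where b': "ap c i \<in> elts C" "\<langle>i, b'\<rangle> \<in> elts (hfst (ap c i))" using ci by blast
        have "\<langle>i, b'\<rangle> \<notin> elts (hfst z)"
          using functionalD[OF f(1)] zx(1) w ib(1) by blast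
        then have "\<not> L (ap c i) z" using b'(2) unfolding L_def by blast
        then have "hsnd (ap c i) \<preceq> hsnd z" using C(3)[OF b'(1) z] unfolding L_def by blast
        moreover have "q \<preceq> hsnd (ap c i)" using q(2) \<open>i \<in> elts I0\<close> unfolding A by blast
        ultimately show "q \<preceq> hsnd z" using le_trans by blast
      qed
      define SS where "SS = hset (hfst ` elts C)"
      have "SS \<in> V" unfolding SS_def by (intro dfun_V0[OF dfun_image[where F = "\<lambda>x e. hfst x"]] dintros C(1))
      have SS: "elts SS = hfst ` elts C" unfolding SS_def by simp
      define U where "U = hset (\<Union>s\<in>elts SS. elts s)"
      have "U \<in> V" unfolding U_def by (intro dfun_V0[OF dfun_Union] dintros \<open>SS \<in> V\<close>)
      have U: "elts U = (\<Union>z\<in>elts C. elts (hfst z))" unfolding U_def SS by simp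
      have "\<Phi> U q"
        unfolding U_def
      proof (rule \<Phi>_chain[OF \<open>SS \<in> V\<close> q(1)])
        fix s assume "s \<in> elts SS"
        then obtain z where z: "z \<in> elts C" "s = hfst z" unfolding SS by blast
        then obtain s' q' where "z = \<langle>s', q'\<rangle>" "\<Phi> s' q'" using Zp C(2) by blast
        then show "\<Phi> s q" using \<Phi>_mono[OF _ qz[OF z(1)]] z(2) by simp
      next
        fix s t assume "s \<in> elts SS" "t \<in> elts SS"
        then show "elts s \<subseteq> elts t \<or> elts t \<subseteq> elts s" unfolding SS using sub by blast
      qed
      moreover have "q \<preceq> p"
      proof -
        obtain z where z: "z \<in> elts C" using 3(1) by blast
        then have "hsnd z \<preceq> p" using Zp C(2) by fastforce
        then show ?thesis using qz[OF z] le_trans by blast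
      qed
      ultimately have "\<langle>U, q\<rangle> \<in> elts Z" unfolding Z using \<open>U \<in> V\<close> by blast
      moreover have "L z \<langle>U, q\<rangle>" if z: "z \<in> elts C" for z
      proof -
        obtain x where "x \<in> elts C" "elts (hfst z) \<subseteq> elts (hfst x)" "hfst x \<noteq> hfst z" using strict[OF z] by blast
        moreover from this have "elts (hfst x) \<subseteq> elts U" unfolding U by blast
        ultimately have "elts (hfst z) \<noteq> elts U"
          using elts_inject[of "hfst x" "hfst z"] by blast
        moreover have "elts (hfst z) \<subseteq> elts U" unfolding U using z by blast
        ultimately show ?thesis unfolding L_def using qz[OF z] by auto
      qed
      ultimately show ?thesis by blast
    qed
  qed
  then obtain m where m: "m \<in> elts Z" "\<And>x. x \<in> elts Z \<Longrightarrow> L m x \<Longrightarrow> x = m" by blast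
  obtain s q where sq: "m = \<langle>s, q\<rangle>" "s \<in> V" "\<Phi> s q" "q \<preceq> p" using Zp[OF m(1)] by blast
  have "t = s" if t: "t \<in> V" "r \<preceq> q" "\<Phi> t r" "elts s \<subseteq> elts t" for t r
  proof (rule ccontr)
    assume "t \<noteq> s"
    then have "L m \<langle>t, r\<rangle>" unfolding L_def sq(1) using t by auto
    moreover have "\<langle>t, r\<rangle> \<in> elts Z" unfolding Z using t le_trans sq(4) by blast
    ultimately have "\<langle>t, r\<rangle> = m" using m(2) by blast
    then show False using \<open>t \<noteq> s\<close> sq(1) by simp
  qed
  then show ?thesis using sq by blast
qed

end

section \<open>Generic filters and truth of atomic statements\<close>

locale generic_ext = forcing V S for V :: "'i hset set" and S +
  fixes G :: "'i hset set"
  assumes gen: "generic V S G"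
begin

lemma G_P: "p \<in> G \<Longrightarrow> p \<in> P"
  using conjunct1[OF gen[unfolded generic_def]] by blast

lemma G_ne: "G \<noteq> {}"
  using conjunct1[OF conjunct2[OF gen[unfolded generic_def]]] .

lemma G_up: "p \<in> G \<Longrightarrow> p \<preceq> q \<Longrightarrow> q \<in> G"
  using conjunct1[OF conjunct2[OF conjunct2[OF gen[unfolded generic_def]]]] leD by blast

lemma G_compat: "p \<in> G \<Longrightarrow> q \<in> G \<Longrightarrow> \<exists>r\<in>G. r \<preceq> p \<and> r \<preceq> q"
  using conjunct1[OF conjunct2[OF conjunct2[OF conjunct2[OF gen[unfolded generic_def]]]]] by blast

lemma G_meets: "D \<in> V \<Longrightarrow> dense_in S D \<Longrightarrow> \<exists>p\<in>G. p \<in> elts D"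
  using conjunct2[OF conjunct2[OF conjunct2[OF conjunct2[OF gen[unfolded generic_def]]]]] by blast

lemma top_G [simp]: "top_cond S \<in> G"
  using G_ne G_up G_P top by blast

text \<open>Genericity speaks of dense sets only. Adding the conditions incompatible with p turns a
  set dense below p into a dense one, and G contains none of the added conditions.\<close>

lemma G_dense_below:
  assumes D: "dpred (\<lambda>e. D (e 0))" and p: "p \<in> G" and dense: "wforce p D"
  shows "\<exists>r\<in>G. r \<preceq> p \<and> D r"
proof -
  have pV: "p \<in> V" using p G_P P_V by blast
  define E where "E = hset {r \<in> P. (D r \<and> r \<preceq> p) \<or> (\<forall>q\<in>P. q \<preceq> r \<longrightarrow> \<not> q \<preceq> p)}"
  have E: "r \<in> elts E \<longleftrightarrow> r \<in> P \<and> ((D r \<and> r \<preceq> p) \<or> (\<forall>q\<in>P. q \<preceq> r \<longrightarrow> \<not> q \<preceq> p))" for r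
    unfolding E_def mem_sep ..
  have "E \<in> V" unfolding E_def by (intro dfun_V0[OF dfun_sep] dintros dpred_comp1[of D, OF D] pV conds_V leq_V)
  moreover have "dense_in S E"
    unfolding dense_in_def
  proof (intro conjI ballI)
    fix r assume r: "r \<in> P"
    show "\<exists>d\<in>elts E. d \<preceq> r"
    proof (cases "\<exists>q\<in>P. q \<preceq> r \<and> q \<preceq> p")
      case True
      then obtain q where q: "q \<in> P" "q \<preceq> r" "q \<preceq> p" by blast
      then obtain d where d: "d \<in> P" "d \<preceq> q" "D d" using dense unfolding wforce_def by blast
      have "d \<preceq> r" "d \<preceq> p" using le_trans[OF d(2)] q by blast+
      then have "d \<in> elts E" unfolding E using d by simp
      then show ?thesis using \<open>d \<preceq> r\<close> by blast
    next
      case False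
      then have "r \<in> elts E" unfolding E using r by simp
      then show ?thesis using le_refl[OF r] by blast
    qed
  next
    show "elts E \<subseteq> P" using E by (simp add: subset_iff)
  qed
  ultimately obtain r where r: "r \<in> G" "r \<in> elts E" using G_meets by blast
  moreover obtain q where "q \<in> G" "q \<preceq> r" "q \<preceq> p" using G_compat[OF r(1) p] by blast
  ultimately show ?thesis unfolding E using G_P[OF \<open>q \<in> G\<close>] by blast
qed

lemma G_dense: "dpred (\<lambda>e. D (e 0)) \<Longrightarrow> (\<And>q. q \<in> P \<Longrightarrow> \<exists>r\<in>P. r \<preceq> q \<and> D r) \<Longrightarrow> \<exists>r\<in>G. D r"
  using G_dense_below[of D "top_cond S"] unfolding wforce_def by auto

text \<open>Induction on the first name. If equality is forced, genericity finds a matching entry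
  for every entry that enters the value. If the values agree, a dense set of conditions either
  forces equality or exhibits an entry without match, and the latter is refuted inside G.\<close>

lemma val_eq_iff:
  assumes "is_name S a" "is_name S b" "a \<in> V" "b \<in> V"
  shows "val G a = val G b \<longleftrightarrow> (\<exists>p\<in>G. feq S p a b)"
  using assms
proof (induction a arbitrary: b rule: trancl_mem_induct)
  case (1 a)
  have nV: "hsnd w \<in> V" "hsnd w \<in> V" if "w \<in> elts a \<or> w \<in> elts b" for w
    using that 1(4,5) V_trans by auto
  have IH: "val G (hsnd w) = val G (hsnd v) \<longleftrightarrow> (\<exists>p\<in>G. feq S p (hsnd w) (hsnd v))"
    if "w \<in> elts a" "v \<in> elts b" for w v
    using 1(1)[OF hsnd_trancl[OF that(1)]] is_name_hsnd[OF 1(2) that(1)] is_name_hsnd[OF 1(3) that(2)]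
      nV that by blast
  have mem: "u \<in> elts (val G x) \<longleftrightarrow> (\<exists>w\<in>elts x. hfst w \<in> G \<and> u = val G (hsnd w))" if "is_name S x" for x u
  proof -
    have "\<langle>p, y\<rangle> \<in> elts x \<longleftrightarrow> (\<exists>w\<in>elts x. hfst w = p \<and> hsnd w = y)" for p y
      using is_name_pair[OF that] by (metis hfst_opair hsnd_opair)
    then show ?thesis unfolding mem_val by auto
  qed
  have aV: "a \<in> V" "b \<in> V" using 1 by blast+
  have wV: "w \<in> V" if "w \<in> elts a \<or> w \<in> elts b" for w using that aV V_trans by blast
  show ?case
  proof
    assume "\<exists>p\<in>G. feq S p a b"
    then obtain p where p: "p \<in> G" "feq S p a b" by blast
    have "elts (val G a) \<subseteq> elts (val G b)"
    proof
      fix u assume "u \<in> elts (val G a)"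
      then obtain w where w: "w \<in> elts a" "hfst w \<in> G" "u = val G (hsnd w)" using mem[OF 1(2)] by blast
      obtain q where q: "q \<in> G" "q \<preceq> p" "q \<preceq> hfst w" using G_compat[OF p(1) w(2)] by blast
      have "dpred (\<lambda>e. \<exists>v\<in>elts b. e 0 \<preceq> hfst v \<and> feq S (e 0) (hsnd w) (hsnd v))"
        by (intro dintros aV wV leq_V) (use w in blast)
      moreover have "wforce q (\<lambda>r. \<exists>v\<in>elts b. r \<preceq> hfst v \<and> feq S r (hsnd w) (hsnd v))"
        unfolding wforce_def
      proof (intro conjI ballI impI)
        fix q' assume q': "q' \<in> P" "q' \<preceq> q"
        then have "q' \<preceq> p" "q' \<preceq> hfst w" using q le_trans by blast+
        then show "\<exists>r\<in>P. r \<preceq> q' \<and> (\<exists>v\<in>elts b. r \<preceq> hfst v \<and> feq S r (hsnd w) (hsnd v))"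
          using p(2) w(1) q'(1) unfolding feq.simps[of S p a b] by blast
      qed (use q G_P in blast)
      ultimately obtain r v where r: "r \<in> G" "v \<in> elts b" "r \<preceq> hfst v" "feq S r (hsnd w) (hsnd v)"
        using G_dense_below[OF _ q(1), of "\<lambda>r. \<exists>v\<in>elts b. r \<preceq> hfst v \<and> feq S r (hsnd w) (hsnd v)"] by blast
      then have "hfst v \<in> G" "u = val G (hsnd v)" using IH[OF w(1) r(2)] w(3) G_up by auto
      then show "u \<in> elts (val G b)" using mem[OF 1(3)] r(2) by blast
    qed
    moreover have "elts (val G b) \<subseteq> elts (val G a)"
    proof
      fix u assume "u \<in> elts (val G b)"
      then obtain v where v: "v \<in> elts b" "hfst v \<in> G" "u = val G (hsnd v)" using mem[OF 1(3)] by blast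
      obtain q where q: "q \<in> G" "q \<preceq> p" "q \<preceq> hfst v" using G_compat[OF p(1) v(2)] by blast
      have "dpred (\<lambda>e. \<exists>w\<in>elts a. e 0 \<preceq> hfst w \<and> feq S (e 0) (hsnd w) (hsnd v))"
        by (intro dintros aV wV leq_V) (use v in blast)
      moreover have "wforce q (\<lambda>r. \<exists>w\<in>elts a. r \<preceq> hfst w \<and> feq S r (hsnd w) (hsnd v))"
        unfolding wforce_def
      proof (intro conjI ballI impI)
        fix q' assume q': "q' \<in> P" "q' \<preceq> q"
        then have "q' \<preceq> p" "q' \<preceq> hfst v" using q le_trans by blast+
        then show "\<exists>r\<in>P. r \<preceq> q' \<and> (\<exists>w\<in>elts a. r \<preceq> hfst w \<and> feq S r (hsnd w) (hsnd v))"
          using p(2) v(1) q'(1) unfolding feq.simps[of S p a b] by blast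
      qed (use q G_P in blast)
      ultimately obtain r w where r: "r \<in> G" "w \<in> elts a" "r \<preceq> hfst w" "feq S r (hsnd w) (hsnd v)"
        using G_dense_below[OF _ q(1), of "\<lambda>r. \<exists>w\<in>elts a. r \<preceq> hfst w \<and> feq S r (hsnd w) (hsnd v)"] by blast
      then have "hfst w \<in> G" "u = val G (hsnd w)" using IH[OF r(2) v(1)] v(3) G_up by auto
      then show "u \<in> elts (val G a)" using mem[OF 1(2)] r(2) by blast
    qed
    ultimately show "val G a = val G b" using elts_inject by blast
  next
    assume eq: "val G a = val G b"
    \<comment> \<open>Witnesses against equality: \<open>D1\<close> names an entry of a, and
      \<open>D2\<close> one of b, that no stronger condition identifies with any entry of the other
      name. A condition not forcing equality has an extension of one of these two kinds.\<close>
    define D1 where "D1 q \<longleftrightarrow> (\<exists>w\<in>elts a. q \<preceq> hfst w \<and>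
      (\<forall>r\<in>P. r \<preceq> q \<longrightarrow> (\<forall>v\<in>elts b. r \<preceq> hfst v \<longrightarrow> \<not> feq S r (hsnd w) (hsnd v))))" for q
    define D2 where "D2 q \<longleftrightarrow> (\<exists>v\<in>elts b. q \<preceq> hfst v \<and>
      (\<forall>r\<in>P. r \<preceq> q \<longrightarrow> (\<forall>w\<in>elts a. r \<preceq> hfst w \<longrightarrow> \<not> feq S r (hsnd w) (hsnd v))))" for q
    have "dpred (\<lambda>e. feq S (e 0) a b \<or> D1 (e 0) \<or> D2 (e 0))"
      unfolding D1_def D2_def by (intro dintros aV leq_V conds_V)
    moreover have "\<exists>r\<in>P. r \<preceq> p \<and> (feq S r a b \<or> D1 r \<or> D2 r)" if p: "p \<in> P" for p
    proof (cases "feq S p a b")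
      case True
      then show ?thesis using p le_refl by blast
    next
      case False
      then show ?thesis
        using p unfolding feq.simps[of S p a b] D1_def D2_def by blast
    qed
    ultimately obtain q where q: "q \<in> G" "feq S q a b \<or> D1 q \<or> D2 q"
      using G_dense[of "\<lambda>q. feq S q a b \<or> D1 q \<or> D2 q"] by blast
    have "\<not> D1 q"
    proof
      assume "D1 q"
      then obtain w where w: "w \<in> elts a" "q \<preceq> hfst w"
        "\<And>r v. r \<in> P \<Longrightarrow> r \<preceq> q \<Longrightarrow> v \<in> elts b \<Longrightarrow> r \<preceq> hfst v \<Longrightarrow> \<not> feq S r (hsnd w) (hsnd v)"
        unfolding D1_def by blast
      then have "val G (hsnd w) \<in> elts (val G b)" using mem[OF 1(2)] G_up[OF q(1)] eq by metis
      then obtain v where v: "v \<in> elts b" "hfst v \<in> G" "val G (hsnd w) = val G (hsnd v)"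
        using mem[OF 1(3)] by blast
      then obtain r0 where r0: "r0 \<in> G" "feq S r0 (hsnd w) (hsnd v)" using IH[OF w(1) v(1)] by blast
      obtain r1 where r1: "r1 \<in> G" "r1 \<preceq> q" "r1 \<preceq> hfst v" using G_compat[OF q(1) v(2)] by blast
      obtain r where r: "r \<in> G" "r \<preceq> r1" "r \<preceq> r0" using G_compat[OF r1(1) r0(1)] by blast
      show False using w(3)[of r v] feq_mono[OF r0(2) r(3)] v(1) r r1 le_trans G_P by blast
    qed
    moreover have "\<not> D2 q"
    proof
      assume "D2 q"
      then obtain v where v: "v \<in> elts b" "q \<preceq> hfst v"
        "\<And>r w. r \<in> P \<Longrightarrow> r \<preceq> q \<Longrightarrow> w \<in> elts a \<Longrightarrow> r \<preceq> hfst w \<Longrightarrow> \<not> feq S r (hsnd w) (hsnd v)"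
        unfolding D2_def by blast
      then have "val G (hsnd v) \<in> elts (val G a)" using mem[OF 1(3)] G_up[OF q(1)] eq by metis
      then obtain w where w: "w \<in> elts a" "hfst w \<in> G" "val G (hsnd v) = val G (hsnd w)"
        using mem[OF 1(2)] by blast
      then obtain r0 where r0: "r0 \<in> G" "feq S r0 (hsnd w) (hsnd v)" using IH[OF w(1) v(1)] by metis
      obtain r1 where r1: "r1 \<in> G" "r1 \<preceq> q" "r1 \<preceq> hfst w" using G_compat[OF q(1) w(2)] by blast
      obtain r where r: "r \<in> G" "r \<preceq> r1" "r \<preceq> r0" using G_compat[OF r1(1) r0(1)] by blast
      show False using v(3)[of r w] feq_mono[OF r0(2) r(3)] w(1) r r1 le_trans G_P by blast
    qed
    ultimately show "\<exists>p\<in>G. feq S p a b" using q by blast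
  qed
qed

lemma val_mem_iff:
  assumes "is_name S c" "is_name S x" "c \<in> V" "x \<in> V"
  shows "val G c \<in> elts (val G x) \<longleftrightarrow> (\<exists>p\<in>G. fmem S p c x)"
proof
  assume "val G c \<in> elts (val G x)"
  then obtain q y where y: "q \<in> G" "\<langle>q, y\<rangle> \<in> elts x" "val G c = val G y" unfolding mem_val by blast
  then have "is_name S y" "y \<in> V" using is_name_hsnd[OF assms(2) y(2)] V_opair_memD[OF y(2) assms(4)] by auto
  then obtain p where p: "p \<in> G" "feq S p c y" using val_eq_iff[of c y] assms y(3) by blast
  obtain r where r: "r \<in> G" "r \<preceq> p" "r \<preceq> q" using G_compat[OF p(1) y(1)] by blast
  then have "fmem S r c x" unfolding fmem_def using feq_mono[OF p(2)] y(2) by (metis hfst_opair hsnd_opair)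
  then show "\<exists>p\<in>G. fmem S p c x" using r(1) by blast
next
  assume "\<exists>p\<in>G. fmem S p c x"
  then obtain p w where w: "p \<in> G" "w \<in> elts x" "p \<preceq> hfst w" "feq S p c (hsnd w)" unfolding fmem_def by blast
  then have "val G c = val G (hsnd w)"
    using val_eq_iff[of c "hsnd w"] assms is_name_hsnd[OF assms(2) w(2)] V_trans[OF assms(4) w(2)] by auto
  moreover have "hfst w \<in> G" using G_up w(1,3) by blast
  moreover have "\<langle>hfst w, hsnd w\<rangle> \<in> elts x" using is_name_pair[OF assms(2) w(2)] w(2) by simp
  ultimately show "val G c \<in> elts (val G x)" unfolding mem_val by blast
qed

lemma val_check [simp]: "val G (check S x) = x"
proof (induction x rule: hset_induct)
  case (1 x)
  have "\<langle>p, y\<rangle> \<in> elts (check S x) \<longleftrightarrow> p = top_cond S \<and> (\<exists>z\<in>elts x. y = check S z)" for p y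
    unfolding check.simps[of S x] by auto
  then have "elts (val G (check S x)) = elts x"
    unfolding set_eq_iff mem_val using 1 by auto
  then show ?case using elts_inject by blast
qed

end

section \<open>Functions as sets\<close>

lemma func_app: "is_func f A B \<Longrightarrow> a \<in> A \<Longrightarrow> \<langle>a, app f a\<rangle> \<in> elts f"
  unfolding is_func_def app_def by (metis (mono_tags, lifting) theI')

lemma func_app_eq: "is_func f A B \<Longrightarrow> \<langle>a, b\<rangle> \<in> elts f \<Longrightarrow> app f a = b"
proof -
  assume f: "is_func f A B" and ab: "\<langle>a, b\<rangle> \<in> elts f"
  then have "a \<in> A" unfolding is_func_def by force
  then have "\<exists>!b. \<langle>a, b\<rangle> \<in> elts f" using f unfolding is_func_def by blast
  then show ?thesis using func_app[OF f \<open>a \<in> A\<close>] ab by blast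
qed

lemma func_mem: "is_func f A B \<Longrightarrow> a \<in> A \<Longrightarrow> app f a \<in> B"
  using func_app[of f A B a] unfolding is_func_def by force

lemma elts_func: "is_func f A B \<Longrightarrow> elts f = (\<lambda>a. \<langle>a, app f a\<rangle>) ` A"
proof -
  assume f: "is_func f A B"
  have "z \<in> (\<lambda>a. \<langle>a, app f a\<rangle>) ` A" if "z \<in> elts f" for z
  proof -
    obtain a b where "z = \<langle>a, b\<rangle>" "a \<in> A" using f \<open>z \<in> elts f\<close> unfolding is_func_def by blast
    then show ?thesis using func_app_eq[OF f] \<open>z \<in> elts f\<close> by blast
  qed
  then show ?thesis using func_app[OF f] by blast
qed

lemma is_funcI: "elts f = (\<lambda>a. \<langle>a, F a\<rangle>) ` A \<Longrightarrow> (\<And>a. a \<in> A \<Longrightarrow> F a \<in> B) \<Longrightarrow> is_func f A B"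
  unfolding is_func_def by auto

lemma app_eq: "elts f = (\<lambda>a. \<langle>a, F a\<rangle>) ` A \<Longrightarrow> a \<in> A \<Longrightarrow> app f a = F a"
  by (rule func_app_eq[OF is_funcI[of f F A UNIV]]) auto

lemma func_eqI: "is_func f A B \<Longrightarrow> is_func g A C \<Longrightarrow> (\<And>a. a \<in> A \<Longrightarrow> app f a = app g a) \<Longrightarrow> f = g"
  using elts_func[of f A B] elts_func[of g A C] elts_inject[of f g] by simp

lemma fdom_func: "is_func f A B \<Longrightarrow> fdom f = A"
  unfolding fdom_def by (drule elts_func) auto

lemma small_fdom: "small (fdom f)"
proof (rule small_subset)
  show "small (hfst ` elts f)" by simp
  show "fdom f \<subseteq> hfst ` elts f" unfolding fdom_def by force
qed

lemma small_func_dom: "is_func f A B \<Longrightarrow> small A"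
  using small_fdom[of f] fdom_func by metis

lemma is_bij_iff: "is_bij f A B \<longleftrightarrow> is_func f A B \<and> bij_betw (app f) A B"
proof (cases "is_func f A B")
  case True
  have eq: "\<langle>a, b\<rangle> \<in> elts f \<longleftrightarrow> a \<in> A \<and> app f a = b" for a b
    using elts_func[OF True] by auto
  show ?thesis
  proof
    assume "is_bij f A B"
    then have "\<forall>b\<in>B. \<exists>!a. a \<in> A \<and> app f a = b" unfolding is_bij_def eq by blast
    then have "bij_betw (app f) A B"
      using func_mem[OF True] by (intro bij_betwI') metis+
    then show "is_func f A B \<and> bij_betw (app f) A B" using True by blast
  next
    assume "is_func f A B \<and> bij_betw (app f) A B"
    then have "\<exists>!a. a \<in> A \<and> app f a = b" if "b \<in> B" for b
      using that unfolding bij_betw_def inj_on_def by (metis imageE)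
    then show "is_bij f A B" unfolding is_bij_def eq using True by blast
  qed
qed (simp add: is_bij_def)

lemma elts_compose: "is_func f A B \<Longrightarrow> elts (compose g f) = (\<lambda>a. \<langle>a, app g (app f a)\<rangle>) ` A"
  unfolding compose_def by (simp add: fdom_func small_func_dom)

lemma compose_func: "is_func f A B \<Longrightarrow> is_func g B C \<Longrightarrow> is_func (compose g f) A C"
  by (rule is_funcI[OF elts_compose]) (auto intro: func_mem)

lemma app_compose: "is_func f A B \<Longrightarrow> a \<in> A \<Longrightarrow> app (compose g f) a = app g (app f a)"
  by (rule app_eq[OF elts_compose])

lemma compose_bij: "is_bij f A B \<Longrightarrow> is_bij g B C \<Longrightarrow> is_bij (compose g f) A C"
  unfolding is_bij_iff
  using compose_func[of f A B g C] bij_betw_trans[of "app f" A B "app g" C]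
    bij_betw_cong[of A "app (compose g f)" "app g \<circ> app f" C] app_compose[of f A B] by auto

lemma elts_conv: "is_func f A B \<Longrightarrow> elts (conv f) = (\<lambda>a. \<langle>app f a, a\<rangle>) ` A"
proof -
  assume f: "is_func f A B"
  have "{\<langle>b, a\<rangle> |a b. \<langle>a, b\<rangle> \<in> elts f} = (\<lambda>z. \<langle>hsnd z, hfst z\<rangle>) ` elts f"
    unfolding elts_func[OF f] by force
  then show ?thesis
    unfolding conv_def using small_func_dom[OF f] by (simp add: elts_func[OF f] image_image)
qed

lemma conv_bij: "is_bij f A B \<Longrightarrow> is_bij (conv f) B A"
  and app_conv: "is_bij f A B \<Longrightarrow> b \<in> B \<Longrightarrow> app (conv f) b = the_inv_into A (app f) b"
proof -
  assume f: "is_bij f A B"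
  then have ff: "is_func f A B" and bij: "bij_betw (app f) A B" unfolding is_bij_iff by blast+
  let ?g = "the_inv_into A (app f)"
  have "elts (conv f) = (\<lambda>b. \<langle>b, ?g b\<rangle>) ` B"
    unfolding elts_conv[OF ff] bij_betw_imp_surj_on[OF bij, symmetric]
    using the_inv_into_f_f[OF bij_betw_imp_inj_on[OF bij]] by (auto simp: image_image)
  moreover have g: "bij_betw ?g B A" by (rule bij_betw_the_inv_into[OF bij])
  ultimately have 1: "is_func (conv f) B A" and 2: "\<And>b. b \<in> B \<Longrightarrow> app (conv f) b = ?g b"
    using is_funcI[of "conv f" ?g B A] app_eq[of "conv f" ?g B] bij_betwE[OF g] by blast+
  show "is_bij (conv f) B A" unfolding is_bij_iff using 1 2 g bij_betw_cong[of B "app (conv f)" ?g] by auto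
  show "b \<in> B \<Longrightarrow> app (conv f) b = ?g b" by (rule 2)
qed

lemma app_conv_app [simp]: "is_bij f A B \<Longrightarrow> a \<in> A \<Longrightarrow> app (conv f) (app f a) = a"
  by (subst app_conv[of f A B]) (auto simp: is_bij_iff the_inv_into_f_f bij_betw_def func_mem)

lemma app_app_conv [simp]: "is_bij f A B \<Longrightarrow> b \<in> B \<Longrightarrow> app f (app (conv f) b) = b"
  by (subst app_conv[of f A B]) (auto simp: is_bij_iff f_the_inv_into_f bij_betw_def)

lemma bij_func: "is_bij f A B \<Longrightarrow> is_func f A B"
  unfolding is_bij_def by blast

lemma bij_mem: "is_bij f A B \<Longrightarrow> a \<in> A \<Longrightarrow> app f a \<in> B"
  using func_mem bij_func by metis

lemma elts_ident: "elts (ident A) = (\<lambda>a. \<langle>a, a\<rangle>) ` elts A"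
  unfolding ident_def by simp

lemma app_ident [simp]: "a \<in> elts A \<Longrightarrow> app (ident A) a = a"
  by (rule app_eq[OF elts_ident])

lemma ident_bij: "is_bij (ident A) (elts A) (elts A)"
  unfolding is_bij_iff
  using is_funcI[OF elts_ident, of A "elts A"] bij_betw_cong[of "elts A" "app (ident A)" id "elts A"] by auto

lemma graph_bij:
  assumes "bij_betw F (elts A) B"
  shows "is_bij (hset ((\<lambda>a. \<langle>a, F a\<rangle>) ` elts A)) (elts A) B"
proof -
  have 1: "elts (hset ((\<lambda>a. \<langle>a, F a\<rangle>) ` elts A)) = (\<lambda>a. \<langle>a, F a\<rangle>) ` elts A" by simp
  show ?thesis
    unfolding is_bij_iff
    using assms is_funcI[OF 1] bij_betw_cong[of "elts A" _ F B, OF app_eq[OF 1]] by (auto dest: bij_betwE)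
qed

text \<open>Built from \<open>ap\<close> and the projections alone, these variants of
  \<open>compose\<close> and \<open>conv\<close> are definable on all of V.\<close>

definition comp' :: "'i hset \<Rightarrow> 'i hset \<Rightarrow> 'i hset" where
  "comp' g f = hset ((\<lambda>z. \<langle>hfst z, ap g (hsnd z)\<rangle>) ` elts f)"

definition conv' :: "'i hset \<Rightarrow> 'i hset" where
  "conv' f = hset ((\<lambda>z. \<langle>hsnd z, hfst z\<rangle>) ` elts f)"

lemma comp'_eq: "is_func f A B \<Longrightarrow> is_func g B C \<Longrightarrow> comp' g f = compose g f"
proof -
  assume f: "is_func f A B" and g: "is_func g B C"
  have "elts (comp' g f) = elts (compose g f)"
    unfolding comp'_def elts_compose[OF f] using ap_eq_app[OF g] func_mem[OF f]
    using small_func_dom[OF f] by (simp add: elts_func[OF f] image_image)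
  then show ?thesis using elts_inject by blast
qed

lemma conv'_eq: "is_func f A B \<Longrightarrow> conv' f = conv f"
proof -
  assume f: "is_func f A B"
  have "elts (conv' f) = (\<lambda>z. \<langle>hsnd z, hfst z\<rangle>) ` elts f" unfolding conv'_def by simp
  then have "elts (conv' f) = elts (conv f)"
    unfolding elts_conv[OF f] elts_func[OF f] by (simp add: image_image)
  then show ?thesis using elts_inject by blast
qed

text \<open>The unique existence in \<open>is_func\<close> ranges over all sets of the universe.
  Bounding its quantifiers by B makes the notion a formula that can be evaluated in V.\<close>

lemma is_func_alt: "is_func f A B \<longleftrightarrow> (\<forall>z\<in>elts f. \<exists>a\<in>A. \<exists>b\<in>B. z = \<langle>a, b\<rangle>) \<and>
    (\<forall>a\<in>A. \<exists>b\<in>B. \<langle>a, b\<rangle> \<in> elts f \<and> (\<forall>c\<in>B. \<langle>a, c\<rangle> \<in> elts f \<longrightarrow> c = b))"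
  unfolding is_func_def by (intro conj_cong refl) (smt (verit) opair_inject)

lemma is_bij_alt: "is_bij f A B \<longleftrightarrow> is_func f A B \<and>
    (\<forall>b\<in>B. \<exists>a\<in>A. \<langle>a, b\<rangle> \<in> elts f \<and> (\<forall>c\<in>A. \<langle>c, b\<rangle> \<in> elts f \<longrightarrow> c = a))"
  unfolding is_bij_def is_func_def by (intro conj_cong refl) (smt (verit) opair_inject)

lemma perm_group_alt: "perm_group A K \<longleftrightarrow> (\<forall>\<pi>\<in>elts K. is_bij \<pi> (elts A) (elts A)) \<and> ident A \<in> elts K \<and>
    (\<forall>\<pi>\<in>elts K. \<forall>\<sigma>\<in>elts K. comp' \<pi> \<sigma> \<in> elts K) \<and> (\<forall>\<pi>\<in>elts K. conv' \<pi> \<in> elts K)"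
proof (cases "\<forall>\<pi>\<in>elts K. is_bij \<pi> (elts A) (elts A)")
  case True
  then have "comp' \<pi> \<sigma> = compose \<pi> \<sigma>" "conv' \<pi> = conv \<pi>" if "\<pi> \<in> elts K" "\<sigma> \<in> elts K" for \<pi> \<sigma>
    using that comp'_eq conv'_eq bij_func by metis+
  then show ?thesis unfolding perm_group_def by auto
qed (auto simp: perm_group_def)

context zfc_model
begin

lemma dfun_comp' [dintros]: "dfun s \<Longrightarrow> dfun t \<Longrightarrow> dfun (\<lambda>e. comp' (s e) (t e))"
  unfolding comp'_def by (intro dintros dfun_weaken)

lemma dfun_conv' [dintros]: "dfun s \<Longrightarrow> dfun (\<lambda>e. conv' (s e))"
  unfolding conv'_def by (intro dintros dfun_weaken)

lemma dfun_ident [dintros]: "dfun s \<Longrightarrow> dfun (\<lambda>e. ident (s e))"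
  unfolding ident_def by (intro dintros dfun_weaken)

lemma dpred_is_func [dintros]: "dfun s \<Longrightarrow> dfun t \<Longrightarrow> dfun u \<Longrightarrow> dpred (\<lambda>e. is_func (s e) (elts (t e)) (elts (u e)))"
  unfolding is_func_alt by (intro dintros dfun_weaken)

lemma dpred_is_bij [dintros]: "dfun s \<Longrightarrow> dfun t \<Longrightarrow> dfun u \<Longrightarrow> dpred (\<lambda>e. is_bij (s e) (elts (t e)) (elts (u e)))"
  unfolding is_bij_alt by (intro dintros dfun_weaken)

lemma dpred_perm_group [dintros]: "dfun s \<Longrightarrow> dfun t \<Longrightarrow> dpred (\<lambda>e. perm_group (s e) (t e))"
  unfolding perm_group_alt by (intro dintros dfun_weaken)

lemma V_compose: "is_func f A B \<Longrightarrow> is_func g B C \<Longrightarrow> f \<in> V \<Longrightarrow> g \<in> V \<Longrightarrow> compose g f \<in> V"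
  using dfun_V0[OF dfun_comp'[OF dfun_const dfun_const]] comp'_eq by metis

lemma V_conv: "is_func f A B \<Longrightarrow> f \<in> V \<Longrightarrow> conv f \<in> V"
  using dfun_V0[OF dfun_conv'[OF dfun_const]] conv'_eq by metis

lemma V_ident: "A \<in> V \<Longrightarrow> ident A \<in> V"
  by (intro dfun_V0[OF dfun_ident] dintros)

end

section \<open>Symmetric systems\<close>

lemma act_name:
  assumes "is_name S x"
  shows "elts (act \<pi> x) = (\<lambda>w. \<langle>app \<pi> (hfst w), act \<pi> (hsnd w)\<rangle>) ` elts x"
proof -
  have "\<langle>p, y\<rangle> \<in> elts x \<longleftrightarrow> (\<exists>w\<in>elts x. hfst w = p \<and> hsnd w = y)" for p y
    using is_name_pair[OF assms] by (metis hfst_opair hsnd_opair)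
  then show ?thesis unfolding set_eq_iff mem_act by auto
qed

lemma is_name_act:
  assumes "is_func \<pi> (elts (conds S)) (elts (conds S))"
  shows "is_name S x \<Longrightarrow> is_name S (act \<pi> x)"
proof (induction x rule: is_name.induct)
  case (1 x)
  show ?case
  proof (rule is_name.intros, rule ballI)
    fix z assume "z \<in> elts (act \<pi> x)"
    then obtain p y where py: "\<langle>p, y\<rangle> \<in> elts x" "z = \<langle>app \<pi> p, act \<pi> y\<rangle>" unfolding mem_act by blast
    with 1 have "p \<in> elts (conds S)" "is_name S (act \<pi> y)" by fastforce+
    then show "\<exists>p\<in>elts (conds S). \<exists>y. z = \<langle>p, y\<rangle> \<and> is_name S y"
      using py(2) func_mem[OF assms] by blast
  qed
qed

lemma act_compose:
  assumes "is_func \<sigma> (elts (conds S)) (elts (conds S))"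
  shows "is_name S x \<Longrightarrow> act (compose \<pi> \<sigma>) x = act \<pi> (act \<sigma> x)"
proof (induction x rule: trancl_mem_induct)
  case (1 x)
  have "elts (act (compose \<pi> \<sigma>) x) = (\<lambda>w. \<langle>app \<pi> (app \<sigma> (hfst w)), act \<pi> (act \<sigma> (hsnd w))\<rangle>) ` elts x"
    unfolding act_name[OF 1(2)]
    using 1(1)[OF hsnd_trancl is_name_hsnd[OF 1(2)]] is_name_hfst[OF 1(2)]
    by (intro image_cong refl) (simp add: app_compose[OF assms])
  also have "\<dots> = elts (act \<pi> (act \<sigma> x))"
    unfolding act_name[OF is_name_act[OF assms 1(2)]] act_name[OF 1(2)] by (simp add: image_image)
  finally show ?case using elts_inject by blast
qed

lemma act_ident: "is_name S x \<Longrightarrow> act (ident (conds S)) x = x"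
proof (induction x rule: trancl_mem_induct)
  case (1 x)
  have "elts (act (ident (conds S)) x) = (\<lambda>w. w) ` elts x"
    unfolding act_name[OF 1(2)]
    using 1(1)[OF hsnd_trancl is_name_hsnd[OF 1(2)]] is_name_hfst[OF 1(2)] is_name_pair[OF 1(2)]
    by (intro image_cong refl) simp
  then show ?case unfolding image_ident elts_inject .
qed

lemma act_conv:
  assumes "is_bij \<pi> (elts (conds S)) (elts (conds S))" "is_name S x"
  shows "act \<pi> (act (conv \<pi>) x) = x" "act (conv \<pi>) (act \<pi> x) = x"
proof -
  have f: "is_func \<pi> (elts (conds S)) (elts (conds S))" "is_func (conv \<pi>) (elts (conds S)) (elts (conds S))"
    using assms(1) conv_bij bij_func by blast+
  have "compose \<pi> (conv \<pi>) = ident (conds S)" "compose (conv \<pi>) \<pi> = ident (conds S)"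
    by (rule func_eqI[OF compose_func bij_func[OF ident_bij]], (rule f)+,
        simp add: app_compose[OF f(1)] app_compose[OF f(2)] app_conv_app[OF assms(1)] app_app_conv[OF assms(1)])+
  then show "act \<pi> (act (conv \<pi>) x) = x" "act (conv \<pi>) (act \<pi> x) = x"
    using act_compose[OF f(2) assms(2), of \<pi>] act_compose[OF f(1) assms(2), of "conv \<pi>"] act_ident[OF assms(2)]
    by simp_all
qed

text \<open>Entries at the maximum enter the value under every generic filter, and automorphisms fix
  the maximum; so evaluation and group action pass through \<open>up\<close> to the names listed in
  B. \<open>opn\<close> is Kuratowski's pair built in this way.\<close>

definition up :: "'i symsys \<Rightarrow> 'i hset \<Rightarrow> 'i hset" where
  "up S B = hset ((\<lambda>y. \<langle>top_cond S, y\<rangle>) ` elts B)"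

definition opn :: "'i symsys \<Rightarrow> 'i hset \<Rightarrow> 'i hset \<Rightarrow> 'i hset" where
  "opn S a b = up S (hset {up S (hset {a}), up S (hset {a, b})})"

lemma elts_up: "elts (up S B) = (\<lambda>y. \<langle>top_cond S, y\<rangle>) ` elts B"
  unfolding up_def by simp

lemma pair_up [simp]: "\<langle>p, y\<rangle> \<in> elts (up S B) \<longleftrightarrow> p = top_cond S \<and> y \<in> elts B"
  unfolding elts_up by auto

lemma check_up: "check S x = up S (hset (check S ` elts x))"
  unfolding check.simps[of S x] up_def by (simp add: image_image)

lemma is_name_up: "top_cond S \<in> elts (conds S) \<Longrightarrow> (\<And>y. y \<in> elts B \<Longrightarrow> is_name S y) \<Longrightarrow> is_name S (up S B)"
  by (rule is_name.intros) (auto simp: elts_up)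

lemma is_name_opn: "top_cond S \<in> elts (conds S) \<Longrightarrow> is_name S a \<Longrightarrow> is_name S b \<Longrightarrow> is_name S (opn S a b)"
  unfolding opn_def by (auto intro!: is_name_up simp: small_countable)

lemma elts_inj: "elts x = elts y \<Longrightarrow> x = y"
  using elts_inject by blast

lemma act_up: "app \<pi> (top_cond S) = top_cond S \<Longrightarrow> act \<pi> (up S B) = up S (hset (act \<pi> ` elts B))"
  by (rule elts_inj) (auto simp: set_eq_iff mem_act elts_up[of _ "hset _"])

lemma act_opn: "app \<pi> (top_cond S) = top_cond S \<Longrightarrow> act \<pi> (opn S a b) = opn S (act \<pi> a) (act \<pi> b)"
  unfolding opn_def by (simp add: act_up small_countable)

lemma act_check: "app \<pi> (top_cond S) = top_cond S \<Longrightarrow> act \<pi> (check S x) = check S x"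
proof (induction x rule: hset_induct)
  case (1 x)
  then have "act \<pi> ` check S ` elts x = check S ` elts x" by (simp add: image_image)
  then show ?case unfolding check_up[of S x] by (simp add: act_up[OF 1(2)])
qed

lemma val_up: "top_cond S \<in> G \<Longrightarrow> elts (val G (up S B)) = val G ` elts B"
  by (auto simp: set_eq_iff mem_val)

lemma val_opn: "top_cond S \<in> G \<Longrightarrow> val G (opn S a b) = \<langle>val G a, val G b\<rangle>"
proof -
  assume t: "top_cond S \<in> G"
  have 1: "val G (up S B) = hset (val G ` elts B)" for B
    by (rule elts_inj) (simp add: val_up[OF t])
  show ?thesis unfolding opn_def 1 opair_def by (simp add: small_countable 1)
qed

context forcing
begin

lemma dfun_up [dintros]: "dfun s \<Longrightarrow> dfun (\<lambda>e. up S (s e))"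
  unfolding up_def by (intro dfun_image dfun_opair dfun_const dfun_var top_V)

lemma dfun_opn [dintros]: "dfun s \<Longrightarrow> dfun t \<Longrightarrow> dfun (\<lambda>e. opn S (s e) (t e))"
  unfolding opn_def by (intro dintros)

lemma V_check [simp]: "x \<in> V \<Longrightarrow> check S x \<in> V"
  by (intro dfun_V0[OF dfun_check] dintros)

lemma V_opn [simp]: "a \<in> V \<Longrightarrow> b \<in> V \<Longrightarrow> opn S a b \<in> V"
  by (intro dfun_V0[OF dfun_opn] dintros)

lemma V_up [simp]: "B \<in> V \<Longrightarrow> up S B \<in> V"
  by (intro dfun_V0[OF dfun_up] dintros)

text \<open>The symmetry lemma. A condition below the translate of p is itself a translate, since
  the automorphism is onto, so the matching of entries can be pulled back, applied, and pushed
  forward.\<close>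

lemma feq_act:
  assumes \<pi>: "forcing_aut S \<pi>"
  shows "feq S p a b \<Longrightarrow> is_name S a \<Longrightarrow> is_name S b \<Longrightarrow> feq S (app \<pi> p) (act \<pi> a) (act \<pi> b)"
proof (induction a arbitrary: p b rule: trancl_mem_induct)
  case (1 a)
  have bij: "is_bij \<pi> P P" using \<pi> unfolding forcing_aut_def by blast
  have le_iff: "app \<pi> p \<preceq> app \<pi> q \<longleftrightarrow> p \<preceq> q" if "p \<in> P" "q \<in> P" for p q
    using \<pi> that unfolding forcing_aut_def by blast
  have surj: "\<exists>q'\<in>P. q = app \<pi> q'" if "q \<in> P" for q
    using app_app_conv[OF bij that] bij_mem[OF conv_bij[OF bij] that] by metis
  have pP: "p \<in> P" using 1(2) feq_P by blast
  note h = 1(2)[unfolded feq.simps[of S p a b]]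
  have IH: "feq S (app \<pi> r) (act \<pi> (hsnd w)) (act \<pi> (hsnd v))"
    if "w \<in> elts a" "v \<in> elts b" "feq S r (hsnd w) (hsnd v)" for w v r
    using 1(1)[OF hsnd_trancl[OF that(1)] that(3)] is_name_hsnd[OF 1(3) that(1)] is_name_hsnd[OF 1(4) that(2)] by blast
  note na = is_name_hfst[OF 1(3)] and nb = is_name_hfst[OF 1(4)]
  show ?case
    unfolding feq.simps[of S "app \<pi> p"] act_name[OF 1(3)] act_name[OF 1(4)]
  proof (intro conjI ballI impI)
    show "app \<pi> p \<in> P" using bij_mem[OF bij pP] .
  next
    fix w' q' assume w': "w' \<in> (\<lambda>w. \<langle>app \<pi> (hfst w), act \<pi> (hsnd w)\<rangle>) ` elts a"
      and q': "q' \<in> P" "q' \<preceq> app \<pi> p" "q' \<preceq> hfst w'"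
    obtain w where w: "w \<in> elts a" "w' = \<langle>app \<pi> (hfst w), act \<pi> (hsnd w)\<rangle>" using w' by blast
    obtain q where q: "q \<in> P" "q' = app \<pi> q" using surj[OF q'(1)] by blast
    have "q \<preceq> p" "q \<preceq> hfst w" using q'(2,3) le_iff[OF q(1)] pP na[OF w(1)] unfolding q(2) w(2) by simp_all
    then obtain v r where v: "v \<in> elts b" "r \<in> P" "r \<preceq> q" "r \<preceq> hfst v" "feq S r (hsnd w) (hsnd v)"
      using h w(1) q(1) by blast
    have "app \<pi> r \<preceq> q'" "app \<pi> r \<preceq> app \<pi> (hfst v)" "app \<pi> r \<in> P"
      using le_iff[OF v(2)] q v nb[OF v(1)] bij_mem[OF bij] by simp_all
    then show "\<exists>v\<in>(\<lambda>w. \<langle>app \<pi> (hfst w), act \<pi> (hsnd w)\<rangle>) ` elts b. \<exists>r\<in>P. r \<preceq> q' \<and> r \<preceq> hfst v \<and>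
        feq S r (hsnd w') (hsnd v)"
      using IH[OF w(1) v(1,5)] v(1) w(2) by (intro bexI[OF _ imageI[OF v(1)]] bexI[of _ "app \<pi> r"]) simp_all
  next
    fix v' q' assume v': "v' \<in> (\<lambda>w. \<langle>app \<pi> (hfst w), act \<pi> (hsnd w)\<rangle>) ` elts b"
      and q': "q' \<in> P" "q' \<preceq> app \<pi> p" "q' \<preceq> hfst v'"
    obtain v where v: "v \<in> elts b" "v' = \<langle>app \<pi> (hfst v), act \<pi> (hsnd v)\<rangle>" using v' by blast
    obtain q where q: "q \<in> P" "q' = app \<pi> q" using surj[OF q'(1)] by blast
    have "q \<preceq> p" "q \<preceq> hfst v" using q'(2,3) le_iff[OF q(1)] pP nb[OF v(1)] unfolding q(2) v(2) by simp_all
    then obtain w r where w: "w \<in> elts a" "r \<in> P" "r \<preceq> q" "r \<preceq> hfst w" "feq S r (hsnd w) (hsnd v)"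
      using h v(1) q(1) by blast
    have "app \<pi> r \<preceq> q'" "app \<pi> r \<preceq> app \<pi> (hfst w)" "app \<pi> r \<in> P"
      using le_iff[OF w(2)] q w na[OF w(1)] bij_mem[OF bij] by simp_all
    then show "\<exists>w\<in>(\<lambda>w. \<langle>app \<pi> (hfst w), act \<pi> (hsnd w)\<rangle>) ` elts a. \<exists>r\<in>P. r \<preceq> q' \<and> r \<preceq> hfst w \<and>
        feq S r (hsnd w) (hsnd v')"
      using IH[OF w(1) v(1) w(5)] v(2) by (intro bexI[OF _ imageI[OF w(1)]] bexI[of _ "app \<pi> r"]) simp_all
  qed
qed

lemma fmem_act:
  assumes \<pi>: "forcing_aut S \<pi>" and f: "fmem S p c x" and n: "is_name S c" "is_name S x"
  shows "fmem S (app \<pi> p) (act \<pi> c) (act \<pi> x)"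
proof -
  obtain w where w: "w \<in> elts x" "p \<preceq> hfst w" "feq S p c (hsnd w)" using f unfolding fmem_def by blast
  have "app \<pi> p \<preceq> app \<pi> (hfst w)" using \<pi> w(2) leD unfolding forcing_aut_def by blast
  moreover have "feq S (app \<pi> p) (act \<pi> c) (act \<pi> (hsnd w))"
    using feq_act[OF \<pi> w(3) n(1) is_name_hsnd[OF n(2) w(1)]] .
  ultimately show ?thesis unfolding fmem_def act_name[OF n(2)] using w(1) by force
qed

end

locale symmetric = forcing V S for V :: "'i hset set" and S +
  assumes sys: "symmetric_system V S"
begin

lemma grp_V [simp]: "grp S \<in> V" and filt_V [simp]: "filt S \<in> V"
  using sys unfolding symmetric_system_def by blast+

lemma grp_aut: "\<pi> \<in> elts (grp S) \<Longrightarrow> forcing_aut S \<pi>"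
  using sys unfolding symmetric_system_def by blast

lemma grp_bij: "\<pi> \<in> elts (grp S) \<Longrightarrow> is_bij \<pi> P P"
  using grp_aut unfolding forcing_aut_def by blast

lemma grp_top: "\<pi> \<in> elts (grp S) \<Longrightarrow> app \<pi> (top_cond S) = top_cond S"
  using grp_aut unfolding forcing_aut_def by blast

lemma grp_group: "perm_group (conds S) (grp S)"
  using sys unfolding symmetric_system_def by blast

lemmas nf = conjunct2[OF conjunct2[OF conjunct2[OF conjunct2[OF sys[unfolded symmetric_system_def]]]],
    unfolded normal_filter_def]

lemma filt_sub: "K \<in> elts (filt S) \<Longrightarrow> perm_group (conds S) K \<and> elts K \<subseteq> elts (grp S)"
  using conjunct1[OF conjunct2[OF nf]] unfolding perm_subgroup_def by blast

lemma filt_super: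
  "K \<in> elts (filt S) \<Longrightarrow> K' \<in> V \<Longrightarrow> perm_group (conds S) K' \<Longrightarrow> elts K' \<subseteq> elts (grp S) \<Longrightarrow>
   elts K \<subseteq> elts K' \<Longrightarrow> K' \<in> elts (filt S)"
  using conjunct1[OF conjunct2[OF conjunct2[OF nf]]] unfolding perm_subgroup_def by blast

lemma filt_ne: "\<exists>K. K \<in> elts (filt S)"
  using conjunct1[OF nf] by blast

text \<open>The filter contains the stabilizer because that is a group belonging to \<open>V\<close>.\<close>

lemma symmetric_nameI:
  assumes x: "is_name S x" "x \<in> V" and K: "K \<in> elts (filt S)" "\<And>\<pi>. \<pi> \<in> elts K \<Longrightarrow> act \<pi> x = x"
  shows "symmetric_name S x"
proof -
  let ?E = "hset {\<pi> \<in> elts (grp S). act \<pi> x = x}"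
  have "?E = hset {\<pi> \<in> elts (grp S). act' \<pi> x = x}"
    using act'_eq[OF bij_func[OF grp_bij] x(1)] by (intro arg_cong[of _ _ hset] Collect_cong) auto
  moreover have "hset {\<pi> \<in> elts (grp S). act' \<pi> x = x} \<in> V"
    by (intro dfun_V0[OF dfun_sep] dintros grp_V x(2))
  ultimately have "?E \<in> V" by simp
  moreover have "perm_group (conds S) ?E"
    unfolding perm_group_def mem_sep ball_simps
  proof (intro conjI allI impI ballI; (elim conjE)?)
    show "\<pi> \<in> elts ?E \<Longrightarrow> is_bij \<pi> P P" for \<pi> unfolding mem_sep using grp_bij by blast
    show "ident (conds S) \<in> elts (grp S)" using grp_group unfolding perm_group_def by blast
    show "act (ident (conds S)) x = x" using act_ident[OF x(1)] .
    fix \<pi> assume "\<pi> \<in> elts ?E"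
    then have \<pi>: "\<pi> \<in> elts (grp S)" "act \<pi> x = x" unfolding mem_sep by blast+
    show "conv \<pi> \<in> elts (grp S)" using \<pi>(1) grp_group unfolding perm_group_def by blast
    show "act (conv \<pi>) x = x" using act_conv(2)[OF grp_bij[OF \<pi>(1)] x(1)] \<pi>(2) by simp
    fix \<sigma> assume "\<sigma> \<in> elts ?E"
    then have \<sigma>: "\<sigma> \<in> elts (grp S)" "act \<sigma> x = x" unfolding mem_sep by blast+
    show "compose \<pi> \<sigma> \<in> elts (grp S)" using \<pi>(1) \<sigma>(1) grp_group unfolding perm_group_def by blast
    show "act (compose \<pi> \<sigma>) x = x" using act_compose[OF bij_func[OF grp_bij[OF \<sigma>(1)]] x(1)] \<pi>(2) \<sigma>(2) by simp
  qed
  ultimately have "?E \<in> elts (filt S)"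
    using K filt_sub[OF K(1)] by (intro filt_super[OF K(1)]) auto
  then show ?thesis unfolding symmetric_name_def using x(1) by blast
qed

lemma hs_name: "hered_symmetric S x \<Longrightarrow> is_name S x"
  by (auto elim: hered_symmetric.cases simp: symmetric_name_def)

lemma hs_sub: "hered_symmetric S x \<Longrightarrow> w \<in> elts x \<Longrightarrow> hered_symmetric S (hsnd w)"
  using is_name_pair[OF hs_name] by (metis hered_symmetric.cases)

lemma hsI:
  assumes "is_name S x" "x \<in> V" "\<And>w. w \<in> elts x \<Longrightarrow> hered_symmetric S (hsnd w)"
    "K \<in> elts (filt S)" "\<And>\<pi>. \<pi> \<in> elts K \<Longrightarrow> act \<pi> x = x"
  shows "hered_symmetric S x"
proof (rule hered_symmetric.intros)
  show "symmetric_name S x" using symmetric_nameI[OF assms(1,2,4,5)] .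
  show "\<forall>p y. \<langle>p, y\<rangle> \<in> elts x \<longrightarrow> hered_symmetric S y" using assms(3) by fastforce
qed

lemma hs_supp: "hered_symmetric S x \<Longrightarrow> \<exists>K\<in>elts (filt S). \<forall>\<pi>\<in>elts K. act \<pi> x = x"
  by (erule hered_symmetric.cases) (auto simp: symmetric_name_def intro!: bexI[of _ "hset {\<pi> \<in> elts (grp S). act \<pi> x = x}"])

text \<open>Closure of B under a group already gives equality: the inverse of \<open>\<pi>\<close>
  belongs to the group and provides preimages.\<close>

lemma act_image_eq:
  assumes K: "perm_group (conds S) K" "\<pi> \<in> elts K" and sub: "\<And>\<sigma> y. \<sigma> \<in> elts K \<Longrightarrow> y \<in> elts B \<Longrightarrow> act \<sigma> y \<in> elts B"
    and n: "\<And>y. y \<in> elts B \<Longrightarrow> is_name S y"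
  shows "act \<pi> ` elts B = elts B"
proof -
  have bij: "is_bij \<pi> P P" and c: "conv \<pi> \<in> elts K" using K unfolding perm_group_def by blast+
  have "y \<in> act \<pi> ` elts B" if "y \<in> elts B" for y
    using act_conv(1)[OF bij n[OF that]] sub[OF c that] by (metis imageI)
  then show ?thesis using sub[OF K(2)] by blast
qed

lemma hs_up:
  assumes "B \<in> V" "\<And>y. y \<in> elts B \<Longrightarrow> hered_symmetric S y" "K \<in> elts (filt S)"
    "\<And>\<pi> y. \<pi> \<in> elts K \<Longrightarrow> y \<in> elts B \<Longrightarrow> act \<pi> y \<in> elts B"
  shows "hered_symmetric S (up S B)"
proof (rule hsI[OF _ _ _ assms(3)])
  show "is_name S (up S B)" using is_name_up[OF top(1)] hs_name assms(2) by blast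
  show "up S B \<in> V" using assms(1) by simp
  show "hered_symmetric S (hsnd w)" if "w \<in> elts (up S B)" for w using that assms(2) by (auto simp: elts_up)
  fix \<pi> assume \<pi>: "\<pi> \<in> elts K"
  have "act \<pi> ` elts B = elts B"
    using filt_sub[OF assms(3)] \<pi> assms(4) hs_name[OF assms(2)] by (intro act_image_eq[of K]) blast+
  then show "act \<pi> (up S B) = up S B"
    using act_up[OF grp_top, of \<pi> B] \<pi> filt_sub[OF assms(3)] by auto
qed

lemma filt_inter:
  assumes "K \<in> elts (filt S)" "K' \<in> elts (filt S)"
  shows "hset (elts K \<inter> elts K') \<in> elts (filt S)"
  using conjunct1[OF conjunct2[OF conjunct2[OF conjunct2[OF nf]]]] assms by blast

lemma hs_opn:
  assumes "a \<in> V" "b \<in> V" "hered_symmetric S a" "hered_symmetric S b"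
  shows "hered_symmetric S (opn S a b)"
proof -
  have pair: "hered_symmetric S (up S (hset {x, y}))"
    if xy: "x \<in> V" "y \<in> V" "hered_symmetric S x" "hered_symmetric S y" for x y
  proof -
    obtain K K' where K: "K \<in> elts (filt S)" "\<forall>\<pi>\<in>elts K. act \<pi> x = x"
      "K' \<in> elts (filt S)" "\<forall>\<pi>\<in>elts K'. act \<pi> y = y" using hs_supp xy(3,4) by meson
    show ?thesis
      by (rule hs_up[OF V_pair[OF xy(1,2)] _ filt_inter[OF K(1,3)]]) (use K xy in \<open>auto simp: small_countable\<close>)
  qed
  have "hered_symmetric S (up S (hset {a}))" using pair[OF assms(1,1,3,3)] by simp
  then show ?thesis unfolding opn_def using pair assms by (simp add: V_pair)
qed

lemma hs_check: "x \<in> V \<Longrightarrow> hered_symmetric S (check S x)"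
proof (induction x rule: hset_induct)
  case (1 x)
  obtain K where K: "K \<in> elts (filt S)" using filt_ne by blast
  have "hset (check S ` elts x) \<in> V"
    using 1(2) by (intro dfun_V0[OF dfun_image[where F = "\<lambda>x e. check S x"]] dintros)
  then show ?case
    unfolding check_up[of S x]
    using 1 V_trans act_check[OF grp_top] filt_sub[OF K] by (intro hs_up[OF _ _ K]) auto
qed

end

locale symmetric_ext = generic_ext V S G + symmetric V S for V :: "'i hset set" and S G
begin

abbreviation W :: "'i hset set" where "W \<equiv> symmetric_extension V S G"

lemma W_I: "x \<in> V \<Longrightarrow> hered_symmetric S x \<Longrightarrow> val G x \<in> W"
  unfolding symmetric_extension_def by blast

lemma VG_I: "x \<in> V \<Longrightarrow> is_name S x \<Longrightarrow> val G x \<in> generic_extension V S G"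
  unfolding generic_extension_def by blast

lemma V_sub_W: "V \<subseteq> W"
proof
  fix x assume "x \<in> V"
  then have "val G (check S x) \<in> W" by (intro W_I hs_check) simp_all
  then show "x \<in> W" by simp
qed

lemma W_sub_VG: "W \<subseteq> generic_extension V S G"
  unfolding symmetric_extension_def generic_extension_def using hs_name by blast

end

section \<open>The symmetric system of a structure\<close>

lemma conv_eqI:
  assumes f: "is_bij f A A" and h: "is_func h A A" and fh: "\<And>x. x \<in> A \<Longrightarrow> app f (app h x) = x"
  shows "conv f = h"
proof (rule func_eqI[OF bij_func[OF conv_bij[OF f]] h])
  fix x assume x: "x \<in> A"
  show "app (conv f) x = app h x"
    using app_conv_app[OF f func_mem[OF h x]] fh[OF x] by simp
qed

lemma perm_group_conjugate:
  assumes K: "perm_group A K" and g: "is_bij g (elts A) (elts A)"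
  shows "perm_group A (conjugate g K)"
proof -
  let ?A = "elts A"
  define c where "c s = compose g (compose s (conv g))" for s
  have el: "elts (conjugate g K) = c ` elts K" unfolding conjugate_def c_def by simp
  have g': "is_bij (conv g) ?A ?A" by (rule conv_bij[OF g])
  have Kb: "is_bij s ?A ?A" if "s \<in> elts K" for s using K that unfolding perm_group_def by blast
  have cb: "is_bij (c s) ?A ?A" if "is_bij s ?A ?A" for s
    unfolding c_def by (intro compose_bij[OF compose_bij[OF g' that] g])
  have ca: "app (c s) x = app g (app s (app (conv g) x))" if "is_bij s ?A ?A" "x \<in> ?A" for s x
    unfolding c_def
    using app_compose[OF bij_func[OF compose_bij[OF g' that(1)]] that(2)] app_compose[OF bij_func[OF g'] that(2)]
    by simp
  note b = bij_mem[OF g] bij_mem[OF g'] bij_mem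
  have "ident A \<in> c ` elts K"
  proof -
    have "ident A = c (ident A)"
      by (rule func_eqI[OF bij_func[OF ident_bij] bij_func[OF cb[OF ident_bij]]])
        (simp add: ca[OF ident_bij] b(2) app_app_conv[OF g])
    then show ?thesis using K unfolding perm_group_def by blast
  qed
  moreover have "compose (c s) (c t) \<in> c ` elts K" if st: "s \<in> elts K" "t \<in> elts K" for s t
  proof -
    note bs = Kb[OF st(1)] and bt = Kb[OF st(2)]
    have bst: "is_bij (compose s t) ?A ?A" by (rule compose_bij[OF bt bs])
    have "compose (c s) (c t) = c (compose s t)"
    proof (rule func_eqI[OF bij_func[OF compose_bij[OF cb[OF bt] cb[OF bs]]] bij_func[OF cb[OF bst]]])
      fix x assume x: "x \<in> ?A"
      show "app (compose (c s) (c t)) x = app (c (compose s t)) x"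
        using x by (simp add: app_compose[OF bij_func[OF cb[OF bt]]] ca[OF bt] ca[OF bst] ca[OF bs] b(1,2)
            bij_mem[OF bt] bij_mem[OF bs] app_compose[OF bij_func[OF bt]] app_conv_app[OF g])
    qed
    then show ?thesis using K st unfolding perm_group_def by blast
  qed
  moreover have "conv (c s) \<in> c ` elts K" if s: "s \<in> elts K" for s
  proof -
    note bs = Kb[OF s]
    note bs' = conv_bij[OF bs]
    have "conv (c s) = c (conv s)"
    proof (rule conv_eqI[OF cb[OF bs] bij_func[OF cb[OF bs']]])
      fix x assume x: "x \<in> ?A"
      show "app (c s) (app (c (conv s)) x) = x"
        using x by (simp add: ca[OF bs] ca[OF bs'] b(1,2) bij_mem[OF bs] bij_mem[OF bs'] app_conv_app[OF g]
            app_app_conv[OF bs] app_app_conv[OF g])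
    qed
    then show ?thesis using K s unfolding perm_group_def by blast
  qed
  moreover have "is_bij s ?A ?A" if "s \<in> c ` elts K" for s using that cb Kb by blast
  ultimately show ?thesis unfolding perm_group_def el by blast
qed

context zfc_model
begin

lemma dfun_if [dintros]:
  assumes "dpred Q" "dfun s" "dfun t"
  shows "dfun (\<lambda>e. if Q e then s e else t e)"
proof (rule dfunI[where R = "\<lambda>x e. (Q e \<longrightarrow> x = s e) \<and> (\<not> Q e \<longrightarrow> x = t e)"])
  show "dpred (\<lambda>e. (Q (\<lambda>n. e (Suc n)) \<longrightarrow> e 0 = s (\<lambda>n. e (Suc n))) \<and> (\<not> Q (\<lambda>n. e (Suc n)) \<longrightarrow> e 0 = t (\<lambda>n. e (Suc n))))"
    by (intro dintros dfun_weaken dpred_tl assms)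
qed (use assms dfun_V in auto)

end

section \<open>The forcing, its automorphisms and the normal filter\<close>

locale copy_setup = zfc_model V for V :: "'i hset set" +
  fixes L :: "'i lang" and M :: "'i struct" and \<G> \<I> \<kappa> :: "'i hset"
  assumes lang: "lang_in V L" and struct: "struct_in V L M" and aut: "aut_group_in V L M \<G>"
    and ideal: "ideal_in V (univ M) \<I>" and kappa_V [simp]: "\<kappa> \<in> V"
begin

abbreviation U :: "'i hset set" where "U \<equiv> elts (univ M)"

lemma univ_V [simp]: "univ M \<in> V"
  using struct unfolding struct_in_def by blast

lemma G_V [simp]: "\<G> \<in> V"
  using aut unfolding aut_group_in_def by blast

lemma I_V [simp]: "\<I> \<in> V"
  using ideal unfolding ideal_in_def by blast

lemma G_group: "perm_group (univ M) \<G>"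
  using aut unfolding aut_group_in_def by blast

lemma G_bij: "\<pi> \<in> elts \<G> \<Longrightarrow> is_bij \<pi> U U"
  and G_ident: "ident (univ M) \<in> elts \<G>"
  and G_compose: "\<pi> \<in> elts \<G> \<Longrightarrow> \<sigma> \<in> elts \<G> \<Longrightarrow> compose \<pi> \<sigma> \<in> elts \<G>"
  and G_conv: "\<pi> \<in> elts \<G> \<Longrightarrow> conv \<pi> \<in> elts \<G>"
  using G_group unfolding perm_group_def by blast+

lemma ideal_sub: "A \<in> elts \<I> \<Longrightarrow> elts A \<subseteq> U"
  and ideal_empty: "hset {} \<in> elts \<I>"
  and ideal_single: "d \<in> U \<Longrightarrow> hset {d} \<in> elts \<I>"
  and ideal_Un: "A \<in> elts \<I> \<Longrightarrow> B \<in> elts \<I> \<Longrightarrow> hset (elts A \<union> elts B) \<in> elts \<I>"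
  using ideal unfolding ideal_in_def by blast+

text \<open>The ideal need not be invariant under \<open>\<G>\<close>, so it is replaced by its largest invariant
  subideal, which still contains all singletons.\<close>

definition inv_ideal :: "'i hset" where
  "inv_ideal = hset {A \<in> elts \<I>. \<forall>\<pi>\<in>elts \<G>. hset ((\<lambda>a. ap \<pi> a) ` elts A) \<in> elts \<I>}"

text \<open>The points of M are included so that deciding a subset of M stays within the closure of
  the forcing, the members of \<open>\<kappa>\<close> for sequences of length below
  \<open>\<kappa>\<close>. The empty set makes X nonempty, and with closure under pairing this
  provides two distinct codes.\<close>

definition X :: "'i hset" where
  "X = (SOME X. X \<in> V \<and> insert (hset {}) (U \<union> elts \<kappa>) \<subseteq> elts X \<and> (\<forall>a\<in>elts X. \<forall>b\<in>elts X. \<langle>a, b\<rangle> \<in> elts X))"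

lemma X: "X \<in> V" "U \<subseteq> elts X" "elts \<kappa> \<subseteq> elts X" "\<And>a b. a \<in> elts X \<Longrightarrow> b \<in> elts X \<Longrightarrow> \<langle>a, b\<rangle> \<in> elts X"
  and X_empty: "hset {} \<in> elts X"
proof -
  have "\<exists>X\<in>V. elts (hset (insert (hset {}) (elts (hset (U \<union> elts \<kappa>))))) \<subseteq> elts X \<and>
      (\<forall>a\<in>elts X. \<forall>b\<in>elts X. \<langle>a, b\<rangle> \<in> elts X)"
    by (rule pairing_closed_ex[OF V_insert[OF V_empty V_Un[OF univ_V kappa_V]]])
  then have "\<exists>X. X \<in> V \<and> insert (hset {}) (U \<union> elts \<kappa>) \<subseteq> elts X \<and> (\<forall>a\<in>elts X. \<forall>b\<in>elts X. \<langle>a, b\<rangle> \<in> elts X)"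
    by auto
  from someI_ex[OF this]
  have *: "X \<in> V \<and> insert (hset {}) (U \<union> elts \<kappa>) \<subseteq> elts X \<and> (\<forall>a\<in>elts X. \<forall>b\<in>elts X. \<langle>a, b\<rangle> \<in> elts X)"
    unfolding X_def .
  show "X \<in> V" "U \<subseteq> elts X" "elts \<kappa> \<subseteq> elts X" "hset {} \<in> elts X" using * by blast+
  show "a \<in> elts X \<Longrightarrow> b \<in> elts X \<Longrightarrow> \<langle>a, b\<rangle> \<in> elts X" for a b using * by blast
qed

declare X(1) [simp]

text \<open>The set of rows. Conditions have size at most that of X, so none of them can meet every
  row.\<close>

definition J :: "'i hset" where "J = powV X"
definition bit0 :: "'i hset" where "bit0 = hset {}"
definition bit1 :: "'i hset" where "bit1 = hset {hset {}}"
definition two :: "'i hset" where "two = hset {bit0, bit1}"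

text \<open>The extra column \<open>star\<close> is moved by members of every filter group, even when the whole of
  \<open>M\<close> belongs to the ideal.\<close>

definition star :: "'i hset" where "star = univ M"
definition cols :: "'i hset" where "cols = hset (insert star U)"
text \<open>Cells, consisting of a column, a row and a bit. A condition is literally a function from
  pairs of column and row to bits, and all automorphisms come from permutations of cells.\<close>

definition C :: "'i hset" where "C = prodset (prodset cols J) two"
definition Cond :: "'i hset" where "Cond = hset {p \<in> elts (powV C). functional p \<and> dominated X p}"
definition Le :: "'i hset" where
  "Le = hset {z \<in> elts (prodset Cond Cond). elts (hsnd z) \<subseteq> elts (hfst z)}"

definition ext :: "'i hset \<Rightarrow> 'i hset \<Rightarrow> 'i hset" where
  "ext \<pi> m = (if m \<in> U then ap \<pi> m else m)"
text \<open>The permutation k moves columns as \<open>\<pi>\<close> does and preserves rows. Being a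
  bijection, it is otherwise free only to swap or keep the two bits at each place.\<close>

definition over :: "'i hset \<Rightarrow> 'i hset \<Rightarrow> bool" where
  "over k \<pi> \<longleftrightarrow> (\<forall>c\<in>elts C. hfst (ap k c) = \<langle>ext \<pi> (hfst (hfst c)), hsnd (hfst c)\<rangle>)"
text \<open>For the empty A nothing is required to be fixed, so \<open>hset {}\<close> yields the
  whole group and the same definition serves for the group and for the subgroups that generate the
  filter.\<close>

definition fix_perms :: "'i hset \<Rightarrow> 'i hset" where
  "fix_perms A = hset {k \<in> elts (powV (prodset C C)). is_bij k (elts C) (elts C) \<and> (\<exists>\<pi>\<in>elts \<G>. over k \<pi>) \<and>
     (\<forall>c\<in>elts C. hfst (hfst c) \<in> elts A \<longrightarrow> ap k c = c)}"
definition img :: "'i hset \<Rightarrow> 'i hset \<Rightarrow> 'i hset" where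
  "img k p = hset ((\<lambda>c. ap k c) ` elts p)"
definition lift :: "'i hset \<Rightarrow> 'i hset" where
  "lift k = hset ((\<lambda>p. \<langle>p, img k p\<rangle>) ` elts Cond)"
definition fix_auts :: "'i hset \<Rightarrow> 'i hset" where
  "fix_auts A = hset ((\<lambda>k. lift k) ` elts (fix_perms A))"
definition Filt :: "'i hset" where
  "Filt = hset {K \<in> elts (powV (fix_auts (hset {}))). perm_group Cond K \<and> (\<exists>A\<in>elts inv_ideal. elts (fix_auts A) \<subseteq> elts K)}"

definition Sys :: "'i symsys" where
  "Sys = \<lparr>conds = Cond, leq = Le, top_cond = hset {}, grp = fix_auts (hset {}), filt = Filt\<rparr>"

lemma Sys_simps [simp]: "conds Sys = Cond" "leq Sys = Le" "top_cond Sys = hset {}"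
    "grp Sys = fix_auts (hset {})" "filt Sys = Filt"
  unfolding Sys_def by simp_all

lemma star_notin: "star \<notin> U"
  unfolding star_def by (rule mem_irrefl)

lemma elts_cols: "elts cols = insert star U"
  unfolding cols_def by simp

lemma bit0_neq_bit1: "bit0 \<noteq> bit1"
  unfolding bit0_def bit1_def by (simp add: hset_countable_inject)

lemma elts_two: "elts two = {bit0, bit1}"
  unfolding two_def by simp

lemma star_V [simp]: "star \<in> V" and J_V [simp]: "J \<in> V" and bit0_V [simp]: "bit0 \<in> V" and bit1_V [simp]: "bit1 \<in> V"
  unfolding star_def J_def bit0_def bit1_def by simp_all

lemma two_V [simp]: "two \<in> V" unfolding two_def by (simp add: V_pair)
lemma cols_V [simp]: "cols \<in> V" unfolding cols_def by simp
lemma C_V [simp]: "C \<in> V" unfolding C_def by (intro dfun_V0[OF dfun_prodset] dintros) simp_all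

lemma in_C: "c \<in> elts C \<longleftrightarrow> (\<exists>m\<in>elts cols. \<exists>i\<in>elts J. \<exists>e\<in>elts two. c = \<langle>\<langle>m, i\<rangle>, e\<rangle>)"
  unfolding C_def elts_prodset by blast

lemma C_pair [simp]: "\<langle>\<langle>m, i\<rangle>, e\<rangle> \<in> elts C \<longleftrightarrow> m \<in> elts cols \<and> i \<in> elts J \<and> e \<in> elts two"
  unfolding C_def by simp

lemma Cond_V [simp]: "Cond \<in> V"
  unfolding Cond_def by (intro dfun_V0[OF dfun_sep] dintros) simp_all

lemma in_Cond: "p \<in> elts Cond \<longleftrightarrow> p \<in> V \<and> elts p \<subseteq> elts C \<and> functional p \<and> dominated X p"
  unfolding Cond_def mem_sep by auto

lemma Le_V [simp]: "Le \<in> V"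
  unfolding Le_def by (intro dfun_V0[OF dfun_sep] dintros) simp_all

lemma in_Le [simp]: "\<langle>p, q\<rangle> \<in> elts Le \<longleftrightarrow> p \<in> elts Cond \<and> q \<in> elts Cond \<and> elts q \<subseteq> elts p"
  unfolding Le_def mem_sep by auto

lemma dfun_ext [dintros]: "dfun s \<Longrightarrow> dfun t \<Longrightarrow> dfun (\<lambda>e. ext (s e) (t e))"
  unfolding ext_def by (intro dintros) simp_all

lemma dpred_over [dintros]: "dfun s \<Longrightarrow> dfun t \<Longrightarrow> dpred (\<lambda>e. over (s e) (t e))"
  unfolding over_def by (intro dpred_ball dpred_eq dfun_hfst dfun_hsnd dfun_ap dfun_opair dfun_ext dfun_var dfun_const dfun_weaken C_V)

lemma dfun_fix_perms [dintros]: "dfun s \<Longrightarrow> dfun (\<lambda>e. fix_perms (s e))"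
proof (rule dfun_comp1[where F = fix_perms])
  show "dfun (\<lambda>e. fix_perms (e 0))" unfolding fix_perms_def by (intro dintros) simp_all
qed

lemma dfun_img [dintros]: "dfun s \<Longrightarrow> dfun t \<Longrightarrow> dfun (\<lambda>e. img (s e) (t e))"
  unfolding img_def by (intro dintros dfun_weaken)

lemma dfun_lift [dintros]: "dfun s \<Longrightarrow> dfun (\<lambda>e. lift (s e))"
proof (rule dfun_comp1[where F = lift])
  show "dfun (\<lambda>e. lift (e 0))" unfolding lift_def by (intro dintros) simp_all
qed

lemma dfun_fix_auts [dintros]: "dfun s \<Longrightarrow> dfun (\<lambda>e. fix_auts (s e))"
proof (rule dfun_comp1[where F = fix_auts])
  show "dfun (\<lambda>e. fix_auts (e 0))" unfolding fix_auts_def by (intro dintros)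
qed

lemma V_fix_auts [simp]: "A \<in> V \<Longrightarrow> fix_auts A \<in> V"
  by (intro dfun_V0[OF dfun_fix_auts] dintros)

lemma inv_ideal_V [simp]: "inv_ideal \<in> V"
  unfolding inv_ideal_def by (intro dfun_V0[OF dfun_sep] dintros) simp_all

lemma Filt_V [simp]: "Filt \<in> V"
  unfolding Filt_def by (intro dfun_V0[OF dfun_sep] dintros) simp_all

lemma ap_G: "\<pi> \<in> elts \<G> \<Longrightarrow> a \<in> U \<Longrightarrow> ap \<pi> a = app \<pi> a"
  using ap_eq_app bij_func G_bij by metis

lemma in_inv_ideal: "A \<in> elts inv_ideal \<longleftrightarrow> A \<in> elts \<I> \<and> (\<forall>\<pi>\<in>elts \<G>. hset (ap \<pi> ` elts A) \<in> elts \<I>)"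
  unfolding inv_ideal_def mem_sep by blast

lemma inv_ideal_sub: "A \<in> elts inv_ideal \<Longrightarrow> elts A \<subseteq> U"
  using in_inv_ideal ideal_sub by blast

lemma inv_ideal_mem_V: "A \<in> elts inv_ideal \<Longrightarrow> A \<in> V"
  using V_trans[OF inv_ideal_V] .

lemma inv_ideal_empty: "hset {} \<in> elts inv_ideal"
  unfolding in_inv_ideal using ideal_empty by simp

lemma inv_ideal_single: "d \<in> U \<Longrightarrow> hset {d} \<in> elts inv_ideal"
  unfolding in_inv_ideal using ideal_single func_mem[OF bij_func[OF G_bij]] ap_G by simp

lemma inv_ideal_Un: "A \<in> elts inv_ideal \<Longrightarrow> B \<in> elts inv_ideal \<Longrightarrow> hset (elts A \<union> elts B) \<in> elts inv_ideal"
proof -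
  assume A: "A \<in> elts inv_ideal" "B \<in> elts inv_ideal"
  have "hset (ap \<pi> ` elts (hset (elts A \<union> elts B))) \<in> elts \<I>" if "\<pi> \<in> elts \<G>" for \<pi>
  proof -
    have "hset (elts (hset (ap \<pi> ` elts A)) \<union> elts (hset (ap \<pi> ` elts B))) \<in> elts \<I>"
      using A that unfolding in_inv_ideal by (intro ideal_Un) blast+
    then show ?thesis by (simp add: image_Un)
  qed
  then show ?thesis using A ideal_Un unfolding in_inv_ideal by blast
qed

text \<open>Invariance holds since translating by \<open>\<rho>\<close> and then by
  \<open>\<pi>\<close> is translating by their composition. Conjugation moves supports in exactly
  this way, so normality of the filter rests on it.\<close>

lemma inv_ideal_image:
  assumes A: "A \<in> elts inv_ideal" and \<rho>: "\<rho> \<in> elts \<G>"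
  shows "hset (ap \<rho> ` elts A) \<in> elts inv_ideal"
  unfolding in_inv_ideal
proof (intro conjI ballI)
  show "hset (ap \<rho> ` elts A) \<in> elts \<I>" using A \<rho> unfolding in_inv_ideal by blast
  fix \<pi> assume \<pi>: "\<pi> \<in> elts \<G>"
  have "ap \<pi> ` ap \<rho> ` elts A = ap (compose \<pi> \<rho>) ` elts A"
    unfolding image_image
  proof (rule image_cong[OF refl])
    fix a assume "a \<in> elts A"
    then have a: "a \<in> U" using inv_ideal_sub[OF A] by blast
    then show "ap \<pi> (ap \<rho> a) = ap (compose \<pi> \<rho>) a"
      using ap_G[OF \<rho> a] ap_G[OF G_compose[OF \<pi> \<rho>] a] ap_G[OF \<pi> bij_mem[OF G_bij[OF \<rho>] a]]
        app_compose[OF bij_func[OF G_bij[OF \<rho>]] a] by simp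
  qed
  then show "hset (ap \<pi> ` elts (hset (ap \<rho> ` elts A))) \<in> elts \<I>"
    using A G_compose[OF \<pi> \<rho>] unfolding in_inv_ideal by simp
qed

lemma ext_bij: "\<pi> \<in> elts \<G> \<Longrightarrow> bij_betw (ext \<pi>) (elts cols) (elts cols)"
proof -
  assume \<pi>: "\<pi> \<in> elts \<G>"
  have e: "ext \<pi> m = app \<pi> m" if "m \<in> U" for m using that ap_G[OF \<pi>] unfolding ext_def by simp
  have s: "ext \<pi> star = star" using star_notin unfolding ext_def by simp
  have "bij_betw (ext \<pi>) U U"
    using G_bij[OF \<pi>] bij_betw_cong[of U "ext \<pi>" "app \<pi>" U] e unfolding is_bij_iff by blast
  then show ?thesis unfolding elts_cols bij_betw_def using s star_notin by auto
qed

lemma ext_cols: "\<pi> \<in> elts \<G> \<Longrightarrow> m \<in> elts cols \<Longrightarrow> ext \<pi> m \<in> elts cols"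
  using ext_bij bij_betwE by blast

lemma ext_inj: "\<pi> \<in> elts \<G> \<Longrightarrow> m \<in> elts cols \<Longrightarrow> n \<in> elts cols \<Longrightarrow> ext \<pi> m = ext \<pi> n \<longleftrightarrow> m = n"
  using ext_bij unfolding bij_betw_def inj_on_def by blast

lemma ext_U: "\<pi> \<in> elts \<G> \<Longrightarrow> m \<in> U \<Longrightarrow> ext \<pi> m = app \<pi> m"
  unfolding ext_def using ap_G by simp

lemma in_fix_perms: "k \<in> elts (fix_perms A) \<longleftrightarrow> k \<in> V \<and> is_bij k (elts C) (elts C) \<and> (\<exists>\<pi>\<in>elts \<G>. over k \<pi>) \<and>
    (\<forall>c\<in>elts C. hfst (hfst c) \<in> elts A \<longrightarrow> app k c = c)"
proof -
  have "prodset C C \<in> V" by (intro dfun_V0[OF dfun_prodset] dintros) simp_all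
  moreover have "elts k \<subseteq> elts (prodset C C)" if "is_bij k (elts C) (elts C)"
    using bij_func[OF that] unfolding is_func_def by (auto simp: elts_prodset)
  moreover have "ap k c = app k c" if "is_bij k (elts C) (elts C)" "c \<in> elts C" for c
    using ap_eq_app[OF bij_func[OF that(1)] that(2)] .
  ultimately show ?thesis unfolding fix_perms_def mem_sep by auto
qed

lemma fix_perms_bij: "k \<in> elts (fix_perms A) \<Longrightarrow> is_bij k (elts C) (elts C)"
  and fix_perms_V: "k \<in> elts (fix_perms A) \<Longrightarrow> k \<in> V"
  unfolding in_fix_perms by blast+

lemma over_app: "is_bij k (elts C) (elts C) \<Longrightarrow> over k \<pi> \<longleftrightarrow>
    (\<forall>c\<in>elts C. hfst (app k c) = \<langle>ext \<pi> (hfst (hfst c)), hsnd (hfst c)\<rangle>)"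
  unfolding over_def using ap_eq_app[OF bij_func] by (metis (no_types, lifting))

lemma ext_conv: "\<pi> \<in> elts \<G> \<Longrightarrow> ext (conv \<pi>) (ext \<pi> m) = m" "\<pi> \<in> elts \<G> \<Longrightarrow> ext \<pi> (ext (conv \<pi>) m) = m"
  using ext_U[of \<pi>] ext_U[OF G_conv, of \<pi>] bij_mem[OF G_bij, of \<pi>] bij_mem[OF conv_bij[OF G_bij], of \<pi>]
    app_conv_app[OF G_bij, of \<pi>] app_app_conv[OF G_bij, of \<pi>]
  by (cases "m \<in> U"; simp add: ext_def)+

lemma over_conv:
  assumes kb: "is_bij k (elts C) (elts C)" and \<pi>: "\<pi> \<in> elts \<G>" "over k \<pi>"
  shows "over (conv k) (conv \<pi>)"
  unfolding over_app[OF conv_bij[OF kb]]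
proof
  fix c assume c: "c \<in> elts C"
  define d where "d = app (conv k) c"
  have d: "d \<in> elts C" "app k d = c"
    unfolding d_def using bij_mem[OF conv_bij[OF kb] c] app_app_conv[OF kb c] by blast+
  then obtain m i e where m: "d = \<langle>\<langle>m, i\<rangle>, e\<rangle>" unfolding in_C by blast
  have "hfst c = \<langle>ext \<pi> m, i\<rangle>" using \<pi>(2)[unfolded over_app[OF kb], rule_format, OF d(1)] d(2) m by simp
  then show "hfst (app (conv k) c) = \<langle>ext (conv \<pi>) (hfst (hfst c)), hsnd (hfst c)\<rangle>"
    using m ext_conv(1)[OF \<pi>(1)] by (simp flip: d_def)
qed

section \<open>Groups of cell permutations and their action on conditions\<close>

lemma fix_perms_group:
  assumes "A \<in> V"
  shows "perm_group C (fix_perms A)"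
  unfolding perm_group_def
proof (intro conjI ballI)
  show "is_bij k (elts C) (elts C)" if "k \<in> elts (fix_perms A)" for k using fix_perms_bij that .
  have "over (ident C) (ident (univ M))"
    unfolding over_app[OF ident_bij]
  proof
    fix c assume c: "c \<in> elts C"
    then obtain m i e where "c = \<langle>\<langle>m, i\<rangle>, e\<rangle>" unfolding in_C by blast
    then show "hfst (app (ident C) c) = \<langle>ext (ident (univ M)) (hfst (hfst c)), hsnd (hfst c)\<rangle>"
      using c ap_G[OF G_ident] unfolding ext_def by simp
  qed
  then show "ident C \<in> elts (fix_perms A)" unfolding in_fix_perms using G_ident ident_bij V_ident by auto
  fix k assume k: "k \<in> elts (fix_perms A)"
  then obtain \<pi> where \<pi>: "\<pi> \<in> elts \<G>" "over k \<pi>" unfolding in_fix_perms by blast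
  note kb = fix_perms_bij[OF k]
  note ko = \<pi>(2)[unfolded over_app[OF kb], rule_format]
  note kb' = conv_bij[OF kb]
  show "conv k \<in> elts (fix_perms A)"
    unfolding in_fix_perms
  proof (intro conjI ballI impI kb' V_conv[OF bij_func[OF kb] fix_perms_V[OF k]] bexI[OF _ G_conv[OF \<pi>(1)]])
    show "over (conv k) (conv \<pi>)" by (rule over_conv[OF kb \<pi>])
    fix c assume c: "c \<in> elts C" "hfst (hfst c) \<in> elts A"
    then have "app k c = c" using k unfolding in_fix_perms by blast
    then show "app (conv k) c = c" using app_conv_app[OF kb c(1)] by simp
  qed
  fix l assume l: "l \<in> elts (fix_perms A)"
  then obtain \<rho> where \<rho>: "\<rho> \<in> elts \<G>" "over l \<rho>" unfolding in_fix_perms by blast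
  note lb = fix_perms_bij[OF l]
  note lo = \<rho>(2)[unfolded over_app[OF lb], rule_format]
  note cb = compose_bij[OF lb kb]
  show "compose k l \<in> elts (fix_perms A)"
    unfolding in_fix_perms
  proof (intro conjI ballI impI cb V_compose[OF bij_func[OF lb] bij_func[OF kb] fix_perms_V[OF l] fix_perms_V[OF k]]
      bexI[OF _ G_compose[OF \<pi>(1) \<rho>(1)]])
    show "over (compose k l) (compose \<pi> \<rho>)"
      unfolding over_app[OF cb]
    proof
      fix c assume c: "c \<in> elts C"
      then obtain m i e where m: "c = \<langle>\<langle>m, i\<rangle>, e\<rangle>" "m \<in> elts cols" unfolding in_C by blast
      have "ext \<pi> (ext \<rho> m) = ext (compose \<pi> \<rho>) m"
      proof (cases "m \<in> U")
        case True
        then show ?thesis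
          using ext_U[OF \<rho>(1)] ext_U[OF \<pi>(1)] ext_U[OF G_compose[OF \<pi>(1) \<rho>(1)]] bij_mem[OF G_bij[OF \<rho>(1)]]
            app_compose[OF bij_func[OF G_bij[OF \<rho>(1)]]] by simp
      qed (simp add: ext_def)
      moreover have "hfst (app (compose k l) c) = \<langle>ext \<pi> (ext \<rho> (hfst (hfst c))), hsnd (hfst c)\<rangle>"
        unfolding app_compose[OF bij_func[OF lb] c] ko[OF bij_mem[OF lb c]] lo[OF c] by simp
      ultimately show "hfst (app (compose k l) c) = \<langle>ext (compose \<pi> \<rho>) (hfst (hfst c)), hsnd (hfst c)\<rangle>"
        unfolding m(1) by simp
    qed
    fix c assume c: "c \<in> elts C" "hfst (hfst c) \<in> elts A"
    then show "app (compose k l) c = c"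
      using k l app_compose[OF bij_func[OF lb] c(1)] unfolding in_fix_perms by simp
  qed
qed

lemma elts_img: "is_bij k (elts C) (elts C) \<Longrightarrow> elts p \<subseteq> elts C \<Longrightarrow> elts (img k p) = app k ` elts p"
proof -
  assume k: "is_bij k (elts C) (elts C)" and p: "elts p \<subseteq> elts C"
  have "ap k ` elts p = app k ` elts p"
    using ap_eq_app[OF bij_func[OF k]] p by (intro image_cong refl) blast
  then show ?thesis unfolding img_def by simp
qed

lemma Cond_sub: "p \<in> elts Cond \<Longrightarrow> elts p \<subseteq> elts C"
  unfolding in_Cond by blast

text \<open>The image is again a function because column and row of a moved cell determine those of
  the original: rows are kept and columns are moved injectively. Its size is controlled by that of
  p.\<close>

lemma img_Cond:
  assumes k: "k \<in> elts (fix_perms A)" and p: "p \<in> elts Cond"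
  shows "img k p \<in> elts Cond"
proof -
  obtain \<pi> where \<pi>: "\<pi> \<in> elts \<G>" "over k \<pi>" using k unfolding in_fix_perms by blast
  note kb = fix_perms_bij[OF k]
  note ko = \<pi>(2)[unfolded over_app[OF kb], rule_format]
  have pV: "p \<in> V" and pC: "elts p \<subseteq> elts C" and pf: "functional p" and pd: "dominated X p"
    using p unfolding in_Cond by blast+
  note e = elts_img[OF kb pC]
  have "img k p \<in> V" by (intro dfun_V0[OF dfun_img] dintros fix_perms_V[OF k] pV)
  moreover have sub: "elts (img k p) \<subseteq> elts C" unfolding e using bij_mem[OF kb] pC by blast
  moreover have "functional (img k p)"
  proof (rule functionalI)
    show "\<exists>a b. z = \<langle>a, b\<rangle>" if "z \<in> elts (img k p)" for z using that sub in_C by blast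
    fix a b b' assume "\<langle>a, b\<rangle> \<in> elts (img k p)" "\<langle>a, b'\<rangle> \<in> elts (img k p)"
    then obtain c d where c: "c \<in> elts p" "\<langle>a, b\<rangle> = app k c" and d: "d \<in> elts p" "\<langle>a, b'\<rangle> = app k d"
      unfolding e by blast
    obtain m i x where m: "c = \<langle>\<langle>m, i\<rangle>, x\<rangle>" "m \<in> elts cols" using c pC in_C by blast
    obtain n j y where n: "d = \<langle>\<langle>n, j\<rangle>, y\<rangle>" "n \<in> elts cols" using d pC in_C by blast
    have "\<langle>ext \<pi> m, i\<rangle> = a" "\<langle>ext \<pi> n, j\<rangle> = a"
      using ko[of c] ko[of d] c d pC m(1) n(1) by (metis hfst_opair hsnd_opair subsetD)+
    then have "m = n" "i = j" using ext_inj[OF \<pi>(1) m(2) n(2)] by auto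
    then have "c = d" using functionalD[OF pf] c(1) d(1) m(1) n(1) by blast
    then show "b = b'" using c(2) d(2) by (metis opair_inject)
  qed
  moreover have "dominated X (img k p)"
    by (rule dominated_image[where F = "\<lambda>c. ap k c", OF pd]) (intro dintros fix_perms_V[OF k], simp_all add: img_def pV)
  ultimately show ?thesis unfolding in_Cond by blast
qed

lemma elts_lift: "elts (lift k) = (\<lambda>p. \<langle>p, img k p\<rangle>) ` elts Cond"
  unfolding lift_def by simp

lemma app_lift [simp]: "p \<in> elts Cond \<Longrightarrow> app (lift k) p = img k p"
  by (rule app_eq[OF elts_lift])

lemma img_img:
  assumes k: "is_bij k (elts C) (elts C)" and l: "is_bij l (elts C) (elts C)" and p: "elts p \<subseteq> elts C"
  shows "img k (img l p) = img (compose k l) p"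
proof (rule elts_inj)
  have sub: "elts (img l p) \<subseteq> elts C" unfolding elts_img[OF l p] using bij_mem[OF l] p by blast
  show "elts (img k (img l p)) = elts (img (compose k l) p)"
    unfolding elts_img[OF k sub] elts_img[OF l p] elts_img[OF compose_bij[OF l k] p] image_image
    using app_compose[OF bij_func[OF l]] p by (intro image_cong refl) (simp add: subset_iff)
qed

lemma img_ident: "elts p \<subseteq> elts C \<Longrightarrow> img (ident C) p = p"
  by (rule elts_inj) (subst elts_img[OF ident_bij], auto simp: subset_iff image_iff)

lemma conv_compose_ident:
  assumes "is_bij k (elts C) (elts C)"
  shows "compose (conv k) k = ident C" "compose k (conv k) = ident C"
  using func_eqI[OF compose_func[OF bij_func[OF assms] bij_func[OF conv_bij[OF assms]]] bij_func[OF ident_bij]]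
    func_eqI[OF compose_func[OF bij_func[OF conv_bij[OF assms]] bij_func[OF assms]] bij_func[OF ident_bij]]
    app_compose[OF bij_func[OF assms]] app_compose[OF bij_func[OF conv_bij[OF assms]]]
    app_conv_app[OF assms] app_app_conv[OF assms] by simp_all

lemma lift_bij:
  assumes A: "A \<in> V" and k: "k \<in> elts (fix_perms A)"
  shows "is_bij (lift k) (elts Cond) (elts Cond)"
  unfolding lift_def
proof (rule graph_bij, rule bij_betw_byWitness[where f' = "img (conv k)"])
  have k': "conv k \<in> elts (fix_perms A)" using fix_perms_group[OF A] k unfolding perm_group_def by blast
  note b = fix_perms_bij[OF k] fix_perms_bij[OF k']
  show "\<forall>p\<in>elts Cond. img (conv k) (img k p) = p"
    using img_img[OF b(2,1) Cond_sub] conv_compose_ident(1)[OF b(1)] img_ident[OF Cond_sub] by simp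
  show "\<forall>p\<in>elts Cond. img k (img (conv k) p) = p"
    using img_img[OF b(1,2) Cond_sub] conv_compose_ident(2)[OF b(1)] img_ident[OF Cond_sub] by simp
  show "img k ` elts Cond \<subseteq> elts Cond" "img (conv k) ` elts Cond \<subseteq> elts Cond"
    using img_Cond[OF k] img_Cond[OF k'] by blast+
qed

lemma lift_compose:
  assumes A: "A \<in> V" and k: "k \<in> elts (fix_perms A)" and l: "l \<in> elts (fix_perms A)"
  shows "compose (lift k) (lift l) = lift (compose k l)"
proof (rule func_eqI[OF bij_func[OF compose_bij[OF lift_bij[OF A l] lift_bij[OF A k]]]])
  have "compose k l \<in> elts (fix_perms A)" using fix_perms_group[OF A] k l unfolding perm_group_def by blast
  then show "is_func (lift (compose k l)) (elts Cond) (elts Cond)" using lift_bij[OF A] bij_func by blast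
  fix p assume p: "p \<in> elts Cond"
  then show "app (compose (lift k) (lift l)) p = app (lift (compose k l)) p"
    using app_compose[OF bij_func[OF lift_bij[OF A l]] p] img_Cond[OF l p]
      img_img[OF fix_perms_bij[OF k] fix_perms_bij[OF l] Cond_sub[OF p]] by simp
qed

lemma lift_conv:
  assumes A: "A \<in> V" and k: "k \<in> elts (fix_perms A)"
  shows "conv (lift k) = lift (conv k)"
proof (rule conv_eqI[OF lift_bij[OF A k]])
  have k': "conv k \<in> elts (fix_perms A)" using fix_perms_group[OF A] k unfolding perm_group_def by blast
  then show "is_func (lift (conv k)) (elts Cond) (elts Cond)" using lift_bij[OF A] bij_func by blast
  note b = fix_perms_bij[OF k] fix_perms_bij[OF k']
  fix p assume p: "p \<in> elts Cond"
  then show "app (lift k) (app (lift (conv k)) p) = p"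
    using img_Cond[OF k' p] img_img[OF b(1,2) Cond_sub[OF p]] conv_compose_ident(2)[OF b(1)] img_ident[OF Cond_sub[OF p]]
    by simp
qed

lemma lift_ident: "lift (ident C) = ident Cond"
proof (rule func_eqI[OF _ bij_func[OF ident_bij]])
  show "is_func (lift (ident C)) (elts Cond) UNIV" by (rule is_funcI[OF elts_lift]) simp
qed (simp add: img_ident[OF Cond_sub])

lemma elts_fix_auts: "elts (fix_auts A) = lift ` elts (fix_perms A)"
  unfolding fix_auts_def by simp

lemma fix_auts_group:
  assumes "A \<in> V"
  shows "perm_group Cond (fix_auts A)"
  unfolding perm_group_def elts_fix_auts
proof (intro conjI ballI)
  note g = fix_perms_group[OF assms, unfolded perm_group_def]
  show "is_bij s (elts Cond) (elts Cond)" if "s \<in> lift ` elts (fix_perms A)" for s using that lift_bij[OF assms] by blast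
  show "ident Cond \<in> lift ` elts (fix_perms A)" using g lift_ident by (metis imageI)
  show "compose s t \<in> lift ` elts (fix_perms A)" if "s \<in> lift ` elts (fix_perms A)" "t \<in> lift ` elts (fix_perms A)" for s t
    using that g lift_compose[OF assms] by auto
  show "conv s \<in> lift ` elts (fix_perms A)" if "s \<in> lift ` elts (fix_perms A)" for s
    using that g lift_conv[OF assms] by auto
qed

lemma fix_perms_mono: "elts B \<subseteq> elts A \<Longrightarrow> elts (fix_perms A) \<subseteq> elts (fix_perms B)"
  unfolding subset_iff in_fix_perms by blast

lemma fix_auts_mono: "elts B \<subseteq> elts A \<Longrightarrow> elts (fix_auts A) \<subseteq> elts (fix_auts B)"
  unfolding elts_fix_auts using fix_perms_mono by blast

lemma fix_auts_sub: "elts (fix_auts A) \<subseteq> elts (fix_auts (hset {}))"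
  by (rule fix_auts_mono) simp

lemma in_Filt: "K \<in> elts Filt \<longleftrightarrow> K \<in> V \<and> elts K \<subseteq> elts (fix_auts (hset {})) \<and> perm_group Cond K \<and>
    (\<exists>A\<in>elts inv_ideal. elts (fix_auts A) \<subseteq> elts K)"
  unfolding Filt_def mem_sep by auto

lemma fix_auts_Filt: "A \<in> elts inv_ideal \<Longrightarrow> fix_auts A \<in> elts Filt"
  unfolding in_Filt using fix_auts_group fix_auts_sub inv_ideal_mem_V by auto

definition tog :: "'i hset \<Rightarrow> 'i hset" where
  "tog e = (if e = bit0 then bit1 else bit0)"

lemma tog_two: "e \<in> elts two \<Longrightarrow> tog e \<in> elts two" "e \<in> elts two \<Longrightarrow> tog (tog e) = e" "tog e \<noteq> e"
  unfolding elts_two tog_def using bit0_neq_bit1 by auto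

lemma tog_inj: "e \<in> elts two \<Longrightarrow> e' \<in> elts two \<Longrightarrow> tog e = tog e' \<longleftrightarrow> e = e'"
  by (metis tog_two(2))

text \<open>The prototype of a permutation over \<open>\<pi>\<close>: columns are moved by
  \<open>\<pi>\<close>, and bits are toggled at the places in b, measured before the move. It fixes
  every cell whose column is fixed by \<open>\<pi>\<close> and disjoint from b.\<close>

definition flips :: "'i hset \<Rightarrow> 'i hset \<Rightarrow> 'i hset" where
  "flips \<pi> b = hset ((\<lambda>c. \<langle>c, \<langle>\<langle>ext \<pi> (hfst (hfst c)), hsnd (hfst c)\<rangle>,
     if hfst c \<in> elts b then tog (hsnd c) else hsnd c\<rangle>\<rangle>) ` elts C)"

lemma flips_app: "\<langle>\<langle>m, i\<rangle>, e\<rangle> \<in> elts C \<Longrightarrow>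
    app (flips \<pi> b) \<langle>\<langle>m, i\<rangle>, e\<rangle> = \<langle>\<langle>ext \<pi> m, i\<rangle>, if \<langle>m, i\<rangle> \<in> elts b then tog e else e\<rangle>"
  by (subst app_eq[where f = "flips \<pi> b" and A = "elts C"]) (simp add: flips_def, simp, simp)

lemma flips_fix_perms:
  assumes \<pi>: "\<pi> \<in> elts \<G>" and b: "b \<in> V"
    and A: "\<And>m i. m \<in> elts A \<Longrightarrow> m \<in> elts cols \<Longrightarrow> ext \<pi> m = m \<and> \<langle>m, i\<rangle> \<notin> elts b"
  shows "flips \<pi> b \<in> elts (fix_perms A)" "over (flips \<pi> b) \<pi>"
proof -
  define F where "F c = \<langle>\<langle>ext \<pi> (hfst (hfst c)), hsnd (hfst c)\<rangle>, if hfst c \<in> elts b then tog (hsnd c) else hsnd c\<rangle>"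
    for c
  have F: "F \<langle>\<langle>m, i\<rangle>, e\<rangle> = \<langle>\<langle>ext \<pi> m, i\<rangle>, if \<langle>m, i\<rangle> \<in> elts b then tog e else e\<rangle>" for m i e
    unfolding F_def by simp
  have "inj_on F (elts C)"
  proof (rule inj_onI)
    fix c d assume c: "c \<in> elts C" and d: "d \<in> elts C" and cd: "F c = F d"
    obtain m i e where m: "c = \<langle>\<langle>m, i\<rangle>, e\<rangle>" "m \<in> elts cols" "e \<in> elts two" using c in_C by blast
    obtain n j x where n: "d = \<langle>\<langle>n, j\<rangle>, x\<rangle>" "n \<in> elts cols" "x \<in> elts two" using d in_C by blast
    have "m = n" "i = j" using cd ext_inj[OF \<pi> m(2) n(2)] unfolding m(1) n(1) F by auto
    moreover from this have "e = x" using cd tog_inj[OF m(3) n(3)] unfolding m(1) n(1) F by (auto split: if_splits)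
    ultimately show "c = d" using m n by simp
  qed
  moreover have "F ` elts C = elts C"
  proof (intro equalityI subsetI)
    fix d assume "d \<in> F ` elts C"
    then obtain c where c: "c \<in> elts C" "d = F c" by blast
    then obtain m i e where "c = \<langle>\<langle>m, i\<rangle>, e\<rangle>" "m \<in> elts cols" "i \<in> elts J" "e \<in> elts two"
      using in_C by blast
    then show "d \<in> elts C" unfolding c(2) using ext_cols[OF \<pi>] tog_two by (simp add: F)
  next
    fix d assume "d \<in> elts C"
    then obtain n i x where n: "d = \<langle>\<langle>n, i\<rangle>, x\<rangle>" "n \<in> elts cols" "i \<in> elts J" "x \<in> elts two" using in_C by blast
    obtain m where m: "m \<in> elts cols" "n = ext \<pi> m" using ext_bij[OF \<pi>] n(2) unfolding bij_betw_def by blast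
    let ?e = "if \<langle>m, i\<rangle> \<in> elts b then tog x else x"
    have "d = F \<langle>\<langle>m, i\<rangle>, ?e\<rangle>" unfolding F n(1) m(2) using tog_two n(4) by simp
    moreover have "\<langle>\<langle>m, i\<rangle>, ?e\<rangle> \<in> elts C" using m n tog_two by simp
    ultimately show "d \<in> F ` elts C" by blast
  qed
  ultimately have "bij_betw F (elts C) (elts C)" unfolding bij_betw_def by blast
  from graph_bij[OF this] have kb: "is_bij (flips \<pi> b) (elts C) (elts C)"
    unfolding flips_def F_def .
  have "dfun (\<lambda>e. tog (e 0))" unfolding tog_def by (intro dintros) simp_all
  then have dtog: "dfun (\<lambda>e. tog (s e))" if "dfun s" for s using that by (rule dfun_comp1[of tog])
  have "flips \<pi> b \<in> V" unfolding flips_def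
    by (intro dfun_V0[OF dfun_image] dintros dtog C_V b V_trans[OF G_V \<pi>])
  moreover show ov: "over (flips \<pi> b) \<pi>"
    unfolding over_app[OF kb]
  proof
    fix c assume c: "c \<in> elts C"
    then obtain m i e where m: "c = \<langle>\<langle>m, i\<rangle>, e\<rangle>" using in_C by blast
    show "hfst (app (flips \<pi> b) c) = \<langle>ext \<pi> (hfst (hfst c)), hsnd (hfst c)\<rangle>"
      using flips_app[of m i e \<pi> b] c unfolding m by simp
  qed
  moreover have "app (flips \<pi> b) c = c" if c: "c \<in> elts C" "hfst (hfst c) \<in> elts A" for c
  proof -
    obtain m i e where m: "c = \<langle>\<langle>m, i\<rangle>, e\<rangle>" "m \<in> elts cols" using c(1) in_C by blast
    then show ?thesis using flips_app[of m i e \<pi> b] A[of m i] c unfolding m(1) by simp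
  qed
  ultimately show "flips \<pi> b \<in> elts (fix_perms A)" unfolding in_fix_perms using kb \<pi> by blast
qed


text \<open>The empty set and the pair of two empty sets serve as two distinct codes in X.\<close>

lemma dominated_pair:
  assumes "a \<in> V" "b \<in> V"
  shows "dominated X (hset {a, b})"
proof -
  let ?x = "hset {}" and ?y = "\<langle>hset {}, hset {}\<rangle>"
  let ?g = "hset {\<langle>?x, a\<rangle>, \<langle>?y, b\<rangle>}"
  have "elts ?y \<noteq> {}" unfolding opair_def by simp
  then have ne: "?x \<noteq> ?y" by (metis elts_hset small_empty)
  have y: "?y \<in> elts X" by (rule X(4)[OF X_empty X_empty])
  have "?g \<in> V" using assms by (intro V_pair) simp_all
  moreover have "functional ?g" by (rule functionalI) (use ne in \<open>auto simp: small_countable\<close>)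
  moreover have "\<exists>x\<in>elts X. \<langle>x, c\<rangle> \<in> elts ?g" if "c \<in> elts (hset {a, b})" for c
  proof -
    from that consider "c = a" | "c = b" by auto
    then show ?thesis by cases (use X_empty y in \<open>auto simp: small_countable\<close>)
  qed
  ultimately show ?thesis unfolding dominated_def by blast
qed

lemma dominated_Un:
  assumes "a \<in> V" "b \<in> V" "dominated X a" "dominated X b"
  shows "dominated X (hset (elts a \<union> elts b))"
proof -
  have "dominated X (hset (\<Union>i\<in>elts (hset {a, b}). elts i))"
    by (rule dominated_Union[where F = "\<lambda>i. i"]) (use X assms V_pair dominated_pair in \<open>auto intro: dintros\<close>)
  then show ?thesis by simp
qed

lemma single_Cond: "c \<in> elts C \<Longrightarrow> hset {c} \<in> elts Cond"
  using V_trans[OF C_V] dominated_pair[of c c] in_C unfolding in_Cond by (auto intro!: functionalI)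

lemma Un_Cond:
  assumes "p \<in> elts Cond" "q \<in> elts Cond" "functional (hset (elts p \<union> elts q))"
  shows "hset (elts p \<union> elts q) \<in> elts Cond"
  using assms dominated_Un unfolding in_Cond by auto

lemma empty_Cond: "hset {} \<in> elts Cond"
  unfolding in_Cond dominated_def by (auto simp: functional_def intro!: bexI[of _ "hset {}"])

lemma forcing_Sys: "forcing_notion Sys"
  unfolding forcing_notion_def Sys_simps
proof (intro conjI ballI allI impI)
  fix z assume "z \<in> elts Le"
  then have "z \<in> elts (prodset Cond Cond)" unfolding Le_def mem_sep by blast
  then show "\<exists>p\<in>elts Cond. \<exists>q\<in>elts Cond. z = \<langle>p, q\<rangle>" unfolding elts_prodset by blast
qed (auto simp: empty_Cond)

sublocale forcing V Sys
  by unfold_locales (simp_all add: forcing_Sys)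

notation le (infix "\<preceq>" 50)

lemma aut_Sys:
  assumes "g \<in> elts (fix_auts A)" "A \<in> V"
  shows "forcing_aut Sys g"
proof -
  obtain k where k: "k \<in> elts (fix_perms A)" "g = lift k" using assms(1) unfolding elts_fix_auts by blast
  note kb = fix_perms_bij[OF k(1)]
  have "img k (hset {}) = hset {}" unfolding img_def by simp
  moreover have "elts (img k q) \<subseteq> elts (img k p) \<longleftrightarrow> elts q \<subseteq> elts p" if "p \<in> elts Cond" "q \<in> elts Cond" for p q
    unfolding elts_img[OF kb Cond_sub[OF that(1)]] elts_img[OF kb Cond_sub[OF that(2)]]
  proof -
    have "inj_on (app k) (elts C)" using kb unfolding is_bij_iff bij_betw_def by blast
    then have "x \<in> elts p" if "app k x \<in> app k ` elts p" "x \<in> elts q" for x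
      using that Cond_sub[OF \<open>p \<in> _\<close>] Cond_sub[OF \<open>q \<in> _\<close>] by (auto dest: inj_onD)
    then show "app k ` elts q \<subseteq> app k ` elts p \<longleftrightarrow> elts q \<subseteq> elts p" by blast
  qed
  ultimately show ?thesis
    unfolding forcing_aut_def k(2) Sys_simps
    using lift_bij[OF assms(2) k(1)] img_Cond[OF k(1)] empty_Cond by simp
qed

text \<open>A conjugate of the group supported by A contains the group supported by the translate B
  of A: if l fixes the columns in B and k carries the columns in A to those in B, then conjugating l
  back by k fixes the columns in A.\<close>

lemma conj_fix_auts:
  assumes g: "g \<in> elts (fix_auts (hset {}))" and A: "A \<in> elts inv_ideal"
  shows "\<exists>B\<in>elts inv_ideal. elts (fix_auts B) \<subseteq> elts (conjugate g (fix_auts A))"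
proof -
  obtain k where k: "k \<in> elts (fix_perms (hset {}))" "g = lift k" using g unfolding elts_fix_auts by blast
  obtain \<rho> where \<rho>: "\<rho> \<in> elts \<G>" "over k \<rho>" using k(1) unfolding in_fix_perms by blast
  define B where "B = hset (ap \<rho> ` elts A)"
  have "B \<in> elts inv_ideal" unfolding B_def by (rule inv_ideal_image[OF A \<rho>(1)])
  note kb = fix_perms_bij[OF k(1)]
  note ko = \<rho>(2)[unfolded over_app[OF kb], rule_format]
  note G0 = fix_perms_group[of "hset {}", simplified, unfolded perm_group_def]
  have k': "conv k \<in> elts (fix_perms (hset {}))" using G0 k(1) by blast
  have "lift l \<in> elts (conjugate g (fix_auts A))" if l: "l \<in> elts (fix_perms B)" for l
  proof -
    have l0: "l \<in> elts (fix_perms (hset {}))" using l fix_perms_mono[of "hset {}" B] by auto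
    define s where "s = compose (conv k) (compose l k)"
    have lk: "compose l k \<in> elts (fix_perms (hset {}))" using G0 l0 k(1) by blast
    have s0: "s \<in> elts (fix_perms (hset {}))" unfolding s_def using G0 k' lk by blast
    note lb = fix_perms_bij[OF l0] and k'b = fix_perms_bij[OF k'] and lkb = fix_perms_bij[OF lk]
    have sa: "app s c = app (conv k) (app l (app k c))" if "c \<in> elts C" for c
      unfolding s_def using app_compose[OF bij_func[OF lkb] that] app_compose[OF bij_func[OF kb] that] by simp
    have "app s c = c" if c: "c \<in> elts C" "hfst (hfst c) \<in> elts A" for c
    proof -
      have m: "hfst (hfst c) \<in> U" using inv_ideal_sub[OF A] c(2) by blast
      have "hfst (hfst (app k c)) \<in> elts B"
        unfolding ko[OF c(1)] using m c(2) unfolding ext_def B_def by simp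
      then have "app l (app k c) = app k c" using l bij_mem[OF kb c(1)] unfolding in_fix_perms by blast
      then show ?thesis unfolding sa[OF c(1)] using app_conv_app[OF kb c(1)] by simp
    qed
    then have s: "s \<in> elts (fix_perms A)" using s0 unfolding in_fix_perms by blast
    have "compose k (compose s (conv k)) = l"
    proof (rule func_eqI[OF _ bij_func[OF lb]])
      note sb = fix_perms_bij[OF s]
      show "is_func (compose k (compose s (conv k))) (elts C) (elts C)"
        using compose_bij[OF compose_bij[OF k'b sb] kb] bij_func by blast
      fix c assume c: "c \<in> elts C"
      then show "app (compose k (compose s (conv k))) c = app l c"
        using app_compose[OF bij_func[OF compose_bij[OF k'b sb]] c] app_compose[OF bij_func[OF k'b] c]
          sa[OF bij_mem[OF k'b c]] app_app_conv[OF kb c] app_app_conv[OF kb bij_mem[OF lb c]] by simp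
    qed
    moreover have "compose s (conv k) \<in> elts (fix_perms (hset {}))" using G0 s0 k' by blast
    ultimately have "lift l = compose g (compose (lift s) (conv g))"
      unfolding k(2) lift_conv[OF V_empty k(1)]
      using lift_compose[OF V_empty s0 k'] lift_compose[OF V_empty k(1), of "compose s (conv k)"] by simp
    then show ?thesis unfolding conjugate_def using s by (simp add: elts_fix_auts)
  qed
  then show ?thesis using \<open>B \<in> elts inv_ideal\<close> unfolding elts_fix_auts by blast
qed

lemma normal_Sys: "normal_filter V Sys"
  unfolding normal_filter_def Sys_simps perm_subgroup_def
proof (intro conjI ballI impI)
  show "elts Filt \<noteq> {}" using fix_auts_Filt[OF inv_ideal_empty] by blast
  fix K assume K: "K \<in> elts Filt"
  then obtain A where A: "A \<in> elts inv_ideal" "elts (fix_auts A) \<subseteq> elts K" unfolding in_Filt by blast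
  show "perm_group Cond K" "elts K \<subseteq> elts (fix_auts (hset {}))" using K unfolding in_Filt by blast+
  show "K' \<in> elts Filt" if "K' \<in> V" "perm_group Cond K' \<and> elts K' \<subseteq> elts (fix_auts (hset {}))" "elts K \<subseteq> elts K'" for K'
    using that A unfolding in_Filt by blast
  show "hset (elts K \<inter> elts K') \<in> elts Filt" if K': "K' \<in> elts Filt" for K'
  proof -
    obtain B where B: "B \<in> elts inv_ideal" "elts (fix_auts B) \<subseteq> elts K'" using K' unfolding in_Filt by blast
    have "elts (fix_auts (hset (elts A \<union> elts B))) \<subseteq> elts K \<inter> elts K'"
      using fix_auts_mono[of A "hset (elts A \<union> elts B)"] fix_auts_mono[of B "hset (elts A \<union> elts B)"] A(2) B(2) by auto
    moreover have "perm_group Cond (hset (elts K \<inter> elts K'))"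
      using K K' unfolding in_Filt perm_group_def by simp
    ultimately show ?thesis
      using K K' inv_ideal_Un[OF A(1) B(1)] unfolding in_Filt by auto
  qed
  show "conjugate g K \<in> elts Filt" if g: "g \<in> elts (fix_auts (hset {}))" for g
  proof -
    note G0 = fix_auts_group[OF V_empty, unfolded perm_group_def]
    have gb: "is_bij g (elts Cond) (elts Cond)" and gV: "g \<in> V" and gc: "conv g \<in> elts (fix_auts (hset {}))"
      using g G0 V_trans[OF V_fix_auts[OF V_empty]] by blast+
    have Kb: "is_bij s (elts Cond) (elts Cond)" if "s \<in> elts K" for s
      using K that unfolding in_Filt perm_group_def by blast
    have eq: "compose g (compose s (conv g)) = comp' g (comp' s (conv' g))" if "s \<in> elts K" for s
      using comp'_eq[OF bij_func[OF conv_bij[OF gb]] bij_func[OF Kb[OF that]]] conv'_eq[OF bij_func[OF gb]]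
        comp'_eq[OF bij_func[OF compose_bij[OF conv_bij[OF gb] Kb[OF that]]] bij_func[OF gb]] by simp
    have "conjugate g K = hset ((\<lambda>s. comp' g (comp' s (conv' g))) ` elts K)"
      unfolding conjugate_def using eq by (intro arg_cong[of _ _ hset] image_cong refl) blast
    moreover have "hset ((\<lambda>s. comp' g (comp' s (conv' g))) ` elts K) \<in> V"
      using K unfolding in_Filt by (intro dfun_V0[OF dfun_image] dintros gV) blast
    ultimately have "conjugate g K \<in> V" by simp
    moreover have "elts (conjugate g K) \<subseteq> elts (fix_auts (hset {}))"
      unfolding conjugate_def using K G0 g gc unfolding in_Filt by auto
    moreover have "perm_group Cond (conjugate g K)"
      using perm_group_conjugate[OF _ gb] K unfolding in_Filt by blast
    moreover obtain B where "B \<in> elts inv_ideal" "elts (fix_auts B) \<subseteq> elts (conjugate g (fix_auts A))" using conj_fix_auts[OF g A(1)] by blast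
    moreover have "elts (conjugate g (fix_auts A)) \<subseteq> elts (conjugate g K)"
      unfolding conjugate_def using A(2) by auto
    ultimately show ?thesis unfolding in_Filt by blast
  qed
next
  show "hset {ident Cond} \<notin> elts Filt"
  proof
    assume "hset {ident Cond} \<in> elts Filt"
    then obtain A where A: "A \<in> elts inv_ideal" "elts (fix_auts A) \<subseteq> {ident Cond}" unfolding in_Filt by auto
    \<comment> \<open>Flipping the whole extra column fixes all columns in A, which are points of M,
      yet it moves a condition consisting of one cell of that column. So no group in the filter is
      trivial.\<close>
    define b where "b = prodset (hset {star}) J"
    have "b \<in> V" unfolding b_def by (intro dfun_V0[OF dfun_prodset] dintros) simp_all
    have "star \<notin> elts A" using inv_ideal_sub[OF A(1)] star_notin by blast
    then have k: "flips (ident (univ M)) b \<in> elts (fix_perms A)"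
      using inv_ideal_sub[OF A(1)] ext_U[OF G_ident] by (intro flips_fix_perms[OF G_ident \<open>b \<in> V\<close>]) (auto simp: b_def)
    have e: "lift (flips (ident (univ M)) b) = ident Cond" using A(2) k unfolding elts_fix_auts by blast
    have j: "hset {} \<in> elts J" unfolding J_def by simp
    let ?c = "\<langle>\<langle>star, hset {}\<rangle>, bit0\<rangle>"
    have c: "?c \<in> elts C" using j by (simp add: elts_cols elts_two)
    have "img (flips (ident (univ M)) b) (hset {?c}) = hset {?c}"
      using app_lift[OF single_Cond[OF c], of "flips (ident (univ M)) b"] single_Cond[OF c] unfolding e by simp
    then have "app (flips (ident (univ M)) b) ?c \<in> elts (hset {?c})"
      using elts_img[OF fix_perms_bij[OF k], of "hset {?c}"] c by simp
    then show False
      using flips_app[OF c] j star_notin bit0_neq_bit1 unfolding b_def ext_def tog_def by simp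
  qed
qed

lemma symmetric_Sys: "symmetric_system V Sys"
  unfolding symmetric_system_def
  using forcing_Sys normal_Sys fix_auts_group[OF V_empty] aut_Sys[OF _ V_empty] by simp

sublocale symmetric V Sys
  by unfold_locales (rule symmetric_Sys)

end

section \<open>The symmetric copy\<close>

lemma finite_nat_set: "finite (elts (nat_set k))"
  by (induction k) auto

lemma tuple_mem: "t \<in> tuples A k \<Longrightarrow> z \<in> elts t \<Longrightarrow> \<exists>i\<in>elts (nat_set k). z = \<langle>i, app t i\<rangle> \<and> app t i \<in> A"
  unfolding tuples_def using elts_func[of t] func_mem[of t] by blast

lemma tuple_func: "t \<in> tuples A k \<Longrightarrow> is_func t (elts (nat_set k)) A"
  unfolding tuples_def by simp

lemma compose_tuple: "t \<in> tuples A k \<Longrightarrow> is_func f A B \<Longrightarrow> compose f t \<in> tuples B k"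
  unfolding tuples_def using compose_func by blast

lemma compose_ident_tuple:
  fixes t f :: "'i hset"
  assumes "t \<in> tuples A k" "is_bij f A B"
  shows "compose (conv f) (compose f t) = t"
proof (rule func_eqI[OF _ tuple_func[OF assms(1)]])
  note t = tuple_func[OF assms(1)] and f = bij_func[OF assms(2)]
  show "is_func (compose (conv f) (compose f t)) (elts (nat_set k)) A"
    by (rule compose_func[OF compose_func[OF t f] bij_func[OF conv_bij[OF assms(2)]]])
  fix i :: "'i hset" assume i: "i \<in> elts (nat_set k)"
  then show "app (compose (conv f) (compose f t)) i = app t i"
    using app_compose[OF compose_func[OF t f] i] app_compose[OF t i] app_conv_app[OF assms(2) func_mem[OF t i]]
    by simp
qed

lemma compose_conv_tuple:
  fixes u f :: "'i hset"
  assumes "u \<in> tuples B k" "is_bij f A B"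
  shows "compose f (compose (conv f) u) = u"
proof (rule func_eqI[OF _ tuple_func[OF assms(1)]])
  note u = tuple_func[OF assms(1)] and f = bij_func[OF assms(2)] and f' = bij_func[OF conv_bij[OF assms(2)]]
  show "is_func (compose f (compose (conv f) u)) (elts (nat_set k)) B"
    by (rule compose_func[OF compose_func[OF u f'] f])
  fix i :: "'i hset" assume i: "i \<in> elts (nat_set k)"
  then show "app (compose f (compose (conv f) u)) i = app u i"
    using app_compose[OF compose_func[OF u f'] i] app_compose[OF u i] app_app_conv[OF assms(2) func_mem[OF u i]]
    by simp
qed

context symmetric
begin

text \<open>The intersection of finitely many supports is in the filter and fixes each of the names.
  This is what makes names of finite tuples symmetric without completeness of the ideal.\<close>

lemma hs_up_finite:
  assumes B: "finite (elts B)" "B \<in> V" and hs: "\<And>y. y \<in> elts B \<Longrightarrow> hered_symmetric S y"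
  shows "hered_symmetric S (up S B)"
proof -
  have "\<exists>K\<in>elts (filt S). \<forall>y\<in>F. \<forall>\<pi>\<in>elts K. act \<pi> y = y" if "finite F" "F \<subseteq> elts B" for F
    using that
  proof (induction rule: finite_induct)
    case empty
    then show ?case using filt_ne by blast
  next
    case (insert y F)
    then obtain K where K: "K \<in> elts (filt S)" "\<forall>y\<in>F. \<forall>\<pi>\<in>elts K. act \<pi> y = y" by blast
    obtain K' where K': "K' \<in> elts (filt S)" "\<forall>\<pi>\<in>elts K'. act \<pi> y = y"
      using hs_supp[OF hs[of y]] insert(4) by blast
    show ?case by (rule bexI[OF _ filt_inter[OF K(1) K'(1)]]) (use K(2) K'(2) in simp)
  qed
  from this[OF B(1) order_refl] obtain K where "K \<in> elts (filt S)" "\<forall>y\<in>elts B. \<forall>\<pi>\<in>elts K. act \<pi> y = y" by blast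
  then show ?thesis using hs_up[OF B(2) hs] by simp
qed

end

section \<open>Names for elements and tuples of the copy\<close>

locale copy_ext = copy_setup V L M \<G> \<I> \<kappa> for V :: "'i hset set" and L M \<G> \<I> \<kappa> +
  fixes G :: "'i hset set"
  assumes genG: "generic V Sys G"
begin

sublocale symmetric_ext V Sys G
  by unfold_locales (rule genG)

definition sel :: "'i hset \<Rightarrow> 'i hset \<Rightarrow> 'i hset" where
  "sel b i = (if i \<in> elts b then bit1 else bit0)"

text \<open>Names the set of rows at which the generic column m agrees with the characteristic
  function of b, that is, the symmetric difference of the generic subset with the complement of b.
  As b ranges over the subsets of J in V, all modifications from V arise.\<close>

definition alpha :: "'i hset \<Rightarrow> 'i hset \<Rightarrow> 'i hset" where
  "alpha m b = hset ((\<lambda>i. \<langle>hset {\<langle>\<langle>m, i\<rangle>, sel b i\<rangle>}, check Sys i\<rangle>) ` elts J)"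

definition alphas :: "'i hset \<Rightarrow> 'i hset" where
  "alphas m = hset ((\<lambda>b. alpha m b) ` elts (powV J))"

definition elt_name :: "'i hset \<Rightarrow> 'i hset" where
  "elt_name m = up Sys (alphas m)"

definition univ_name :: "'i hset" where
  "univ_name = up Sys (hset ((\<lambda>m. elt_name m) ` U))"

definition tuple_name :: "'i hset \<Rightarrow> 'i hset" where
  "tuple_name t = up Sys (hset ((\<lambda>z. opn Sys (check Sys (hfst z)) (elt_name (hsnd z))) ` elts t))"

lemma sel_two: "sel b i \<in> elts two"
  unfolding sel_def elts_two by simp

lemma dfun_sel [dintros]: "dfun s \<Longrightarrow> dfun t \<Longrightarrow> dfun (\<lambda>e. sel (s e) (t e))"
  unfolding sel_def by (intro dintros) simp_all

lemma dfun_alpha [dintros]: "dfun s \<Longrightarrow> dfun t \<Longrightarrow> dfun (\<lambda>e. alpha (s e) (t e))"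
proof (rule dfun_comp2[of alpha])
  show "dfun (\<lambda>e. alpha (e 0) (e (Suc 0)))" unfolding alpha_def by (intro dintros) simp_all
qed

lemma dfun_alphas [dintros]: "dfun s \<Longrightarrow> dfun (\<lambda>e. alphas (s e))"
proof (rule dfun_comp1[of alphas])
  show "dfun (\<lambda>e. alphas (e 0))" unfolding alphas_def by (intro dintros) simp_all
qed

lemma dfun_elt_name [dintros]: "dfun s \<Longrightarrow> dfun (\<lambda>e. elt_name (s e))"
  unfolding elt_name_def by (intro dfun_up dfun_alphas)

lemma dfun_tuple_name [dintros]: "dfun s \<Longrightarrow> dfun (\<lambda>e. tuple_name (s e))"
  unfolding tuple_name_def by (intro dfun_up dfun_image dfun_opn dfun_check dfun_elt_name dfun_hfst dfun_hsnd dfun_var)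

lemma univ_name_V [simp]: "univ_name \<in> V"
  unfolding univ_name_def by (intro dfun_V0[OF dfun_up] dfun_image dfun_elt_name dfun_var dfun_const univ_V)

lemma V_elt_name [simp]: "m \<in> V \<Longrightarrow> elt_name m \<in> V" by (intro dfun_V0[OF dfun_elt_name] dintros)
lemma V_tuple_name [simp]: "t \<in> V \<Longrightarrow> tuple_name t \<in> V" by (intro dfun_V0[OF dfun_tuple_name] dintros)
lemma V_alphas [simp]: "m \<in> V \<Longrightarrow> alphas m \<in> V" by (intro dfun_V0[OF dfun_alphas] dintros)
lemma V_alpha [simp]: "m \<in> V \<Longrightarrow> b \<in> V \<Longrightarrow> alpha m b \<in> V" by (intro dfun_V0[OF dfun_alpha] dintros)

lemma U_V: "m \<in> U \<Longrightarrow> m \<in> V" using V_trans[OF univ_V] .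
lemma U_cols: "m \<in> U \<Longrightarrow> m \<in> elts cols" unfolding elts_cols by simp
lemma cols_mem_V: "m \<in> elts cols \<Longrightarrow> m \<in> V" using V_trans[OF cols_V] .
lemma elts_alpha: "elts (alpha m b) = (\<lambda>i. \<langle>hset {\<langle>\<langle>m, i\<rangle>, sel b i\<rangle>}, check Sys i\<rangle>) ` elts J"
  unfolding alpha_def by simp

lemma elts_alphas: "elts (alphas m) = alpha m ` elts (powV J)"
  unfolding alphas_def by (rule elts_hset) (rule small_image, rule small_elts)

lemma empty_J [simp]: "hset {} \<in> elts J"
  unfolding J_def by simp

lemma alpha_name:
  assumes m: "m \<in> elts cols"
  shows "is_name Sys (alpha m b)"
proof (rule is_name.intros, rule ballI)
  fix z assume "z \<in> elts (alpha m b)"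
  then obtain i where "i \<in> elts J" "z = \<langle>hset {\<langle>\<langle>m, i\<rangle>, sel b i\<rangle>}, check Sys i\<rangle>" unfolding elts_alpha by blast
  moreover from this have "hset {\<langle>\<langle>m, i\<rangle>, sel b i\<rangle>} \<in> elts (conds Sys)"
    using single_Cond m sel_two by simp
  ultimately show "\<exists>p\<in>elts (conds Sys). \<exists>y. z = \<langle>p, y\<rangle> \<and> is_name Sys y" using is_name_check by blast
qed

lemma elt_name_name: "m \<in> elts cols \<Longrightarrow> is_name Sys (elt_name m)"
  unfolding elt_name_def using alpha_name elts_alphas empty_Cond by (intro is_name_up) auto

lemma lift_top: "k \<in> elts (fix_perms A) \<Longrightarrow> app (lift k) (top_cond Sys) = top_cond Sys"
  using empty_Cond by (simp add: img_def)

text \<open>A permutation over \<open>\<pi>\<close> moves the column \<open>m\<close> to \<open>\<pi> m\<close> up to a change of coordinates in \<open>V\<close>, which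
  the set \<open>elt_name m\<close> of all such modifications absorbs.\<close>

lemma act_alpha:
  assumes k: "k \<in> elts (fix_perms A)" and \<pi>: "\<pi> \<in> elts \<G>" "over k \<pi>" and m: "m \<in> elts cols"
  shows "act (lift k) (alpha m b) = alpha (ext \<pi> m) (hset {i \<in> elts J. app k \<langle>\<langle>m, i\<rangle>, sel b i\<rangle> = \<langle>\<langle>ext \<pi> m, i\<rangle>, bit1\<rangle>})"
proof (rule elts_inj)
  let ?b = "hset {i \<in> elts J. app k \<langle>\<langle>m, i\<rangle>, sel b i\<rangle> = \<langle>\<langle>ext \<pi> m, i\<rangle>, bit1\<rangle>}"
  note kb = fix_perms_bij[OF k]
  have "\<langle>app (lift k) (hset {\<langle>\<langle>m, i\<rangle>, sel b i\<rangle>}), act (lift k) (check Sys i)\<rangle> =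
      \<langle>hset {\<langle>\<langle>ext \<pi> m, i\<rangle>, sel ?b i\<rangle>}, check Sys i\<rangle>" if i: "i \<in> elts J" for i
  proof -
    let ?c = "\<langle>\<langle>m, i\<rangle>, sel b i\<rangle>"
    have c: "?c \<in> elts C" using m i sel_two by simp
    have "hfst (app k ?c) = \<langle>ext \<pi> m, i\<rangle>"
      using \<pi>(2)[unfolded over_app[OF kb], rule_format, OF c] by simp
    moreover obtain n j e where e: "app k ?c = \<langle>\<langle>n, j\<rangle>, e\<rangle>" "e \<in> elts two" using bij_mem[OF kb c] in_C by blast
    ultimately have kc: "app k ?c = \<langle>\<langle>ext \<pi> m, i\<rangle>, e\<rangle>" by simp
    have "sel ?b i = e" using e(2) i kc bit0_neq_bit1 unfolding sel_def mem_sep elts_two by auto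
    moreover have "img k (hset {?c}) = hset {app k ?c}"
      by (rule elts_inj) (use elts_img[OF kb, of "hset {?c}"] c in simp)
    ultimately show ?thesis
      using app_lift[OF single_Cond[OF c]] act_check[OF lift_top[OF k]] kc by simp
  qed
  then show "elts (act (lift k) (alpha m b)) = elts (alpha (ext \<pi> m) ?b)"
    unfolding act_name[OF alpha_name[OF m]] elts_alpha image_image by (intro image_cong refl) simp
qed

lemma act_alphas_sub:
  assumes k: "k \<in> elts (fix_perms A)" and \<pi>: "\<pi> \<in> elts \<G>" "over k \<pi>" and m: "m \<in> elts cols"
    and y: "y \<in> elts (alphas m)"
  shows "act (lift k) y \<in> elts (alphas (ext \<pi> m))"
proof -
  obtain b where b: "y = alpha m b" "b \<in> V" using y unfolding elts_alphas by auto
  let ?b = "hset {i \<in> elts J. app k \<langle>\<langle>m, i\<rangle>, sel b i\<rangle> = \<langle>\<langle>ext \<pi> m, i\<rangle>, bit1\<rangle>}"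
  \<comment> \<open>The modifying set has to lie in V; with \<open>ap\<close> in place of
    \<open>app\<close> it is a definable subset of J.\<close>
  have "?b = hset {i \<in> elts J. ap k \<langle>\<langle>m, i\<rangle>, sel b i\<rangle> = \<langle>\<langle>ext \<pi> m, i\<rangle>, bit1\<rangle>}"
    using ap_eq_app[OF bij_func[OF fix_perms_bij[OF k]]] m sel_two
    by (intro arg_cong[of _ _ hset] Collect_cong conj_cong refl) simp
  also have "\<dots> \<in> V"
    by (intro dfun_V0[OF dfun_sep] dintros fix_perms_V[OF k] b(2) cols_mem_V[OF m] V_trans[OF G_V \<pi>(1)] bit1_V J_V)
  finally have "?b \<in> elts (powV J)" by simp
  then show ?thesis unfolding b(1) act_alpha[OF k \<pi> m] elts_alphas by (rule imageI)
qed

lemma act_elt_name: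
  assumes A: "A \<in> V" and k: "k \<in> elts (fix_perms A)" and \<pi>: "\<pi> \<in> elts \<G>" "over k \<pi>" and m: "m \<in> elts cols"
  shows "act (lift k) (elt_name m) = elt_name (ext \<pi> m)"
proof -
  have k': "conv k \<in> elts (fix_perms A)" using fix_perms_group[OF A] k unfolding perm_group_def by blast
  note \<pi>' = G_conv[OF \<pi>(1)] over_conv[OF fix_perms_bij[OF k] \<pi>]
  note m' = ext_cols[OF \<pi>(1) m]
  \<comment> \<open>The reverse inclusion comes from the inverse permutation, which lies over the
    inverse of \<open>\<pi>\<close>.\<close>
  have "elts (alphas (ext \<pi> m)) \<subseteq> act (lift k) ` elts (alphas m)"
  proof
    fix y assume y: "y \<in> elts (alphas (ext \<pi> m))"
    have "act (lift (conv k)) y \<in> elts (alphas m)"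
      using act_alphas_sub[OF k' \<pi>' m' y] ext_conv(1)[OF \<pi>(1)] by simp
    moreover have "is_name Sys y" using y alpha_name[OF m'] unfolding elts_alphas by blast
    then have "act (lift k) (act (lift (conv k)) y) = y"
      using act_conv(1)[of "lift k" Sys y] lift_bij[OF A k] lift_conv[OF A k] by simp
    ultimately show "y \<in> act (lift k) ` elts (alphas m)" by (metis imageI)
  qed
  then have "act (lift k) ` elts (alphas m) = elts (alphas (ext \<pi> m))"
    using act_alphas_sub[OF k \<pi> m] by blast
  then show ?thesis unfolding elt_name_def act_up[OF lift_top[OF k]] by simp
qed

text \<open>One fixed cell of the column suffices, since its image lies in the translated column.
  The empty set is a row, so every column has a cell.\<close>

lemma fix_perms_fix: "k \<in> elts (fix_perms A) \<Longrightarrow> over k \<pi> \<Longrightarrow> m \<in> elts A \<Longrightarrow> m \<in> elts cols \<Longrightarrow> ext \<pi> m = m"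
proof -
  assume k: "k \<in> elts (fix_perms A)" and o: "over k \<pi>" and m: "m \<in> elts A" "m \<in> elts cols"
  let ?c = "\<langle>\<langle>m, hset {}\<rangle>, bit0\<rangle>"
  have c: "?c \<in> elts C" using m(2) by (simp add: elts_two)
  have "app k ?c = ?c" using k m c unfolding in_fix_perms by simp
  then show "ext \<pi> m = m" using o[unfolded over_app[OF fix_perms_bij[OF k]], rule_format, OF c] by simp
qed

lemma fix_auts_E:
  assumes "g \<in> elts (fix_auts A)"
  obtains k \<pi> where "g = lift k" "k \<in> elts (fix_perms A)" "\<pi> \<in> elts \<G>" "over k \<pi>"
proof -
  obtain k where k: "g = lift k" "k \<in> elts (fix_perms A)" using assms unfolding elts_fix_auts by blast
  then obtain \<pi> where "\<pi> \<in> elts \<G>" "over k \<pi>" unfolding in_fix_perms by blast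
  then show ?thesis using that k by blast
qed

text \<open>The singleton of m is a support: a permutation fixing the cells of column m leaves the
  comparison with b unchanged in that column. Singletons belong to the invariant ideal.\<close>

lemma hs_alpha:
  assumes m: "m \<in> U" and b: "b \<in> elts (powV J)"
  shows "hered_symmetric Sys (alpha m b)"
proof (rule hsI[OF alpha_name[OF U_cols[OF m]]])
  show "alpha m b \<in> V" using U_V[OF m] b by simp
  show "hered_symmetric Sys (hsnd w)" if w: "w \<in> elts (alpha m b)" for w
  proof -
    obtain i where "i \<in> elts J" "w = \<langle>hset {\<langle>\<langle>m, i\<rangle>, sel b i\<rangle>}, check Sys i\<rangle>"
      using w unfolding elts_alpha by blast
    then show ?thesis using hs_check V_trans[OF J_V] by simp
  qed
  show "fix_auts (hset {m}) \<in> elts (filt Sys)" using fix_auts_Filt[OF inv_ideal_single[OF m]] by simp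
  fix g assume "g \<in> elts (fix_auts (hset {m}))"
  then obtain k \<pi> where k: "g = lift k" "k \<in> elts (fix_perms (hset {m}))" "\<pi> \<in> elts \<G>" "over k \<pi>" by (rule fix_auts_E)
  have e: "ext \<pi> m = m" using fix_perms_fix[OF k(2,4)] U_cols[OF m] by simp
  have "app k \<langle>\<langle>m, i\<rangle>, sel b i\<rangle> = \<langle>\<langle>m, i\<rangle>, sel b i\<rangle>" if "i \<in> elts J" for i
    using k(2) that sel_two U_cols[OF m] unfolding in_fix_perms by simp
  then have "app k \<langle>\<langle>m, i\<rangle>, sel b i\<rangle> = \<langle>\<langle>m, i\<rangle>, bit1\<rangle> \<longleftrightarrow> i \<in> elts b" if "i \<in> elts J" for i
    using that bit0_neq_bit1 by (simp add: sel_def)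
  then have "hset {i \<in> elts J. app k \<langle>\<langle>m, i\<rangle>, sel b i\<rangle> = \<langle>\<langle>m, i\<rangle>, bit1\<rangle>} = hset {i \<in> elts J. i \<in> elts b}"
    by (intro arg_cong[of _ _ hset] Collect_cong) blast
  also have "\<dots> = b" using b by (intro elts_inj) auto
  finally have "hset {i \<in> elts J. app k \<langle>\<langle>m, i\<rangle>, sel b i\<rangle> = \<langle>\<langle>m, i\<rangle>, bit1\<rangle>} = b" .
  then show "act g (alpha m b) = alpha m b"
    using act_alpha[OF k(2-4) U_cols[OF m], of b] unfolding k(1) e by simp
qed

lemma hs_elt_name:
  assumes m: "m \<in> U"
  shows "hered_symmetric Sys (elt_name m)"
  unfolding elt_name_def
proof (rule hs_up)
  show "alphas m \<in> V" using U_V[OF m] by simp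
  show "hered_symmetric Sys y" if "y \<in> elts (alphas m)" for y using that hs_alpha[OF m] unfolding elts_alphas by blast
  show "fix_auts (hset {m}) \<in> elts (filt Sys)" using fix_auts_Filt[OF inv_ideal_single[OF m]] by simp
  fix g y assume "g \<in> elts (fix_auts (hset {m}))" and y: "y \<in> elts (alphas m)"
  from this(1) obtain k \<pi> where k: "g = lift k" "k \<in> elts (fix_perms (hset {m}))" "\<pi> \<in> elts \<G>" "over k \<pi>" by (rule fix_auts_E)
  have e: "ext \<pi> m = m" using fix_perms_fix[OF k(2,4)] U_cols[OF m] by simp
  show "act g y \<in> elts (alphas m)" using act_alphas_sub[OF k(2-4) U_cols[OF m] y] unfolding k(1) e .
qed

lemma KA0_Filt: "fix_auts (hset {}) \<in> elts (filt Sys)"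
  using fix_auts_Filt[OF inv_ideal_empty] by simp

text \<open>The whole group fixes this name, because an automorphism over \<open>\<pi>\<close>
  permutes the names of elements just as \<open>\<pi>\<close> permutes M.\<close>

lemma hs_univ_name: "hered_symmetric Sys univ_name"
  unfolding univ_name_def
proof (rule hs_up[OF _ _ KA0_Filt])
  show "hset (elt_name ` U) \<in> V" by (intro dfun_V0[OF dfun_image[where F = "\<lambda>x e. elt_name x"]] dintros univ_V)
  show "hered_symmetric Sys y" if "y \<in> elts (hset (elt_name ` U))" for y using that hs_elt_name by auto
  fix g y assume "g \<in> elts (fix_auts (hset {}))" and y: "y \<in> elts (hset (elt_name ` U))"
  from this(1) obtain k \<pi> where k: "g = lift k" "k \<in> elts (fix_perms (hset {}))" "\<pi> \<in> elts \<G>" "over k \<pi>" by (rule fix_auts_E)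
  obtain m where m: "m \<in> U" "y = elt_name m" using y by auto
  have "act g y = elt_name (app \<pi> m)"
    unfolding k(1) m(2) using act_elt_name[OF V_empty k(2-4) U_cols[OF m(1)]] ext_U[OF k(3) m(1)] by simp
  then show "act g y \<in> elts (hset (elt_name ` U))" using bij_mem[OF G_bij[OF k(3)] m(1)] by simp
qed

text \<open>A tuple is finite and its entries lie in V, so no tuple is lost by forming tuples
  externally.\<close>

lemma tuples_V: "t \<in> tuples U k \<Longrightarrow> t \<in> V"
proof -
  assume t: "t \<in> tuples U k"
  have "elts t = (\<lambda>i. \<langle>i, app t i\<rangle>) ` elts (nat_set k)" by (rule elts_func[OF tuple_func[OF t]])
  then have "finite (elts t)" by (simp add: finite_nat_set)
  moreover have "elts t \<subseteq> V" using tuple_mem[OF t] U_V V_trans[OF V_nat_set] by fastforce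
  ultimately show "t \<in> V" using V_finite[of "elts t"] by simp
qed

lemma finite_tuple: "t \<in> tuples U k \<Longrightarrow> finite (elts t)"
  using elts_func[OF tuple_func, of t U k] by (simp add: finite_nat_set)

lemma tuples_set_ex: "\<exists>T\<in>V. elts T = tuples U k"
proof -
  have NM: "prodset (nat_set k) (univ M) \<in> V" by (intro dfun_V0[OF dfun_prodset] dintros) simp_all
  have "hset {t \<in> elts (powV (prodset (nat_set k) (univ M))). is_func t (elts (nat_set k)) U} \<in> V"
    by (intro dfun_V0[OF dfun_sep] dintros NM V_nat_set univ_V)
  moreover have sub: "elts t \<subseteq> elts (prodset (nat_set k) (univ M))" if "t \<in> tuples U k" for t
    using tuple_mem[OF that] unfolding elts_prodset by blast
  have "t \<in> elts (hset {t \<in> elts (powV (prodset (nat_set k) (univ M))). is_func t (elts (nat_set k)) U}) \<longleftrightarrow>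
      t \<in> tuples U k" for t
    unfolding mem_sep using sub[of t] NM tuples_V[of t k] by (auto simp: tuples_def)
  then have "elts (hset {t \<in> elts (powV (prodset (nat_set k) (univ M))). is_func t (elts (nat_set k)) U}) = tuples U k"
    by blast
  ultimately show ?thesis by blast
qed

lemma tuple_name_name:
  assumes t: "t \<in> tuples U k"
  shows "is_name Sys (tuple_name t)"
proof -
  have "is_name Sys (opn Sys (check Sys (hfst z)) (elt_name (hsnd z)))" if "z \<in> elts t" for z
    using tuple_mem[OF t that] elt_name_name[OF U_cols] is_name_check empty_Cond by (auto intro!: is_name_opn)
  then show ?thesis unfolding tuple_name_def using empty_Cond by (intro is_name_up) auto
qed

lemma hs_tuple_name:
  assumes t: "t \<in> tuples U k"
  shows "hered_symmetric Sys (tuple_name t)"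
  unfolding tuple_name_def
proof (rule hs_up_finite)
  show "finite (elts (hset ((\<lambda>z. opn Sys (check Sys (hfst z)) (elt_name (hsnd z))) ` elts t)))"
    using finite_tuple[OF t] by simp
  show "hset ((\<lambda>z. opn Sys (check Sys (hfst z)) (elt_name (hsnd z))) ` elts t) \<in> V"
    using tuples_V[OF t] by (intro dfun_V0[OF dfun_image] dintros)
  fix y assume "y \<in> elts (hset ((\<lambda>z. opn Sys (check Sys (hfst z)) (elt_name (hsnd z))) ` elts t))"
  then obtain z where z: "z \<in> elts t" "y = opn Sys (check Sys (hfst z)) (elt_name (hsnd z))" by auto
  obtain i where i: "i \<in> elts (nat_set k)" "z = \<langle>i, app t i\<rangle>" "app t i \<in> U" using tuple_mem[OF t z(1)] by blast
  then have "i \<in> V" using V_trans[OF V_nat_set] by blast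
  then show "hered_symmetric Sys y"
    unfolding z(2) i(2) hfst_opair hsnd_opair using hs_elt_name[OF i(3)] U_V[OF i(3)] by (intro hs_opn hs_check) simp_all
qed

lemma act_tuple_name:
  assumes A: "A \<in> V" and k: "k \<in> elts (fix_perms A)" and \<pi>: "\<pi> \<in> elts \<G>" "over k \<pi>" and t: "t \<in> tuples U j"
  shows "act (lift k) (tuple_name t) = tuple_name (compose \<pi> t)"
proof -
  have "act (lift k) (opn Sys (check Sys (hfst z)) (elt_name (hsnd z))) =
      opn Sys (check Sys (hfst z)) (elt_name (app \<pi> (hsnd z)))" if "z \<in> elts t" for z
  proof -
    have z: "hsnd z \<in> U" using tuple_mem[OF t that] by auto
    show ?thesis
      unfolding act_opn[OF lift_top[OF k]] act_check[OF lift_top[OF k]]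
      using act_elt_name[OF A k \<pi> U_cols[OF z]] ext_U[OF \<pi>(1) z] by simp
  qed
  moreover have "elts (compose \<pi> t) = (\<lambda>z. \<langle>hfst z, app \<pi> (hsnd z)\<rangle>) ` elts t"
    unfolding elts_compose[OF tuple_func[OF t]] elts_func[OF tuple_func[OF t]] by (simp add: image_image)
  ultimately show ?thesis unfolding tuple_name_def act_up[OF lift_top[OF k]]
    by (simp add: image_image del: elts_hset) (simp add: image_image cong: image_cong)
qed

section \<open>The generic bijection between M and its copy\<close>

definition n :: "'i hset \<Rightarrow> 'i hset" where "n m = val G (elt_name m)"

definition iso :: "'i hset" where "iso = hset ((\<lambda>m. \<langle>m, n m\<rangle>) ` U)"

lemma mem_val_alpha: "i \<in> elts (val G (alpha m b)) \<longleftrightarrow> i \<in> elts J \<and> hset {\<langle>\<langle>m, i\<rangle>, sel b i\<rangle>} \<in> G"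
proof -
  have "\<langle>p, y\<rangle> \<in> elts (alpha m b) \<longleftrightarrow> (\<exists>i\<in>elts J. p = hset {\<langle>\<langle>m, i\<rangle>, sel b i\<rangle>} \<and> y = check Sys i)" for p y
    unfolding elts_alpha by auto
  then have "i \<in> elts (val G (alpha m b)) \<longleftrightarrow>
      (\<exists>p\<in>G. \<exists>y. \<exists>j\<in>elts J. p = hset {\<langle>\<langle>m, j\<rangle>, sel b j\<rangle>} \<and> y = check Sys j \<and> i = val G y)"
    unfolding mem_val by blast
  also have "\<dots> \<longleftrightarrow> (\<exists>j\<in>elts J. hset {\<langle>\<langle>m, j\<rangle>, sel b j\<rangle>} \<in> G \<and> i = val G (check Sys j))" by blast
  finally show ?thesis unfolding val_check by blast
qed

lemma elts_n: "elts (n m) = (\<lambda>b. val G (alpha m b)) ` elts (powV J)"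
  unfolding n_def elt_name_def val_up[OF top_G] elts_alphas by (simp add: image_image)

text \<open>If every row occurred in p, the projection of cells to rows would bound the power set of
  X by X, against Cantor's theorem.\<close>

lemma free_index:
  assumes "p \<in> elts Cond"
  shows "\<exists>i\<in>elts J. \<forall>c\<in>elts p. hsnd (hfst c) \<noteq> i"
proof (rule ccontr)
  assume "\<not> ?thesis"
  then have "\<exists>c\<in>elts p. i = hsnd (hfst c)" if "i \<in> elts J" for i using that by metis
  then have sub: "elts J \<subseteq> (\<lambda>c. hsnd (hfst c)) ` elts p" by blast
  have "dfun (\<lambda>e. hsnd (hfst (e 0)))" by (intro dintros)
  from dominated_image[OF _ this sub] have "dominated X J" using assms unfolding in_Cond by simp
  then show False using not_dominated_powV[OF X(1)] unfolding J_def by blast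
qed

lemma G_sub: "p \<in> G \<Longrightarrow> c \<in> elts p \<Longrightarrow> hset {c} \<in> G"
proof -
  assume p: "p \<in> G" and c: "c \<in> elts p"
  then have "p \<in> elts Cond" using G_P by simp
  then have "\<langle>p, hset {c}\<rangle> \<in> elts (leq Sys)" using c single_Cond[of c] Cond_sub[of p] by auto
  then show ?thesis using G_up[OF p] by blast
qed

lemma G_consistent: "hset {\<langle>a, e\<rangle>} \<in> G \<Longrightarrow> hset {\<langle>a, e'\<rangle>} \<in> G \<Longrightarrow> e = e'"
proof -
  assume "hset {\<langle>a, e\<rangle>} \<in> G" "hset {\<langle>a, e'\<rangle>} \<in> G"
  then obtain r where r: "r \<in> G" "\<langle>r, hset {\<langle>a, e\<rangle>}\<rangle> \<in> elts (leq Sys)" "\<langle>r, hset {\<langle>a, e'\<rangle>}\<rangle> \<in> elts (leq Sys)"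
    using G_compat by blast
  then have "functional r" using G_P[OF r(1)] unfolding Sys_simps in_Cond by blast
  then show ?thesis using r(2,3) functionalD[of r a e e'] by simp
qed

text \<open>If two columns had the same class, the value for column m with empty pattern would equal
  the value for column m' with some pattern b in V. A fresh row allows any condition to be extended
  so as to contradict this equality.\<close>

lemma n_inj:
  assumes m: "m \<in> U" "m' \<in> U" and eq: "n m = n m'"
  shows "m = m'"
proof (rule ccontr)
  assume ne: "m \<noteq> m'"
  have "val G (alpha m (hset {})) \<in> elts (n m')" unfolding eq[symmetric] elts_n by auto
  then obtain b where b: "b \<in> elts (powV J)" "val G (alpha m (hset {})) = val G (alpha m' b)" unfolding elts_n by auto
  \<comment> \<open>At the row i, bit 0 in column m puts i into the value with empty pattern, while
    column m' receives the bit opposite to that prescribed by b. The opposite bit is written as the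
    bit of the complement of b, which lies in V.\<close>
  define D where "D p \<longleftrightarrow> (\<exists>i\<in>elts J. \<langle>\<langle>m, i\<rangle>, bit0\<rangle> \<in> elts p \<and> \<langle>\<langle>m', i\<rangle>, sel (hset {i \<in> elts J. i \<notin> elts b}) i\<rangle> \<in> elts p)" for p
  have "dpred (\<lambda>e. D (e 0))" unfolding D_def
    by (intro dintros J_V bit0_V U_V[OF m(1)] U_V[OF m(2)]) (use b(1) in simp)
  moreover have "\<exists>r\<in>P. r \<preceq> q \<and> D r" if "q \<in> P" for q
  proof -
    have q: "q \<in> elts Cond" using that by simp
    obtain i where i: "i \<in> elts J" "\<forall>c\<in>elts q. hsnd (hfst c) \<noteq> i" using free_index[OF q] by blast
    let ?e = "sel (hset {i \<in> elts J. i \<notin> elts b}) i"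
    let ?c = "\<langle>\<langle>m, i\<rangle>, bit0\<rangle>" and ?d = "\<langle>\<langle>m', i\<rangle>, ?e\<rangle>"
    have c: "?c \<in> elts C" "?d \<in> elts C" using i(1) U_cols[OF m(1)] U_cols[OF m(2)] sel_two by (simp_all add: elts_two)
    have fresh: "\<langle>\<langle>x, i\<rangle>, y\<rangle> \<notin> elts q" for x y using i(2) by force
    have qf: "functional q" using q unfolding in_Cond by blast
    define r1 where "r1 = hset (elts q \<union> elts (hset {?c}))"
    have r1: "elts r1 = insert ?c (elts q)" unfolding r1_def by simp
    have "r1 \<in> elts Cond"
      unfolding r1_def
    proof (rule Un_Cond[OF q single_Cond[OF c(1)]])
      show "functional (hset (elts q \<union> elts (hset {?c})))"
        using functionalD[OF qf] fresh functional_pair[OF qf] by (intro functionalI) (simp, metis, auto)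
    qed
    define r where "r = hset (elts r1 \<union> elts (hset {?d}))"
    have r: "elts r = insert ?d (insert ?c (elts q))" unfolding r_def using r1 by simp
    have "r \<in> elts Cond"
      unfolding r_def
    proof (rule Un_Cond[OF \<open>r1 \<in> elts Cond\<close> single_Cond[OF c(2)]])
      have r1f: "functional r1" using \<open>r1 \<in> elts Cond\<close> unfolding in_Cond by blast
      have fresh': "\<langle>\<langle>m', i\<rangle>, y\<rangle> \<notin> elts r1" for y unfolding r1 using fresh ne by simp
      show "functional (hset (elts r1 \<union> elts (hset {?d})))"
        using functionalD[OF r1f] fresh' functional_pair[OF r1f] by (intro functionalI) (simp, metis, auto)
    qed
    then have "r \<preceq> q" "D r" using q r i(1) unfolding D_def by auto
    then show ?thesis using \<open>r \<in> elts Cond\<close> by auto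
  qed
  ultimately obtain p where p: "p \<in> G" "D p" using G_dense[of D] by blast
  then obtain i where i: "i \<in> elts J" "\<langle>\<langle>m, i\<rangle>, bit0\<rangle> \<in> elts p"
    "\<langle>\<langle>m', i\<rangle>, sel (hset {i \<in> elts J. i \<notin> elts b}) i\<rangle> \<in> elts p" unfolding D_def by blast
  have "i \<in> elts (val G (alpha m (hset {})))"
    unfolding mem_val_alpha using i(1) G_sub[OF p(1) i(2)] by (simp add: sel_def)
  then have "hset {\<langle>\<langle>m', i\<rangle>, sel b i\<rangle>} \<in> G" unfolding b(2) mem_val_alpha by blast
  then have "sel b i = sel (hset {i \<in> elts J. i \<notin> elts b}) i"
    using G_consistent G_sub[OF p(1) i(3)] by blast
  then show False using i(1) bit0_neq_bit1 unfolding sel_def mem_sep by (auto split: if_splits)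
qed

lemma elts_iso: "elts iso = (\<lambda>m. \<langle>m, n m\<rangle>) ` U"
  unfolding iso_def by simp

lemma elts_N: "elts (val G univ_name) = n ` U"
  unfolding univ_name_def val_up[OF top_G] n_def by (simp add: image_image)

lemma iso_bij: "is_bij iso U (elts (val G univ_name))"
  unfolding iso_def elts_N by (rule graph_bij) (auto simp: bij_betw_def inj_on_def dest: n_inj)

lemma app_iso: "m \<in> U \<Longrightarrow> app iso m = n m"
  by (rule app_eq[OF elts_iso])

text \<open>The name pairs each check name with the corresponding \<open>elt_name\<close>. A
  permutation keeps the first and moves the second, so only membership in the full generic extension
  is claimed.\<close>

lemma iso_VG: "iso \<in> generic_extension V Sys G"
proof -
  let ?B = "hset ((\<lambda>m. opn Sys (check Sys m) (elt_name m)) ` U)"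
  have "val G (up Sys ?B) = iso"
    by (rule elts_inj) (simp add: val_up[OF top_G] image_image val_opn[OF top_G] elts_iso n_def)
  moreover have "?B \<in> V" by (intro dfun_V0[OF dfun_image] dintros univ_V)
  moreover have "is_name Sys (up Sys ?B)"
    using is_name_check elt_name_name U_cols empty_Cond by (intro is_name_up) (auto intro!: is_name_opn)
  ultimately show ?thesis using VG_I[of "up Sys ?B"] by simp
qed

lemma val_tuple_name: "t \<in> tuples U k \<Longrightarrow> val G (tuple_name t) = compose iso t"
proof -
  assume t: "t \<in> tuples U k"
  have "elts (val G (tuple_name t)) = (\<lambda>z. \<langle>hfst z, n (hsnd z)\<rangle>) ` elts t"
    unfolding tuple_name_def val_up[OF top_G] by (simp add: image_image val_opn[OF top_G] n_def)
  also have "\<dots> = elts (compose iso t)"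
    unfolding elts_compose[OF tuple_func[OF t]] elts_func[OF tuple_func[OF t]] image_image
    using app_iso func_mem[OF tuple_func[OF t]] by (intro image_cong refl) simp
  finally show ?thesis by (rule elts_inj)
qed


section \<open>The relations and functions of the copy\<close>

definition rel_name :: "'i hset \<Rightarrow> 'i hset" where
  "rel_name R = up Sys (hset ((\<lambda>t. tuple_name t) ` elts R))"

definition fun_name :: "'i hset \<Rightarrow> 'i hset" where
  "fun_name F = up Sys (hset ((\<lambda>w. opn Sys (tuple_name (hfst w)) (elt_name (hsnd w))) ` elts F))"

definition rels_name :: "'i hset" where
  "rels_name = up Sys (hset ((\<lambda>z. opn Sys (check Sys (hfst z)) (rel_name (hsnd z))) ` elts (rels M)))"

definition funs_name :: "'i hset" where
  "funs_name = up Sys (hset ((\<lambda>z. opn Sys (check Sys (hfst z)) (fun_name (hsnd z))) ` elts (funs M)))"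

definition N :: "'i struct" where
  "N = \<lparr>univ = val G univ_name, rels = val G rels_name, funs = val G funs_name\<rparr>"

lemma N_simps [simp]: "univ N = val G univ_name" "rels N = val G rels_name" "funs N = val G funs_name"
  unfolding N_def by simp_all

abbreviation U' :: "'i hset set" where "U' \<equiv> elts (val G univ_name)"

lemma dfun_rel_name: "dfun s \<Longrightarrow> dfun (\<lambda>e. rel_name (s e))"
  unfolding rel_name_def by (intro dfun_up dfun_image dfun_tuple_name dfun_var)

lemma dfun_fun_name: "dfun s \<Longrightarrow> dfun (\<lambda>e. fun_name (s e))"
  unfolding fun_name_def by (intro dfun_up dfun_image dfun_opn dfun_tuple_name dfun_elt_name dfun_hfst dfun_hsnd dfun_var)

lemma rels_V [simp]: "rels M \<in> V" and funs_V [simp]: "funs M \<in> V"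
  and rels_func: "is_func (rels M) (fdom (rel_ar L)) UNIV" and funs_func: "is_func (funs M) (fdom (fun_ar L)) UNIV"
  and rel_tuples: "rel_symb L r k \<Longrightarrow> elts (app (rels M) r) \<subseteq> tuples U k"
  and fun_func: "fun_symb L g k \<Longrightarrow> is_func (app (funs M) g) (tuples U k) U"
  using struct unfolding struct_in_def by simp_all

lemma rel_sym_ex: "r \<in> fdom (rel_ar L) \<Longrightarrow> \<exists>k. rel_symb L r k"
proof -
  assume "r \<in> fdom (rel_ar L)"
  then obtain b where b: "\<langle>r, b\<rangle> \<in> elts (rel_ar L)" unfolding fdom_def by blast
  have "is_func (rel_ar L) (fdom (rel_ar L)) (range nat_set)" using lang unfolding lang_in_def by blast
  then have "b \<in> range nat_set" using b unfolding is_func_def by fastforce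
  then show ?thesis using b by blast
qed

lemma fun_sym_ex: "g \<in> fdom (fun_ar L) \<Longrightarrow> \<exists>k. fun_symb L g k"
proof -
  assume "g \<in> fdom (fun_ar L)"
  then obtain b where b: "\<langle>g, b\<rangle> \<in> elts (fun_ar L)" unfolding fdom_def by blast
  have "is_func (fun_ar L) (fdom (fun_ar L)) (range nat_set)" using lang unfolding lang_in_def by blast
  then have "b \<in> range nat_set" using b unfolding is_func_def by fastforce
  then show ?thesis using b by blast
qed

lemma aut_iso: "\<pi> \<in> elts \<G> \<Longrightarrow> isomorphism L M M \<pi>"
  using aut unfolding aut_group_in_def by blast

lemma aut_rel: "\<pi> \<in> elts \<G> \<Longrightarrow> rel_symb L r k \<Longrightarrow> t \<in> elts (app (rels M) r) \<Longrightarrow> compose \<pi> t \<in> elts (app (rels M) r)"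
  using aut_iso[of \<pi>] rel_tuples[of r k] unfolding isomorphism_def by blast

lemma aut_fun:
  assumes \<pi>: "\<pi> \<in> elts \<G>" and g: "fun_symb L g k" and t: "t \<in> tuples U k"
  shows "app \<pi> (app (app (funs M) g) t) = app (app (funs M) g) (compose \<pi> t)"
  using aut_iso[OF \<pi>] g t unfolding isomorphism_def by blast

lemma up_fix:
  assumes g: "g \<in> elts (fix_auts (hset {}))" and cl: "\<And>h y. h \<in> elts (fix_auts (hset {})) \<Longrightarrow> y \<in> elts B \<Longrightarrow> act h y \<in> elts B"
    and nm: "\<And>y. y \<in> elts B \<Longrightarrow> is_name Sys y"
  shows "act g (up Sys B) = up Sys B"
proof -
  have "act g ` elts B = elts B"
    using act_image_eq[of "fix_auts (hset {})" g B] fix_auts_group[OF V_empty] g cl nm by simp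
  then show ?thesis using act_up[OF grp_top, of g B] g by simp
qed

lemma rel_name_closed:
  assumes r: "rel_symb L r k" and g: "g \<in> elts (fix_auts (hset {}))" and y: "y \<in> elts (hset (tuple_name ` elts (app (rels M) r)))"
  shows "act g y \<in> elts (hset (tuple_name ` elts (app (rels M) r)))"
proof -
  obtain l \<pi> where l: "g = lift l" "l \<in> elts (fix_perms (hset {}))" "\<pi> \<in> elts \<G>" "over l \<pi>" using g by (rule fix_auts_E)
  obtain t where t: "t \<in> elts (app (rels M) r)" "y = tuple_name t" using y by auto
  then have "act g y = tuple_name (compose \<pi> t)" unfolding l(1) t(2) using rel_tuples[OF r] by (intro act_tuple_name[OF V_empty l(2-4)]) blast
  then show ?thesis using aut_rel[OF l(3) r t(1)] by simp
qed

lemma app_rels_V: "rel_symb L r k \<Longrightarrow> app (rels M) r \<in> V"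
proof -
  assume "rel_symb L r k"
  then have "r \<in> fdom (rel_ar L)" unfolding fdom_def by blast
  then have "\<langle>r, app (rels M) r\<rangle> \<in> elts (rels M)" by (rule func_app[OF rels_func])
  then show ?thesis using V_opair_memD[OF _ rels_V] by blast
qed

lemma app_funs_V: "fun_symb L g k \<Longrightarrow> app (funs M) g \<in> V"
proof -
  assume "fun_symb L g k"
  then have "g \<in> fdom (fun_ar L)" unfolding fdom_def by blast
  then have "\<langle>g, app (funs M) g\<rangle> \<in> elts (funs M)" by (rule func_app[OF funs_func])
  then show ?thesis using V_opair_memD[OF _ funs_V] by blast
qed

text \<open>Members of \<open>\<G>\<close> preserve the relation, so the whole group permutes the
  tuple names occurring here and fixes the resulting name.\<close>

lemma rel_name_hs:
  assumes r: "rel_symb L r k"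
  shows "hered_symmetric Sys (rel_name (app (rels M) r))"
    and "g \<in> elts (fix_auts (hset {})) \<Longrightarrow> act g (rel_name (app (rels M) r)) = rel_name (app (rels M) r)"
proof -
  let ?B = "hset (tuple_name ` elts (app (rels M) r))"
  have hs: "hered_symmetric Sys y" if "y \<in> elts ?B" for y using that hs_tuple_name rel_tuples[OF r] by auto
  have "?B \<in> V" using app_rels_V[OF r] by (intro dfun_V0[OF dfun_image[where F = "\<lambda>x e. tuple_name x"]] dintros)
  then show "hered_symmetric Sys (rel_name (app (rels M) r))"
    unfolding rel_name_def by (rule hs_up[OF _ hs KA0_Filt rel_name_closed[OF r]])
  show "g \<in> elts (fix_auts (hset {})) \<Longrightarrow> act g (rel_name (app (rels M) r)) = rel_name (app (rels M) r)"
    unfolding rel_name_def using hs_name[OF hs] by (intro up_fix rel_name_closed[OF r])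
qed

lemma fun_name_closed:
  assumes f: "fun_symb L f k" and g: "g \<in> elts (fix_auts (hset {}))"
    and y: "y \<in> (\<lambda>w. opn Sys (tuple_name (hfst w)) (elt_name (hsnd w))) ` elts (app (funs M) f)"
  shows "act g y \<in> (\<lambda>w. opn Sys (tuple_name (hfst w)) (elt_name (hsnd w))) ` elts (app (funs M) f)"
proof -
  obtain l \<pi> where l: "g = lift l" "l \<in> elts (fix_perms (hset {}))" "\<pi> \<in> elts \<G>" "over l \<pi>" using g by (rule fix_auts_E)
  note ff = fun_func[OF f]
  obtain t where t: "t \<in> tuples U k" "y = opn Sys (tuple_name t) (elt_name (app (app (funs M) f) t))"
    using y unfolding elts_func[OF ff] by auto
  note a = func_mem[OF ff t(1)]
  have "act g y = opn Sys (tuple_name (compose \<pi> t)) (elt_name (app \<pi> (app (app (funs M) f) t)))"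
    unfolding l(1) t(2) act_opn[OF lift_top[OF l(2)]] act_tuple_name[OF V_empty l(2-4) t(1)]
      act_elt_name[OF V_empty l(2-4) U_cols[OF a]] ext_U[OF l(3) a] ..
  also have "\<dots> = opn Sys (tuple_name (compose \<pi> t)) (elt_name (app (app (funs M) f) (compose \<pi> t)))"
    unfolding aut_fun[OF l(3) f t(1)] ..
  also have "\<dots> \<in> (\<lambda>w. opn Sys (tuple_name (hfst w)) (elt_name (hsnd w))) ` elts (app (funs M) f)"
    using func_app[OF ff compose_tuple[OF t(1) bij_func[OF G_bij[OF l(3)]]]]
    by (intro image_eqI[where x = "\<langle>compose \<pi> t, app (app (funs M) f) (compose \<pi> t)\<rangle>"]) simp_all
  finally show ?thesis .
qed

lemma fun_name_hs:
  assumes f: "fun_symb L f k"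
  shows "hered_symmetric Sys (fun_name (app (funs M) f))"
    and "g \<in> elts (fix_auts (hset {})) \<Longrightarrow> act g (fun_name (app (funs M) f)) = fun_name (app (funs M) f)"
proof -
  let ?B = "hset ((\<lambda>w. opn Sys (tuple_name (hfst w)) (elt_name (hsnd w))) ` elts (app (funs M) f))"
  have B: "elts ?B = (\<lambda>w. opn Sys (tuple_name (hfst w)) (elt_name (hsnd w))) ` elts (app (funs M) f)" by simp
  note ff = fun_func[OF f]
  have hs: "hered_symmetric Sys y" if y: "y \<in> elts ?B" for y
  proof -
    have "y \<in> (\<lambda>w. opn Sys (tuple_name (hfst w)) (elt_name (hsnd w))) ` elts (app (funs M) f)" using y by (simp only: B)
    then obtain t where t: "t \<in> tuples U k" "y = opn Sys (tuple_name t) (elt_name (app (app (funs M) f) t))"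
      unfolding elts_func[OF ff] by auto
    note a = func_mem[OF ff t(1)]
    show ?thesis
      unfolding t(2) using tuples_V[OF t(1)] U_V[OF a] by (intro hs_opn hs_tuple_name[OF t(1)] hs_elt_name[OF a]) simp_all
  qed
  have cl: "act h y \<in> elts ?B" if "h \<in> elts (fix_auts (hset {}))" "y \<in> elts ?B" for h y
    using fun_name_closed[OF f that(1)] that(2) by (simp only: B)
  have "?B \<in> V" using app_funs_V[OF f] by (intro dfun_V0[OF dfun_image] dintros)
  then show "hered_symmetric Sys (fun_name (app (funs M) f))"
    unfolding fun_name_def by (rule hs_up[OF _ hs KA0_Filt cl])
  show "g \<in> elts (fix_auts (hset {})) \<Longrightarrow> act g (fun_name (app (funs M) f)) = fun_name (app (funs M) f)"
    unfolding fun_name_def using hs_name[OF hs] by (intro up_fix cl)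
qed

text \<open>Shared by relations and functions. The language may be infinite, so supports cannot be
  intersected symbol by symbol; invariance of every component under the whole group makes this
  unnecessary, as labels are check names.\<close>

lemma family_hs:
  assumes Z: "Z \<in> V" "is_func Z D UNIV" and T: "\<And>s. dfun s \<Longrightarrow> dfun (\<lambda>e. T (s e))"
    and hs: "\<And>r. r \<in> D \<Longrightarrow> hered_symmetric Sys (T (app Z r))"
    and fixed: "\<And>r g. r \<in> D \<Longrightarrow> g \<in> elts (fix_auts (hset {})) \<Longrightarrow> act g (T (app Z r)) = T (app Z r)"
  shows "up Sys (hset ((\<lambda>z. opn Sys (check Sys (hfst z)) (T (hsnd z))) ` elts Z)) \<in> V"
    and "hered_symmetric Sys (up Sys (hset ((\<lambda>z. opn Sys (check Sys (hfst z)) (T (hsnd z))) ` elts Z)))"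
    and "elts (val G (up Sys (hset ((\<lambda>z. opn Sys (check Sys (hfst z)) (T (hsnd z))) ` elts Z)))) =
      (\<lambda>r. \<langle>r, val G (T (app Z r))\<rangle>) ` D"
proof -
  let ?B = "hset ((\<lambda>z. opn Sys (check Sys (hfst z)) (T (hsnd z))) ` elts Z)"
  have B: "?B \<in> V" by (intro dfun_V0[OF dfun_image] dfun_opn dfun_check dfun_hfst T dfun_hsnd dintros Z(1))
  then show "up Sys ?B \<in> V" by simp
  have eB: "elts ?B = (\<lambda>z. opn Sys (check Sys (hfst z)) (T (hsnd z))) ` elts Z" by simp
  then have eB': "elts ?B = (\<lambda>r. opn Sys (check Sys r) (T (app Z r))) ` D"
    unfolding elts_func[OF Z(2)] by (simp add: image_image)
  have DV: "r \<in> V \<and> T (app Z r) \<in> V" if "r \<in> D" for r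
  proof -
    have "\<langle>r, app Z r\<rangle> \<in> elts Z" using func_app[OF Z(2) that] .
    then have "r \<in> V" "app Z r \<in> V" using V_opair_memD[OF _ Z(1)] by blast+
    then show ?thesis using dfun_V0[OF T[OF dfun_const]] by blast
  qed
  show "hered_symmetric Sys (up Sys ?B)"
  proof (rule hs_up[OF B _ KA0_Filt])
    fix y assume "y \<in> elts ?B"
    then obtain r where r: "r \<in> D" "y = opn Sys (check Sys r) (T (app Z r))" unfolding eB' by blast
    show "hered_symmetric Sys y" unfolding r(2) using DV[OF r(1)] by (intro hs_opn hs_check hs r(1)) simp_all
    fix g assume g: "g \<in> elts (fix_auts (hset {}))"
    have "app g (top_cond Sys) = top_cond Sys" using grp_top g by simp
    then have "act g y = y" unfolding r(2) using fixed[OF r(1) g] by (simp only: act_opn act_check)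
    then show "act g y \<in> elts ?B" using \<open>y \<in> elts ?B\<close> by simp
  qed
  show "elts (val G (up Sys ?B)) = (\<lambda>r. \<langle>r, val G (T (app Z r))\<rangle>) ` D"
    unfolding val_up[OF top_G] eB' by (simp add: image_image val_opn[OF top_G])
qed

lemma rels_name: "rels_name \<in> V" "hered_symmetric Sys rels_name"
    "elts (val G rels_name) = (\<lambda>r. \<langle>r, val G (rel_name (app (rels M) r))\<rangle>) ` fdom (rel_ar L)"
proof -
  have 1: "hered_symmetric Sys (rel_name (app (rels M) r))" if "r \<in> fdom (rel_ar L)" for r
    using rel_name_hs(1) rel_sym_ex[OF that] by blast
  have 2: "act g (rel_name (app (rels M) r)) = rel_name (app (rels M) r)"
    if "r \<in> fdom (rel_ar L)" "g \<in> elts (fix_auts (hset {}))" for r g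
    using rel_name_hs(2) rel_sym_ex[OF that(1)] that(2) by blast
  note f = family_hs[where T = rel_name, OF rels_V rels_func dfun_rel_name 1 2, folded rels_name_def]
  show "rels_name \<in> V" "hered_symmetric Sys rels_name"
    "elts (val G rels_name) = (\<lambda>r. \<langle>r, val G (rel_name (app (rels M) r))\<rangle>) ` fdom (rel_ar L)"
    by (rule f; assumption)+
qed

lemma funs_name: "funs_name \<in> V" "hered_symmetric Sys funs_name"
    "elts (val G funs_name) = (\<lambda>r. \<langle>r, val G (fun_name (app (funs M) r))\<rangle>) ` fdom (fun_ar L)"
proof -
  have 1: "hered_symmetric Sys (fun_name (app (funs M) r))" if "r \<in> fdom (fun_ar L)" for r
    using fun_name_hs(1) fun_sym_ex[OF that] by blast
  have 2: "act g (fun_name (app (funs M) r)) = fun_name (app (funs M) r)"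
    if "r \<in> fdom (fun_ar L)" "g \<in> elts (fix_auts (hset {}))" for r g
    using fun_name_hs(2) fun_sym_ex[OF that(1)] that(2) by blast
  note f = family_hs[where T = fun_name, OF funs_V funs_func dfun_fun_name 1 2, folded funs_name_def]
  show "funs_name \<in> V" "hered_symmetric Sys funs_name"
    "elts (val G funs_name) = (\<lambda>r. \<langle>r, val G (fun_name (app (funs M) r))\<rangle>) ` fdom (fun_ar L)"
    by (rule f; assumption)+
qed

lemma val_rel_name: "elts R \<subseteq> tuples U k \<Longrightarrow> elts (val G (rel_name R)) = compose iso ` elts R"
  unfolding rel_name_def val_up[OF top_G] using val_tuple_name by (auto simp: image_image subset_iff intro!: image_cong)

lemma val_fun_name:
  assumes "is_func F (tuples U k) U"
  shows "elts (val G (fun_name F)) = (\<lambda>t. \<langle>compose iso t, n (app F t)\<rangle>) ` tuples U k"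
  unfolding fun_name_def val_up[OF top_G]
  using val_tuple_name by (simp add: elts_func[OF assms] image_image small_func_dom[OF assms] val_opn[OF top_G] n_def)

lemma app_rels_N: "rel_symb L r k \<Longrightarrow> app (rels N) r = val G (rel_name (app (rels M) r))"
  using app_eq[OF rels_name(3), of r] unfolding fdom_def by auto

lemma app_funs_N: "fun_symb L g k \<Longrightarrow> app (funs N) g = val G (fun_name (app (funs M) g))"
  using app_eq[OF funs_name(3), of g] unfolding fdom_def by auto

lemma iso_func: "is_func iso U U'"
  using iso_bij bij_func by blast

text \<open>Every tuple over the copy is the transport of a tuple over M, so the graph can be
  indexed by tuples over the copy; this shows that it is a total function on them.\<close>

lemma fun_name_tuples:
  assumes "is_func F (tuples U k) U"
  shows "elts (val G (fun_name F)) = (\<lambda>u. \<langle>u, n (app F (compose (conv iso) u))\<rangle>) ` tuples U' k"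
  unfolding val_fun_name[OF assms]
proof (intro equalityI subsetI)
  fix z assume "z \<in> (\<lambda>t. \<langle>compose iso t, n (app F t)\<rangle>) ` tuples U k"
  then obtain t where t: "t \<in> tuples U k" "z = \<langle>compose iso t, n (app F t)\<rangle>" by blast
  then show "z \<in> (\<lambda>u. \<langle>u, n (app F (compose (conv iso) u))\<rangle>) ` tuples U' k"
    using compose_ident_tuple[OF t(1) iso_bij] compose_tuple[OF t(1) iso_func]
    by (intro image_eqI[where x = "compose iso t"]) simp_all
next
  fix z assume "z \<in> (\<lambda>u. \<langle>u, n (app F (compose (conv iso) u))\<rangle>) ` tuples U' k"
  then obtain u where u: "u \<in> tuples U' k" "z = \<langle>u, n (app F (compose (conv iso) u))\<rangle>" by blast
  then show "z \<in> (\<lambda>t. \<langle>compose iso t, n (app F t)\<rangle>) ` tuples U k"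
    using compose_conv_tuple[OF u(1) iso_bij] compose_tuple[OF u(1) bij_func[OF conv_bij[OF iso_bij]]]
    by (intro image_eqI[where x = "compose (conv iso) u"]) simp_all
qed

lemma n_U': "m \<in> U \<Longrightarrow> n m \<in> U'"
  unfolding elts_N by blast

lemma struct_N: "struct_in W L N"
  unfolding struct_in_def
proof (intro conjI allI impI)
  show "{univ N, rels N, funs N} \<subseteq> W"
    using W_I[OF univ_name_V hs_univ_name] W_I[OF rels_name(1,2)] W_I[OF funs_name(1,2)] by simp
  show "is_func (rels N) (fdom (rel_ar L)) UNIV" using rels_name(3) by (intro is_funcI) simp_all
  show "is_func (funs N) (fdom (fun_ar L)) UNIV" using funs_name(3) by (intro is_funcI) simp_all
  show "elts (app (rels N) r) \<subseteq> tuples (elts (univ N)) k" if r: "rel_symb L r k" for r k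
    unfolding app_rels_N[OF r] unfolding val_rel_name[OF rel_tuples[OF r]] N_simps
    using rel_tuples[OF r] compose_tuple[OF _ iso_func] by blast
  show "is_func (app (funs N) g) (tuples (elts (univ N)) k) (elts (univ N))" if g: "fun_symb L g k" for g k
    unfolding app_funs_N[OF g] unfolding N_simps
  proof (rule is_funcI[OF fun_name_tuples[OF fun_func[OF g]]])
    fix u assume u: "u \<in> tuples U' k"
    show "n (app (app (funs M) g) (compose (conv iso) u)) \<in> U'"
      using n_U' func_mem[OF fun_func[OF g]] compose_tuple[OF u bij_func[OF conv_bij[OF iso_bij]]] by blast
  qed
qed

lemma isomorphism_N: "isomorphism L M N iso"
  unfolding isomorphism_def
proof (intro conjI allI impI ballI)
  show "is_bij iso U (elts (univ N))" using iso_bij by simp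
  show "t \<in> elts (app (rels M) r) \<longleftrightarrow> compose iso t \<in> elts (app (rels N) r)"
    if r: "rel_symb L r k" and t: "t \<in> tuples U k" for r k t
  proof -
    have "t = s" if "s \<in> elts (app (rels M) r)" "compose iso t = compose iso s" for s
      using that rel_tuples[OF r] compose_ident_tuple[OF _ iso_bij] t by (metis subsetD)
    then show ?thesis unfolding app_rels_N[OF r] val_rel_name[OF rel_tuples[OF r]] by blast
  qed
  show "app iso (app (app (funs M) g) t) = app (app (funs N) g) (compose iso t)"
    if g: "fun_symb L g k" and t: "t \<in> tuples U k" for g k t
    unfolding app_funs_N[OF g] app_iso[OF func_mem[OF fun_func[OF g] t]]
    using app_eq[OF fun_name_tuples[OF fun_func[OF g]] compose_tuple[OF t iso_func]] compose_ident_tuple[OF t iso_bij]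
    by simp
qed

subsection \<open>Stability\<close>

text \<open>The bits to be flipped are those at which \<open>q\<close> disagrees with its own translate.\<close>

lemma compatible_lift:
  assumes \<pi>: "\<pi> \<in> elts \<G>" and q: "q \<in> elts Cond" and A: "A \<in> V" "elts A \<subseteq> U" "\<And>a. a \<in> elts A \<Longrightarrow> app \<pi> a = a"
  shows "\<exists>k\<in>elts (fix_perms A). over k \<pi> \<and> (\<exists>s\<in>elts Cond. elts q \<subseteq> elts s \<and> elts (img k q) \<subseteq> elts s)"
proof -
  have \<pi>V: "\<pi> \<in> V" and qV: "q \<in> V" using V_trans[OF G_V \<pi>] q unfolding in_Cond by blast+
  have qC: "elts q \<subseteq> elts C" and qf: "functional q" using q unfolding in_Cond by blast+
  define b where "b = hset {z \<in> elts (prodset cols J). \<exists>e\<in>elts two. \<langle>z, e\<rangle> \<in> elts q \<and>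
    (\<exists>e'\<in>elts two. e' \<noteq> e \<and> \<langle>\<langle>ext \<pi> (hfst z), hsnd z\<rangle>, e'\<rangle> \<in> elts q)}"
  have "b \<in> V" unfolding b_def
    by (intro dfun_V0[OF dfun_sep] dpred_bex dpred_conj dpred_not dpred_eq dpred_mem dfun_prodset dfun_opair dfun_ext
        dfun_hfst dfun_hsnd dfun_var dfun_const cols_V J_V two_V \<pi>V qV)
  have b: "\<langle>m, i\<rangle> \<in> elts b \<longleftrightarrow> m \<in> elts cols \<and> i \<in> elts J \<and> (\<exists>e\<in>elts two. \<langle>\<langle>m, i\<rangle>, e\<rangle> \<in> elts q \<and>
    (\<exists>e'\<in>elts two. e' \<noteq> e \<and> \<langle>\<langle>ext \<pi> m, i\<rangle>, e'\<rangle> \<in> elts q))" for m i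
    unfolding b_def mem_sep by simp
  \<comment> \<open>A column in A is its own translate, so a disagreement there would give q two
    values at one place. Hence no bit in the support is flipped.\<close>
  have fixA: "ext \<pi> m = m \<and> \<langle>m, i\<rangle> \<notin> elts b" if "m \<in> elts A" "m \<in> elts cols" for m i
  proof -
    have "m \<in> U" using A(2) that(1) by blast
    then have "ext \<pi> m = m" using ext_U[OF \<pi>] A(3)[OF that(1)] by simp
    then show ?thesis unfolding b using functionalD[OF qf] by metis
  qed
  note k = flips_fix_perms[OF \<pi> \<open>b \<in> V\<close> fixA]
  let ?k = "flips \<pi> b"
  note kb = fix_perms_bij[OF k(1)]
  have ic: "img ?k q \<in> elts Cond" by (rule img_Cond[OF k(1) q])
  \<comment> \<open>There are only two bits: toggling at a disagreement produces the bit q already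
    has at the target, and elsewhere the two bits agree without toggling.\<close>
  have compat: "e' = y" if c: "\<langle>\<langle>m, i\<rangle>, e\<rangle> \<in> elts q" and y: "app ?k \<langle>\<langle>m, i\<rangle>, e\<rangle> = \<langle>a, y\<rangle>" and d: "\<langle>a, e'\<rangle> \<in> elts q"
    for m i e a y e'
  proof -
    have cC: "\<langle>\<langle>m, i\<rangle>, e\<rangle> \<in> elts C" using c qC by blast
    have y': "a = \<langle>ext \<pi> m, i\<rangle>" "y = (if \<langle>m, i\<rangle> \<in> elts b then tog e else e)"
      using flips_app[OF cC, of \<pi> b] y by auto
    have mi: "m \<in> elts cols" "i \<in> elts J" "e \<in> elts two" using cC by simp_all
    have e': "e' \<in> elts two" using d qC in_C by fastforce
    have ee: "e'' = e" if "\<langle>\<langle>m, i\<rangle>, e''\<rangle> \<in> elts q" for e'' using functionalD[OF qf that c] .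
    have dd: "e'' = e'" if "\<langle>\<langle>ext \<pi> m, i\<rangle>, e''\<rangle> \<in> elts q" for e'' using functionalD[OF qf] that d y'(1) by metis
    have "\<langle>m, i\<rangle> \<in> elts b \<longleftrightarrow> e' \<noteq> e"
      unfolding b using mi e' c d y'(1) ee dd by blast
    then show "e' = y" using y'(2) mi(3) e' unfolding elts_two tog_def by auto
  qed
  have "functional (hset (elts q \<union> elts (img ?k q)))"
  proof (rule functionalI)
    have img_f: "functional (img ?k q)" using ic unfolding in_Cond by blast
    show "\<exists>a b. z = \<langle>a, b\<rangle>" if "z \<in> elts (hset (elts q \<union> elts (img ?k q)))" for z
      using that functional_pair[OF qf] functional_pair[OF img_f] by (metis UnE elts_hset small_Un small_elts)
    have cross: "x = y" if x: "\<langle>a, x\<rangle> \<in> elts q" and y: "\<langle>a, y\<rangle> \<in> elts (img ?k q)" for a x y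
    proof -
      have "\<langle>a, y\<rangle> \<in> app ?k ` elts q" using y elts_img[OF kb qC] by simp
      then obtain c where c: "c \<in> elts q" "app ?k c = \<langle>a, y\<rangle>" by (metis imageE)
      obtain m i e where "c = \<langle>\<langle>m, i\<rangle>, e\<rangle>" using c(1) qC in_C by blast
      then show "x = y" using compat c x by blast
    qed
    fix a x y assume "\<langle>a, x\<rangle> \<in> elts (hset (elts q \<union> elts (img ?k q)))" "\<langle>a, y\<rangle> \<in> elts (hset (elts q \<union> elts (img ?k q)))"
    then have "\<langle>a, x\<rangle> \<in> elts q \<or> \<langle>a, x\<rangle> \<in> elts (img ?k q)" "\<langle>a, y\<rangle> \<in> elts q \<or> \<langle>a, y\<rangle> \<in> elts (img ?k q)" by simp_all
    then show "x = y" using functionalD[OF qf] functionalD[OF img_f] cross by metis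
  qed
  from Un_Cond[OF q ic this] show ?thesis
    using k by (intro bexI[OF _ k(1)] conjI bexI[of _ "hset (elts q \<union> elts (img ?k q))"]) auto
qed

text \<open>Below any q stronger than p, an automorphism over \<open>\<pi>\<close> from the support
  of x carries the forced membership of t to that of its translate. The condition \<open>s\<close>
  extends both q and the image of q, so the translated membership is forced densely below p.\<close>

lemma stable_step:
  assumes x: "x \<in> V" "is_name Sys x" and A: "A \<in> elts inv_ideal" and sup: "\<And>g. g \<in> elts (fix_auts A) \<Longrightarrow> act g x = x"
    and \<pi>: "\<pi> \<in> elts \<G>" "\<And>a. a \<in> elts A \<Longrightarrow> app \<pi> a = a" and t: "t \<in> tuples U k"
    and tx: "compose iso t \<in> elts (val G x)"
  shows "compose iso (compose \<pi> t) \<in> elts (val G x)"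
proof -
  have AV: "A \<in> V" by (rule inv_ideal_mem_V[OF A])
  note t' = compose_tuple[OF t bij_func[OF G_bij[OF \<pi>(1)]]]
  obtain p where p: "p \<in> G" "fmem Sys p (tuple_name t) x"
    using tx val_mem_iff[OF tuple_name_name[OF t] x(2) V_tuple_name[OF tuples_V[OF t]] x(1)] unfolding val_tuple_name[OF t] by blast
  have "wforce p (\<lambda>r. fmem Sys r (tuple_name (compose \<pi> t)) x)"
    unfolding wforce_def
  proof (intro conjI ballI impI)
    fix q assume q: "q \<in> P" "q \<preceq> p"
    have qC: "q \<in> elts Cond" using q by simp
    obtain l s where l: "l \<in> elts (fix_perms A)" "over l \<pi>" "s \<in> elts Cond" "elts q \<subseteq> elts s" "elts (img l q) \<subseteq> elts s"
      using compatible_lift[OF \<pi>(1) qC AV inv_ideal_sub[OF A] \<pi>(2)] by blast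
    have g: "lift l \<in> elts (fix_auts A)" using l(1) unfolding elts_fix_auts by blast
    have "fmem Sys q (tuple_name t) x" using fmem_mono[OF p(2) q(2)] .
    from fmem_act[OF aut_Sys[OF g AV] this tuple_name_name[OF t] x(2)]
    have "fmem Sys (img l q) (tuple_name (compose \<pi> t)) x"
      unfolding act_tuple_name[OF AV l(1) \<pi>(1) l(2) t] sup[OF g] app_lift[OF qC] .
    moreover have "s \<preceq> img l q" using l img_Cond[OF l(1) qC] by simp
    ultimately have "fmem Sys s (tuple_name (compose \<pi> t)) x" by (rule fmem_mono)
    then show "\<exists>r\<in>P. r \<preceq> q \<and> fmem Sys r (tuple_name (compose \<pi> t)) x"
      using l qC by (intro bexI[of _ s]) simp_all
  qed (use p(1) G_P in blast)
  moreover have "dpred (\<lambda>e. fmem Sys (e 0) (tuple_name (compose \<pi> t)) x)"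
    by (intro dpred_fmem dfun_var dfun_const V_tuple_name tuples_V[OF t'] x(1))
  ultimately obtain r where "r \<in> G" "fmem Sys r (tuple_name (compose \<pi> t)) x"
    using G_dense_below[OF _ p(1), of "\<lambda>r. fmem Sys r (tuple_name (compose \<pi> t)) x"] by blast
  then show ?thesis
    using val_mem_iff[OF tuple_name_name[OF t'] x(2) V_tuple_name[OF tuples_V[OF t']] x(1)] unfolding val_tuple_name[OF t'] by blast
qed

lemma fix_group_sub:
  assumes A: "A \<in> V" "elts A \<subseteq> U"
  shows "\<exists>K\<in>V. elts K = fix_group \<G> A \<and> perm_subgroup (univ M) K \<G>"
proof -
  define K where "K = hset {\<pi> \<in> elts \<G>. \<forall>a\<in>elts A. ap \<pi> a = a}"
  have "K \<in> V" unfolding K_def by (intro dfun_V0[OF dfun_sep] dintros A(1) G_V)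
  have K: "\<pi> \<in> elts K \<longleftrightarrow> \<pi> \<in> elts \<G> \<and> (\<forall>a\<in>elts A. app \<pi> a = a)" for \<pi>
    unfolding K_def mem_sep using ap_G A(2) by (metis subsetD)
  have "perm_group (univ M) K"
    unfolding perm_group_def
  proof (intro conjI ballI)
    show "is_bij \<pi> U U" if "\<pi> \<in> elts K" for \<pi> using that G_bij unfolding K by blast
    show "ident (univ M) \<in> elts K" unfolding K using G_ident A(2) by auto
    fix \<pi> assume \<pi>: "\<pi> \<in> elts K"
    show "conv \<pi> \<in> elts K"
      unfolding K
    proof (intro conjI ballI)
      show "conv \<pi> \<in> elts \<G>" using \<pi> G_conv unfolding K by blast
      fix a assume a: "a \<in> elts A"
      then show "app (conv \<pi>) a = a" using \<pi> A(2) app_conv_app[OF G_bij, of \<pi> a] unfolding K by auto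
    qed
    fix \<sigma> assume \<sigma>: "\<sigma> \<in> elts K"
    show "compose \<pi> \<sigma> \<in> elts K"
      unfolding K
    proof (intro conjI ballI)
      show "compose \<pi> \<sigma> \<in> elts \<G>" using \<pi> \<sigma> G_compose unfolding K by blast
      fix a assume a: "a \<in> elts A"
      then show "app (compose \<pi> \<sigma>) a = a"
        using \<pi> \<sigma> A(2) app_compose[OF bij_func[OF G_bij], of \<sigma> a \<pi>] unfolding K by auto
    qed
  qed
  then show ?thesis
    using \<open>K \<in> V\<close> K unfolding perm_subgroup_def fix_group_def by (intro bexI[of _ K]) auto
qed

lemma stable_copy:
  assumes X: "X' \<in> W" "elts X' \<subseteq> tuples U' k"
  shows "\<exists>Y\<in>generic_extension V Sys G. elts Y \<subseteq> tuples U k \<and> compose iso ` elts Y = elts X' \<and>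
    (\<exists>K\<in>V. large_subgroup M \<G> \<I> K \<and> (\<forall>\<pi>\<in>elts K. stable \<pi> Y))"
proof -
  obtain x where x: "x \<in> V" "hered_symmetric Sys x" "X' = val G x" using X(1) unfolding symmetric_extension_def by blast
  note xn = hs_name[OF x(2)]
  obtain T where T: "T \<in> V" "elts T = tuples U k" using tuples_set_ex by blast
  define y where "y = hset ((\<lambda>w. \<langle>hfst w, check Sys (hsnd w)\<rangle>) `
    elts (hset {w \<in> elts (prodset Cond T). fmem Sys (hfst w) (tuple_name (hsnd w)) x}))"
  have "y \<in> V" unfolding y_def by (intro dfun_V0[OF dfun_image] dintros Cond_V T(1) x(1))
  have y: "\<langle>p, c\<rangle> \<in> elts y \<longleftrightarrow> p \<in> elts Cond \<and> (\<exists>t\<in>tuples U k. c = check Sys t \<and> fmem Sys p (tuple_name t) x)" for p c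
  proof -
    have ey: "elts y = (\<lambda>w. \<langle>hfst w, check Sys (hsnd w)\<rangle>) `
        {w \<in> elts (prodset Cond T). fmem Sys (hfst w) (tuple_name (hsnd w)) x}"
      unfolding y_def by (simp only: elts_hset small_image small_elts small_Collect)
    show ?thesis unfolding ey elts_prodset T(2) by force
  qed
  have "is_name Sys y"
  proof (rule is_name.intros, rule ballI)
    fix z assume "z \<in> elts y"
    moreover from this obtain p c where "z = \<langle>p, c\<rangle>" unfolding y_def by auto
    ultimately show "\<exists>p\<in>elts (conds Sys). \<exists>c. z = \<langle>p, c\<rangle> \<and> is_name Sys c" using y is_name_check by auto
  qed
  define Y where "Y = val G y"
  have "Y \<in> generic_extension V Sys G" unfolding Y_def by (rule VG_I[OF \<open>y \<in> V\<close> \<open>is_name Sys y\<close>])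
  have Y: "t \<in> elts Y \<longleftrightarrow> t \<in> tuples U k \<and> compose iso t \<in> elts X'" for t
  proof -
    have "p \<in> elts Cond" if "p \<in> G" for p using G_P[OF that] by simp
    then have "t \<in> elts Y \<longleftrightarrow> (\<exists>p\<in>G. \<exists>s\<in>tuples U k. fmem Sys p (tuple_name s) x \<and> t = val G (check Sys s))"
      unfolding Y_def mem_val y by blast
    then have "t \<in> elts Y \<longleftrightarrow> t \<in> tuples U k \<and> (\<exists>p\<in>G. fmem Sys p (tuple_name t) x)"
      unfolding val_check by blast
    moreover have "compose iso t \<in> elts X' \<longleftrightarrow> (\<exists>p\<in>G. fmem Sys p (tuple_name t) x)" if t: "t \<in> tuples U k"
      using val_mem_iff[OF tuple_name_name[OF t] xn V_tuple_name[OF tuples_V[OF t]] x(1)] unfolding val_tuple_name[OF t] x(3) .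
    ultimately show ?thesis by blast
  qed
  have img: "compose iso ` elts Y = elts X'"
  proof (intro equalityI subsetI)
    fix u assume u: "u \<in> elts X'"
    then have u': "u \<in> tuples U' k" using X(2) by blast
    have "compose (conv iso) u \<in> elts Y"
      unfolding Y using compose_conv_tuple[OF u' iso_bij] compose_tuple[OF u' bij_func[OF conv_bij[OF iso_bij]]] u by simp
    then show "u \<in> compose iso ` elts Y" using compose_conv_tuple[OF u' iso_bij] by (metis imageI)
  qed (use Y in blast)
  obtain K where K: "K \<in> elts (filt Sys)" "\<forall>g\<in>elts K. act g x = x" using hs_supp[OF x(2)] by blast
  then obtain A where A: "A \<in> elts inv_ideal" "elts (fix_auts A) \<subseteq> elts K" unfolding Sys_simps in_Filt by blast
  obtain K0 where K0: "K0 \<in> V" "elts K0 = fix_group \<G> A" "perm_subgroup (univ M) K0 \<G>"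
    using fix_group_sub[OF inv_ideal_mem_V[OF A(1)] inv_ideal_sub[OF A(1)]] by blast
  have step: "compose \<pi> t \<in> elts Y" if \<pi>: "\<pi> \<in> elts K0" and t: "t \<in> elts Y" for \<pi> t
  proof -
    have p: "\<pi> \<in> elts \<G>" "\<And>a. a \<in> elts A \<Longrightarrow> app \<pi> a = a" using \<pi> unfolding K0(2) fix_group_def by blast+
    have t': "t \<in> tuples U k" "compose iso t \<in> elts (val G x)" using t unfolding Y x(3) by blast+
    have "compose iso (compose \<pi> t) \<in> elts (val G x)"
      using K(2) A(2) by (intro stable_step[OF x(1) xn A(1) _ p t']) blast
    then show ?thesis unfolding Y x(3) using compose_tuple[OF t'(1) bij_func[OF G_bij[OF p(1)]]] by blast
  qed
  have "stable \<pi> Y" if \<pi>: "\<pi> \<in> elts K0" for \<pi>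
    unfolding stable_def
  proof (intro equalityI subsetI)
    fix t assume t: "t \<in> elts Y"
    have pG: "\<pi> \<in> elts \<G>" using \<pi> unfolding K0(2) fix_group_def by blast
    have c: "conv \<pi> \<in> elts K0" using \<pi> K0(3) unfolding perm_subgroup_def perm_group_def by blast
    have t': "t \<in> tuples U k" using t unfolding Y by blast
    have "compose \<pi> (compose (conv \<pi>) t) = t" by (rule compose_conv_tuple[OF t' G_bij[OF pG]])
    then show "t \<in> compose \<pi> ` elts Y" using step[OF c t] by (metis imageI)
  qed (use step[OF \<pi>] in blast)
  moreover have "large_subgroup M \<G> \<I> K0"
    unfolding large_subgroup_def using K0 A(1) in_inv_ideal by blast
  ultimately have "\<exists>K\<in>V. large_subgroup M \<G> \<I> K \<and> (\<forall>\<pi>\<in>elts K. stable \<pi> Y)" using K0(1) by blast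
  moreover have "elts Y \<subseteq> tuples U k" using Y by blast
  ultimately show ?thesis using \<open>Y \<in> generic_extension V Sys G\<close> img by blast
qed

lemma symmetric_copy: "has_symmetric_copy V Sys G L M \<G> \<I>"
  unfolding has_symmetric_copy_def
proof (rule exI[of _ N], rule bexI[OF _ iso_VG], intro conjI struct_N isomorphism_N allI ballI impI)
  fix k X' assume "X' \<in> W" "elts X' \<subseteq> tuples (elts (univ N)) k"
  then show "\<exists>Y\<in>generic_extension V Sys G. elts Y \<subseteq> tuples U k \<and> compose iso ` elts Y = elts X' \<and>
      (\<exists>K\<in>V. large_subgroup M \<G> \<I> K \<and> (\<forall>\<pi>\<in>elts K. stable \<pi> Y))"
    unfolding N_simps by (rule stable_copy)
qed

subsection \<open>No new subsets\<close>

text \<open>The union of the chain is a lower bound: comparability makes it a function, and closure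
  of X under pairing keeps its size within that of X.\<close>

lemma closed_Cond:
  assumes A: "A \<in> V" "elts A \<subseteq> P" "dominated X A"
    and chain: "\<And>a b. a \<in> elts A \<Longrightarrow> b \<in> elts A \<Longrightarrow> a \<preceq> b \<or> b \<preceq> a"
  shows "\<exists>q\<in>P. \<forall>a\<in>elts A. q \<preceq> a"
proof -
  define q where "q = hset (\<Union>a\<in>elts A. elts a)"
  have q: "elts q = (\<Union>a\<in>elts A. elts a)" unfolding q_def by simp
  have AC: "a \<in> elts Cond" if "a \<in> elts A" for a using A(2) that by auto
  have sub: "elts a \<subseteq> elts b \<or> elts b \<subseteq> elts a" if "a \<in> elts A" "b \<in> elts A" for a b
    using chain[OF that] by auto
  have "q \<in> V" unfolding q_def by (intro dfun_V0[OF dfun_Union] dintros A(1))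
  moreover have "elts q \<subseteq> elts C" unfolding q using AC Cond_sub by blast
  moreover have "functional q"
  proof (rule functionalI)
    fix z assume "z \<in> elts q"
    then obtain a where "a \<in> elts A" "z \<in> elts a" unfolding q by blast
    then show "\<exists>x y. z = \<langle>x, y\<rangle>" using Cond_sub[OF AC] in_C by blast
  next
    fix x y z assume "\<langle>x, y\<rangle> \<in> elts q" "\<langle>x, z\<rangle> \<in> elts q"
    then obtain a b where ab: "a \<in> elts A" "\<langle>x, y\<rangle> \<in> elts a" "b \<in> elts A" "\<langle>x, z\<rangle> \<in> elts b" unfolding q by blast
    then obtain c where "c \<in> elts A" "\<langle>x, y\<rangle> \<in> elts c" "\<langle>x, z\<rangle> \<in> elts c" using sub[OF ab(1,3)] by blast
    then show "y = z" using AC functionalD[of c] unfolding in_Cond by blast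
  qed
  moreover have "dominated X q"
    unfolding q_def
  proof (rule dominated_Union[where F = "\<lambda>a. a"])
    show "\<langle>a, b\<rangle> \<in> elts X" if "a \<in> elts X" "b \<in> elts X" for a b using X(4) that .
    show "dfun (\<lambda>e. e 0)" by (rule dfun_var)
    show "dominated X a" if "a \<in> elts A" for a using AC[OF that] unfolding in_Cond by blast
  qed (use X(1) A in blast)+
  ultimately have "q \<in> elts Cond" unfolding in_Cond by blast
  then show ?thesis using AC q by (intro bexI[of _ q]) auto
qed

text \<open>A function from M to bits records decisions about membership in Y. A maximal such record
  below some condition must be total, since any undecided point could be added after strengthening
  the condition; a total record in V then computes Y.\<close>

lemma no_new: "no_new_subsets V (generic_extension V Sys G) (univ M)"
  unfolding no_new_subsets_def
proof (intro ballI impI)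
  fix Y assume "Y \<in> generic_extension V Sys G" and YU: "elts Y \<subseteq> U"
  then obtain x where x: "x \<in> V" "is_name Sys x" "Y = val G x" unfolding generic_extension_def by blast
  \<comment> \<open>Bit 1 records that q strongly forces the point into Y; the other bit records
    that no extension of q does. Both persist to stronger conditions.\<close>
  define \<Phi> where "\<Phi> s q \<longleftrightarrow> q \<in> elts Cond \<and> functional s \<and> elts s \<subseteq> elts (prodset (univ M) two) \<and>
    (\<forall>z\<in>elts s. (hsnd z = bit1 \<longrightarrow> fmem Sys q (check Sys (hfst z)) x) \<and>
      (hsnd z \<noteq> bit1 \<longrightarrow> (\<forall>r\<in>elts Cond. \<langle>r, q\<rangle> \<in> elts Le \<longrightarrow> \<not> fmem Sys r (check Sys (hfst z)) x)))" for s q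
  have V2: "prodset (univ M) two \<in> V" by (intro dfun_V0[OF dfun_prodset] dintros univ_V two_V)
  have "dpred (\<lambda>e. \<Phi> (e 0) (e (Suc 0)))"
    unfolding \<Phi>_def by (intro dintros Cond_V Le_V bit1_V univ_V two_V x(1))
  then have d\<Phi>: "dpred (\<lambda>e. \<Phi> (s e) (t e))" if "dfun s" "dfun t" for s t
    using dpred_comp2[of \<Phi>] that by blast
  have mono: "\<Phi> s r" if sq: "\<Phi> s q" and rq: "r \<preceq> q" for s q r
  proof -
    have "r \<in> elts Cond" using rq by simp
    moreover have "\<langle>r', q\<rangle> \<in> elts Le" if "\<langle>r', r\<rangle> \<in> elts Le" for r' using le_trans[of r' r q] rq that by simp
    moreover have "fmem Sys r c x" if "fmem Sys q c x" for c using fmem_mono[OF that rq] .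
    ultimately show ?thesis using sq unfolding \<Phi>_def by blast
  qed
  define D where "D q \<longleftrightarrow> (\<exists>s\<in>V. \<Phi> s q \<and> (\<forall>m\<in>U. \<exists>e\<in>elts two. \<langle>m, e\<rangle> \<in> elts s))" for q
  have "dpred (\<lambda>e. D (e 0))" unfolding D_def by (intro dintros d\<Phi> univ_V two_V)
  moreover have "\<exists>r\<in>P. r \<preceq> p \<and> D r" if p: "p \<in> P" for p
  proof -
    have "\<exists>s\<in>V. \<exists>q. q \<preceq> p \<and> \<Phi> s q \<and>
      (\<forall>t\<in>V. \<forall>r. r \<preceq> q \<longrightarrow> \<Phi> t r \<longrightarrow> elts s \<subseteq> elts t \<longrightarrow> t = s)"
    proof (rule dense_extension[OF X(1) univ_V dominated_refl[OF X(1,2)] two_V closed_Cond _ _ _ _ p])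
      show "dpred (\<lambda>e. \<Phi> (e 0) (e (Suc 0)))" by (intro d\<Phi> dfun_var)
      show "\<Phi> s q \<Longrightarrow> functional s \<and> elts s \<subseteq> elts (prodset (univ M) two)" for s q unfolding \<Phi>_def by blast
      show "\<Phi> s r" if "\<Phi> s q" "r \<preceq> q" for s q r using mono that .
      fix CC q assume CC: "CC \<in> V" "q \<in> P" "\<And>s. s \<in> elts CC \<Longrightarrow> \<Phi> s q"
        "\<And>s t. s \<in> elts CC \<Longrightarrow> t \<in> elts CC \<Longrightarrow> elts s \<subseteq> elts t \<or> elts t \<subseteq> elts s"
      have e: "elts (hset (\<Union>s\<in>elts CC. elts s)) = (\<Union>s\<in>elts CC. elts s)" by simp
      have "functional (hset (\<Union>s\<in>elts CC. elts s))"
      proof (rule functionalI, unfold e)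
        show "\<exists>a b. z = \<langle>a, b\<rangle>" if "z \<in> (\<Union>s\<in>elts CC. elts s)" for z
          using that CC(3) unfolding \<Phi>_def by (metis UN_E functional_pair)
        fix a b c assume "\<langle>a, b\<rangle> \<in> (\<Union>s\<in>elts CC. elts s)" "\<langle>a, c\<rangle> \<in> (\<Union>s\<in>elts CC. elts s)"
        then obtain s t where st: "s \<in> elts CC" "\<langle>a, b\<rangle> \<in> elts s" "t \<in> elts CC" "\<langle>a, c\<rangle> \<in> elts t" by blast
        then obtain w where "w \<in> elts CC" "\<langle>a, b\<rangle> \<in> elts w" "\<langle>a, c\<rangle> \<in> elts w" using CC(4)[OF st(1,3)] by blast
        then show "b = c" using CC(3) functionalD[of w] unfolding \<Phi>_def by blast
      qed
      then show "\<Phi> (hset (\<Union>s\<in>elts CC. elts s)) q"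
        using CC(2,3) unfolding \<Phi>_def e Sys_simps by blast
    qed
    then obtain s q where s: "s \<in> V" "q \<preceq> p" "\<Phi> s q"
      "\<And>t r. t \<in> V \<Longrightarrow> r \<preceq> q \<Longrightarrow> \<Phi> t r \<Longrightarrow> elts s \<subseteq> elts t \<Longrightarrow> t = s" by blast
    have qC: "q \<in> elts Cond" using s(2) by simp
    have "\<exists>e\<in>elts two. \<langle>m, e\<rangle> \<in> elts s" if m: "m \<in> U" for m
    proof (rule ccontr)
      assume no: "\<not> (\<exists>e\<in>elts two. \<langle>m, e\<rangle> \<in> elts s)"
      have sp: "functional s" "elts s \<subseteq> elts (prodset (univ M) two)" using s(3) unfolding \<Phi>_def by blast+
      have new: "\<langle>m, e\<rangle> \<notin> elts s" for e using no sp(2) by auto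
      have "\<exists>r e. r \<preceq> q \<and> e \<in> elts two \<and>
          (e = bit1 \<longrightarrow> fmem Sys r (check Sys m) x) \<and>
          (e \<noteq> bit1 \<longrightarrow> (\<forall>r'\<in>elts Cond. \<langle>r', r\<rangle> \<in> elts Le \<longrightarrow> \<not> fmem Sys r' (check Sys m) x))"
      proof (cases "\<exists>r\<in>elts Cond. \<langle>r, q\<rangle> \<in> elts Le \<and> fmem Sys r (check Sys m) x")
        case True
        then show ?thesis unfolding Sys_simps elts_two by blast
      next
        case False
        then show ?thesis unfolding Sys_simps elts_two
          using bit0_neq_bit1 qC by (intro exI[of _ q] exI[of _ bit0]) auto
      qed
      then obtain r e where re: "r \<preceq> q" "e \<in> elts two" "e = bit1 \<longrightarrow> fmem Sys r (check Sys m) x"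
        "e \<noteq> bit1 \<longrightarrow> (\<forall>r'\<in>elts Cond. \<langle>r', r\<rangle> \<in> elts Le \<longrightarrow> \<not> fmem Sys r' (check Sys m) x)" by blast
      define t where "t = hset (insert \<langle>m, e\<rangle> (elts s))"
      have t: "elts t = insert \<langle>m, e\<rangle> (elts s)" unfolding t_def by simp
      have eV: "e \<in> V" using re(2) V_trans[OF two_V] by blast
      have "t \<in> V" unfolding t_def using s(1) U_V[OF m] eV by simp
      moreover have "\<Phi> s r" using mono[OF s(3) re(1)] .
      then have "\<Phi> t r"
      proof -
        have "functional t"
          by (rule functionalI) (use functional_pair[OF sp(1)] functionalD[OF sp(1)] new in \<open>auto simp: t, metis\<close>)
        then show ?thesis using \<open>\<Phi> s r\<close> re m unfolding \<Phi>_def t by simp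
      qed
      ultimately have "t = s" using s(4)[OF _ re(1)] t by blast
      then show False using t new by blast
    qed
    then have "D q" unfolding D_def using s by blast
    then show ?thesis using s(2) qC by auto
  qed
  ultimately obtain q where q: "q \<in> G" "D q" using G_dense[of D] by blast
  then obtain s where s: "s \<in> V" "\<Phi> s q" "\<And>m. m \<in> U \<Longrightarrow> \<exists>e\<in>elts two. \<langle>m, e\<rangle> \<in> elts s" unfolding D_def by blast
  have "m \<in> elts Y \<longleftrightarrow> \<langle>m, bit1\<rangle> \<in> elts s" if m: "m \<in> U" for m
  proof -
    have Ym: "m \<in> elts Y \<longleftrightarrow> (\<exists>p\<in>G. fmem Sys p (check Sys m) x)"
      using val_mem_iff[OF is_name_check x(2) V_check[OF U_V[OF m]] x(1)] x(3) by simp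
    obtain e where e: "e \<in> elts two" "\<langle>m, e\<rangle> \<in> elts s" using s(3)[OF m] by blast
    have sf: "functional s" using s(2) unfolding \<Phi>_def by blast
    show ?thesis
    proof (cases "e = bit1")
      case True
      then have "fmem Sys q (check Sys m) x" using s(2) e(2) unfolding \<Phi>_def by fastforce
      then show ?thesis using Ym q(1) e(2) True by blast
    next
      case False
      then have no: "\<not> fmem Sys r (check Sys m) x" if "r \<in> elts Cond" "\<langle>r, q\<rangle> \<in> elts Le" for r
        using s(2) e(2) that unfolding \<Phi>_def by fastforce
      have "\<not> fmem Sys p (check Sys m) x" if p: "p \<in> G" for p
      proof
        assume f: "fmem Sys p (check Sys m) x"
        obtain r where r: "r \<in> G" "r \<preceq> p" "r \<preceq> q" using G_compat[OF p q(1)] by blast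
        then show False using no[of r] fmem_mono[OF f r(2)] by simp
      qed
      moreover have "\<langle>m, bit1\<rangle> \<notin> elts s" using functionalD[OF sf e(2)] False by blast
      ultimately show ?thesis using Ym by blast
    qed
  qed
  then have "Y = hset {m \<in> elts (univ M). \<langle>m, bit1\<rangle> \<in> elts s}" using YU by (intro elts_inj) auto
  also have "\<dots> \<in> V" by (intro dfun_V0[OF dfun_sep] dintros univ_V bit1_V s(1))
  finally show "Y \<in> V" .
qed

end

section \<open>Ordinals and complete ideals\<close>

lemma ord_mem: "is_ord x \<Longrightarrow> y \<in> elts x \<Longrightarrow> is_ord y"
  unfolding is_ord_def by blast

lemma ord_trans: "is_ord x \<Longrightarrow> y \<in> elts x \<Longrightarrow> z \<in> elts y \<Longrightarrow> z \<in> elts x"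
  unfolding is_ord_def by blast

lemma ord_linear: "is_ord x \<Longrightarrow> is_ord y \<Longrightarrow> x \<in> elts y \<or> x = y \<or> y \<in> elts x"
proof (induction x arbitrary: y rule: hset_induct)
  case (1 x)
  note IHx = 1(1)
  show ?case
    using 1(3)
  proof (induction y rule: hset_induct)
    case (1 y)
    show ?case
    proof (rule ccontr)
      assume n: "\<not> ?case"
      have "elts x \<subseteq> elts y"
      proof
        fix z assume z: "z \<in> elts x"
        then have "z \<in> elts y \<or> z = y \<or> y \<in> elts z" using IHx ord_mem[OF \<open>is_ord x\<close>] 1(2) by blast
        then show "z \<in> elts y" using n z ord_trans[OF \<open>is_ord x\<close> z] by blast
      qed
      moreover have "elts y \<subseteq> elts x"
      proof
        fix z assume z: "z \<in> elts y"
        then have "x \<in> elts z \<or> x = z \<or> z \<in> elts x" using 1(1) ord_mem[OF 1(2)] by blast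
        then show "z \<in> elts x" using n z ord_trans[OF 1(2) z] by blast
      qed
      ultimately show False using n elts_inject[of x y] by blast
    qed
  qed
qed

text \<open>A transitive set of ordinals is an ordinal. By linearity it could otherwise only lie
  above \<open>a\<close>, which would make \<open>a\<close> an element of itself.\<close>

lemma trans_subset_ord:
  assumes a: "is_ord a" and x: "elts x \<subseteq> elts a" "trans_set x"
  shows "x = a \<or> x \<in> elts a"
proof -
  have "is_ord x" using a x unfolding is_ord_def trans_set_def by blast
  from ord_linear[OF this a] show ?thesis
    using x(1) mem_irrefl by blast
qed

text \<open>The Mostowski collapse of b relative to D. For an ordinal b it gives the order type of
  the members of D below b.\<close>

function coll :: "'i hset \<Rightarrow> 'i hset \<Rightarrow> 'i hset" where
  "coll D b = hset ((\<lambda>c. coll D c) ` elts (hset {c \<in> elts b. c \<in> elts D}))"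
  by auto
termination
proof (relation "inv_image mem_rel snd")
  show "wf (inv_image mem_rel (snd :: 'i hset \<times> 'i hset \<Rightarrow> 'i hset))"
    by (intro wf_inv_image wf_mem)
qed auto

declare coll.simps [simp del]

lemma elts_coll: "elts (coll D b) = coll D ` (elts b \<inter> elts D)"
proof -
  have "elts (hset {c \<in> elts b. c \<in> elts D}) = elts b \<inter> elts D" unfolding elts_hset[OF small_Collect] by blast
  then show ?thesis unfolding coll.simps[of D b] by simp
qed

text \<open>Collapsing never increases an ordinal: by induction the collapsed predecessors still lie
  in b, so the result is a transitive subset of b.\<close>

lemma coll_ord: "is_ord b \<Longrightarrow> coll D b = b \<or> coll D b \<in> elts b"
proof (induction b rule: hset_induct)
  case (1 b)
  have "elts (coll D b) \<subseteq> elts b"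
  proof
    fix z assume "z \<in> elts (coll D b)"
    then obtain c where c: "c \<in> elts b" "z = coll D c" unfolding elts_coll by blast
    from 1(1)[OF c(1) ord_mem[OF 1(2) c(1)]] show "z \<in> elts b"
      using c ord_trans[OF 1(2) c(1)] by auto
  qed
  moreover have "trans_set (coll D b)"
    unfolding trans_set_def
  proof (intro ballI subsetI)
    fix y z assume y: "y \<in> elts (coll D b)" and z: "z \<in> elts y"
    obtain c where c: "c \<in> elts b" "y = coll D c" using y unfolding elts_coll by blast
    obtain d where "d \<in> elts c" "d \<in> elts D" "z = coll D d" using z unfolding c(2) elts_coll by blast
    moreover from this c have "d \<in> elts b" using ord_trans[OF 1(2)] by blast
    ultimately show "z \<in> elts (coll D b)" unfolding elts_coll by blast
  qed
  ultimately show ?case by (rule trans_subset_ord[OF 1(2)])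
qed

context zfc_model
begin

lemma dfun_coll: "D \<in> V \<Longrightarrow> dfun s \<Longrightarrow> dfun (\<lambda>e. coll D (s e))"
proof (rule dfun_rec[where H = "\<lambda>b f e. hset ((\<lambda>c. ap f c) ` elts (hset {c \<in> elts b. c \<in> elts D}))"
      and F = "\<lambda>x e. coll D x"])
  show "D \<in> V \<Longrightarrow> dfun (\<lambda>e. hset ((\<lambda>c. ap (e (Suc 0)) c) ` elts (hset {c \<in> elts (e 0). c \<in> elts D})))"
    by (intro dintros)
  fix x f :: "'i hset"
  assume *: "\<And>y. (y, x) \<in> mem_rel\<^sup>+ \<Longrightarrow> ap f y = coll D y"
  show "coll D x = hset ((\<lambda>c. ap f c) ` elts (hset {c \<in> elts x. c \<in> elts D}))"
    unfolding coll.simps[of D x] by (intro arg_cong[of _ _ hset] image_cong refl) (simp add: * r_into_trancl)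
qed

text \<open>The image of \<open>\<alpha>\<close> is in bijection with an ordinal below \<open>\<kappa>\<close>: collapse the set of least
  representatives of the fibres.\<close>

lemma complete_ideal_family:
  assumes I: "complete_ideal_in V \<kappa> \<I>" and \<kappa>: "is_ord \<kappa>" and \<alpha>: "\<alpha> \<in> elts \<kappa>" "\<alpha> \<in> V"
    and h: "dfun (\<lambda>e. h (e 0))" and hI: "\<And>b. b \<in> elts \<alpha> \<Longrightarrow> h b \<in> elts \<I>"
  shows "hset (\<Union>b\<in>elts \<alpha>. elts (h b)) \<in> elts \<I>"
proof -
  have dh: "dfun (\<lambda>e. h (s e))" if "dfun s" for s using dfun_comp1[of h, OF h that] .
  have oa: "is_ord \<alpha>" by (rule ord_mem[OF \<kappa> \<alpha>(1)])
  define AA where "AA = hset ((\<lambda>b. h b) ` elts \<alpha>)"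
  have AA: "elts AA = h ` elts \<alpha>" unfolding AA_def by simp
  have "AA \<in> V" unfolding AA_def by (intro dfun_V0[OF dfun_image] dh dintros \<alpha>(2))
  \<comment> \<open>The least representative of each fibre of h. On these h is injective, and every
    value of h on \<open>\<alpha>\<close> is attained at one of them.\<close>
  define D where "D = hset {b \<in> elts \<alpha>. \<forall>c\<in>elts b. h c \<noteq> h b}"
  have "D \<in> V" unfolding D_def by (intro dfun_V0[OF dfun_sep] dintros dh \<alpha>(2))
  have D: "b \<in> elts D \<longleftrightarrow> b \<in> elts \<alpha> \<and> (\<forall>c\<in>elts b. h c \<noteq> h b)" for b unfolding D_def mem_sep ..
  have lin: "b \<in> elts c \<or> b = c \<or> c \<in> elts b" if "b \<in> elts \<alpha>" "c \<in> elts \<alpha>" for b c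
    using ord_linear ord_mem[OF oa] that by blast
  have inj: "b = c" if "b \<in> elts D" "c \<in> elts D" "h b = h c" for b c
    using lin[of b c] that unfolding D by force
  have cinj: "b = c" if "b \<in> elts D" "c \<in> elts D" "coll D b = coll D c" for b c
  proof (rule ccontr)
    assume "b \<noteq> c"
    then have "b \<in> elts c \<or> c \<in> elts b" using lin[of b c] that unfolding D by blast
    then have "coll D b \<in> elts (coll D c) \<or> coll D c \<in> elts (coll D b)" using that unfolding elts_coll by blast
    then show False using that(3) mem_irrefl by metis
  qed
  have surj: "\<exists>c\<in>elts D. h c = h b" if "b \<in> elts \<alpha>" for b
    using that
  proof (induction b rule: hset_induct)
    case (1 b)
    show ?case
    proof (cases "b \<in> elts D")
      case False
      then obtain c where c: "c \<in> elts b" "h c = h b" using 1(2) unfolding D by blast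
      then show ?thesis using 1(1)[OF c(1) ord_trans[OF oa 1(2) c(1)]] by simp
    qed blast
  qed
  define R where "R = coll D \<alpha>"
  have "elts \<alpha> \<inter> elts D = elts D" using D by blast
  then have R: "elts R = coll D ` elts D" unfolding R_def elts_coll by simp
  have "R \<in> elts \<kappa>" using coll_ord[OF oa, of D] \<alpha>(1) ord_trans[OF \<kappa> \<alpha>(1)] unfolding R_def by auto
  define f where "f = hset ((\<lambda>b. \<langle>coll D b, h b\<rangle>) ` elts D)"
  have f: "elts f = (\<lambda>b. \<langle>coll D b, h b\<rangle>) ` elts D" unfolding f_def by simp
  have "f \<in> V" unfolding f_def
    by (intro dfun_V0[OF dfun_image] dfun_opair dfun_coll dh dfun_var dfun_const \<open>D \<in> V\<close>)
  have fm: "\<langle>x, y\<rangle> \<in> elts f \<longleftrightarrow> (\<exists>b\<in>elts D. x = coll D b \<and> y = h b)" for x y unfolding f by auto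
  have "is_func f (elts R) (elts AA)"
    unfolding is_func_def fm
  proof (intro conjI ballI)
    fix z assume "z \<in> elts f"
    then show "\<exists>a\<in>elts R. \<exists>b\<in>elts AA. z = \<langle>a, b\<rangle>" unfolding f R AA using D by blast
  next
    fix a assume "a \<in> elts R"
    then obtain b where b: "b \<in> elts D" "a = coll D b" unfolding R by blast
    then show "\<exists>!y. \<exists>b\<in>elts D. a = coll D b \<and> y = h b" using cinj by (intro ex1I[of _ "h b"]) blast+
  qed
  moreover have "\<exists>!a. \<langle>a, y\<rangle> \<in> elts f" if y: "y \<in> elts AA" for y
  proof -
    obtain b where b: "b \<in> elts D" "y = h b" using y surj unfolding AA by force
    then show ?thesis unfolding fm using inj by (intro ex1I[of _ "coll D b"]) blast+
  qed
  ultimately have "is_bij f (elts R) (elts AA)" unfolding is_bij_def by blast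
  moreover have "elts AA \<subseteq> elts \<I>" unfolding AA using hI by blast
  ultimately have "hset (\<Union>A\<in>elts AA. elts A) \<in> elts \<I>"
    using I \<open>AA \<in> V\<close> \<open>R \<in> elts \<kappa>\<close> \<open>f \<in> V\<close> unfolding complete_ideal_in_def by blast
  then show ?thesis unfolding AA by simp
qed

end

section \<open>Dependent choice in the symmetric extension\<close>

locale dc_ext = copy_ext V L M \<G> \<I> \<kappa> G for V :: "'i hset set" and L M \<G> \<I> \<kappa> G +
  assumes aleph: "aleph_in V \<kappa>" and complete: "complete_ideal_in V \<kappa> \<I>"
begin

lemma kappa_ord: "is_ord \<kappa>"
  using aleph unfolding aleph_in_def by blast

lemma kappa_mem_V: "\<alpha> \<in> elts \<kappa> \<Longrightarrow> \<alpha> \<in> V"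
  using V_trans[OF kappa_V] .

text \<open>The translate of a union is the union of the translates, so completeness of
  \<open>\<I>\<close> applied to each translated family carries over to the invariant ideal.\<close>

lemma inv_ideal_family:
  assumes \<alpha>: "\<alpha> \<in> elts \<kappa>" and h: "dfun (\<lambda>e. h (e 0))" and hI: "\<And>b. b \<in> elts \<alpha> \<Longrightarrow> h b \<in> elts inv_ideal"
  shows "hset (\<Union>b\<in>elts \<alpha>. elts (h b)) \<in> elts inv_ideal"
  unfolding in_inv_ideal
proof (intro conjI ballI)
  note fam = complete_ideal_family[OF complete kappa_ord \<alpha> kappa_mem_V[OF \<alpha>]]
  show "hset (\<Union>b\<in>elts \<alpha>. elts (h b)) \<in> elts \<I>" using hI in_inv_ideal by (intro fam h) blast
  fix \<pi> assume \<pi>: "\<pi> \<in> elts \<G>"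
  have "dfun (\<lambda>e. hset ((\<lambda>a. ap \<pi> a) ` elts (h (e 0))))"
    by (intro dintros h V_trans[OF G_V \<pi>])
  then have "hset (\<Union>b\<in>elts \<alpha>. elts (hset ((\<lambda>a. ap \<pi> a) ` elts (h b)))) \<in> elts \<I>"
    using hI \<pi> unfolding in_inv_ideal by (intro fam) blast+
  then show "hset (ap \<pi> ` elts (hset (\<Union>b\<in>elts \<alpha>. elts (h b)))) \<in> elts \<I>" by (simp add: image_UN)
qed

text \<open>Here completeness enters: supports of the names in the sequence are chosen inside V, and
  their union over \<open>\<alpha>\<close> is still in the ideal. It fixes every entry of the
  sequence, hence the name of the whole sequence.\<close>

lemma hs_sequence:
  assumes \<alpha>: "\<alpha> \<in> elts \<kappa>" and s: "s \<in> V" "functional s" "hfst ` elts s = elts \<alpha>"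
    and hs: "\<And>z. z \<in> elts s \<Longrightarrow> hered_symmetric Sys (hsnd z)"
  shows "hset ((\<lambda>z. \<langle>hfst z, val G (hsnd z)\<rangle>) ` elts s) \<in> W"
proof -
  have \<alpha>V: "\<alpha> \<in> V" by (rule kappa_mem_V[OF \<alpha>])
  have sz: "\<langle>hfst z, hsnd z\<rangle> = z" if "z \<in> elts s" for z using functional_pair[OF s(2) that] .
  have aps: "ap s (hfst z) = hsnd z" if "z \<in> elts s" for z
    by (rule functional_ap[OF s(2)]) (simp add: sz that)
  have hsb: "hered_symmetric Sys (ap s b)" if b: "b \<in> elts \<alpha>" for b
  proof -
    obtain z where z: "z \<in> elts s" "b = hfst z" using b s(3) by blast
    then show ?thesis using hs[OF z(1)] aps by simp
  qed
  \<comment> \<open>The relation from which supports are chosen must be a set in V; this is why it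
    is stated with \<open>act'\<close>, which agrees with \<open>act\<close> on the names in the
    sequence.\<close>
  define R where "R = hset {w \<in> elts (prodset \<alpha> inv_ideal). \<forall>g\<in>elts (fix_auts (hsnd w)). act' g (ap s (hfst w)) = ap s (hfst w)}"
  have "R \<in> V" unfolding R_def by (intro dfun_V0[OF dfun_sep] dintros \<alpha>V inv_ideal_V s(1))
  have act'_fix_auts: "act' g x = act g x" if "g \<in> elts (fix_auts A)" "is_name Sys x" for g A x
  proof -
    have "is_func g (elts (conds Sys)) (elts (conds Sys))"
      using fix_auts_sub[of A] that(1) grp_bij[of g] bij_func[of g] by (simp add: subset_iff)
    then show ?thesis using act'_eq that(2) by blast
  qed
  have "\<exists>A. \<langle>b, A\<rangle> \<in> elts R" if b: "b \<in> elts \<alpha>" for b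
  proof -
    obtain K where K: "K \<in> elts (filt Sys)" "\<forall>g\<in>elts K. act g (ap s b) = ap s b" using hs_supp[OF hsb[OF b]] by blast
    then obtain A where A: "A \<in> elts inv_ideal" "elts (fix_auts A) \<subseteq> elts K" unfolding Sys_simps in_Filt by blast
    have "\<forall>g\<in>elts (fix_auts A). act' g (ap s b) = ap s b"
      using K(2) A(2) act'_fix_auts hs_name[OF hsb[OF b]] by (metis subsetD)
    then show ?thesis unfolding R_def mem_sep using A(1) b by (intro exI[of _ A]) simp
  qed
  from V_choice_fun[OF \<open>R \<in> V\<close> \<alpha>V this] obtain h where
    h: "h \<in> V" "elts h \<subseteq> elts R" "\<And>b. b \<in> elts \<alpha> \<Longrightarrow> \<langle>b, ap h b\<rangle> \<in> elts h" by blast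
  have hb: "ap h b \<in> elts inv_ideal" "\<And>g. g \<in> elts (fix_auts (ap h b)) \<Longrightarrow> act g (ap s b) = ap s b" if b: "b \<in> elts \<alpha>" for b
  proof -
    have "\<langle>b, ap h b\<rangle> \<in> elts R" using h(2,3) b by blast
    then have r: "ap h b \<in> elts inv_ideal" "\<forall>g\<in>elts (fix_auts (ap h b)). act' g (ap s b) = ap s b"
      unfolding R_def mem_sep by simp_all
    show "ap h b \<in> elts inv_ideal" by (rule r(1))
    show "act g (ap s b) = ap s b" if g: "g \<in> elts (fix_auts (ap h b))" for g
      using r(2) g act'_fix_auts[OF g hs_name[OF hsb[OF b]]] by simp
  qed
  define A where "A = hset (\<Union>b\<in>elts \<alpha>. elts (ap h b))"
  have "A \<in> elts inv_ideal" unfolding A_def by (rule inv_ideal_family[OF \<alpha> _ hb(1)]) (intro dintros h(1))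
  have subA: "elts (ap h b) \<subseteq> elts A" if "b \<in> elts \<alpha>" for b unfolding A_def using that by auto
  define y where "y = hset ((\<lambda>z. opn Sys (check Sys (hfst z)) (hsnd z)) ` elts s)"
  have y: "elts y = (\<lambda>z. opn Sys (check Sys (hfst z)) (hsnd z)) ` elts s" unfolding y_def by simp
  have "y \<in> V" unfolding y_def by (intro dfun_V0[OF dfun_image] dintros s(1))
  have "hered_symmetric Sys (up Sys y)"
  proof (rule hs_up[OF \<open>y \<in> V\<close>])
    show "fix_auts A \<in> elts (filt Sys)" using fix_auts_Filt[OF \<open>A \<in> elts inv_ideal\<close>] by simp
    fix w assume "w \<in> elts y"
    then obtain z where z: "z \<in> elts s" "w = opn Sys (check Sys (hfst z)) (hsnd z)" unfolding y by blast
    have zV: "hfst z \<in> V" "hsnd z \<in> V" using V_trans[OF s(1) z(1)] by simp_all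
    show "hered_symmetric Sys w" unfolding z(2) using zV hs[OF z(1)] by (intro hs_opn hs_check) simp_all
    fix g assume g: "g \<in> elts (fix_auts A)"
    have b: "hfst z \<in> elts \<alpha>" using z(1) s(3) by blast
    have "g \<in> elts (fix_auts (ap h (hfst z)))" using g fix_auts_mono[OF subA[OF b]] by blast
    then have "act g (hsnd z) = hsnd z" using hb(2)[OF b] aps[OF z(1)] by simp
    moreover have "app g (top_cond Sys) = top_cond Sys" using g fix_auts_sub grp_top[of g] by auto
    ultimately have "act g w = w" unfolding z(2) by (simp only: act_opn act_check)
    then show "act g w \<in> elts y" using \<open>w \<in> elts y\<close> by simp
  qed
  then have "val G (up Sys y) \<in> W" using \<open>y \<in> V\<close> by (intro W_I) simp_all
  moreover have "val G (up Sys y) = hset ((\<lambda>z. \<langle>hfst z, val G (hsnd z)\<rangle>) ` elts s)"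
    by (rule elts_inj) (simp add: val_up[OF top_G] y image_image val_opn[OF top_G])
  ultimately show ?thesis by simp
qed

text \<open>A maximal chain of names is decided by a generic condition. Its sequence of names lies in \<open>V\<close>
  because the forcing is closed enough, and then its evaluation lies in \<open>W\<close> because the filter is
  \<open>\<kappa>\<close>-complete.\<close>

lemma DC:
  assumes l: "l \<in> elts \<kappa>"
  shows "DC_in W l"
  unfolding DC_in_def
proof (intro allI impI)
  fix T le assume T: "tree_in W T le" and cl: "closed_tree_in W l T le"
  have TW: "T \<in> W" "le \<in> W" using T unfolding tree_in_def by blast+
  have anti: "\<And>s t. \<langle>s, t\<rangle> \<in> elts le \<Longrightarrow> \<langle>t, s\<rangle> \<in> elts le \<Longrightarrow> s = t"
    and tr: "\<And>s t u. \<langle>s, t\<rangle> \<in> elts le \<Longrightarrow> \<langle>t, u\<rangle> \<in> elts le \<Longrightarrow> \<langle>s, u\<rangle> \<in> elts le"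
    using T unfolding tree_in_def by blast+
  obtain x where x: "x \<in> V" "hered_symmetric Sys x" "T = val G x" using TW(1) unfolding symmetric_extension_def by blast
  obtain lx where lx: "lx \<in> V" "hered_symmetric Sys lx" "le = val G lx" using TW(2) unfolding symmetric_extension_def by blast
  note xn = hs_name[OF x(2)] and lxn = hs_name[OF lx(2)]
  have lV: "l \<in> V" by (rule kappa_mem_V[OF l])
  have lo: "is_ord l" by (rule ord_mem[OF kappa_ord l])
  \<comment> \<open>Every node of T is the value of a name listed in x, so this set of names in V
    suffices for building chains.\<close>
  define B where "B = hset ((\<lambda>w. hsnd w) ` elts x)"
  have B: "elts B = hsnd ` elts x" unfolding B_def by simp
  have BV: "B \<in> V" unfolding B_def by (intro dfun_V0[OF dfun_image] dintros x(1))
  have Bh: "hered_symmetric Sys y" and Bv: "y \<in> V" if "y \<in> elts B" for y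
    using that hs_sub[OF x(2)] V_trans[OF BV] unfolding B by blast+
  note Bn = hs_name[OF Bh]
  have on: "is_name Sys (opn Sys y y')" if "y \<in> elts B" "y' \<in> elts B" for y y'
    using is_name_opn[of Sys] Bn that empty_Cond by simp
  define In where "In q y \<longleftrightarrow> wforce q (\<lambda>r. fmem Sys r y x)" for q y
  \<comment> \<open>Forces that y is strictly below y' in the tree; inequality is expressed by the
    absence of stronger conditions forcing equality.\<close>
  define St where "St q y y' \<longleftrightarrow> wforce q (\<lambda>r. fmem Sys r (opn Sys y y') lx) \<and>
    (\<forall>r\<in>P. r \<preceq> q \<longrightarrow> \<not> feq Sys r y y')" for q y y'
  have dIn: "dpred (\<lambda>e. In (s e) (t e))" if "dfun s" "dfun t" for s t
  proof (rule dpred_comp2[of In, OF _ that])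
    show "dpred (\<lambda>e. In (e 0) (e (Suc 0)))" unfolding In_def by (intro dpred_wforce dintros x(1))
  qed
  have dSt: "dpred (\<lambda>e. St (s e) (t e) (u e))" if "dfun s" "dfun t" "dfun u" for s t u
  proof (rule dpred_comp3[of St, OF _ that])
    show "dpred (\<lambda>e. St (e 0) (e (Suc 0)) (e (Suc (Suc 0))))"
      unfolding St_def by (intro dpred_wforce dintros lx(1) conds_V leq_V)
  qed
  have InG: "val G y \<in> elts T" if "q \<in> G" "In q y" "y \<in> elts B" for q y
  proof -
    have "dpred (\<lambda>e. fmem Sys (e 0) y x)" by (intro dintros x(1) Bv that(3))
    then have "\<exists>r\<in>G. fmem Sys r y x" using G_dense_below[OF _ that(1) that(2)[unfolded In_def]] by blast
    then show ?thesis using val_mem_iff[OF Bn[OF that(3)] xn Bv[OF that(3)] x(1)] x(3) by blast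
  qed
  have StG: "\<langle>val G y, val G y'\<rangle> \<in> elts le \<and> val G y \<noteq> val G y'"
    if q: "q \<in> G" "St q y y'" and y: "y \<in> elts B" "y' \<in> elts B" for q y y'
  proof -
    have "dpred (\<lambda>e. fmem Sys (e 0) (opn Sys y y') lx)" by (intro dintros lx(1) Bv y)
    from G_dense_below[OF this q(1) conjunct1[OF q(2)[unfolded St_def]]]
    have "\<exists>r\<in>G. fmem Sys r (opn Sys y y') lx" by blast
    then have "\<langle>val G y, val G y'\<rangle> \<in> elts le"
      using val_mem_iff[OF on[OF y] lxn V_opn[OF Bv[OF y(1)] Bv[OF y(2)]] lx(1)] lx(3) val_opn[OF top_G] by simp
    moreover have "val G y \<noteq> val G y'"
    proof
      assume "val G y = val G y'"
      then obtain p where p: "p \<in> G" "feq Sys p y y'" using val_eq_iff[OF Bn[OF y(1)] Bn[OF y(2)] Bv[OF y(1)] Bv[OF y(2)]] by blast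
      obtain r where r: "r \<in> G" "r \<preceq> p" "r \<preceq> q" using G_compat[OF p(1) q(1)] by blast
      show False using q(2) feq_mono[OF p(2) r(2)] r(3) G_P[OF r(1)] unfolding St_def by blast
    qed
    ultimately show ?thesis by blast
  qed
  have In_mono: "In r y" if "In q y" "r \<preceq> q" for q r y
    using that wforce_mono unfolding In_def by blast
  have St_mono: "St r y y'" if a: "St q y y'" and b: "r \<preceq> q" for q r y y'
  proof -
    have "r' \<preceq> q" if "r' \<preceq> r" for r' using that b by (rule le_trans)
    then show ?thesis using a wforce_mono[OF _ b] unfolding St_def by blast
  qed
  \<comment> \<open>The function s assigns names to the members of an initial segment of l, and q
    forces them to form a strictly increasing chain in T. Closure of the domain downwards makes it
    an ordinal.\<close>
  define \<Phi> where "\<Phi> s q \<longleftrightarrow> q \<in> P \<and> functional s \<and> elts s \<subseteq> elts (prodset l B) \<and>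
    (\<forall>z\<in>elts s. In q (hsnd z) \<and> (\<forall>b\<in>elts (hfst z). \<exists>w\<in>elts s. hfst w = b) \<and>
       (\<forall>w\<in>elts s. hfst w \<in> elts (hfst z) \<longrightarrow> St q (hsnd w) (hsnd z)))" for s q
  have "dpred (\<lambda>e. \<Phi> (e 0) (e (Suc 0)))"
    unfolding \<Phi>_def by (intro dintros dIn dSt conds_V lV BV)
  then have d\<Phi>: "dpred (\<lambda>e. \<Phi> (s e) (t e))" if "dfun s" "dfun t" for s t
    using dpred_comp2[of \<Phi>] that by blast
  \<comment> \<open>Maximality is demanded against all stronger conditions, so it survives when q is
    later strengthened inside G.\<close>
  define D where "D q \<longleftrightarrow> (\<exists>s\<in>V. \<Phi> s q \<and> (\<forall>t\<in>V. \<forall>r\<in>P. r \<preceq> q \<longrightarrow> \<Phi> t r \<longrightarrow> elts s \<subseteq> elts t \<longrightarrow> t = s))" for q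
  have "dpred (\<lambda>e. D (e 0))" unfolding D_def by (intro dintros d\<Phi> conds_V leq_V)
  moreover have "\<exists>r\<in>P. r \<preceq> p \<and> D r" if p: "p \<in> P" for p
  proof -
    have "dominated X l" using X(1,3) ord_trans[OF kappa_ord l] by (intro dominated_refl) blast+
    then have "\<exists>s\<in>V. \<exists>q. q \<preceq> p \<and> \<Phi> s q \<and>
      (\<forall>t\<in>V. \<forall>r. r \<preceq> q \<longrightarrow> \<Phi> t r \<longrightarrow> elts s \<subseteq> elts t \<longrightarrow> t = s)"
    proof (rule dense_extension[OF X(1) lV _ BV closed_Cond _ _ _ _ p])
      show "dpred (\<lambda>e. \<Phi> (e 0) (e (Suc 0)))" by (intro d\<Phi> dfun_var)
      show "\<Phi> s q \<Longrightarrow> functional s \<and> elts s \<subseteq> elts (prodset l B)" for s q unfolding \<Phi>_def by blast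
      show "\<Phi> s r" if "\<Phi> s q" "r \<preceq> q" for s q r
        using that(1) In_mono[OF _ that(2)] St_mono[OF _ that(2)] leD(1)[OF that(2)] unfolding \<Phi>_def by blast
      fix CC q assume CC: "CC \<in> V" "q \<in> P" "\<And>s. s \<in> elts CC \<Longrightarrow> \<Phi> s q"
        "\<And>s t. s \<in> elts CC \<Longrightarrow> t \<in> elts CC \<Longrightarrow> elts s \<subseteq> elts t \<or> elts t \<subseteq> elts s"
      define S where "S = hset (\<Union>s\<in>elts CC. elts s)"
      have e: "z \<in> elts S \<longleftrightarrow> (\<exists>s\<in>elts CC. z \<in> elts s)" for z unfolding S_def by simp
      have common: "\<exists>u\<in>elts CC. z \<in> elts u \<and> w \<in> elts u" if "z \<in> elts S" "w \<in> elts S" for z w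
        using that CC(4) unfolding e by blast
      have "functional S"
      proof (rule functionalI)
        fix z assume "z \<in> elts S"
        then obtain s where "s \<in> elts CC" "z \<in> elts s" unfolding e by blast
        then show "\<exists>a b. z = \<langle>a, b\<rangle>" using CC(3) functional_pair[of s z] unfolding \<Phi>_def by metis
      next
        fix a b c assume "\<langle>a, b\<rangle> \<in> elts S" "\<langle>a, c\<rangle> \<in> elts S"
        then obtain u where "u \<in> elts CC" "\<langle>a, b\<rangle> \<in> elts u" "\<langle>a, c\<rangle> \<in> elts u" using common by blast
        then show "b = c" using CC(3) functionalD[of u] unfolding \<Phi>_def by blast
      qed
      moreover have "elts S \<subseteq> elts (prodset l B)" using CC(3) e unfolding \<Phi>_def by blast
      moreover have "In q (hsnd z) \<and> (\<forall>b\<in>elts (hfst z). \<exists>w\<in>elts S. hfst w = b) \<and>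
          (\<forall>w\<in>elts S. hfst w \<in> elts (hfst z) \<longrightarrow> St q (hsnd w) (hsnd z))" if z: "z \<in> elts S" for z
      proof (intro conjI ballI impI)
        obtain s where s: "s \<in> elts CC" "z \<in> elts s" using z e by blast
        show "In q (hsnd z)" using CC(3)[OF s(1)] s(2) unfolding \<Phi>_def by blast
        show "\<exists>w\<in>elts S. hfst w = b" if "b \<in> elts (hfst z)" for b
          using CC(3)[OF s(1)] s that e unfolding \<Phi>_def by blast
        fix w assume w: "w \<in> elts S" "hfst w \<in> elts (hfst z)"
        obtain u where "u \<in> elts CC" "z \<in> elts u" "w \<in> elts u" using common[OF z w(1)] by blast
        then show "St q (hsnd w) (hsnd z)" using CC(3) w(2) unfolding \<Phi>_def by blast
      qed
      ultimately show "\<Phi> (hset (\<Union>s\<in>elts CC. elts s)) q"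
        using CC(2) unfolding \<Phi>_def S_def[symmetric] by blast
    qed
    then obtain s q where s: "s \<in> V" "q \<preceq> p" "\<Phi> s q"
      "\<And>t r. t \<in> V \<Longrightarrow> r \<preceq> q \<Longrightarrow> \<Phi> t r \<Longrightarrow> elts s \<subseteq> elts t \<Longrightarrow> t = s" by blast
    then have "D q" unfolding D_def by blast
    then show ?thesis using s(2) leD(1)[OF s(2)] by blast
  qed
  ultimately obtain q where q: "q \<in> G" "D q" using G_dense[of D] by blast
  then obtain s where s: "s \<in> V" "\<Phi> s q"
    "\<And>t r. t \<in> V \<Longrightarrow> r \<preceq> q \<Longrightarrow> \<Phi> t r \<Longrightarrow> elts s \<subseteq> elts t \<Longrightarrow> t = s"
    unfolding D_def using leD(1) by blast
  have sf: "functional s" and sB: "elts s \<subseteq> elts (prodset l B)"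
    and sIn: "\<And>z. z \<in> elts s \<Longrightarrow> In q (hsnd z)"
    and sdown: "\<And>z b. z \<in> elts s \<Longrightarrow> b \<in> elts (hfst z) \<Longrightarrow> \<exists>w\<in>elts s. hfst w = b"
    and sSt: "\<And>z w. z \<in> elts s \<Longrightarrow> w \<in> elts s \<Longrightarrow> hfst w \<in> elts (hfst z) \<Longrightarrow> St q (hsnd w) (hsnd z)"
    using s(2) unfolding \<Phi>_def by blast+
  have slB: "hfst z \<in> elts l \<and> hsnd z \<in> elts B" if "z \<in> elts s" for z
    using sB that unfolding elts_prodset by auto
  \<comment> \<open>The domain of s is an ordinal at most l. If it is l, the evaluated sequence is
    the desired chain; otherwise closedness of the tree gives an upper bound, and a strict extension
    of that bound would lengthen s.\<close>
  define \<alpha> where "\<alpha> = hset ((\<lambda>z. hfst z) ` elts s)"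
  have \<alpha>: "elts \<alpha> = hfst ` elts s" unfolding \<alpha>_def by simp
  have \<alpha>V: "\<alpha> \<in> V" unfolding \<alpha>_def by (intro dfun_V0[OF dfun_image] dintros s(1))
  have \<alpha>l: "\<alpha> = l \<or> \<alpha> \<in> elts l"
  proof (rule trans_subset_ord[OF lo])
    show "elts \<alpha> \<subseteq> elts l" unfolding \<alpha> using slB by blast
    show "trans_set \<alpha>" unfolding trans_set_def \<alpha> using sdown by blast
  qed
  then have \<alpha>\<kappa>: "\<alpha> \<in> elts \<kappa>" using l ord_trans[OF kappa_ord l] by blast
  have \<alpha>o: "is_ord \<alpha>" by (rule ord_mem[OF kappa_ord \<alpha>\<kappa>])
  define f where "f = hset ((\<lambda>z. \<langle>hfst z, val G (hsnd z)\<rangle>) ` elts s)"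
  have fW: "f \<in> W" unfolding f_def using Bh slB by (intro hs_sequence[OF \<alpha>\<kappa> s(1) sf \<alpha>[symmetric]]) blast
  have aps: "ap s (hfst z) = hsnd z" if "z \<in> elts s" for z
    by (rule functional_ap[OF sf]) (simp add: functional_pair[OF sf that] that)
  have "elts f = (\<lambda>z. \<langle>hfst z, val G (hsnd z)\<rangle>) ` elts s" unfolding f_def by simp
  also have "\<dots> = (\<lambda>b. \<langle>b, val G (ap s b)\<rangle>) ` elts \<alpha>"
    unfolding \<alpha> image_image using aps by (intro image_cong refl) simp
  finally have f: "elts f = (\<lambda>b. \<langle>b, val G (ap s b)\<rangle>) ` elts \<alpha>" .
  have fz: "app f (hfst z) = val G (hsnd z)" if "z \<in> elts s" for z
    using app_eq[OF f, of "hfst z"] aps[OF that] \<alpha> that by simp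
  have "chain_in W T le \<alpha> f"
    unfolding chain_in_def
  proof (intro conjI ballI fW)
    show "is_func f (elts \<alpha>) (elts T)"
    proof (rule is_funcI[OF f])
      fix b assume "b \<in> elts \<alpha>"
      then obtain z where z: "z \<in> elts s" "b = hfst z" unfolding \<alpha> by blast
      then show "val G (ap s b) \<in> elts T" using InG[OF q(1) sIn[OF z(1)]] slB[OF z(1)] aps by simp
    qed
    fix c b assume c: "c \<in> elts \<alpha>" and b: "b \<in> elts c"
    obtain z where z: "z \<in> elts s" "c = hfst z" using c unfolding \<alpha> by blast
    obtain w where w: "w \<in> elts s" "b = hfst w" using sdown[OF z(1)] b z(2) by blast
    note st = StG[OF q(1) sSt[OF z(1) w(1)]]
    show "app f b \<noteq> app f c" "\<langle>app f b, app f c\<rangle> \<in> elts le"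
      using st slB[OF z(1)] slB[OF w(1)] b z(2) w(2) fz[OF z(1)] fz[OF w(1)] by simp_all
  qed
  then have chain: "chain_in W T le \<alpha> f" .
  show "(\<exists>t\<in>elts T. \<forall>s\<in>elts T. \<langle>t, s\<rangle> \<in> elts le \<longrightarrow> s = t) \<or> (\<exists>f. chain_in W T le l f)"
  proof (cases "\<alpha> = l")
    case True
    then show ?thesis using chain by blast
  next
    case False
    then have \<alpha>l': "\<alpha> \<in> elts l" using \<alpha>l by blast
    then obtain u where u: "u \<in> elts T" "\<And>b. b \<in> elts \<alpha> \<Longrightarrow> \<langle>app f b, u\<rangle> \<in> elts le"
      using cl chain unfolding closed_tree_in_def by blast
    show ?thesis
    proof (rule ccontr)
      assume "\<not> ?thesis"
      then obtain v where v: "v \<in> elts T" "\<langle>u, v\<rangle> \<in> elts le" "v \<noteq> u" using u(1) by blast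
      obtain p0 y where y: "p0 \<in> G" "\<langle>p0, y\<rangle> \<in> elts x" "v = val G y" using v(1) unfolding x(3) mem_val by blast
      have yB: "y \<in> elts B" unfolding B using y(2) by (metis hsnd_opair imageI)
      have above: "\<langle>val G (hsnd z), v\<rangle> \<in> elts le" "val G (hsnd z) \<noteq> v" if z: "z \<in> elts s" for z
      proof -
        have zu: "\<langle>val G (hsnd z), u\<rangle> \<in> elts le" using u(2)[of "hfst z"] fz[OF z] \<alpha> z by simp
        then show "\<langle>val G (hsnd z), v\<rangle> \<in> elts le" using tr v(2) by blast
        show "val G (hsnd z) \<noteq> v" using zu anti v(2,3) by blast
      qed
      \<comment> \<open>Either r forces y to continue the chain, or r rules out that y names a node
        or that it names one strictly above some member of the chain. One of these holds densely
        below q, and the true value v of y refutes all but the first.\<close>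
      define E where "E r \<longleftrightarrow> (In r y \<and> (\<forall>z\<in>elts s. St r (hsnd z) y)) \<or>
        (\<forall>r'\<in>P. r' \<preceq> r \<longrightarrow> \<not> fmem Sys r' y x) \<or>
        (\<exists>z\<in>elts s. (\<forall>r'\<in>P. r' \<preceq> r \<longrightarrow> \<not> fmem Sys r' (opn Sys (hsnd z) y) lx) \<or> feq Sys r (hsnd z) y)" for r
      have "dpred (\<lambda>e. E (e 0))"
        unfolding E_def by (intro dintros dIn dSt Bv[OF yB] s(1) conds_V leq_V x(1) lx(1))
      moreover have "wforce q E"
        unfolding wforce_def
      proof (intro conjI ballI impI)
        show "q \<in> P" by (rule G_P[OF q(1)])
        fix r assume r: "r \<in> P" "r \<preceq> q"
        have weak: "\<exists>r1\<in>P. r1 \<preceq> r \<and> (\<forall>r'\<in>P. r' \<preceq> r1 \<longrightarrow> \<not> Q r')"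
          if "\<not> wforce r Q" for Q using that r(1) unfolding wforce_def by blast
        show "\<exists>r1\<in>P. r1 \<preceq> r \<and> E r1"
        proof (cases "In r y")
          case False
          then show ?thesis using weak unfolding In_def E_def by blast
        next
          case InT: True
          show ?thesis
          proof (cases "\<forall>z\<in>elts s. St r (hsnd z) y")
            case True
            then show ?thesis using InT r(1) le_refl unfolding E_def by blast
          next
            case False
            then obtain z where z: "z \<in> elts s" "\<not> St r (hsnd z) y" by blast
            show ?thesis
            proof (cases "wforce r (\<lambda>r. fmem Sys r (opn Sys (hsnd z) y) lx)")
              case True
              then obtain r1 where "r1 \<in> P" "r1 \<preceq> r" "feq Sys r1 (hsnd z) y"
                using z(2) unfolding St_def by blast
              then show ?thesis using z(1) unfolding E_def by blast
            next
              case False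
              from weak[OF this] show ?thesis using z(1) unfolding E_def by blast
            qed
          qed
        qed
      qed
      ultimately obtain r where r: "r \<in> G" "r \<preceq> q" "E r"
        using G_dense_below[of E, OF _ q(1)] by blast
      have meet: "\<exists>r'\<in>P. r' \<preceq> r \<and> fmem Sys r' c d" if "p \<in> G" "fmem Sys p c d" for p c d
        using G_compat[OF that(1) r(1)] fmem_mono[OF that(2)] G_P by blast
      have "\<not> (\<forall>r'\<in>P. r' \<preceq> r \<longrightarrow> \<not> fmem Sys r' y x)"
        using meet val_mem_iff[OF Bn[OF yB] xn Bv[OF yB] x(1)] v(1) unfolding x(3) y(3) by blast
      moreover have "\<not> (\<forall>r'\<in>P. r' \<preceq> r \<longrightarrow> \<not> fmem Sys r' (opn Sys (hsnd z) y) lx)"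
        and "\<not> feq Sys r (hsnd z) y" if z: "z \<in> elts s" for z
      proof -
        have zB: "hsnd z \<in> elts B" using slB[OF z] by blast
        have "val G (opn Sys (hsnd z) y) \<in> elts (val G lx)"
          using above(1)[OF z] unfolding lx(3) y(3) val_opn[OF top_G] .
        then show "\<not> (\<forall>r'\<in>P. r' \<preceq> r \<longrightarrow> \<not> fmem Sys r' (opn Sys (hsnd z) y) lx)"
          using meet val_mem_iff[OF on[OF zB yB] lxn V_opn[OF Bv[OF zB] Bv[OF yB]] lx(1)] by blast
        show "\<not> feq Sys r (hsnd z) y"
          using val_eq_iff[OF Bn[OF zB] Bn[OF yB] Bv[OF zB] Bv[OF yB]] above(2)[OF z] r(1) unfolding y(3) by blast
      qed
      ultimately have good: "In r y" "\<And>z. z \<in> elts s \<Longrightarrow> St r (hsnd z) y" using r(3) unfolding E_def by blast+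
      \<comment> \<open>The first position not yet used is \<open>\<alpha>\<close> itself, so
        placing y there properly extends s under the stronger condition r and contradicts its
        maximality.\<close>
      define t where "t = hset (insert \<langle>\<alpha>, y\<rangle> (elts s))"
      have t: "elts t = insert \<langle>\<alpha>, y\<rangle> (elts s)" unfolding t_def by simp
      have new: "\<langle>\<alpha>, e\<rangle> \<notin> elts s" for e
      proof
        assume "\<langle>\<alpha>, e\<rangle> \<in> elts s"
        then have "\<alpha> \<in> elts \<alpha>" unfolding \<alpha> by (metis hfst_opair imageI)
        then show False using mem_irrefl by blast
      qed
      have "t \<in> V" unfolding t_def using s(1) \<alpha>V Bv[OF yB] by simp
      moreover have "\<Phi> t r"
        unfolding \<Phi>_def
      proof (intro conjI ballI impI)
        show "r \<in> P" by (rule G_P[OF r(1)])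
        show "functional t"
          by (rule functionalI) (use functional_pair[OF sf] functionalD[OF sf] new in \<open>auto simp: t, metis\<close>)
        show "elts t \<subseteq> elts (prodset l B)" unfolding t using sB \<alpha>l' yB by simp
        fix z assume z: "z \<in> elts t"
        show "In r (hsnd z)" using z good(1) In_mono[OF sIn r(2)] unfolding t by auto
        show "\<exists>w\<in>elts t. hfst w = b" if b: "b \<in> elts (hfst z)" for b
          using z b sdown[of z b] \<alpha> unfolding t by auto
        fix w assume w: "w \<in> elts t" "hfst w \<in> elts (hfst z)"
        have "w \<noteq> \<langle>\<alpha>, y\<rangle>"
        proof
          assume wa: "w = \<langle>\<alpha>, y\<rangle>"
          show False
          proof (cases "z = \<langle>\<alpha>, y\<rangle>")
            case True
            then show False using w(2) wa mem_irrefl[of \<alpha>] by simp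
          next
            case False
            then have "hfst z \<in> elts \<alpha>" using z \<alpha> unfolding t by blast
            then have "\<alpha> \<in> elts \<alpha>" using ord_trans[OF \<alpha>o] w(2) wa by simp
            then show False using mem_irrefl by blast
          qed
        qed
        then have ws: "w \<in> elts s" using w(1) unfolding t by blast
        show "St r (hsnd w) (hsnd z)"
          using z good(2)[OF ws] St_mono[OF sSt[OF _ ws w(2)] r(2)] unfolding t by auto
      qed
      ultimately have "t = s" using s(3)[OF _ r(2)] t by blast
      then show False using t new by blast
    qed
  qed
qed

lemma DC_below: "DC_below_in W \<kappa>"
  unfolding DC_below_in_def using DC by blast

end

theorem theorem3p2:
  fixes V :: "'i hset set" and L :: "'i lang" and M :: "'i struct" and \<G> \<I> :: "'i hset"
  assumes "transitive_ZFC_model V"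
    and "lang_in V L"
    and "struct_in V L M"
    and "aut_group_in V L M \<G>"
    and "ideal_in V (univ M) \<I>"
  shows "(\<exists>S. symmetric_system V S \<and>
            (\<forall>G. generic V S G \<longrightarrow>
               V \<subseteq> symmetric_extension V S G \<and>
               symmetric_extension V S G \<subseteq> generic_extension V S G \<and>
               has_symmetric_copy V S G L M \<G> \<I> \<and>
               no_new_subsets V (generic_extension V S G) (univ M))) \<and>
         (\<forall>\<kappa>. aleph_in V \<kappa> \<longrightarrow> complete_ideal_in V \<kappa> \<I> \<longrightarrow>
            (\<exists>S. symmetric_system V S \<and>
               (\<forall>G. generic V S G \<longrightarrow>
                  V \<subseteq> symmetric_extension V S G \<and>
                  symmetric_extension V S G \<subseteq> generic_extension V S G \<and>
                  has_symmetric_copy V S G L M \<G> \<I> \<and>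
                  DC_below_in (symmetric_extension V S G) \<kappa> \<and>
                  no_new_subsets V (generic_extension V S G) (univ M))))"
proof (intro conjI allI impI)
  interpret zfc_model V using assms(1) by unfold_locales
  have cs: "copy_setup V L M \<G> \<I> \<kappa>" if "\<kappa> \<in> V" for \<kappa>
    using assms that by unfold_locales
  show "\<exists>S. symmetric_system V S \<and> (\<forall>G. generic V S G \<longrightarrow>
      V \<subseteq> symmetric_extension V S G \<and> symmetric_extension V S G \<subseteq> generic_extension V S G \<and>
      has_symmetric_copy V S G L M \<G> \<I> \<and> no_new_subsets V (generic_extension V S G) (univ M))"
  proof -
    \<comment> \<open>Nothing is required about sequences in this half, so the empty set is taken
      for \<open>\<kappa>\<close> and the size bound X has to accommodate only M and the empty
      set.\<close>
    interpret copy_setup V L M \<G> \<I> "hset {}" by (rule cs) simp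
    show ?thesis
    proof (intro exI[of _ Sys] conjI allI impI symmetric_Sys)
      fix G assume G: "generic V Sys G"
      interpret copy_ext V L M \<G> \<I> "hset {}" G using G by unfold_locales
      show "V \<subseteq> W" "W \<subseteq> generic_extension V Sys G" "has_symmetric_copy V Sys G L M \<G> \<I>"
        "no_new_subsets V (generic_extension V Sys G) (univ M)"
        by (rule V_sub_W W_sub_VG symmetric_copy no_new)+
    qed
  qed
  fix \<kappa> assume \<kappa>: "aleph_in V \<kappa>" "complete_ideal_in V \<kappa> \<I>"
  show "\<exists>S. symmetric_system V S \<and> (\<forall>G. generic V S G \<longrightarrow>
      V \<subseteq> symmetric_extension V S G \<and> symmetric_extension V S G \<subseteq> generic_extension V S G \<and>
      has_symmetric_copy V S G L M \<G> \<I> \<and> DC_below_in (symmetric_extension V S G) \<kappa> \<and>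
      no_new_subsets V (generic_extension V S G) (univ M))"
  proof -
    interpret copy_setup V L M \<G> \<I> \<kappa> by (rule cs) (use \<kappa>(1) in \<open>simp add: aleph_in_def\<close>)
    show ?thesis
    proof (intro exI[of _ Sys] conjI allI impI symmetric_Sys)
      fix G assume G: "generic V Sys G"
      interpret dc_ext V L M \<G> \<I> \<kappa> G using G \<kappa> by unfold_locales
      show "V \<subseteq> W" "W \<subseteq> generic_extension V Sys G" "has_symmetric_copy V Sys G L M \<G> \<I>"
        "DC_below_in W \<kappa>" "no_new_subsets V (generic_extension V Sys G) (univ M)"
        by (rule V_sub_W W_sub_VG symmetric_copy DC_below no_new)+
    qed
  qed
qed

end
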